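(* Let $\Omega\subset\mathbb{R}^N$ be open and bounded and let $p:\Omega\to(1,\infty)$ be Lipschitz continuous with $p^-:=\operatorname{ess\,inf}_\Omega p>1$. If $u\in W^{1,p(\cdot)}_{loc}(\Omega)$ is a weak solution to $-\Delta^S_{p(x)}u=0$ in $\Omega$, then $u$ is a viscosity solution to $-\Delta^N_{p(x)}u=0$ in $\Omega$.
   Context: Variable exponent spaces: $L^{p(\cdot)}(\Omega)$ is the space of measurable $u$ with $\int_\Omega |u|^{p(x)}\,dx<\infty$; $W^{1,p(\cdot)}(\Omega)$ consists of $u\in L^{p(\cdot)}(\Omega)$ with weak gradient $Du\in L^{p(\cdot)}(\Omega)$; $W^{1,p(\cdot)}_{loc}(\Omega)$ consists of functions in $W^{1,p(\cdot)}(\Omega')$ for all $\Omega'\Subset\Omega$. Weak solutions: $u\in W^{1,p(\cdot)}_{loc}(\Omega)$ is a weak supersolution to $-\Delta^S_{p(x)}u\ge0$ if $\int_\Omega |Du|^{p(x)-2}Du\cdot D\varphi+|Du|^{p(x)-2}\log(|Du|)\,Du\cdot Dp\,\varphi\,dx\ge0$ for all non-negative $\varphi\in W^{1,p(\cdot)}(\Omega)$ with compact support in $\Omega$ (integrand terms taken to be $0$ where $Du=0$); weak subsolution if $-u$ is a weak supersolution; weak solution if both. Viscosity solutions: for $x\in\Omega$, $\eta\ne0$, $X$ symmetric, $F(x,\eta,X):=-\big(\operatorname{tr}X+\frac{p(x)-2}{|\eta|^2}\langle X\eta,\eta\rangle\big)$. The subjet $J^{2,-}u(x)$ is the set of $(\eta,X)$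 with $u(y)\ge u(x)+\eta\cdot(y-x)+\frac12\langle X(y-x),y-x\rangle+o(|y-x|^2)$ as $y\to x$. A lower semicontinuous $u$ is a viscosity supersolution to $-\Delta^N_{p(x)}u\ge0$ if $F(x,\eta,X)\ge0$ whenever $x\in\Omega$, $(\eta,X)\in J^{2,-}u(x)$, $\eta\ne0$ (nothing required when $\eta=0$); viscosity subsolution if $-u$ is a viscosity supersolution; viscosity solution if both. *)

theory Defs
  imports "HOL-Analysis.Analysis"
begin

definition var_Lp :: "(real^'n) set \<Rightarrow> (real^'n \<Rightarrow> real) \<Rightarrow> (real^'n \<Rightarrow> 'b::euclidean_space) \<Rightarrow> bool" where
  "var_Lp U p f \<longleftrightarrow>
     f \<in> borel_measurable (lebesgue_on U) \<and>
     set_integrable lebesgue U (\<lambda>x. norm (f x) powr p x)"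

definition C1c_test :: "(real^'n) set \<Rightarrow> (real^'n \<Rightarrow> real) \<Rightarrow> (real^'n \<Rightarrow> real^'n) \<Rightarrow> bool" where
  "C1c_test U \<phi> g \<longleftrightarrow>
     (\<exists>K. compact K \<and> K \<subseteq> U \<and> (\<forall>x. x \<notin> K \<longrightarrow> \<phi> x = 0)) \<and>
     (\<forall>x. (\<phi> has_derivative (\<lambda>h. g x \<bullet> h)) (at x)) \<and> continuous_on UNIV g"

definition weak_gradient :: "(real^'n) set \<Rightarrow> (real^'n \<Rightarrow> real) \<Rightarrow> (real^'n \<Rightarrow> real^'n) \<Rightarrow> bool" where
  "weak_gradient U u Du \<longleftrightarrow>
     (\<forall>K. compact K \<and> K \<subseteq> U \<longrightarrow> set_integrable lebesgue K u \<and> set_integrable lebesgue K Du) \<and>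
     (\<forall>\<phi> g. C1c_test U \<phi> g \<longrightarrow>
        (\<forall>i. (LINT x:U|lebesgue. u x * g x $ i) = - (LINT x:U|lebesgue. Du x $ i * \<phi> x)))"

definition var_W1p :: "(real^'n) set \<Rightarrow> (real^'n \<Rightarrow> real) \<Rightarrow> (real^'n \<Rightarrow> real) \<Rightarrow> (real^'n \<Rightarrow> real^'n) \<Rightarrow> bool" where
  "var_W1p U p u Du \<longleftrightarrow> var_Lp U p u \<and> var_Lp U p Du \<and> weak_gradient U u Du"

definition var_W1p_loc :: "(real^'n) set \<Rightarrow> (real^'n \<Rightarrow> real) \<Rightarrow> (real^'n \<Rightarrow> real) \<Rightarrow> (real^'n \<Rightarrow> real^'n) \<Rightarrow> bool" where
  "var_W1p_loc U p u Du \<longleftrightarrow>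
     weak_gradient U u Du \<and>
     (\<forall>V. open V \<and> compact (closure V) \<and> closure V \<subseteq> U \<longrightarrow> var_W1p V p u Du)"

text \<open>Compact support in U (up to null sets, as for Sobolev functions).\<close>
definition compact_support_in :: "(real^'n) set \<Rightarrow> (real^'n \<Rightarrow> real) \<Rightarrow> bool" where
  "compact_support_in U \<phi> \<longleftrightarrow>
     (\<exists>K. compact K \<and> K \<subseteq> U \<and> (AE x in lebesgue. x \<notin> K \<longrightarrow> \<phi> x = 0))"

text \<open>Weak supersolution of -Delta^S_{p(x)} u \<ge> 0. Dp is the weak gradient of p
  (for Lipschitz p it agrees a.e. with the classical gradient). Integrand terms are 0 where Du = 0.\<close>
definition weak_supersolution :: "(real^'n) set \<Rightarrow> (real^'n \<Rightarrow> real) \<Rightarrow> (real^'n \<Rightarrow> real) \<Rightarrow> bool" where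
  "weak_supersolution U p u \<longleftrightarrow>
     (\<exists>Du Dp. var_W1p_loc U p u Du \<and> weak_gradient U p Dp \<and>
       (\<forall>\<phi> D\<phi>. var_W1p U p \<phi> D\<phi> \<and> compact_support_in U \<phi> \<and> (\<forall>x\<in>U. 0 \<le> \<phi> x) \<longrightarrow>
          0 \<le> (LINT x:U|lebesgue.
                 (if Du x = 0 then 0 else
                   norm (Du x) powr (p x - 2) * (Du x \<bullet> D\<phi> x)
                   + norm (Du x) powr (p x - 2) * ln (norm (Du x)) * (Du x \<bullet> Dp x) * \<phi> x))))"

definition weak_subsolution :: "(real^'n) set \<Rightarrow> (real^'n \<Rightarrow> real) \<Rightarrow> (real^'n \<Rightarrow> real) \<Rightarrow> bool" where
  "weak_subsolution U p u \<longleftrightarrow> weak_supersolution U p (\<lambda>x. - u x)"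

definition weak_solution :: "(real^'n) set \<Rightarrow> (real^'n \<Rightarrow> real) \<Rightarrow> (real^'n \<Rightarrow> real) \<Rightarrow> bool" where
  "weak_solution U p u \<longleftrightarrow> weak_supersolution U p u \<and> weak_subsolution U p u"

text \<open>Normalized p(x)-Laplace operator F(x, eta, X) for eta \<noteq> 0, X symmetric.\<close>
definition F_norm :: "(real^'n \<Rightarrow> real) \<Rightarrow> real^'n \<Rightarrow> real^'n \<Rightarrow> real^'n^'n \<Rightarrow> real" where
  "F_norm p x \<eta> X = - (trace X + (p x - 2) / (norm \<eta>)^2 * ((X *v \<eta>) \<bullet> \<eta>))"

definition subjet2 :: "(real^'n) set \<Rightarrow> (real^'n \<Rightarrow> real) \<Rightarrow> real^'n \<Rightarrow> ((real^'n) \<times> (real^'n^'n)) set" where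
  "subjet2 U u x = {(\<eta>, X). \<forall>\<epsilon>>0. \<exists>\<delta>>0. \<forall>y\<in>U. norm (y - x) < \<delta> \<longrightarrow>
       u y \<ge> u x + \<eta> \<bullet> (y - x) + (1/2) * ((X *v (y - x)) \<bullet> (y - x)) - \<epsilon> * (norm (y - x))^2}"

definition lsc_on :: "(real^'n) set \<Rightarrow> (real^'n \<Rightarrow> real) \<Rightarrow> bool" where
  "lsc_on U u \<longleftrightarrow> (\<forall>x\<in>U. \<forall>t. t < u x \<longrightarrow> (\<forall>\<^sub>F y in at x within U. t < u y))"

definition visc_supersolution :: "(real^'n) set \<Rightarrow> (real^'n \<Rightarrow> real) \<Rightarrow> (real^'n \<Rightarrow> real) \<Rightarrow> bool" where
  "visc_supersolution U p u \<longleftrightarrow> lsc_on U u \<and>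
     (\<forall>x\<in>U. \<forall>\<eta> X. (\<eta>, X) \<in> subjet2 U u x \<and> transpose X = X \<and> \<eta> \<noteq> 0 \<longrightarrow> F_norm p x \<eta> X \<ge> 0)"

definition visc_subsolution :: "(real^'n) set \<Rightarrow> (real^'n \<Rightarrow> real) \<Rightarrow> (real^'n \<Rightarrow> real) \<Rightarrow> bool" where
  "visc_subsolution U p u \<longleftrightarrow> visc_supersolution U p (\<lambda>x. - u x)"

definition visc_solution :: "(real^'n) set \<Rightarrow> (real^'n \<Rightarrow> real) \<Rightarrow> (real^'n \<Rightarrow> real) \<Rightarrow> bool" where
  "visc_solution U p u \<longleftrightarrow> visc_supersolution U p u \<and> visc_subsolution U p u"

end

theory Submission
  imports Defs
begin

text \<open>
  The point is that the strong \<open>p(x)\<close>-Laplacian is homogeneous: if \<open>u\<close> is a weak supersolution,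
  so is \<open>\<lambda> u\<close>, because the logarithmic term compensates the factor \<open>\<lambda>\<close> to the power
  \<open>p(x) - 1\<close>.  Testing with \<open>\<eta>\<^sup>q z (w/r)\<close> to the power \<open>\<gamma> - p(x)\<close>, where \<open>w\<close> is a positive
  affine function of \<open>u\<close>, the logarithms of \<open>|Du|\<close> and of \<open>w/r\<close> merge into \<open>ln (r |Du| / w)\<close>,
  which is absorbed by Young's inequality; so one gets Caccioppoli and logarithmic estimates with constants
  that do not depend on \<open>u\<close>.  De Giorgi iteration then bounds supersolutions locally from below and
  gives a growth lemma; applied to \<open>u\<close> and \<open>-u\<close> it shows that the oscillation decays geometrically,
  hence that a weak solution has a continuous representative \<open>v\<close>.

  If \<open>v\<close> were touched from below at a point by a quadratic function \<open>\<psi>\<close> with nonvanishing gradient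
  violating the viscosity inequality, then \<open>\<psi>\<close> would be, near that point, a strict classical subsolution
  of the divergence form equation.  Test the weak inequality with \<open>\<zeta> = (\<psi> + l - v)\<^sup>+\<close>: the
  difference of the logarithmic lower order terms is controlled by the monotone principal part up to a
  multiple of \<open>\<zeta>\<^sup>2 \<le> l \<zeta>\<close>, which for small \<open>l\<close> is beaten by the strictness, so \<open>\<zeta>\<close>
  vanishes, a contradiction.
\<close>

section \<open>Mollification and Sobolev functions\<close>

text \<open>A plain Young inequality for |Du|^(p-1) |ln |Du|| leaves an additive constant that does
  not scale with u. The gradient of the variable power of w/r contains -ln(w/r) \<open>Dp\<close>,
  and this is what makes the logarithm one of a dimensionless quantity. The constant gamma has to
  stay below p(x) and, for the De Giorgi step, within 1/2 of it; Lipschitz continuity grants this on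
  small balls only, hence the radius \<open>r0\<close>. A second obstacle: \<open>Dp\<close> is
  merely bounded and has no value at a touching point, whereas the viscosity inequality sees p
  alone. The divergence of |q|^(p-2) q for an affine field q contains the same logarithmic term as
  the equation; the two cancel and only the continuous p survives. For this reason the comparison is
  made under the integral and never pointwise. Sobolev functions enter as strong L1 limits of C1
  functions, so each calculus rule costs a single passage to the limit. The L1 measure inequalities
  come from counting translations, and they suffice because the energy controls |Dw| / w through T
  \<le> 1 + T^p.\<close>

notation scaleR (infixr "*R" 75)

abbreviation seq_lim :: "(nat => 'a::topological_space) => 'a => bool" (infix "~~>" 60) where
 "X ~~> l \<equiv> X \<longlonglongrightarrow> l"

lemmas bi_integrable_add = Bochner_Integration.integrable_add
lemmas bi_integrable_bound = Bochner_Integration.integrable_bound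
lemmas bi_integrable_cong = Bochner_Integration.integrable_cong
lemmas bi_integrable_diff = Bochner_Integration.integrable_diff
lemmas bi_integrable_sum = Bochner_Integration.integrable_sum
lemmas bi_integral_add = Bochner_Integration.integral_add
lemmas bi_integral_cong = Bochner_Integration.integral_cong
lemmas bi_integral_diff = Bochner_Integration.integral_diff
lemmas bi_integral_mult_right = Bochner_Integration.integral_mult_right
lemmas bi_integral_nonneg = Bochner_Integration.integral_nonneg
lemmas bi_integral_nonneg_AE = Bochner_Integration.integral_nonneg_AE
lemmas bi_integral_sum = Bochner_Integration.integral_sum
lemmas bi_integral_zero = Bochner_Integration.integral_zero

section \<open>Continuity of translations in L1\<close>

lemma nn_integral_lborel_shift:
 fixes f :: "'a::euclidean_space => ennreal"
 assumes [measurable]: "f \<in> borel_measurable borel"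
 shows "(\<integral>\<^sup>+x. f (x + t) \<partial>lborel) = (\<integral>\<^sup>+x. f x \<partial>lborel)"
 by (subst (2) lborel_distr_plus[of t, symmetric]) (simp add: nn_integral_distr add.commute)

lemma integral_lborel_shift:
 fixes f :: "'a::euclidean_space => 'b::{banach, second_countable_topology}"
 assumes [measurable]: "f \<in> borel_measurable borel"
 shows "(LBINT x. f (x + t)) = (LBINT x. f x)"
 by (subst (2) lborel_distr_plus[of t, symmetric]) (simp add: integral_distr add.commute)

lemma integrable_lborel_shift:
 fixes f :: "'a::euclidean_space => 'b::{banach, second_countable_topology}"
 assumes "integrable lborel f"
 shows "integrable lborel (%x. f (x + t))"
proof -
 have [measurable]: "f \<in> borel_measurable borel" using assms by auto
 have "integrable (distr lborel borel ((+) t)) f" using assms by (simp add: lborel_distr_plus)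
 thus ?thesis by (subst (asm) integrable_distr_eq) (auto simp: add.commute)
qed

lemma tendsto_zero_squeeze:
 fixes f g :: "nat => real"
 assumes "!!n. 0 <= f n" "!!n. f n <= g n" "g ~~> 0"
 shows "f ~~> 0"
 by (rule tendsto_sandwich[OF _ _ tendsto_const assms(3)]) (use assms in auto)

text \<open>Translation is an isometry of L1, so exchanging \<open>f\<close> for \<open>g\<close>
  costs at most twice their distance, uniformly in the shift. Continuity of translations therefore
  passes to L1 limits.\<close>

lemma translation_continuous_approx:
 fixes f :: "'a::euclidean_space => 'b::{banach, second_countable_topology}"
 assumes f: "integrable lborel f" and h: "h ~~> 0"
  and approx: "!!e::real. e > 0 ==> \<exists>g. integrable lborel g & (LBINT x. norm (f x - g x)) < e &
   (%n. \<integral>x. norm (g (x + h n) - g x) \<partial>lborel) ~~> 0"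
 shows "(%n::nat. \<integral>x. norm (f (x + h n) - f x) \<partial>lborel) ~~> 0"
proof (rule LIMSEQ_I)
 fix e :: real assume "e > 0"
 then obtain g where g: "integrable lborel g" and fg: "(LBINT x. norm (f x - g x)) < e/3"
  and lim: "(%n. \<integral>x. norm (g (x + h n) - g x) \<partial>lborel) ~~> 0" using approx[of "e/3"] by auto
 obtain n0 where n0: "!!n. n \<ge> n0 ==> (LBINT x. norm (g (x + h n) - g x)) < e/3"
  using LIMSEQ_D[OF lim, of "e/3"] \<open>e > 0\<close> by (auto simp: )
 have *: "(LBINT x. norm (f (x + t) - f x)) <= (LBINT x. norm (g (x + t) - g x)) + 2 * (LBINT x. norm (f x - g x))" for t
 proof -
  note i = f g integrable_lborel_shift[OF f, of t] integrable_lborel_shift[OF g, of t]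
  have "(LBINT x. norm (f (x + t) - f x)) <= (LBINT x. norm (g (x + t) - g x) + (norm (f (x + t) - g (x + t)) + norm (f x - g x)))"
  proof (rule integral_mono)
   have "norm (a - b) <= norm (c - d) + (norm (a - c) + norm (b - d))" for a b c d :: 'b by norm
   thus "norm (f (x + t) - f x) <= norm (g (x + t) - g x) + (norm (f (x + t) - g (x + t)) + norm (f x - g x))" for x .
  qed (use i in \<open>auto intro!: integrable_norm bi_integrable_diff bi_integrable_add\<close>)
  also have "... = (LBINT x. norm (g (x + t) - g x)) + ((LBINT x. norm (f (x + t) - g (x + t))) + (LBINT x. norm (f x - g x)))"
   using i by (subst bi_integral_add; (subst bi_integral_add)?)
   (auto intro!: integrable_norm bi_integrable_diff bi_integrable_add)
  also have "(LBINT x. norm (f (x + t) - g (x + t))) = (LBINT x. norm (f x - g x))"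
  proof -
   have [measurable]: "f \<in> borel_measurable borel" "g \<in> borel_measurable borel" using f g by auto
   show ?thesis by (rule integral_lborel_shift[where f="%x. norm (f x - g x)"]) measurable
  qed
  finally show ?thesis by simp
 qed
 hence "norm ((LBINT x. norm (f (x + h n) - f x)) - 0) < e" if "n \<ge> n0" for n
 proof -
  have "0 <= (LBINT x. norm (f (x + h n) - f x))" by (intro bi_integral_nonneg) auto
  thus ?thesis using n0[OF that] fg * [of "h n"] by simp
 qed
 thus "\<exists>no. \<forall>n\<ge>no. norm ((LBINT x. norm (f (x + h n) - f x)) - 0) < e" by blast
qed

text \<open>|1_S(x+h) - 1_S(x)| need not have an integrable majorant, but 1_S and its translate have
  the same integral, so the positive part of 1_S(x) - 1_S(x+h) carries exactly half of the L1
  distance. That part is dominated by \<open>indicator S\<close>, and at each point it vanishes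
  eventually because \<open>S\<close> is open.\<close>

lemma translation_continuous_open:
 fixes S :: "'a::euclidean_space set" and c :: "'b::{banach, second_countable_topology}"
 assumes S: "open S" "emeasure lborel S < \<infinity>" and h: "h ~~> 0"
 shows "(%n::nat. \<integral>x. norm (indicator S (x + h n) *R c - indicator S x *R c) \<partial>lborel) ~~> 0"
proof -
 have i: "integrable lborel (indicator S :: 'a => real)" using S by (simp)
 have [measurable]: "S \<in> sets borel" using S by auto
 note it = integrable_lborel_shift[OF i]
 have imax: "integrable lborel (%x. max 0 (indicator S x - indicator S (x + t) :: real))" for t
  by (intro integrable_max bi_integrable_diff i it) auto
 have eq: "(LBINT x. norm (indicator S (x + t) *R c - indicator S x *R c))
   = norm c * (2 * (LBINT x. max 0 (indicator S x - indicator S (x + t) :: real)))" for t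
 proof -
  have "(LBINT x. norm (indicator S (x + t) *R c - indicator S x *R c))
   = (LBINT x. norm c * (2 * max 0 (indicator S x - indicator S (x + t)) - (indicator S x - indicator S (x + t))))"
   by (intro bi_integral_cong) (auto simp: indicator_def)
  also have "... = norm c * (2 * (LBINT x. max 0 (indicator S x - indicator S (x + t) :: real)) - ((LBINT x. indicator S x) - (LBINT x. indicator S (x + t))))"
   using i it[of t] imax[of t] by simp
  also have "(LBINT x. indicator S (x + t)) = (LBINT x. (indicator S x :: real))"
   by (rule integral_lborel_shift) measurable
  finally show ?thesis by simp
 qed
 have "(%n::nat. \<integral>x. max 0 (indicator S x - indicator S (x + h n) :: real) \<partial>lborel) ~~> integral\<^sup>L lborel (%x::'a. 0)"
 proof (rule integral_dominated_convergence[where w="indicator S"])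
  show "AE x in lborel. (%i. max 0 (indicator S x - indicator S (x + h i) :: real)) ~~> 0"
  proof (intro AE_I2)
   fix x
   have "(%n. x + h n) ~~> x" using tendsto_add[OF tendsto_const h] by simp
   hence "x \<in> S ==> eventually (%n. x + h n \<in> S) sequentially" using S(1) topological_tendstoD by blast
   hence "eventually (%n. max 0 (indicator S x - indicator S (x + h n) :: real) = 0) sequentially"
    by (cases "x \<in> S") (auto elim!: eventually_mono)
   thus "(%i. max 0 (indicator S x - indicator S (x + h i) :: real)) ~~> 0"
    by (rule tendsto_eventually)
  qed
  show "AE x in lborel. norm (max 0 (indicator S x - indicator S (x + h n)) :: real) <= indicator S x" for n
   by (auto simp: indicator_def)
 qed (use i in auto)
 hence "(%n. norm c * (2 * (LBINT x. max 0 (indicator S x - indicator S (x + h n) :: real)))) ~~> norm c * (2 * 0)"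
  by (intro tendsto_intros) simp
 thus ?thesis unfolding eq by simp
qed

text \<open>Induction over integrable functions: outer regularity replaces a Borel set of finite
  measure by an open one, and limits are covered by
  \<open>translation_continuous_approx\<close>.\<close>

lemma L1_translation_continuous:
 fixes f :: "'a::euclidean_space => 'b::{banach, second_countable_topology}"
 assumes f: "integrable lborel f" and h: "h ~~> 0"
 shows "(%n::nat. \<integral>x. norm (f (x + h n) - f x) \<partial>lborel) ~~> 0"
 using f
proof (induction rule: integrable_induct)
 case (base A c)
 have i: "integrable lborel (%x. indicator A x *R c)" using base by (intro integrable_scaleR_left) auto
 show ?case
 proof (rule translation_continuous_approx[OF i h])
  fix e :: real assume e: "e > 0"
  obtain S where S: "open S" "A \<subseteq> S" "emeasure lborel (S - A) < ennreal (e / (norm c + 1))"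
   using outer_regular_lborel[of A "e / (norm c + 1)"] base divide_pos_pos[OF e add_nonneg_pos[OF norm_ge_zero[of c] zero_less_one]] by auto
  have fin: "emeasure lborel S < \<infinity>"
  proof -
   have "emeasure lborel S <= emeasure lborel A + emeasure lborel (S - A)"
    using emeasure_subadditive[of A lborel "S - A"] S base by (auto simp: Un_absorb1)
   also have "... < \<infinity>" using base order_less_trans[OF S(3) ennreal_less_top] by (simp add: less_top[symmetric])
   finally show ?thesis .
  qed
  have SA: "S - A \<in> sets lborel" using S base by auto
  have "(LBINT x. norm (indicator A x *R c - indicator S x *R c)) = (LBINT x. norm c * indicator (S - A) x)"
   using S by (intro bi_integral_cong) (auto simp: indicator_def)
  also have "... = norm c * measure lborel (S - A)" using SA by simp
  also have "... < e"
  proof -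
   have "measure lborel (S - A) < e / (norm c + 1)"
    using S(3) emeasure_eq_ennreal_measure[OF less_imp_neq[OF order_less_trans[OF S(3) ennreal_less_top]]]
    by (simp add: ennreal_less_iff)
   hence "norm c * measure lborel (S - A) <= norm c * (e / (norm c + 1))" by (intro mult_left_mono) auto
   also have "... < e" using e add_nonneg_pos[OF norm_ge_zero[of c] zero_less_one] by (simp add: pos_divide_less_eq algebra_simps)
   finally show ?thesis .
  qed
  finally show "\<exists>g. integrable lborel g & (LBINT x. norm (indicator A x *R c - g x)) < e &
   (%n. \<integral>x. norm (g (x + h n) - g x) \<partial>lborel) ~~> 0"
   using translation_continuous_open[OF S(1) fin h, of c] S(1) fin
   by (intro exI[of _ "%x. indicator S x *R c"]) (auto intro!: integrable_scaleR_left)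
 qed
next
 case (add f g)
 have i: "integrable lborel (%x. norm (f (x + t) - f x))" "integrable lborel (%x. norm (g (x + t) - g x))" for t
  using add(1,2) integrable_lborel_shift[OF add(1), of t] integrable_lborel_shift[OF add(2), of t] by (auto intro!: integrable_norm bi_integrable_diff)
 have "(%n. (LBINT x. norm (f (x + h n) - f x)) + (LBINT x. norm (g (x + h n) - g x))) ~~> 0 + 0"
  by (intro tendsto_add add)
 hence "(%n. (LBINT x. norm (f (x + h n) - f x)) + (LBINT x. norm (g (x + h n) - g x))) ~~> 0" by simp
 thus ?case
 proof (rule tendsto_zero_squeeze[rotated 2])
  fix n
  show "0 <= (LBINT x. norm (f (x + h n) + g (x + h n) - (f x + g x)))" by (intro bi_integral_nonneg) auto
  show "(LBINT x. norm (f (x + h n) + g (x + h n) - (f x + g x))) <=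
   (LBINT x. norm (f (x + h n) - f x)) + (LBINT x. norm (g (x + h n) - g x))"
   unfolding bi_integral_add[OF i(1) i(2), symmetric]
  proof (intro integral_mono)
   fix x
   show "integrable lborel (%x. norm (f (x + h n) + g (x + h n) - (f x + g x)))"
    using add(1,2) integrable_lborel_shift[OF add(1), of "h n"] integrable_lborel_shift[OF add(2), of "h n"] by (auto intro!: integrable_norm bi_integrable_diff bi_integrable_add)
   show "norm (f (x + h n) + g (x + h n) - (f x + g x)) <= norm (f (x + h n) - f x) + norm (g (x + h n) - g x)" by norm
  qed (use i in auto)
 qed
next
 case (lim f s)
 show ?case
 proof (rule translation_continuous_approx[OF lim(4) h])
  fix e :: real assume "e > 0"
  have "(%i. \<integral>x. norm (f x - s i x) \<partial>lborel) ~~> integral\<^sup>L lborel (%x::'a. 0)"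
  proof (rule integral_dominated_convergence[where w="%x. 3 * norm (f x)"])
   have le: "norm (f x - s i x) <= 3 * norm (f x)" for i x
   proof -
    have "norm (s i x) <= 2 * norm (f x)" by (rule lim(3)) simp
    thus ?thesis using norm_triangle_ineq4[of "f x" "s i x"] by linarith
   qed
   show "AE x in lborel. norm (norm (f x - s i x)) <= 3 * norm (f x)" for i using le by (intro AE_I2) simp
   have to0: "(%i. norm (f x - s i x)) ~~> 0" for x
   proof -
    have "(%i. f x - s i x) ~~> f x - f x" by (intro tendsto_diff tendsto_const lim(2)) simp
    thus ?thesis unfolding diff_self by (rule tendsto_norm_zero)
   qed
   show "AE x in lborel. (%i. norm (f x - s i x)) ~~> 0" by (intro AE_I2 to0)
   have [measurable]: "f \<in> borel_measurable lborel" "s i \<in> borel_measurable lborel" for i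
    by (rule borel_measurable_integrable[OF lim(4)], rule borel_measurable_integrable[OF lim(1)])
   show "(%x. norm (f x - s i x)) \<in> borel_measurable lborel" for i by measurable
   show "integrable lborel (%x. 3 * norm (f x))" by (intro integrable_mult_right integrable_norm lim(4))
  qed (rule borel_measurable_const)
  hence "eventually (%i. (LBINT x. norm (f x - s i x)) < e) sequentially"
   unfolding bi_integral_zero by (rule order_tendstoD(2)[OF _ \<open>e > 0\<close>])
  then obtain i where "(LBINT x. norm (f x - s i x)) < e"
   unfolding eventually_sequentially by blast
  thus "\<exists>g. integrable lborel g & (LBINT x. norm (f x - g x)) < e & (%n. \<integral>x. norm (g (x + h n) - g x) \<partial>lborel) ~~> 0"
   using lim(1)[of i] lim(5)[of i] by (intro exI[of _ "s i"] conjI)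
 qed
qed

section \<open>C1 kernels and mollification\<close>

text \<open>Powers of the positive part with exponent at least 2 are C1 on the whole line; kernels
  and cutoffs are built from them.\<close>

lemma max0_power_has_derivative:
 fixes t :: real
 assumes "n > 0"
 shows "((%t. (max 0 t) ^ Suc n) has_real_derivative (1 + real n) * (max 0 t) ^ n) (at t)"
proof -
 consider "t > 0" | "t < 0" | "t = 0" by linarith
 thus ?thesis
 proof cases
  case 1
  have "((%t. t ^ Suc n) has_real_derivative (1 + real n) * (max 0 t) ^ n) (at t)"
   using DERIV_pow[of "Suc n" t] 1 by simp
  thus ?thesis
   by (rule has_field_derivative_transform_within_open[where S="{0<..}"]) (use 1 in auto)
 next
  case 2
  have "((%t. 0) has_real_derivative (1 + real n) * (max 0 t) ^ n) (at t)"
   using 2 assms by (auto intro!: derivative_eq_intros)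
  thus ?thesis
   by (rule has_field_derivative_transform_within_open[where S="{..<0}"]) (use 2 in auto)
 next
  case 3
  have "((%h. (max 0 h) ^ Suc n / h) \<longlongrightarrow> 0) (at (0::real))"
  proof (rule Lim_null_comparison)
   show "\<forall>\<^sub>F h in at 0. norm ((max 0 h) ^ Suc n / h) <= \<bar>h\<bar> ^ n"
    by (auto simp: eventually_at_filter max_def)
   show "((%h::real. \<bar>h\<bar> ^ n) \<longlongrightarrow> 0) (at 0)"
    using assms by (auto intro!: tendsto_eq_intros)
  qed
  thus ?thesis unfolding 3 by (simp add: DERIV_def zero_power[OF assms])
 qed
qed

lemma gradient_mean_value:
 fixes f :: "'a::real_inner => real"
 assumes "!!t. 0 <= t ==> t <= 1 ==> (f has_derivative (%h. g (x + t *R d) \<bullet> h)) (at (x + t *R d))"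
 shows "\<exists>t. 0 < t & t < 1 & f (x + d) - f x = g (x + t *R d) \<bullet> d"
proof -
 have "\<exists>t\<in>{0<..<1}. f (x + 1 *R d) - f (x + 0 *R d) = (%s. g (x + t *R d) \<bullet> (s *R d)) (1 - 0)"
 proof (rule mvt_simple[where f="%t. f (x + t *R d)"])
  fix t :: real assume t: "0 <= t" "t <= 1"
  have "((%t. x + t *R d) has_derivative (%s. s *R d)) (at t)" by (auto intro!: derivative_eq_intros)
  from has_derivative_compose[OF this assms[OF t]]
  show "((%t. f (x + t *R d)) has_derivative (%s. g (x + t *R d) \<bullet> s *R d)) (at t within {0..1})"
   by (rule has_derivative_at_withinI)
 qed simp
 thus ?thesis by auto
qed

text \<open>A C1 probability density supported in the ball of radius \<open>r\<close>, together with its gradient.\<close>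
definition mollifier :: "real => ('a::euclidean_space => real) => ('a => 'a) => bool" where
 "mollifier r k Dk \<longleftrightarrow> 0 < r & (\<forall>x. 0 <= k x) & integrable lborel k & (LBINT x. k x) = 1 &
  (\<forall>x. (k has_derivative (%h. Dk x \<bullet> h)) (at x)) & continuous_on UNIV Dk &
  (\<forall>x. r <= norm x --> k x = 0 & Dk x = 0)"

lemma integrable_continuous_compact_support:
 fixes f :: "'a::euclidean_space => 'b::{banach, second_countable_topology}"
 assumes "continuous_on UNIV f" "!!x. r <= norm x ==> f x = 0"
 shows "integrable lborel f"
proof -
 have "integrable lborel (%x. indicator (cball 0 r) x *R f x)"
  using assms(1) by (intro borel_integrable_compact) (auto intro: continuous_on_subset)
 also have "(%x. indicator (cball 0 r) x *R f x) = f"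
  using assms(2) by (auto simp: indicator_def fun_eq_iff)
 finally show ?thesis .
qed

text \<open>The kernel is the normalised square of the truncated paraboloid r^2 - |x|^2. It is only
  C1, which is all the regularity that \<open>C1c_test\<close> asks of a test function.\<close>

lemma mollifier_exists:
 assumes "r > 0"
 shows "\<exists>k Dk. mollifier r (k :: 'a::euclidean_space => real) Dk"
proof -
 define b :: "'a => real" where "b x = (max 0 (r\<^sup>2 - x \<bullet> x)) ^ 2" for x
 define Db :: "'a => 'a" where "Db x = - (4 * max 0 (r\<^sup>2 - x \<bullet> x)) *R x" for x
 have D: "(b has_derivative (%h. Db x \<bullet> h)) (at x)" for x
 proof -
  have 1: "((%t::real. (max 0 t) ^ 2) has_derivative (%h. 2 * (max 0 (r\<^sup>2 - x \<bullet> x)) * h)) (at (r\<^sup>2 - x \<bullet> x))"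
   using max0_power_has_derivative[of 1 "r\<^sup>2 - x \<bullet> x"] by (simp add: has_field_derivative_def numeral_2_eq_2)
  have 2: "((%x. r\<^sup>2 - x \<bullet> x) has_derivative (%h. - (2 * (x \<bullet> h)))) (at x)"
   by (auto intro!: derivative_eq_intros simp: inner_commute)
  show ?thesis using has_derivative_compose[OF 2 1] unfolding b_def[abs_def] Db_def by (simp add: algebra_simps)
 qed
 have cDb: "continuous_on UNIV Db" unfolding Db_def by (intro continuous_intros)
 have cb: "continuous_on UNIV b" unfolding b_def by (intro continuous_intros)
 have z: "b x = 0" "Db x = 0" if "r <= norm x" for x
 proof -
  have "r\<^sup>2 <= x \<bullet> x" using that assms by (simp add: dot_square_norm power_mono)
  thus "b x = 0" "Db x = 0" unfolding b_def Db_def by (auto simp: max_def)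
 qed
 have ib: "integrable lborel b" using integrable_continuous_compact_support[OF cb z(1)] .
 have "(LBINT x. b x) \<noteq> 0"
 proof
  assume "(LBINT x. b x) = 0"
  hence AEb: "AE x in lborel. b x = 0"
   by (subst (asm) integral_nonneg_eq_0_iff_AE[OF ib]) (auto simp: b_def)
  have imp: "b x = 0 --> x \<notin> ball 0 r" for x
  proof
   assume "b x = 0"
   hence "r\<^sup>2 <= x \<bullet> x" unfolding b_def by (auto simp: max_def split: if_splits)
   thus "x \<notin> ball 0 r" using assms by (auto simp: dot_square_norm abs_le_square_iff[symmetric])
  qed
  have "AE x in (lborel :: 'a measure). x \<notin> ball 0 r" using AEb by (rule AE_mp) (intro AE_I2, rule imp)
  hence "emeasure lborel (ball (0::'a) r) = 0" using AE_iff_null_sets[of "ball (0::'a) r" lborel] by auto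
  thus False using content_ball_pos[OF assms, of "0::'a"] by (simp add: measure_def)
 qed
 moreover have "(LBINT x. b x) \<ge> 0" by (intro bi_integral_nonneg) (auto simp: b_def)
 ultimately have pos: "(LBINT x. b x) > 0" by simp
 define c where "c = 1 / (LBINT x. b x)"
 have c: "c \<ge> 0" "c * (LBINT x. b x) = 1" unfolding c_def using pos by auto
 have "mollifier r (%x. c * b x) (%x. c *R Db x)"
  unfolding mollifier_def
 proof (intro conjI allI impI)
  show "((%x. c * b x) has_derivative (%h. (c *R Db x) \<bullet> h)) (at x)" for x
   using has_derivative_mult_right[OF D[of x], of c] by simp
  show "0 <= c * b x" for x using c unfolding b_def by auto
  show "integrable lborel (%x. c * b x)" by (intro integrable_mult_right ib)
  show "(LBINT x. c * b x) = 1" using c by simp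
  show "continuous_on UNIV (%x. c *R Db x)" by (intro continuous_intros cDb)
 qed (use assms z in auto)
 thus ?thesis by blast
qed

lemma uniformly_continuous_compact_support:
 fixes g :: "'a::euclidean_space => 'b::real_normed_vector"
 assumes "continuous_on UNIV g" "!!x. r <= norm x ==> g x = 0"
 shows "uniformly_continuous_on UNIV g"
 unfolding uniformly_continuous_on_def
proof (intro allI impI)
 fix e :: real assume "e > 0"
 have "uniformly_continuous_on (cball 0 (r + 1)) g"
  using assms(1) by (intro compact_uniformly_continuous) (auto intro: continuous_on_subset)
 then obtain d where d: "d > 0" "!!x x'. x \<in> cball 0 (r+1) ==> x' \<in> cball 0 (r+1) ==> dist x' x < d ==> dist (g x') (g x) < e"
  using \<open>e > 0\<close> unfolding uniformly_continuous_on_def by metis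
 have "dist (g x') (g x) < e" if "dist x' x < min d 1" for x x'
 proof (cases "norm x \<ge> r & norm x' \<ge> r")
  case True thus ?thesis using assms(2) \<open>e > 0\<close> by simp
 next
  case False
  have "norm x' <= norm x + dist x' x" "norm x <= norm x' + dist x' x" by (norm, norm)
  thus ?thesis using False that by (intro d) (auto simp: dist_norm)
 qed
 thus "\<exists>d>0. \<forall>x\<in>UNIV. \<forall>x'\<in>UNIV. dist x' x < d --> dist (g x') (g x) < e"
  using d(1) by (intro exI[of _ "min d 1"]) auto
qed

text \<open>The kernel is evaluated at \<open>y - x\<close>, not \<open>x - y\<close>: for fixed x
  the kernel, as a function of y, is then itself the test function in the weak gradient identity,
  and no symmetry of \<open>k\<close> comes in. Differentiating in x brings a minus sign that
  cancels the one of integration by parts.\<close>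

definition mollify :: "('a::euclidean_space => real) => ('a => 'b::euclidean_space) => 'a => 'b" where
 "mollify k f x = (LBINT y. k (y - x) *R f y)"

lemma mollifier_continuous: "mollifier r k Dk ==> continuous_on UNIV k"
 unfolding mollifier_def by (meson continuous_at_imp_continuous_on has_derivative_continuous)

lemma integrable_mult_bounded_continuous:
 fixes k :: "'a::euclidean_space => real" and f :: "'a => 'b::euclidean_space"
 assumes "continuous_on UNIV k" "!!x. r <= norm x ==> k x = 0" "integrable lborel f"
 shows "integrable lborel (%y. k (y - x) *R f y)"
proof -
 have "bounded (k ` cball 0 r)" using assms(1) by (intro compact_imp_bounded compact_continuous_image) (auto intro: continuous_on_subset)
 then obtain B where B: "!!x. x \<in> cball 0 r ==> \<bar>k x\<bar> <= B" unfolding bounded_iff by (metis imageI real_norm_def)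
 have "\<bar>k x\<bar> <= \<bar>B\<bar>" for x using B[of x] assms(2)[of x] by (cases "r <= norm x") auto
 moreover have [measurable]: "k \<in> borel_measurable borel" using assms(1) by (rule borel_measurable_continuous_onI)
 moreover have [measurable]: "f \<in> borel_measurable borel" using assms(3) by auto
 ultimately show ?thesis
  by (intro bi_integrable_bound[OF integrable_scaleR_right[OF assms(3), of B]])
   (auto intro!: mult_right_mono)
qed

lemma mollify_continuous:
 fixes f :: "'a::euclidean_space => 'b::euclidean_space"
 assumes k: "continuous_on UNIV k" "!!x. r <= norm x ==> k x = 0" and f: "integrable lborel f"
 shows "continuous_on UNIV (mollify k f)"
proof (rule uniformly_continuous_imp_continuous, unfold uniformly_continuous_on_def, intro allI impI)
 fix e :: real assume e: "e > 0"
 define I where "I = (LBINT y. norm (f y))"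
 have I: "I \<ge> 0" unfolding I_def by (intro bi_integral_nonneg) auto
 have "e / (I + 1) > 0" using I e by auto
 then obtain d where d: "d > 0" "!!x x'. dist x' x < d ==> dist (k x') (k x) < e / (I + 1)"
  using uniformly_continuous_compact_support[OF k] unfolding uniformly_continuous_on_def by (metis UNIV_I)
 have "dist (mollify k f x') (mollify k f x) < e" if "dist x' x < d" for x x'
 proof -
  note i = integrable_mult_bounded_continuous[OF k f]
  have "norm (mollify k f x' - mollify k f x) = norm (LBINT y. (k (y - x') - k (y - x)) *R f y)"
   unfolding mollify_def using i by (simp add: scaleR_diff_left)
  also have "... <= (LBINT y. norm ((k (y - x') - k (y - x)) *R f y))" by (rule integral_norm_bound)
  also have "... <= (LBINT y. e / (I + 1) * norm (f y))"
  proof (rule integral_mono)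
   fix y
   have "\<bar>k (y - x') - k (y - x)\<bar> <= e / (I + 1)" using d(2)[of "y - x'" "y - x"] that by (simp add: dist_norm norm_minus_commute)
   thus "norm ((k (y - x') - k (y - x)) *R f y) <= e / (I + 1) * norm (f y)"
    unfolding norm_scaleR by (intro mult_right_mono) auto
   show "integrable lborel (%y. norm ((k (y - x') - k (y - x)) *R f y))"
    unfolding scaleR_diff_left by (intro integrable_norm bi_integrable_diff i)
   show "integrable lborel (%y. e / (I + 1) * norm (f y))" by (intro integrable_mult_right integrable_norm f)
  qed
  also have "... = e / (I + 1) * I" unfolding I_def by (rule bi_integral_mult_right) (use f in auto)
  also have "... < e" using e I by (simp add: field_simps)
  finally show ?thesis by (simp add: dist_norm)
 qed
 thus "\<exists>d>0. \<forall>x\<in>UNIV. \<forall>x'\<in>UNIV. dist x' x < d --> dist (mollify k f x') (mollify k f x) < e"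
  using d(1) by blast
qed

text \<open>\<open>f\<close> is only integrable, so the derivative falls on the kernel. By the mean
  value theorem the linearisation error is at most the modulus of continuity of \<open>Dk\<close>,
  uniformly in y, times the L1 norm of \<open>f\<close>.\<close>

lemma mollify_has_derivative:
 fixes f :: "'a::euclidean_space => real"
 assumes m: "mollifier r k Dk" and f: "integrable lborel f"
 shows "(mollify k f has_derivative (%h. (- (LBINT y. f y *R Dk (y - x))) \<bullet> h)) (at x)"
proof -
 have k: "!!x. (k has_derivative (%h. Dk x \<bullet> h)) (at x)" and Dk: "continuous_on UNIV Dk"
  and z: "!!x. r <= norm x ==> k x = 0" "!!x. r <= norm x ==> Dk x = 0"
  using m unfolding mollifier_def by auto
 note ck = mollifier_continuous[OF m]
 define I where "I = (LBINT y. norm (f y))"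
 have I: "I \<ge> 0" unfolding I_def by (intro bi_integral_nonneg) auto
 have i1: "integrable lborel (%y. k (y - x) *R f y)" for x by (rule integrable_mult_bounded_continuous[OF ck z(1) f])
 have i2': "integrable lborel (%y. (Dk (y - x) \<bullet> h) *R f y)" for h
  by (rule integrable_mult_bounded_continuous[where k="%x. Dk x \<bullet> h" and r=r, OF _ _ f])
   (auto simp: z intro!: continuous_intros continuous_on_subset[OF Dk])
 have i2: "integrable lborel (%y. f y *R Dk (y - x))"
 proof -
  have "integrable lborel (%y. \<Sum>b\<in>Basis. ((Dk (y - x) \<bullet> b) *R f y) *R b)"
   using i2' by (intro bi_integrable_sum integrable_scaleR_left)
  also have "(%y. \<Sum>b\<in>Basis. ((Dk (y - x) \<bullet> b) *R f y) *R b) = (%y. f y *R Dk (y - x))"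
   by (rule ext, subst (2) euclidean_representation[symmetric]) (simp add: scaleR_sum_right mult.commute)
  finally show ?thesis .
 qed
 show ?thesis unfolding has_derivative_at_alt
 proof (intro conjI allI impI)
  show "bounded_linear (%h. (- (LBINT y. f y *R Dk (y - x))) \<bullet> h)" by (rule bounded_linear_inner_right)
  fix e :: real assume e: "e > 0"
  have "e / (I + 1) > 0" using I e by auto
  then obtain d where d: "d > 0" "!!x x'. dist x' x < d ==> dist (Dk x') (Dk x) < e / (I + 1)"
   using uniformly_continuous_compact_support[OF Dk z(2)] unfolding uniformly_continuous_on_def by (metis UNIV_I)
  have "norm (mollify k f x' - mollify k f x - (- (LBINT y. f y *R Dk (y - x))) \<bullet> (x' - x)) <= e * norm (x' - x)"
   if "norm (x' - x) < d" for x'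
  proof -
   have est: "\<bar>k (y - x') - k (y - x) + Dk (y - x) \<bullet> (x' - x)\<bar> <= e / (I + 1) * norm (x' - x)" for y
   proof -
    obtain t where t: "0 < t" "t < 1" "k ((y - x) + (x - x')) - k (y - x) = Dk ((y - x) + t *R (x - x')) \<bullet> (x - x')"
     using gradient_mean_value[of k Dk "y - x" "x - x'", OF k] by blast
    hence "k (y - x') - k (y - x) + Dk (y - x) \<bullet> (x' - x) = (Dk ((y - x) + t *R (x - x')) - Dk (y - x)) \<bullet> (x - x')"
     unfolding inner_diff_left inner_minus_right[symmetric, of _ "x - x'"] by (simp add: inner_diff_right)
    hence "\<bar>k (y - x') - k (y - x) + Dk (y - x) \<bullet> (x' - x)\<bar> = \<bar>(Dk ((y - x) + t *R (x - x')) - Dk (y - x)) \<bullet> (x - x')\<bar>" by simp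
    also have "... <= norm (Dk ((y - x) + t *R (x - x')) - Dk (y - x)) * norm (x - x')" by (rule Cauchy_Schwarz_ineq2)
    also have "... <= e / (I + 1) * norm (x - x')"
    proof (rule mult_right_mono)
     have "t * norm (x - x') <= 1 * norm (x - x')" using t by (intro mult_right_mono) auto
     hence "dist ((y - x) + t *R (x - x')) (y - x) < d" using t that by (simp add: dist_norm norm_minus_commute)
     from d(2)[OF this] show "norm (Dk ((y - x) + t *R (x - x')) - Dk (y - x)) <= e / (I + 1)" by (simp add: dist_norm)
    qed simp
    finally show ?thesis by (simp add: norm_minus_commute)
   qed
   have "mollify k f x' - mollify k f x - (- (LBINT y. f y *R Dk (y - x))) \<bullet> (x' - x)
    = (LBINT y. k (y - x') *R f y) - (LBINT y. k (y - x) *R f y) + (LBINT y. (f y *R Dk (y - x)) \<bullet> (x' - x))"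
    unfolding mollify_def integral_inner_left[OF i2, of "x' - x"] by simp
   also have "... = (LBINT y. k (y - x') *R f y - k (y - x) *R f y + (f y *R Dk (y - x)) \<bullet> (x' - x))"
    unfolding bi_integral_add[OF bi_integrable_diff[OF i1[of x'] i1[of x]] integrable_inner_left[OF i2, of "x' - x"]]
     bi_integral_diff[OF i1[of x'] i1[of x]] ..
   finally have "\<bar>mollify k f x' - mollify k f x - (- (LBINT y. f y *R Dk (y - x))) \<bullet> (x' - x)\<bar>
    = \<bar>\<integral>y. k (y - x') *R f y - k (y - x) *R f y + (f y *R Dk (y - x)) \<bullet> (x' - x) \<partial>lborel\<bar>" by (rule arg_cong)
   also have "... <= (LBINT y. \<bar>k (y - x') *R f y - k (y - x) *R f y + (f y *R Dk (y - x)) \<bullet> (x' - x)\<bar>)"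
    by (rule integral_abs_bound)
   also have "... <= (LBINT y. e / (I + 1) * norm (x' - x) * norm (f y))"
   proof (rule integral_mono)
    fix y
    have "k (y - x') *R f y - k (y - x) *R f y + (f y *R Dk (y - x)) \<bullet> (x' - x) = (k (y - x') - k (y - x) + Dk (y - x) \<bullet> (x' - x)) * f y"
     by (simp add: algebra_simps)
    thus "\<bar>k (y - x') *R f y - k (y - x) *R f y + (f y *R Dk (y - x)) \<bullet> (x' - x)\<bar> <= e / (I + 1) * norm (x' - x) * norm (f y)"
     using mult_right_mono[OF est[of y] abs_ge_zero[of "f y"]] by (simp add: abs_mult)
    show "integrable lborel (%y. \<bar>k (y - x') *R f y - k (y - x) *R f y + (f y *R Dk (y - x)) \<bullet> (x' - x)\<bar>)"
     by (intro integrable_abs bi_integrable_add bi_integrable_diff i1[of x] i1[of x'] integrable_inner_left i2)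
    show "integrable lborel (%y. e / (I + 1) * norm (x' - x) * norm (f y))" by (intro integrable_mult_right integrable_norm f)
   qed
   also have "... = e / (I + 1) * norm (x' - x) * I" unfolding I_def by (rule bi_integral_mult_right) (use f in auto)
   also have "... <= e * norm (x' - x)"
   proof -
    have "e / (I + 1) * I <= e / (I + 1) * (I + 1)" using e I by (intro mult_left_mono) auto
    also have "... = e" using I by simp
    finally have "(e / (I + 1) * I) * norm (x' - x) <= e * norm (x' - x)" by (rule mult_right_mono) simp
    thus ?thesis by (simp only: mult.assoc mult.commute[of I])
   qed
   finally show ?thesis by simp
  qed
  thus "\<exists>d>0. \<forall>y. norm (y - x) < d --> norm (mollify k f y - mollify k f x - (- (LBINT y. f y *R Dk (y - x))) \<bullet> (y - x)) <= e * norm (y - x)"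
   using d(1) by blast
 qed
qed

lemma nn_integral_lborel_swap:
 fixes f :: "'a::euclidean_space => 'b::euclidean_space => ennreal"
 assumes "(%(x, y). f x y) \<in> borel_measurable (borel \<Otimes>\<^sub>M borel)"
 shows "(\<integral>\<^sup>+x. (\<integral>\<^sup>+y. f x y \<partial>lborel) \<partial>lborel) = (\<integral>\<^sup>+y. (\<integral>\<^sup>+x. f x y \<partial>lborel) \<partial>lborel)"
proof -
 have "(%(y, x). f x y) = (%(x, y). f x y) \<circ> (%(y, x). (x, y))" by (auto simp: fun_eq_iff)
 hence "(%(y, x). f x y) \<in> borel_measurable (borel \<Otimes>\<^sub>M borel)"
  using measurable_comp[OF measurable_pair_swap' assms] by simp
 moreover have "sets (lborel \<Otimes>\<^sub>M lborel :: ('b \<times> 'a) measure) = sets (borel \<Otimes>\<^sub>M borel)"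
  by (intro sets_pair_measure_cong) simp_all
 ultimately have "(%(y, x). f x y) \<in> borel_measurable (lborel \<Otimes>\<^sub>M lborel)"
  by (simp cong: measurable_cong_sets)
 from lborel_pair.Fubini'[OF this] show ?thesis .
qed

text \<open>A mollification is an average of translates by vectors shorter than r, so its distance
  to \<open>f\<close> is at most an average of translation moduli. The threshold d depends on
  \<open>f\<close> alone, so one kernel can serve a function and its gradient together.\<close>

lemma mollify_L1_approx:
 fixes f :: "'a::euclidean_space => 'b::euclidean_space"
 assumes f: "integrable lborel f" and e: "e > 0"
 shows "\<exists>d>0. \<forall>r k Dk. mollifier r k Dk & r < d -->
  integrable lborel (mollify k f) & (LBINT x. norm (mollify k f x - f x)) <= e"
proof -
 \<comment> \<open>Continuity of translations is available along sequences, hence the contradiction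
   with shifts shorter than 1/(n+1).\<close>
 have "\<exists>d>0. \<forall>h. norm h < d --> (LBINT x. norm (f (x + h) - f x)) <= e"
 proof (rule ccontr)
  assume neg: "\<not> ?thesis"
  have "\<exists>h. norm h < 1 / real (Suc n) & e < (LBINT x. norm (f (x + h) - f x))" for n
  proof -
   have "0 < 1 / real (Suc n)" by simp
   with neg have "\<not> (\<forall>h. norm h < 1 / real (Suc n) --> (LBINT x. norm (f (x + h) - f x)) <= e)" by blast
   thus ?thesis by (simp only: not_all not_imp not_le)
  qed
  then obtain h where h: "!!n. norm (h n) < 1 / real (Suc n)" "!!n. e < (LBINT x. norm (f (x + h n) - f x))" by metis
  have "h ~~> 0"
   by (rule Lim_null_comparison[OF _ lim_1_over_n[THEN LIMSEQ_Suc]]) (use h(1) in \<open>auto intro!: always_eventually less_imp_le\<close>)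
  from L1_translation_continuous[OF f this] have "eventually (%n. (LBINT x. norm (f (x + h n) - f x)) < e) sequentially"
   using e by (rule order_tendstoD)
  then obtain n where "(LBINT x. norm (f (x + h n) - f x)) < e" unfolding eventually_sequentially by blast
  thus False using h(2)[of n] by linarith
 qed
 then obtain d where d: "d > 0" "!!h. norm h < d ==> (LBINT x. norm (f (x + h) - f x)) <= e" by blast
 have main: "integrable lborel (mollify k f) & (LBINT x. norm (mollify k f x - f x)) <= e" if m: "mollifier r k Dk" and r: "r < d" for r k Dk
 proof -
  have k: "!!x. 0 <= k x" "integrable lborel k" "(LBINT x. k x) = 1" "!!x. r <= norm x ==> k x = 0"
   using m unfolding mollifier_def by auto
  have [measurable]: "k \<in> borel_measurable borel" "f \<in> borel_measurable borel" using k(2) f by auto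
  have [measurable]: "mollify k f \<in> borel_measurable borel"
   using mollify_continuous[OF mollifier_continuous[OF m] k(4) f] by (rule borel_measurable_continuous_onI)
  have i: "integrable lborel (%y. k (y - x) *R f y)" for x
   by (rule integrable_mult_bounded_continuous[OF mollifier_continuous[OF m] k(4) f])
  have pt: "ennreal (norm (mollify k f x - f x)) <= (\<integral>\<^sup>+z. ennreal (k z * norm (f (x + z) - f x)) \<partial>lborel)" for x
  proof -
   have i': "integrable lborel (%z. k z *R f (x + z))" using integrable_lborel_shift[OF i[of x], of x] by (simp add: add.commute)
   have ik: "integrable lborel (%z. k z *R f x)" using k(2) by simp
   have "mollify k f x = (LBINT z. k z *R f (x + z))"
    unfolding mollify_def using integral_lborel_shift[of "%y. k (y - x) *R f y" x] by (simp add: add.commute)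
   moreover have "f x = (LBINT z. k z *R f x)" using k by simp
   ultimately have "mollify k f x - f x = (LBINT z. k z *R f (x + z) - k z *R f x)"
    using i' ik by (simp del: integral_scaleR_left)
   hence "ennreal (norm (mollify k f x - f x)) = ennreal (norm (LBINT z. k z *R f (x + z) - k z *R f x))" by simp
   also have "... <= (\<integral>\<^sup>+z. ennreal (norm (k z *R f (x + z) - k z *R f x)) \<partial>lborel)"
    using i' ik by (intro integral_norm_bound_ennreal) auto
   also have "... = (\<integral>\<^sup>+z. ennreal (k z * norm (f (x + z) - f x)) \<partial>lborel)"
    using k(1) by (intro nn_integral_cong) (simp add: scaleR_diff_right[symmetric])
   finally show ?thesis .
  qed
  have "(\<integral>\<^sup>+x. ennreal (norm (mollify k f x - f x)) \<partial>lborel) <= (\<integral>\<^sup>+x. (\<integral>\<^sup>+z. ennreal (k z * norm (f (x + z) - f x)) \<partial>lborel) \<partial>lborel)"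
   by (intro nn_integral_mono pt)
  also have "... = (\<integral>\<^sup>+z. (\<integral>\<^sup>+x. ennreal (k z * norm (f (x + z) - f x)) \<partial>lborel) \<partial>lborel)"
   proof (rule nn_integral_lborel_swap)
   show "(%(x, z). ennreal (k z * norm (f (x + z) - f x))) \<in> borel_measurable (borel \<Otimes>\<^sub>M borel)" by measurable
  qed
  also have "... <= (\<integral>\<^sup>+z. ennreal (k z * e) \<partial>lborel)"
  proof (rule nn_integral_mono)
   fix z
   show "(\<integral>\<^sup>+x. ennreal (k z * norm (f (x + z) - f x)) \<partial>lborel) <= ennreal (k z * e)"
   proof (cases "r <= norm z")
    case True thus ?thesis by (simp add: k(4))
   next
    case False
    have "integrable lborel (%x. f (x + z) - f x)" using integrable_lborel_shift[OF f, of z] f by simp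
    hence "(\<integral>\<^sup>+x. ennreal (k z * norm (f (x + z) - f x)) \<partial>lborel) = ennreal (LBINT x. k z * norm (f (x + z) - f x))"
     by (intro nn_integral_eq_integral) (auto simp: k)
    also have "... <= ennreal (k z * e)" using d(2)[of z] False r k(1)[of z] by (intro ennreal_leI) (auto intro!: mult_left_mono)
    finally show ?thesis .
   qed
  qed
  also have "... = ennreal (LBINT z. k z * e)"
   using k e by (intro nn_integral_eq_integral) auto
  also have "... = ennreal e" using k by simp
  finally have le: "(\<integral>\<^sup>+x. ennreal (norm (mollify k f x - f x)) \<partial>lborel) <= ennreal e" .
  have id: "integrable lborel (%x. mollify k f x - f x)"
  proof (rule integrableI_bounded)
   show "(\<integral>\<^sup>+x. ennreal (norm (mollify k f x - f x)) \<partial>lborel) < \<infinity>"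
    using le_less_trans[OF le ennreal_less_top] by simp
  qed measurable
  have 1: "integrable lborel (mollify k f)"
   using bi_integrable_add[OF id f] unfolding diff_add_cancel .
  have "ennreal (LBINT x. norm (mollify k f x - f x)) = (\<integral>\<^sup>+x. ennreal (norm (mollify k f x - f x)) \<partial>lborel)"
   using nn_integral_eq_integral[OF integrable_norm[OF id] AE_I2[OF norm_ge_zero]] by (rule sym)
  hence "ennreal (LBINT x. norm (mollify k f x - f x)) <= ennreal e" using le by (rule ord_eq_le_trans)
  hence "(LBINT x. norm (mollify k f x - f x)) <= e" unfolding ennreal_le_iff[OF less_imp_le[OF e]] .
  with 1 show ?thesis by blast
 qed
 show ?thesis
  apply (rule exI[of _ d])
  apply (rule conjI)
  apply (rule d(1))
  apply (intro allI impI)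
  apply (erule conjE)
  apply (rule main)
  apply assumption
  apply assumption
  done
qed

section \<open>Sobolev functions as L1 limits of C1 functions\<close>

definition C1_on :: "'a::euclidean_space set => ('a => real) => ('a => 'a) => bool" where
 "C1_on V F G \<longleftrightarrow> (\<forall>x\<in>V. (F has_derivative (%h. G x \<bullet> h)) (at x)) & continuous_on V G"

abbreviation lb_on :: "'a::euclidean_space set => 'a measure" where
 "lb_on V \<equiv> restrict_space lborel V"

abbreviation L1_on :: "'a::euclidean_space set => ('a => 'b::{banach,second_countable_topology}) => bool" where
 "L1_on V \<equiv> integrable (lb_on V)"

abbreviation bm_on :: "'a::euclidean_space set => ('a => 'b::topological_space) set" where
 "bm_on V \<equiv> borel_measurable (lb_on V)"

text \<open>The strong L1 closure of pairs (C1 function, its gradient) on V. Density of regular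
  functions is built in, so a rule is proved for C1 functions and carried over by a limit. The
  gradient \<open>g\<close> is a datum of the pair, and nothing is prescribed at the boundary of
  V.\<close>

definition W11 :: "'a::euclidean_space set => ('a => real) => ('a => 'a) => bool" where
 "W11 V f g \<longleftrightarrow> L1_on V f & L1_on V g &
  (\<forall>e>0. \<exists>F G. C1_on V F G & L1_on V F & L1_on V G &
   (LINT x|lb_on V. norm (F x - f x)) < e & (LINT x|lb_on V. norm (G x - g x)) < e)"

lemma W11_integrable:
 assumes "W11 V f g"
 shows "L1_on V f" "L1_on V g"
 using assms unfolding W11_def by blast+

lemma W11_approx:
 assumes "W11 V f g" "e > 0"
 obtains F G where "C1_on V F G" "L1_on V F" "L1_on V G"
  "(LINT x|lb_on V. norm (F x - f x)) < e" "(LINT x|lb_on V. norm (G x - g x)) < e"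
proof -
 from assms have "\<exists>F G. C1_on V F G & L1_on V F & L1_on V G &
   (LINT x|lb_on V. norm (F x - f x)) < e & (LINT x|lb_on V. norm (G x - g x)) < e"
  unfolding W11_def by (elim conjE allE[of _ e]) simp
 thus thesis by (elim exE conjE) (rule that)
qed

lemma C1_on_continuous: "C1_on V F G ==> continuous_on V F"
 unfolding C1_on_def by (meson continuous_at_imp_continuous_on has_derivative_continuous)

lemma integral_norm_triangle:
 fixes f g h :: "'a => 'b::{banach, second_countable_topology}"
 assumes f: "integrable M f" and g: "integrable M g" and h: "integrable M h"
 shows "(LINT x|M. norm (f x - h x)) <= (LINT x|M. norm (f x - g x)) + (LINT x|M. norm (g x - h x))"
proof -
 have "(LINT x|M. norm (f x - h x)) <= (LINT x|M. norm (f x - g x) + norm (g x - h x))"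
 proof (rule integral_mono)
  show "norm (f x - h x) <= norm (f x - g x) + norm (g x - h x)" for x by norm
  show "integrable M (%x. norm (f x - h x))" by (intro integrable_norm bi_integrable_diff f h)
  show "integrable M (%x. norm (f x - g x) + norm (g x - h x))"
   by (intro bi_integrable_add integrable_norm bi_integrable_diff f g h)
 qed
 also have "... = (LINT x|M. norm (f x - g x)) + (LINT x|M. norm (g x - h x))"
  by (intro bi_integral_add integrable_norm bi_integrable_diff f g h)
 finally show ?thesis .
qed

lemma L1_dominated_convergence:
 fixes s :: "nat => 'a => 'b::{banach, second_countable_topology}"
 assumes [measurable]: "!!n. s n \<in> borel_measurable M" "f \<in> borel_measurable M"
  and w: "integrable M w" and lim: "AE x in M. (%n. s n x) ~~> f x"
  and bd: "!!n. AE x in M. norm (s n x) <= w x"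
 shows "integrable M f" "(%n. \<integral>x. norm (s n x - f x) \<partial>M) ~~> 0"
proof -
 show f: "integrable M f" by (rule integrable_dominated_convergence[OF assms(2,1) w lim bd])
 have "(%n. \<integral>x. norm (s n x - f x) \<partial>M) ~~> integral\<^sup>L M (%x. 0 :: real)"
 proof (rule integral_dominated_convergence[where w="%x. w x + norm (f x)"])
  show "integrable M (%x. w x + norm (f x))" by (intro bi_integrable_add w integrable_norm f)
  show "AE x in M. (%n. norm (s n x - f x)) ~~> 0" using lim
  proof (rule AE_mp, intro AE_I2 impI)
   fix x assume "(%n. s n x) ~~> f x"
   thus "(%n. norm (s n x - f x)) ~~> 0" by (intro tendsto_norm_zero LIM_zero)
  qed
  show "AE x in M. norm (norm (s n x - f x)) <= w x + norm (f x)" for n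
   using bd[of n]
  proof (rule AE_mp, intro AE_I2 impI)
   fix x assume "norm (s n x) <= w x"
   thus "norm (norm (s n x - f x)) <= w x + norm (f x)" using norm_triangle_ineq4[of "s n x" "f x"] by simp
  qed
 qed measurable
 thus "(%n. \<integral>x. norm (s n x - f x) \<partial>M) ~~> 0" by simp
qed

lemma W11_L1_limit:
 assumes fn: "!!n::nat. W11 V (f n) (g n)" and f: "L1_on V f0" and g: "L1_on V g0"
  and lf: "(%n. \<integral>x. norm (f n x - f0 x) \<partial>lb_on V) ~~> 0"
  and lg: "(%n. \<integral>x. norm (g n x - g0 x) \<partial>lb_on V) ~~> 0"
 shows "W11 V f0 g0"
 unfolding W11_def
proof (intro conjI allI impI f g)
 fix e :: real assume "e > 0"
 hence e2: "e / 2 > 0" by simp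
 have "eventually (%n. (LINT x|lb_on V. norm (f n x - f0 x)) < e/2 & (LINT x|lb_on V. norm (g n x - g0 x)) < e/2) sequentially"
  by (intro eventually_conj order_tendstoD(2)[OF lf e2] order_tendstoD(2)[OF lg e2])
 then obtain n where n: "(LINT x|lb_on V. norm (f n x - f0 x)) < e/2" "(LINT x|lb_on V. norm (g n x - g0 x)) < e/2"
  unfolding eventually_sequentially by blast
 obtain F G where FG: "C1_on V F G" "L1_on V F" "L1_on V G"
  "(LINT x|lb_on V. norm (F x - f n x)) < e/2" "(LINT x|lb_on V. norm (G x - g n x)) < e/2"
  by (rule W11_approx[OF fn e2])
 have "(LINT x|lb_on V. norm (F x - f0 x)) < e"
  using integral_norm_triangle[OF FG(2) W11_integrable(1)[OF fn] f, of n] n FG(4) by linarith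
 moreover have "(LINT x|lb_on V. norm (G x - g0 x)) < e"
  using integral_norm_triangle[OF FG(3) W11_integrable(2)[OF fn] g, of n] n FG(5) by linarith
 ultimately show "\<exists>F G. C1_on V F G & L1_on V F & L1_on V G &
   (LINT x|lb_on V. norm (F x - f0 x)) < e & (LINT x|lb_on V. norm (G x - g0 x)) < e"
  by (intro exI[of _ F] exI[of _ G] conjI FG(1-3))
qed

text \<open>The way out of the bounded or smooth setting: truncate or regularise, apply a rule for
  nice functions, and pass to the limit under a common majorant of functions and gradients.\<close>

lemma W11_dominated_limit:
 assumes fn: "!!n::nat. W11 V (f n) (g n)"
  and [measurable]: "f0 \<in> bm_on V" "g0 \<in> bm_on V"
  and w: "L1_on V w"
  and lim: "AE x in lb_on V. (%n. f n x) ~~> f0 x" "AE x in lb_on V. (%n. g n x) ~~> g0 x"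
  and bd: "!!n. AE x in lb_on V. \<bar>f n x\<bar> <= w x" "!!n. AE x in lb_on V. norm (g n x) <= w x"
 shows "W11 V f0 g0"
proof -
 have m: "f n \<in> bm_on V" "g n \<in> bm_on V" for n
  using W11_integrable[OF fn[of n]] by auto
 show ?thesis
 proof (rule W11_L1_limit[OF fn])
  show "L1_on V f0" "(%n. \<integral>x. norm (f n x - f0 x) \<partial>lb_on V) ~~> 0"
   by (rule L1_dominated_convergence[OF m(1) assms(2) w lim(1)], simp add: bd)+
  show "L1_on V g0" "(%n. \<integral>x. norm (g n x - g0 x) \<partial>lb_on V) ~~> 0"
   by (rule L1_dominated_convergence[OF m(2) assms(3) w lim(2)], simp add: bd)+
 qed
qed

text \<open>A subsequence makes the functions converge almost everywhere as well. For the gradients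
  L1 convergence suffices, since they enter the chain rule linearly.\<close>

lemma W11_AE_approx:
 assumes "W11 V f g"
 obtains F G where "!!n::nat. C1_on V (F n) (G n)" "!!n. L1_on V (F n)" "!!n. L1_on V (G n)"
  "(%n. \<integral>x. norm (F n x - f x) \<partial>lb_on V) ~~> 0" "(%n. \<integral>x. norm (G n x - g x) \<partial>lb_on V) ~~> 0"
  "AE x in lb_on V. (%n. F n x) ~~> f x"
proof -
 note fg = W11_integrable[OF assms]
 define R where "R n p \<longleftrightarrow> C1_on V (fst p) (snd p) & L1_on V (fst p) & L1_on V (snd p) &
   (LINT x|lb_on V. norm (fst p x - f x)) < 1 / real (Suc n) & (LINT x|lb_on V. norm (snd p x - g x)) < 1 / real (Suc n)" for n p
 have "\<exists>p. R n p" for n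
 proof -
  obtain F G where "C1_on V F G" "L1_on V F" "L1_on V G"
   "(LINT x|lb_on V. norm (F x - f x)) < 1 / real (Suc n)" "(LINT x|lb_on V. norm (G x - g x)) < 1 / real (Suc n)"
   by (rule W11_approx[OF assms, of "1 / real (Suc n)"]) auto
  hence "R n (F, G)" unfolding R_def fst_conv snd_conv by (intro conjI)
  thus ?thesis ..
 qed
 hence "\<exists>p. \<forall>n. R n (p n)" by (intro choice allI)
 then obtain p where p: "!!n. R n (p n)" by blast
 define F G where "F n = fst (p n)" and "G n = snd (p n)" for n
 have FG: "C1_on V (F n) (G n)" "L1_on V (F n)" "L1_on V (G n)"
   "(LINT x|lb_on V. norm (F n x - f x)) < 1 / real (Suc n)" "(LINT x|lb_on V. norm (G n x - g x)) < 1 / real (Suc n)" for n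
  using p[of n] unfolding R_def F_def G_def by blast+
 have l1: "(%n. \<integral>x. norm (F n x - f x) \<partial>lb_on V) ~~> 0"
 proof (rule tendsto_zero_squeeze[OF _ _ LIMSEQ_Suc[OF lim_1_over_n]])
  show "0 <= (LINT x|lb_on V. norm (F n x - f x))" for n by (intro bi_integral_nonneg norm_ge_zero)
  show "(LINT x|lb_on V. norm (F n x - f x)) <= 1 / real (Suc n)" for n using FG(4) by (rule less_imp_le)
 qed
 have l2: "(%n. \<integral>x. norm (G n x - g x) \<partial>lb_on V) ~~> 0"
 proof (rule tendsto_zero_squeeze[OF _ _ LIMSEQ_Suc[OF lim_1_over_n]])
  show "0 <= (LINT x|lb_on V. norm (G n x - g x))" for n by (intro bi_integral_nonneg norm_ge_zero)
  show "(LINT x|lb_on V. norm (G n x - g x)) <= 1 / real (Suc n)" for n using FG(5) by (rule less_imp_le)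
 qed
 have "\<exists>r::nat => nat. strict_mono r & (AE x in lb_on V. (%n. F (r n) x - f x) ~~> 0)"
 proof (rule tendsto_L1_AE_subseq[where u="%n x. F n x - f x"])
  show "L1_on V (%x. F n x - f x)" for n by (intro bi_integrable_diff FG(2) fg(1))
 qed (rule l1)
 then obtain r :: "nat => nat" where r0: "strict_mono r & (AE x in lb_on V. (%n. F (r n) x - f x) ~~> 0)"
  by (rule exE)
 note r = conjunct1[OF r0] conjunct2[OF r0]
 define F' G' where "F' n = F (r n)" and "G' n = G (r n)" for n
 have f: "C1_on V (F' n) (G' n)" "L1_on V (F' n)" "L1_on V (G' n)" for n
  unfolding F'_def G'_def by (rule FG)+
 have f4: "(%n. \<integral>x. norm (F' n x - f x) \<partial>lb_on V) ~~> 0"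
  using LIMSEQ_subseq_LIMSEQ[OF l1 r(1)] unfolding comp_def F'_def .
 have f5: "(%n. \<integral>x. norm (G' n x - g x) \<partial>lb_on V) ~~> 0"
  using LIMSEQ_subseq_LIMSEQ[OF l2 r(1)] unfolding comp_def G'_def .
 have f6: "AE x in lb_on V. (%n. F' n x) ~~> f x"
  using r(2)
 proof (rule AE_mp, intro AE_I2 impI)
  fix x assume "(%n. F (r n) x - f x) ~~> 0"
  thus "(%n. F' n x) ~~> f x" unfolding F'_def by (rule LIM_zero_cancel)
 qed
 show ?thesis by (rule that[OF f f4 f5 f6])
qed

lemma W11_cong:
 assumes "W11 V f g" "!!x. x \<in> V ==> f x = f' x" "!!x. x \<in> V ==> g x = g' x"
 shows "W11 V f' g'"
proof -
 have sp: "x \<in> V" if "x \<in> space (lb_on V)" for x using that by (simp add: space_restrict_space)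
 have c: "L1_on V f = L1_on V f'" "L1_on V g = L1_on V g'"
  using assms(2,3) sp by (auto intro!: bi_integrable_cong)
 have d: "(LINT x|lb_on V. norm (F x - f x)) = (LINT x|lb_on V. norm (F x - f' x))"
  "(LINT x|lb_on V. norm (G x - g x)) = (LINT x|lb_on V. norm (G x - g' x))" for F G
  using assms(2,3) sp by (auto intro!: bi_integral_cong)
 show ?thesis using assms(1) unfolding W11_def c d .
qed

section \<open>Chain, product, power and lattice rules\<close>

lemma gradient_bounded_lipschitz:
 fixes F :: "'a::real_inner => real"
 assumes "!!z. (F has_derivative (%h. DF z \<bullet> h)) (at z)" "!!z. norm (DF z) <= C"
 shows "\<bar>F w - F z\<bar> <= C * norm (w - z)"
proof -
 obtain t where t: "F (z + (w - z)) - F z = DF (z + t *R (w - z)) \<bullet> (w - z)"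
  using gradient_mean_value[of F DF z "w - z", OF assms(1)] by blast
 have "\<bar>DF (z + t *R (w - z)) \<bullet> (w - z)\<bar> <= norm (DF (z + t *R (w - z))) * norm (w - z)" by (rule Cauchy_Schwarz_ineq2)
 also have "... <= C * norm (w - z)" by (intro mult_right_mono assms(2)) simp
 finally show ?thesis using t by simp
qed

lemma borel_measurable_compose_continuous:
 assumes "continuous_on UNIV (F :: 'b::topological_space => 'c::topological_space)" "f \<in> borel_measurable M"
 shows "(%x. F (f x)) \<in> borel_measurable M"
 using measurable_compose[OF assms(2) borel_measurable_continuous_onI[OF assms(1)]] .

text \<open>Two inner functions let one lemma yield linear combinations, products and variable
  powers. Only the coefficients \<open>DF (a x, b x)\<close> need pointwise convergence; being
  bounded, they may multiply gradients that converge in L1.\<close>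

lemma W11_chain:
 fixes F :: "real \<times> real => real"
 assumes a: "W11 V a Da" and b: "W11 V b Db" and V: "open V" "emeasure lborel V < \<infinity>"
  and F: "!!z. (F has_derivative (%h. DF z \<bullet> h)) (at z)" "continuous_on UNIV DF" "!!z. norm (DF z) <= C"
 shows "W11 V (%x. F (a x, b x)) (%x. fst (DF (a x, b x)) *R Da x + snd (DF (a x, b x)) *R Db x)"
proof -
 obtain A GA where A: "!!n::nat. C1_on V (A n) (GA n)" "!!n. L1_on V (A n)" "!!n. L1_on V (GA n)"
  "(%n. \<integral>x. norm (A n x - a x) \<partial>lb_on V) ~~> 0" "(%n. \<integral>x. norm (GA n x - Da x) \<partial>lb_on V) ~~> 0"
  "AE x in lb_on V. (%n. A n x) ~~> a x" by (rule W11_AE_approx[OF a]) blast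
 obtain B0 GB0 where B0: "!!n::nat. C1_on V (B0 n) (GB0 n)" "!!n. L1_on V (B0 n)" "!!n. L1_on V (GB0 n)"
  "(%n. \<integral>x. norm (B0 n x - b x) \<partial>lb_on V) ~~> 0" "(%n. \<integral>x. norm (GB0 n x - Db x) \<partial>lb_on V) ~~> 0"
  "AE x in lb_on V. (%n. B0 n x) ~~> b x" by (rule W11_AE_approx[OF b]) blast
 define B where "B = B0"
 define GB where "GB = GB0"
 note B = B0[folded B_def GB_def]
 note ia = W11_integrable[OF a] and ib = W11_integrable[OF b]
 define P where "P z = fst (DF z)" for z
 define Q where "Q z = snd (DF z)" for z
 have cP: "continuous_on UNIV P" and cQ: "continuous_on UNIV Q" unfolding P_def Q_def by (intro continuous_intros F(2))+
 have fs: "\<bar>fst w\<bar> <= norm w" "\<bar>snd w\<bar> <= norm w" for w :: "real \<times> real"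
  using norm_fst_le[of "fst w" "snd w"] norm_snd_le[of "snd w" "fst w"] by simp_all
 have bP: "\<bar>P z\<bar> <= C" and bQ: "\<bar>Q z\<bar> <= C" for z
  using F(3)[of z] fs[of "DF z"] unfolding P_def Q_def by linarith+
 have C0: "C \<ge> 0" using bP[of undefined] by linarith
 have cF: "continuous_on UNIV F" by (meson F(1) continuous_at_imp_continuous_on has_derivative_continuous)
 have lip: "\<bar>F (s, t) - F (s', t')\<bar> <= C * (\<bar>s - s'\<bar> + \<bar>t - t'\<bar>)" for s t s' t'
 proof -
  have "\<bar>F (s, t) - F (s', t')\<bar> <= C * norm ((s, t) - (s', t'))" by (rule gradient_bounded_lipschitz[OF F(1,3)])
  also have "... <= C * (\<bar>s - s'\<bar> + \<bar>t - t'\<bar>)" using norm_Pair_le[of "s - s'" "t - t'"] C0 by (intro mult_left_mono) auto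
  finally show ?thesis .
 qed
 have [measurable]: "a \<in> bm_on V" "Da \<in> bm_on V"
  "b \<in> bm_on V" "Db \<in> bm_on V"
  "!!n. A n \<in> bm_on V" "!!n. GA n \<in> bm_on V"
  "!!n. B n \<in> bm_on V" "!!n. GB n \<in> bm_on V"
  by (intro borel_measurable_integrable ia ib A B)+
 have mF: "(%x. H (c x, d x)) \<in> bm_on V" if "continuous_on UNIV (H :: real \<times> real => real)"
  "c \<in> bm_on V" "d \<in> bm_on V" for H c d
  by (rule borel_measurable_compose_continuous[OF that(1)]) (intro borel_measurable_Pair that)
 have iconst: "L1_on V (%x. c)" for c :: real
  using V by (simp add: integrable_restrict_space integrable_mult_left)
 have iF: "L1_on V (%x. F (c x, d x))" if "L1_on V c" "L1_on V d" for c d :: "'a => real"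
 proof (rule bi_integrable_bound)
  show "L1_on V (%x. \<bar>F (0, 0)\<bar> + C * (\<bar>c x\<bar> + \<bar>d x\<bar>))"
   by (intro bi_integrable_add iconst integrable_mult_right integrable_abs that)
  show "AE x in lb_on V. norm (F (c x, d x)) <= norm (\<bar>F (0, 0)\<bar> + C * (\<bar>c x\<bar> + \<bar>d x\<bar>))"
  proof (rule AE_I2)
   fix x
   show "norm (F (c x, d x)) <= norm (\<bar>F (0, 0)\<bar> + C * (\<bar>c x\<bar> + \<bar>d x\<bar>))"
    using lip[of "c x" "d x" 0 0] C0 by simp
  qed
  show "(%x. F (c x, d x)) \<in> bm_on V"
   by (rule mF[OF cF]) (use that in auto)
 qed
 have iP: "L1_on V (%x. H (c x, d x) *R g x)" if "L1_on V c" "L1_on V d" "L1_on V g"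
  "continuous_on UNIV H" "!!z. \<bar>H z\<bar> <= C" for c d :: "'a => real" and H and g :: "'a => 'a"
 proof (rule bi_integrable_bound)
  show "L1_on V (%x. C * norm (g x))" by (intro integrable_mult_right integrable_norm that)
  show "AE x in lb_on V. norm (H (c x, d x) *R g x) <= norm (C * norm (g x))"
   using that(5) C0 by (intro AE_I2) (simp add: mult_right_mono)
  have "(%x. H (c x, d x)) \<in> bm_on V"
   by (rule mF[OF that(4)]) (use that(1,2) in auto)
  thus "(%x. H (c x, d x) *R g x) \<in> bm_on V"
   by (intro borel_measurable_scaleR) (use that(3) in auto)
 qed
 \<comment> \<open>The difference is split into H(A_n, B_n) (g_n - g0), small because H is bounded,
   and (H(A_n, B_n) - H(a, b)) g0, small by dominated convergence.\<close>
 have term_lim: "(%n. \<integral>x. norm (H (A n x, B n x) *R g n x - H (a x, b x) *R g0 x) \<partial>lb_on V) ~~> 0"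
  if H: "continuous_on UNIV H" "!!z. \<bar>H z\<bar> <= C" and g: "!!n. L1_on V (g n)" "L1_on V g0"
   "(%n. \<integral>x. norm (g n x - g0 x) \<partial>lb_on V) ~~> 0" for H and g :: "nat => 'a => 'a" and g0
 proof -
  have l1: "(%n. \<integral>x. norm (H (A n x, B n x) *R g0 x - H (a x, b x) *R g0 x) \<partial>lb_on V) ~~> 0"
  proof (rule L1_dominated_convergence(2))
   show "(%x. H (A n x, B n x) *R g0 x) \<in> bm_on V" for n
    by (rule borel_measurable_integrable[OF iP[OF A(2) B(2) g(2) H]])
   show "(%x. H (a x, b x) *R g0 x) \<in> bm_on V"
    by (rule borel_measurable_integrable[OF iP[OF ia(1) ib(1) g(2) H]])
   show "L1_on V (%x. C * norm (g0 x))" by (intro integrable_mult_right integrable_norm g)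
   show "AE x in lb_on V. norm (H (A n x, B n x) *R g0 x) <= C * norm (g0 x)" for n
    using H(2) by (intro AE_I2) (simp add: mult_right_mono)
   have "AE x in lb_on V. (%n. A n x) ~~> a x & (%n. B n x) ~~> b x" by (intro AE_conjI A(6) B(6))
   thus "AE x in lb_on V. (%n. H (A n x, B n x) *R g0 x) ~~> H (a x, b x) *R g0 x"
   proof (rule AE_mp, intro AE_I2 impI)
    fix x assume "(%n. A n x) ~~> a x & (%n. B n x) ~~> b x"
    hence "(%n. (A n x, B n x)) ~~> (a x, b x)" by (intro tendsto_Pair) auto
    hence "(%n. H (A n x, B n x)) ~~> H (a x, b x)"
     by (rule isCont_tendsto_compose[rotated]) (use H(1) in \<open>simp add: continuous_on_eq_continuous_at\<close>)
    thus "(%n. H (A n x, B n x) *R g0 x) ~~> H (a x, b x) *R g0 x" by (intro tendsto_scaleR tendsto_const)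
   qed
  qed
  have l2: "(%n. C * (LINT x|lb_on V. norm (g n x - g0 x)) + (LINT x|lb_on V. norm (H (A n x, B n x) *R g0 x - H (a x, b x) *R g0 x))) ~~> 0"
   using tendsto_add[OF tendsto_mult[OF tendsto_const[of C] g(3)] l1] by simp
  show ?thesis
  proof (rule tendsto_zero_squeeze[OF _ _ l2])
   fix n
   show "0 <= (LINT x|lb_on V. norm (H (A n x, B n x) *R g n x - H (a x, b x) *R g0 x))"
    by (intro bi_integral_nonneg norm_ge_zero)
   note i1 = iP[OF A(2) B(2) g(1) H, of n n n] and i2 = iP[OF A(2) B(2) g(2) H, of n n] and i3 = iP[OF ia(1) ib(1) g(2) H]
   have "(LINT x|lb_on V. norm (H (A n x, B n x) *R g n x - H (a x, b x) *R g0 x))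
    <= (LINT x|lb_on V. norm (H (A n x, B n x) *R g n x - H (A n x, B n x) *R g0 x)) + (LINT x|lb_on V. norm (H (A n x, B n x) *R g0 x - H (a x, b x) *R g0 x))"
    by (rule integral_norm_triangle[OF i1 i2 i3])
   also have "(LINT x|lb_on V. norm (H (A n x, B n x) *R g n x - H (A n x, B n x) *R g0 x)) <= (LINT x|lb_on V. C * norm (g n x - g0 x))"
   proof (rule integral_mono)
    show "L1_on V (%x. norm (H (A n x, B n x) *R g n x - H (A n x, B n x) *R g0 x))"
     by (intro integrable_norm bi_integrable_diff i1 i2)
    show "L1_on V (%x. C * norm (g n x - g0 x))"
     by (intro integrable_mult_right integrable_norm bi_integrable_diff g)
    show "norm (H (A n x, B n x) *R g n x - H (A n x, B n x) *R g0 x) <= C * norm (g n x - g0 x)" for x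
     unfolding scaleR_diff_right[symmetric] norm_scaleR by (intro mult_right_mono H(2)) simp
   qed
   also have "(LINT x|lb_on V. C * norm (g n x - g0 x)) = C * (LINT x|lb_on V. norm (g n x - g0 x))" by simp
   finally show "(LINT x|lb_on V. norm (H (A n x, B n x) *R g n x - H (a x, b x) *R g0 x))
    <= C * (LINT x|lb_on V. norm (g n x - g0 x)) + (LINT x|lb_on V. norm (H (A n x, B n x) *R g0 x - H (a x, b x) *R g0 x))" by simp
  qed
 qed
 have main: "W11 V (%x. F (a x, b x)) (%x. P (a x, b x) *R Da x + Q (a x, b x) *R Db x)"
 proof (rule W11_L1_limit[where f="%n x. F (A n x, B n x)" and g="%n x. P (A n x, B n x) *R GA n x + Q (A n x, B n x) *R GB n x"])
  show "L1_on V (%x. F (a x, b x))" by (rule iF[OF ia(1) ib(1)])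
  show "L1_on V (%x. P (a x, b x) *R Da x + Q (a x, b x) *R Db x)"
   by (intro bi_integrable_add iP ia ib cP cQ bP bQ)
  show "W11 V (%x. F (A n x, B n x)) (%x. P (A n x, B n x) *R GA n x + Q (A n x, B n x) *R GB n x)" for n
   unfolding W11_def
  proof (intro conjI allI impI exI)
   show 1: "L1_on V (%x. F (A n x, B n x))" by (rule iF[OF A(2) B(2)])
   show 1: "L1_on V (%x. F (A n x, B n x))" by (rule iF[OF A(2) B(2)])
   show 2: "L1_on V (%x. P (A n x, B n x) *R GA n x + Q (A n x, B n x) *R GB n x)"
    by (intro bi_integrable_add iP A B cP cQ bP bQ)
   show 2: "L1_on V (%x. P (A n x, B n x) *R GA n x + Q (A n x, B n x) *R GB n x)"
    by (intro bi_integrable_add iP A B cP cQ bP bQ)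
   show "C1_on V (%x. F (A n x, B n x)) (%x. P (A n x, B n x) *R GA n x + Q (A n x, B n x) *R GB n x)"
    unfolding C1_on_def
   proof (intro conjI ballI)
    fix x assume x: "x \<in> V"
    have "((%x. (A n x, B n x)) has_derivative (%h. (GA n x \<bullet> h, GB n x \<bullet> h))) (at x)"
     using A(1)[of n] B(1)[of n] x unfolding C1_on_def by (intro has_derivative_Pair) auto
    from has_derivative_compose[OF this F(1)]
    show "((%x. F (A n x, B n x)) has_derivative (%h. (P (A n x, B n x) *R GA n x + Q (A n x, B n x) *R GB n x) \<bullet> h)) (at x)"
     by (simp add: inner_prod_def inner_add_left P_def Q_def)
   next
    have c: "continuous_on V (%x. (A n x, B n x))" by (intro continuous_on_Pair C1_on_continuous[OF A(1)] C1_on_continuous[OF B(1)])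
    have cg: "continuous_on V (GA n)" "continuous_on V (GB n)" using A(1)[of n] B(1)[of n] unfolding C1_on_def by auto
    show "continuous_on V (%x. P (A n x, B n x) *R GA n x + Q (A n x, B n x) *R GB n x)"
     by (intro continuous_on_add continuous_on_scaleR cg continuous_on_compose2[OF cP c] continuous_on_compose2[OF cQ c]) auto
   qed
  qed simp_all
  have l2: "(%n. C * ((LINT x|lb_on V. norm (A n x - a x)) + (LINT x|lb_on V. norm (B n x - b x)))) ~~> 0"
   using tendsto_mult[OF tendsto_const[of C] tendsto_add[OF A(4) B(4)]] by simp
  show "(%n. \<integral>x. norm (F (A n x, B n x) - F (a x, b x)) \<partial>lb_on V) ~~> 0"
  proof (rule tendsto_zero_squeeze[OF _ _ l2])
   fix n
   show "0 <= (LINT x|lb_on V. norm (F (A n x, B n x) - F (a x, b x)))"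
    by (intro bi_integral_nonneg norm_ge_zero)
   have i: "L1_on V (%x. norm (A n x - a x))" "L1_on V (%x. norm (B n x - b x))"
    by (intro integrable_norm bi_integrable_diff A B ia ib)+
   have "(LINT x|lb_on V. norm (F (A n x, B n x) - F (a x, b x))) <= (LINT x|lb_on V. C * (norm (A n x - a x) + norm (B n x - b x)))"
   proof (rule integral_mono)
    show "norm (F (A n x, B n x) - F (a x, b x)) <= C * (norm (A n x - a x) + norm (B n x - b x))" for x
     using lip by simp
   qed (intro integrable_norm bi_integrable_diff iF A B ia ib integrable_mult_right bi_integrable_add)+
   also have "... = C * ((LINT x|lb_on V. norm (A n x - a x)) + (LINT x|lb_on V. norm (B n x - b x)))"
    using i by simp
   finally show "(LINT x|lb_on V. norm (F (A n x, B n x) - F (a x, b x))) <= C * ((LINT x|lb_on V. norm (A n x - a x)) + (LINT x|lb_on V. norm (B n x - b x)))" .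
  qed
  have lP: "(%n. \<integral>x. norm (P (A n x, B n x) *R GA n x - P (a x, b x) *R Da x) \<partial>lb_on V) ~~> 0"
   by (rule term_lim[OF cP bP A(3) ia(2) A(5)])
  have lQ: "(%n. \<integral>x. norm (Q (A n x, B n x) *R GB n x - Q (a x, b x) *R Db x) \<partial>lb_on V) ~~> 0"
   by (rule term_lim[OF cQ bQ B(3) ib(2) B(5)])
  have lPQ: "(%n. (LINT x|lb_on V. norm (P (A n x, B n x) *R GA n x - P (a x, b x) *R Da x)) + (LINT x|lb_on V. norm (Q (A n x, B n x) *R GB n x - Q (a x, b x) *R Db x))) ~~> 0"
   using tendsto_add[OF lP lQ] by simp
  show "(%n. \<integral>x. norm (P (A n x, B n x) *R GA n x + Q (A n x, B n x) *R GB n x - (P (a x, b x) *R Da x + Q (a x, b x) *R Db x)) \<partial>lb_on V) ~~> 0"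
  proof (rule tendsto_zero_squeeze[OF _ _ lPQ])
   fix n
   show "0 <= (LINT x|lb_on V. norm (P (A n x, B n x) *R GA n x + Q (A n x, B n x) *R GB n x - (P (a x, b x) *R Da x + Q (a x, b x) *R Db x)))"
    by (intro bi_integral_nonneg norm_ge_zero)
   have i: "L1_on V (%x. norm (P (A n x, B n x) *R GA n x - P (a x, b x) *R Da x))"
    "L1_on V (%x. norm (Q (A n x, B n x) *R GB n x - Q (a x, b x) *R Db x))"
    by (intro integrable_norm bi_integrable_diff iP A B ia ib cP cQ bP bQ)+
   show "(LINT x|lb_on V. norm (P (A n x, B n x) *R GA n x + Q (A n x, B n x) *R GB n x - (P (a x, b x) *R Da x + Q (a x, b x) *R Db x)))
    <= (LINT x|lb_on V. norm (P (A n x, B n x) *R GA n x - P (a x, b x) *R Da x)) + (LINT x|lb_on V. norm (Q (A n x, B n x) *R GB n x - Q (a x, b x) *R Db x))"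
    unfolding bi_integral_add[OF i, symmetric]
   proof (rule integral_mono)
    show "norm (P (A n x, B n x) *R GA n x + Q (A n x, B n x) *R GB n x - (P (a x, b x) *R Da x + Q (a x, b x) *R Db x))
     <= norm (P (A n x, B n x) *R GA n x - P (a x, b x) *R Da x) + norm (Q (A n x, B n x) *R GB n x - Q (a x, b x) *R Db x)" for x
     by (rule norm_diff_triangle_ineq)
    show "L1_on V (%x. norm (P (A n x, B n x) *R GA n x - P (a x, b x) *R Da x) + norm (Q (A n x, B n x) *R GB n x - Q (a x, b x) *R Db x))"
     by (intro bi_integrable_add i)
    show "L1_on V (%x. norm (P (A n x, B n x) *R GA n x + Q (A n x, B n x) *R GB n x - (P (a x, b x) *R Da x + Q (a x, b x) *R Db x)))"
     by (intro integrable_norm bi_integrable_diff bi_integrable_add iP A B ia ib cP cQ bP bQ)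
   qed
  qed
 qed
 thus ?thesis unfolding P_def Q_def .
qed

lemma integrable_lb_on_const:
 assumes "open V" "emeasure lborel V < \<infinity>"
 shows "L1_on V (%x. c :: real)"
 using assms by (simp add: integrable_restrict_space integrable_mult_left)

lemma integrable_lb_on_bounded:
 fixes f :: "'a::euclidean_space => 'b::{banach, second_countable_topology}"
 assumes "open V" "emeasure lborel V < \<infinity>" "f \<in> bm_on V" "!!x. x \<in> V ==> norm (f x) <= B"
 shows "L1_on V f"
proof (rule bi_integrable_bound[OF integrable_lb_on_const[OF assms(1,2), of B] assms(3)])
 show "AE x in lb_on V. norm (f x) <= norm B"
 proof (rule AE_I2)
  fix x assume "x \<in> space (lb_on V)"
  hence "x \<in> V" by (simp add: space_restrict_space)
  thus "norm (f x) <= norm B" using assms(4)[of x] by simp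
 qed
qed

lemma borel_measurable_lb_on_continuous:
 assumes "open V" "continuous_on V f"
 shows "f \<in> bm_on V"
proof -
 have "f \<in> borel_measurable (restrict_space borel V)" by (rule borel_measurable_continuous_on_restrict[OF assms(2)])
 moreover have "sets (restrict_space borel V) = sets (lb_on V)" by (intro sets_restrict_space_cong) simp
 ultimately show ?thesis by (simp cong: measurable_cong_sets)
qed

lemma W11_C1:
 assumes V: "open V" "emeasure lborel V < \<infinity>" and F: "C1_on V F G"
  and B: "!!x. x \<in> V ==> \<bar>F x\<bar> <= B" "!!x. x \<in> V ==> norm (G x) <= B"
 shows "W11 V F G"
proof -
 have cG: "continuous_on V G" using F unfolding C1_on_def by blast
 have 1: "L1_on V F"
  by (rule integrable_lb_on_bounded[OF V borel_measurable_lb_on_continuous[OF V(1) C1_on_continuous[OF F]], where B=B]) (simp add: B)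
 have 2: "L1_on V G"
  by (rule integrable_lb_on_bounded[OF V borel_measurable_lb_on_continuous[OF V(1) cG], where B=B]) (simp add: B)
 show ?thesis unfolding W11_def
 proof (intro conjI allI impI 1 2)
  fix e :: real assume "e > 0"
  thus "\<exists>F' G'. C1_on V F' G' & L1_on V F' & L1_on V G' &
   (LINT x|lb_on V. norm (F' x - F x)) < e & (LINT x|lb_on V. norm (G' x - G x)) < e"
   by (intro exI[of _ F] exI[of _ G] conjI F 1 2) simp_all
 qed
qed

lemma W11_linear:
 assumes a: "W11 V a Da" and b: "W11 V b Db" and V: "open V" "emeasure lborel V < \<infinity>"
 shows "W11 V (%x. alpha * a x + beta * b x) (%x. alpha *R Da x + beta *R Db x)"
proof -
 have "W11 V (%x. (%z. alpha * fst z + beta * snd z) (a x, b x))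
   (%x. fst ((%z::real\<times>real. (alpha, beta)) (a x, b x)) *R Da x + snd ((%z::real\<times>real. (alpha, beta)) (a x, b x)) *R Db x)"
 proof (rule W11_chain[OF a b V, where C="norm (alpha, beta)"])
  show "((%z. alpha * fst z + beta * snd z) has_derivative (%h. (alpha, beta) \<bullet> h)) (at z)" for z :: "real \<times> real"
   by (auto intro!: derivative_eq_intros simp: inner_prod_def)
 qed simp_all
 thus ?thesis by simp
qed

lemma W11_compose_real:
 fixes F :: "real => real"
 assumes a: "W11 V a Da" and V: "open V" "emeasure lborel V < \<infinity>"
  and F: "!!t. (F has_real_derivative F' t) (at t)" "continuous_on UNIV F'" "!!t. \<bar>F' t\<bar> <= C"
 shows "W11 V (%x. F (a x)) (%x. F' (a x) *R Da x)"
proof -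
 have "W11 V (%x. (%z. F (fst z)) (a x, a x))
   (%x. fst ((%z::real\<times>real. (F' (fst z), 0::real)) (a x, a x)) *R Da x + snd ((%z::real\<times>real. (F' (fst z), 0::real)) (a x, a x)) *R Da x)"
 proof (rule W11_chain[OF a a V, where C=C])
  show "((%z. F (fst z)) has_derivative (%h. (F' (fst z), 0) \<bullet> h)) (at z)" for z :: "real \<times> real"
  proof -
   have 1: "(fst has_derivative fst) (at z)" by (auto intro!: derivative_eq_intros)
   have 2: "(F has_derivative (%h. F' (fst z) * h)) (at (fst z))" using F(1)[of "fst z"] by (simp add: has_field_derivative_def)
   show ?thesis using has_derivative_compose[OF 1 2] by (simp add: inner_prod_def)
  qed
  show "continuous_on UNIV (%z::real\<times>real. (F' (fst z), 0::real))"
   by (intro continuous_on_Pair continuous_on_const continuous_on_compose2[OF F(2)] continuous_on_fst continuous_on_id) simp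
  show "norm (F' (fst z), 0::real) <= C" for z :: "real \<times> real" using F(3)[of "fst z"] by (simp add: norm_Pair)
 qed
 thus ?thesis by simp
qed

text \<open>A C1 substitute for the positive part: the identity for t \<ge> 0, continued by exp t -
  1, hence bounded below by -1 and with slope in (0, 1].\<close>

definition softramp :: "real => real" where "softramp t = max 0 t + exp (min 0 t) - 1"

lemma softramp_has_derivative: "(softramp has_real_derivative exp (min 0 t)) (at t)"
proof -
 consider "t > 0" | "t < 0" | "t = 0" by linarith
 thus ?thesis
 proof cases
  case 1
  have "((%t. t) has_real_derivative exp (min 0 t)) (at t)" using 1 by (auto intro!: derivative_eq_intros)
  thus ?thesis
   by (rule has_field_derivative_transform_within_open[where S="{0<..}"]) (use 1 in \<open>auto simp: softramp_def\<close>)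
 next
  case 2
  have "((%t. exp t - 1) has_real_derivative exp (min 0 t)) (at t)" using 2 by (auto intro!: derivative_eq_intros)
  thus ?thesis
   by (rule has_field_derivative_transform_within_open[where S="{..<0}"]) (use 2 in \<open>auto simp: softramp_def\<close>)
 next
  case 3
  have "((%h. (softramp (0 + h) - softramp 0) / h) \<longlongrightarrow> 1) (at 0)"
  proof (rule filterlim_split_at)
   have "eventually (%h::real. (exp h - 1) / h = (softramp (0 + h) - softramp 0) / h) (at_left 0)"
    unfolding eventually_at_filter by (rule always_eventually) (auto simp: softramp_def)
   moreover have "((%h::real. (exp h - 1) / h) \<longlongrightarrow> 1) (at_left 0)"
   proof (rule filterlim_mono[OF _ order_refl])
    show "((%h::real. (exp h - 1) / h) \<longlongrightarrow> 1) (at 0)" using DERIV_exp[of "0::real"] by (simp add: DERIV_def)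
   qed (simp add: at_le)
   ultimately show "((%h. (softramp (0 + h) - softramp 0) / h) \<longlongrightarrow> 1) (at_left 0)"
    by (rule Lim_transform_eventually[rotated])
   have "eventually (%h::real. 1 = (softramp (0 + h) - softramp 0) / h) (at_right 0)"
    unfolding eventually_at_filter by (rule always_eventually) (auto simp: softramp_def)
   thus "((%h. (softramp (0 + h) - softramp 0) / h) \<longlongrightarrow> 1) (at_right 0)"
    by (rule Lim_transform_eventually[OF tendsto_const])
  qed
  thus ?thesis unfolding 3 by (simp add: DERIV_def)
 qed
qed

lemma softramp_bounds: "softramp t \<ge> -1" "t \<ge> 0 ==> softramp t = t" "t \<ge> 0 ==> softramp t \<ge> 0" "softramp t <= max 0 t"
proof -
 have "exp (min 0 t) > 0" by simp
 thus "softramp t \<ge> -1" unfolding softramp_def by linarith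
 show "t \<ge> 0 ==> softramp t = t" "t \<ge> 0 ==> softramp t \<ge> 0" by (simp_all add: softramp_def)
 have "exp (min 0 t) <= 1" by simp
 thus "softramp t <= max 0 t" unfolding softramp_def by linarith
qed

text \<open>One soft ramp at each end gives a C1 clamp: the identity on [a, b], values within s of
  that interval, slope between 0 and 1.\<close>

definition softclamp :: "real => real => real => real => real" where
 "softclamp a b s t = b - s * softramp ((b - (a + s * softramp ((t - a) / s))) / s)"

definition softclamp' :: "real => real => real => real => real" where
 "softclamp' a b s t = exp (min 0 ((b - (a + s * softramp ((t - a) / s))) / s)) * exp (min 0 ((t - a) / s))"

lemma softclamp:
 assumes s: "s > 0" and ab: "a <= b"
 shows "(softclamp a b s has_real_derivative softclamp' a b s t) (at t)"
  "continuous_on UNIV (softclamp' a b s)" "\<bar>softclamp' a b s t\<bar> <= 1"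
  "t \<in> {a..b} ==> softclamp a b s t = t" "t \<in> {a..b} ==> softclamp' a b s t = 1"
  "softclamp a b s t \<in> {a - s..b + s}"
proof -
 have 1: "((%t. a + s * softramp ((t - a) / s)) has_real_derivative exp (min 0 ((t - a) / s))) (at t)" for t
 proof -
  have "((%t. t - a) has_real_derivative 1) (at t)" by (auto intro!: derivative_eq_intros)
  from DERIV_cdivide[OF this] have "((%t. (t - a) / s) has_real_derivative 1 / s) (at t)" .
  from DERIV_chain2[OF softramp_has_derivative this]
  have "((%t. softramp ((t - a) / s)) has_real_derivative exp (min 0 ((t - a) / s)) * (1 / s)) (at t)" .
  from DERIV_add[OF DERIV_const DERIV_cmult[OF this, of s], of a] show ?thesis using s by simp
 qed
 have 2: "((%u. b - s * softramp ((b - u) / s)) has_real_derivative exp (min 0 ((b - u) / s))) (at u)" for u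
 proof -
  have "((%u. b - u) has_real_derivative - 1) (at u)" by (auto intro!: derivative_eq_intros)
  from DERIV_cdivide[OF this] have "((%u. (b - u) / s) has_real_derivative - 1 / s) (at u)" .
  from DERIV_chain2[OF softramp_has_derivative this]
  have "((%u. softramp ((b - u) / s)) has_real_derivative exp (min 0 ((b - u) / s)) * (- 1 / s)) (at u)" .
  from DERIV_diff[OF DERIV_const DERIV_cmult[OF this, of s], of b] show ?thesis using s by simp
 qed
 show "(softclamp a b s has_real_derivative softclamp' a b s t) (at t)"
  using DERIV_chain2[OF 2 1[of t]] unfolding softclamp_def[abs_def] softclamp'_def .
 have cs: "continuous_on UNIV (%t. a + s * softramp ((t - a) / s))"
  by (intro continuous_at_imp_continuous_on ballI DERIV_isCont[OF 1])
 show "continuous_on UNIV (softclamp' a b s)" unfolding softclamp'_def[abs_def]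
  by (intro continuous_intros cs) (use s in auto)
 show "\<bar>softclamp' a b s t\<bar> <= 1" unfolding softclamp'_def by (simp add: mult_le_one)
 have L: "t \<in> {a..b} ==> a + s * softramp ((t - a) / s) = t"
  using s softramp_bounds(2)[of "(t - a) / s"] by simp
 show "t \<in> {a..b} ==> softclamp a b s t = t"
  unfolding softclamp_def using L s softramp_bounds(2)[of "(b - t) / s"] by simp
 show "t \<in> {a..b} ==> softclamp' a b s t = 1"
  unfolding softclamp'_def using L s by (simp add: min_def)
 have La: "a + s * softramp ((t - a) / s) \<ge> a - s"
  using mult_left_mono[OF softramp_bounds(1)[of "(t - a) / s"], of s] s by simp
 define u where "u = a + s * softramp ((t - a) / s)"
 have u: "u \<ge> a - s" using La unfolding u_def .
 have "b - s * softramp ((b - u) / s) <= b + s"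
  using mult_left_mono[OF softramp_bounds(1)[of "(b - u) / s"], of s] s by simp
 moreover have "b - s * softramp ((b - u) / s) \<ge> a - s"
 proof (cases "u <= b")
  case True
  hence "softramp ((b - u) / s) = (b - u) / s" using s by (intro softramp_bounds(2)) simp
  thus ?thesis using s u by simp
 next
  case False
  hence "(b - u) / s <= 0" using s by (simp add: divide_nonpos_pos)
  hence "softramp ((b - u) / s) <= 0" using softramp_bounds(4)[of "(b - u) / s"] by (simp add: max_def split: if_splits)
  hence "s * softramp ((b - u) / s) <= 0" using s by (simp add: mult_nonneg_nonpos)
  thus ?thesis using ab s by linarith
 qed
 ultimately show "softclamp a b s t \<in> {a - s..b + s}" unfolding softclamp_def u_def by simp
qed

text \<open>F has to be C1 only near the box in which (a, b) takes its values. Precomposition with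
  the soft clamp makes it globally C1 with bounded gradient and leaves it unchanged on the box; this
  admits \<open>powr\<close> and \<open>ln\<close> away from 0.\<close>

lemma W11_chain_bounded:
 fixes F :: "real \<times> real => real"
 assumes a: "W11 V a Da" and b: "W11 V b Db" and V: "open V" "emeasure lborel V < \<infinity>"
  and ar: "!!x. x \<in> V ==> a x \<in> {a0..a1}" and br: "!!x. x \<in> V ==> b x \<in> {b0..b1}"
  and s: "s > 0" "a0 <= a1" "b0 <= b1"
  and F: "!!z. z \<in> {a0 - s..a1 + s} \<times> {b0 - s..b1 + s} ==> (F has_derivative (%h. DF z \<bullet> h)) (at z)"
   "continuous_on ({a0 - s..a1 + s} \<times> {b0 - s..b1 + s}) DF"
 shows "W11 V (%x. F (a x, b x)) (%x. fst (DF (a x, b x)) *R Da x + snd (DF (a x, b x)) *R Db x)"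
proof -
 define K where "K = {a0 - s..a1 + s} \<times> {b0 - s..b1 + s}"
 note F = F[folded K_def]
 define theta where "theta z = (softclamp a0 a1 s (fst z), softclamp b0 b1 s (snd z))" for z
 define DG where "DG z = (fst (DF (theta z)) * softclamp' a0 a1 s (fst z), snd (DF (theta z)) * softclamp' b0 b1 s (snd z))" for z
 note ca = softclamp[OF s(1) s(2)] and cb = softclamp[OF s(1) s(3)]
 have thetaK: "theta z \<in> K" for z unfolding theta_def K_def using ca(6) cb(6) by simp
 have ctheta: "continuous_on UNIV theta"
 proof -
  have "continuous_on UNIV (softclamp a0 a1 s)" "continuous_on UNIV (softclamp b0 b1 s)"
   by (intro continuous_at_imp_continuous_on ballI DERIV_isCont[OF ca(1)], intro continuous_at_imp_continuous_on ballI DERIV_isCont[OF cb(1)])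
  from continuous_on_compose2[OF this(1) continuous_on_fst[OF continuous_on_id] subset_UNIV]
   continuous_on_compose2[OF this(2) continuous_on_snd[OF continuous_on_id] subset_UNIV]
  show ?thesis unfolding theta_def[abs_def] by (rule continuous_on_Pair)
 qed
 have cDF: "continuous_on UNIV (%z. DF (theta z))"
  by (rule continuous_on_compose2[OF F(2) ctheta]) (use thetaK in auto)
 have "bounded (DF ` K)" unfolding K_def
  by (intro compact_imp_bounded compact_continuous_image compact_Times compact_Icc F(2)[unfolded K_def])
 then obtain C where "\<forall>x\<in>DF ` K. norm x <= C" unfolding bounded_iff ..
 hence C: "norm (DF (theta z)) <= C" for z using thetaK[of z] by blast
 have "W11 V (%x. (%z. F (theta z)) (a x, b x)) (%x. fst (DG (a x, b x)) *R Da x + snd (DG (a x, b x)) *R Db x)"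
 proof (rule W11_chain[OF a b V, where C=C])
  fix z
  have "(theta has_derivative (%h. (softclamp' a0 a1 s (fst z) * fst h, softclamp' b0 b1 s (snd z) * snd h))) (at z)"
   unfolding theta_def[abs_def]
  proof (rule has_derivative_Pair)
   have 1: "(fst has_derivative fst) (at z)" "(snd has_derivative snd) (at z)" by (auto intro!: derivative_eq_intros)
   show "((%z. softclamp a0 a1 s (fst z)) has_derivative (%h. softclamp' a0 a1 s (fst z) * fst h)) (at z)"
    using has_derivative_compose[OF 1(1) ca(1)[unfolded has_field_derivative_def]] .
   show "((%z. softclamp b0 b1 s (snd z)) has_derivative (%h. softclamp' b0 b1 s (snd z) * snd h)) (at z)"
    using has_derivative_compose[OF 1(2) cb(1)[unfolded has_field_derivative_def]] .
  qed
  from has_derivative_compose[OF this F(1)[OF thetaK]]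
  show "((%z. F (theta z)) has_derivative (%h. DG z \<bullet> h)) (at z)"
   unfolding DG_def by (simp add: inner_prod_def mult.assoc)
  have "norm (DG z) <= norm (DF (theta z))"
   unfolding DG_def norm_prod_def fst_conv snd_conv
  proof (intro real_sqrt_le_mono add_mono power_mono)
   show "norm (fst (DF (theta z)) * softclamp' a0 a1 s (fst z)) <= norm (fst (DF (theta z)))"
    using mult_left_mono[OF ca(3) abs_ge_zero] by (simp add: abs_mult)
   show "norm (snd (DF (theta z)) * softclamp' b0 b1 s (snd z)) <= norm (snd (DF (theta z)))"
    using mult_left_mono[OF cb(3) abs_ge_zero] by (simp add: abs_mult)
  qed simp_all
  thus "norm (DG z) <= C" using C[of z] by linarith
 next
  note c1 = continuous_on_mult[OF continuous_on_fst[OF cDF] continuous_on_compose2[OF ca(2) continuous_on_fst[OF continuous_on_id] subset_UNIV]]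
  note c2 = continuous_on_mult[OF continuous_on_snd[OF cDF] continuous_on_compose2[OF cb(2) continuous_on_snd[OF continuous_on_id] subset_UNIV]]
  show "continuous_on UNIV DG" unfolding DG_def[abs_def] by (rule continuous_on_Pair[OF c1 c2])
 qed
 thus ?thesis
 proof (rule W11_cong)
  fix x assume "x \<in> V"
  hence "theta (a x, b x) = (a x, b x)" "DG (a x, b x) = DF (a x, b x)"
   unfolding DG_def theta_def using ca(4,5)[OF ar] cb(4,5)[OF br] by simp_all
  thus "F (theta (a x, b x)) = F (a x, b x)"
   "fst (DG (a x, b x)) *R Da x + snd (DG (a x, b x)) *R Db x = fst (DF (a x, b x)) *R Da x + snd (DF (a x, b x)) *R Db x"
   by simp_all
 qed
qed

lemma W11_mult:
 assumes a: "W11 V a Da" and b: "W11 V b Db" and V: "open V" "emeasure lborel V < \<infinity>"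
  and ar: "!!x. x \<in> V ==> \<bar>a x\<bar> <= A" and br: "!!x. x \<in> V ==> \<bar>b x\<bar> <= B" and AB: "0 <= A" "0 <= B"
 shows "W11 V (%x. a x * b x) (%x. b x *R Da x + a x *R Db x)"
proof -
 have "W11 V (%x. (%z. fst z * snd z) (a x, b x))
  (%x. fst ((%z. (snd z, fst z)) (a x, b x)) *R Da x + snd ((%z. (snd z, fst z)) (a x, b x)) *R Db x)"
 proof (rule W11_chain_bounded[OF a b V, where s=1 and ?a0.0="-A" and ?a1.0=A and ?b0.0="-B" and ?b1.0=B])
  show "((%z. fst z * snd z) has_derivative (%h. (snd z, fst z) \<bullet> h)) (at z)" for z :: "real \<times> real"
   by (auto intro!: derivative_eq_intros simp: inner_prod_def)
  show "continuous_on ({- A - 1..A + 1} \<times> {- B - 1..B + 1}) (%z. (snd z, fst z))" by (intro continuous_intros)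
  show "x \<in> V ==> a x \<in> {-A..A}" for x using ar[of x] by auto
  show "x \<in> V ==> b x \<in> {-B..B}" for x using br[of x] by auto
 qed (use AB in simp_all)
 thus ?thesis by simp
qed

text \<open>The exponent is itself a Sobolev function. The second summand of the gradient, with
  \<open>ln (a x)\<close>, is the one that later meets the logarithm of the equation.\<close>

lemma W11_powr:
 assumes a: "W11 V a Da" and b: "W11 V b Db" and V: "open V" "emeasure lborel V < \<infinity>"
  and d: "0 < d" "d <= A" and ar: "!!x. x \<in> V ==> d <= a x & a x <= A" and br: "!!x. x \<in> V ==> \<bar>b x\<bar> <= B" and B: "0 <= B"
 shows "W11 V (%x. a x powr b x) (%x. (b x * a x powr b x / a x) *R Da x + (a x powr b x * ln (a x)) *R Db x)"
proof -
 define DF :: "real \<times> real => real \<times> real" where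
  "DF z = (snd z * fst z powr snd z / fst z, fst z powr snd z * ln (fst z))" for z
 have "W11 V (%x. (%z. fst z powr snd z) (a x, b x))
  (%x. fst (DF (a x, b x)) *R Da x + snd (DF (a x, b x)) *R Db x)"
 proof (rule W11_chain_bounded[OF a b V, where s="d/2" and ?a0.0=d and ?a1.0=A and ?b0.0="-B" and ?b1.0=B])
  show "((%z. fst z powr snd z) has_derivative (%h. DF z \<bullet> h)) (at z)"
   if "z \<in> {d - d/2..A + d/2} \<times> {-B - d/2..B + d/2}" for z
  proof -
   have p: "fst z > 0" using that d by (cases z) auto
   have 1: "(fst has_derivative fst) (at z)" "(snd has_derivative snd) (at z)" by (auto intro!: derivative_eq_intros)
   have "((%z. fst z powr snd z) has_derivative (%h. fst z powr snd z * (snd h * ln (fst z) + fst h * snd z / fst z))) (at z)"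
    by (rule has_derivative_powr[OF 1 p]) simp
   moreover have "(%h. fst z powr snd z * (snd h * ln (fst z) + fst h * snd z / fst z)) = (%h. DF z \<bullet> h)"
    unfolding DF_def by (rule ext) (simp add: inner_prod_def algebra_simps)
   ultimately show ?thesis by simp
  qed
  show "continuous_on ({d - d/2..A + d/2} \<times> {-B - d/2..B + d/2}) DF"
   unfolding DF_def[abs_def] using d by (intro continuous_intros) auto
  show "x \<in> V ==> a x \<in> {d..A}" for x using ar[of x] by auto
  show "x \<in> V ==> b x \<in> {-B..B}" for x using br[of x] by auto
 qed (use d B in simp_all)
 thus ?thesis unfolding DF_def by simp
qed

lemma W11_ln:
 assumes a: "W11 V a Da" and V: "open V" "emeasure lborel V < \<infinity>"
  and d: "0 < d" "d <= A" and ar: "!!x. x \<in> V ==> d <= a x & a x <= A"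
 shows "W11 V (%x. ln (a x)) (%x. (1 / a x) *R Da x)"
proof -
 define DF :: "real \<times> real => real \<times> real" where "DF z = (1 / fst z, 0)" for z
 have "W11 V (%x. (%z. ln (fst z)) (a x, a x))
  (%x. fst (DF (a x, a x)) *R Da x + snd (DF (a x, a x)) *R Da x)"
 proof (rule W11_chain_bounded[OF a a V, where s="d/2" and ?a0.0=d and ?a1.0=A and ?b0.0=d and ?b1.0=A])
  show "((%z. ln (fst z)) has_derivative (%h. DF z \<bullet> h)) (at z)"
   if "z \<in> {d - d/2..A + d/2} \<times> {d - d/2..A + d/2}" for z
  proof -
   have p: "fst z > 0" using that d by (cases z) auto
   have 1: "(fst has_derivative fst) (at z)" by (auto intro!: derivative_eq_intros)
   have 2: "(ln has_derivative (%h. 1 / fst z * h)) (at (fst z))"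
    using DERIV_ln_divide[OF p] unfolding has_field_derivative_def .
   show ?thesis using has_derivative_compose[OF 1 2] unfolding DF_def by (simp add: inner_prod_def)
  qed
  show "continuous_on ({d - d/2..A + d/2} \<times> {d - d/2..A + d/2}) DF"
   unfolding DF_def[abs_def] using d by (intro continuous_intros) auto
  show "x \<in> V ==> a x \<in> {d..A}" for x using ar[of x] by auto
  thus "x \<in> V ==> a x \<in> {d..A}" for x .
 qed (use d in simp_all)
 thus ?thesis unfolding DF_def by simp
qed

text \<open>The functions sqrt(e^2 + t_+^2) - e are C1 with slope exactly 0 for t \<le> 0. In the
  limit the gradient is therefore 0 on {f = 0}, without knowing that \<open>g\<close> vanishes
  there.\<close>

lemma W11_max0:
 assumes f: "W11 V f g" and V: "open V" "emeasure lborel V < \<infinity>"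
 shows "W11 V (%x. max 0 (f x)) (%x. if f x > 0 then g x else 0)"
proof -
 note i = W11_integrable[OF f]
 have [measurable]: "f \<in> bm_on V" "g \<in> bm_on V"
  by (intro borel_measurable_integrable i)+
 define e :: "nat => real" where "e n = 1 / real (Suc n)" for n
 have e: "e n > 0" for n unfolding e_def by simp
 have e0: "e ~~> 0" unfolding e_def[abs_def] by (rule LIMSEQ_Suc[OF lim_1_over_n])
 define F where "F n t = sqrt ((e n)\<^sup>2 + (max 0 t) ^ 2) - e n" for n t
 define F' where "F' n t = max 0 t / sqrt ((e n)\<^sup>2 + (max 0 t) ^ 2)" for n t
 have pos: "(e n)\<^sup>2 + (max 0 t) ^ 2 > 0" for n t using e[of n] by (intro add_pos_nonneg) auto
 have D: "(F n has_real_derivative F' n t) (at t)" for n t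
 proof -
  have "((%t. (e n)\<^sup>2 + (max 0 t) ^ 2) has_real_derivative 2 * max 0 t) (at t)"
   using DERIV_add[OF DERIV_const max0_power_has_derivative[of 1 t], of "(e n)\<^sup>2"] by (simp add: numeral_2_eq_2)
  from DERIV_chain2[OF DERIV_real_sqrt[OF pos] this]
  have "((%t. sqrt ((e n)\<^sup>2 + (max 0 t) ^ 2)) has_real_derivative inverse (sqrt ((e n)\<^sup>2 + (max 0 t) ^ 2)) / 2 * (2 * max 0 t)) (at t)" .
  from DERIV_diff[OF this DERIV_const, of "e n"] show ?thesis unfolding F_def F'_def by (simp add: field_simps)
 qed
 have le: "max 0 t <= sqrt ((e n)\<^sup>2 + (max 0 t) ^ 2)" for n t by (rule real_le_rsqrt) simp
 have F'1: "\<bar>F' n t\<bar> <= 1" for n t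
  unfolding F'_def using le[of t n] pos[of n t] by (simp add: abs_div divide_le_eq)
 have Fb: "\<bar>F n t\<bar> <= \<bar>t\<bar>" for n t
 proof -
  have "sqrt ((e n)\<^sup>2 + (max 0 t) ^ 2) <= e n + max 0 t"
   using sqrt_add_le_add_sqrt[of "(e n)\<^sup>2" "(max 0 t)^2"] e[of n] by simp
  moreover have "e n <= sqrt ((e n)\<^sup>2 + (max 0 t) ^ 2)" by (rule real_le_rsqrt) simp
  ultimately show ?thesis unfolding F_def by (simp add: max_def split: if_splits)
 qed
 show ?thesis
 proof (rule W11_dominated_limit[where w="%x. \<bar>f x\<bar> + norm (g x)"])
  show "W11 V (%x. F n (f x)) (%x. F' n (f x) *R g x)" for n
  proof (rule W11_compose_real[OF f V D])
   show "continuous_on UNIV (F' n)" unfolding F'_def[abs_def]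
   proof (intro continuous_intros ballI)
    show "sqrt ((e n)\<^sup>2 + (max 0 t) ^ 2) \<noteq> 0" for t using pos[of n t] unfolding real_sqrt_eq_0_iff by linarith
   qed
  qed (rule F'1)
  show "(%x. max 0 (f x)) \<in> bm_on V" "(%x. if f x > 0 then g x else 0) \<in> bm_on V"
   by measurable
  show "L1_on V (%x. \<bar>f x\<bar> + norm (g x))" by (intro bi_integrable_add integrable_abs integrable_norm i)
  show "AE x in lb_on V. \<bar>F n (f x)\<bar> <= \<bar>f x\<bar> + norm (g x)" for n
   using Fb by (intro AE_I2) (simp add: add_increasing2)
  show "AE x in lb_on V. norm (F' n (f x) *R g x) <= \<bar>f x\<bar> + norm (g x)" for n
  proof (rule AE_I2)
   fix x show "norm (F' n (f x) *R g x) <= \<bar>f x\<bar> + norm (g x)"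
    using mult_right_mono[OF F'1[of n "f x"] norm_ge_zero[of "g x"]] by simp
  qed
  show "AE x in lb_on V. (%n. F n (f x)) ~~> max 0 (f x)"
  proof (rule AE_I2)
   fix x
   have "(%n. sqrt ((e n)\<^sup>2 + (max 0 (f x)) ^ 2) - e n) ~~> sqrt (0\<^sup>2 + (max 0 (f x)) ^ 2) - 0"
    by (intro tendsto_intros e0)
   thus "(%n. F n (f x)) ~~> max 0 (f x)" unfolding F_def by simp
  qed
  show "AE x in lb_on V. (%n. F' n (f x) *R g x) ~~> (if f x > 0 then g x else 0)"
  proof (rule AE_I2)
   fix x
   show "(%n. F' n (f x) *R g x) ~~> (if f x > 0 then g x else 0)"
   proof (cases "f x > 0")
    case True
    have "(%n. max 0 (f x) / sqrt ((e n)\<^sup>2 + (max 0 (f x)) ^ 2)) ~~> max 0 (f x) / sqrt (0\<^sup>2 + (max 0 (f x)) ^ 2)"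
     using True by (intro tendsto_intros e0) auto
    hence "(%n. F' n (f x)) ~~> 1" unfolding F'_def using True by simp
    from tendsto_scaleR[OF this tendsto_const[of "g x"]] show ?thesis using True by simp
   next
    case False
    hence "F' n (f x) = 0" for n unfolding F'_def by (simp add: max_def)
    thus ?thesis using False by simp
   qed
  qed
 qed
qed

section \<open>From weak gradients to C1 approximation, and integration by parts\<close>

lemma integrable_lb_on_restrict:
 fixes f :: "'a::euclidean_space => 'b::{banach, second_countable_topology}"
 assumes "open V" "integrable lborel f"
 shows "L1_on V f" "(LINT x|lb_on V. norm (f x)) <= (LBINT x. norm (f x))"
proof -
 have V: "V \<inter> space lborel \<in> sets lborel" using assms(1) by simp
 have i: "integrable lborel (%x. indicator V x *R f x)" by (rule integrable_mult_indicator[OF _ assms(2)]) (use assms(1) in simp)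
 thus "L1_on V f" by (subst integrable_restrict_space[OF V])
 have "(LINT x|lb_on V. norm (f x)) = (LBINT x. indicator V x *R norm (f x))"
  by (rule integral_restrict_space[OF V])
 also have "... <= (LBINT x. norm (f x))"
 proof (rule integral_mono)
  have "integrable lborel (%x. norm (indicator V x *R f x))" using i by (rule integrable_norm)
  thus "integrable lborel (%x. indicator V x *R norm (f x))" by (simp add: abs_of_nonneg)
  show "integrable lborel (%x. norm (f x))" by (rule integrable_norm[OF assms(2)])
  show "indicator V x *R norm (f x) <= norm (f x)" for x by (simp add: indicator_def)
 qed
 finally show "(LINT x|lb_on V. norm (f x)) <= (LBINT x. norm (f x))" .
qed

lemma gradient_le_lipschitz:
 fixes F :: "'a::euclidean_space => real"
 assumes D: "(F has_derivative (%h. g \<bullet> h)) (at x)" and V: "open V" "x \<in> V" and L: "0 <= L"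
  and lip: "!!y. y \<in> V ==> \<bar>F y - F x\<bar> <= L * norm (y - x)"
 shows "norm g <= L"
proof (rule field_le_epsilon)
 fix e :: real assume e: "e > 0"
 from D obtain d where d: "d > 0" "!!y. norm (y - x) < d ==> norm (F y - F x - g \<bullet> (y - x)) <= e * norm (y - x)"
  using e unfolding has_derivative_at_alt by blast
 obtain d' where d': "d' > 0" "ball x d' \<subseteq> V" using V open_contains_ball by blast
 show "norm g <= L + e"
 proof (cases "g = 0")
  case True thus ?thesis using L e by simp
 next
  case False
  define t where "t = min d d' / (2 * norm g)"
  have t: "t > 0" unfolding t_def using d(1) d'(1) False by simp
  have tg: "norm (t *R g) = min d d' / 2" unfolding t_def using False d(1) d'(1) by simp
  have 1: "norm (F (x + t *R g) - F x - g \<bullet> (t *R g)) <= e * norm (t *R g)"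
   using d(2)[of "x + t *R g"] tg d(1) d'(1) by simp
  have "x + t *R g \<in> V" using d'(2) tg d(1) d'(1) by (auto simp: dist_norm)
  from lip[OF this] have 2: "\<bar>F (x + t *R g) - F x\<bar> <= L * norm (t *R g)" by simp
  have "g \<bullet> (t *R g) <= (L + e) * norm (t *R g)" using 1 2 by (simp add: distrib_right)
  hence "(t * norm g) * norm g <= (t * norm g) * (L + e)" using t by (simp add: dot_square_norm power2_eq_square mult.assoc mult.commute mult.left_commute)
  thus ?thesis using t False by simp
 qed
qed

text \<open>At points of \<open>V\<close> the gradient of the mollified u is the mollified
  \<open>Du\<close>, because there the kernel is a test function supported in \<open>K\<close>. A
  mollification also inherits the Lipschitz constant of u on \<open>K\<close>, which is recorded
  here in order to bound the gradient of p later.\<close>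

lemma weak_gradient_mollify:
 fixes u :: "'a::euclidean_space => real"
 assumes V: "open V" and e0: "e0 > 0" and VK: "!!x. x \<in> V ==> cball x e0 \<subseteq> K"
  and iu: "integrable lborel (%y. indicator K y *R u y)" and iD: "integrable lborel (%y. indicator K y *R Du y)"
  and ibp: "!!x r k Dk. x \<in> V ==> mollifier r k Dk ==> r < e0 ==>
   (LBINT y. (indicator K y *R u y) *R Dk (y - x)) = - (LBINT y. k (y - x) *R (indicator K y *R Du y))"
  and e: "e > 0"
 shows "\<exists>F G. C1_on V F G & integrable lborel F & integrable lborel G &
   (LBINT x. norm (F x - indicator K x *R u x)) < e & (LBINT x. norm (G x - indicator K x *R Du x)) < e &
   (\<forall>L\<ge>0. (\<forall>x\<in>K. \<forall>y\<in>K. \<bar>u x - u y\<bar> <= L * norm (x - y)) --> (\<forall>x\<in>V. norm (G x) <= L))"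
proof -
 define U where "U y = indicator K y *R u y" for y
 define DU where "DU y = indicator K y *R Du y" for y
 note iu = iu[folded U_def] and iD = iD[folded DU_def] and ibp = ibp[folded U_def DU_def]
 have e2: "e / 2 > 0" using e by simp
 obtain d1 where d1: "d1 > 0" "!!r k Dk. mollifier r k Dk ==> r < d1 ==> integrable lborel (mollify k U) & (LBINT x. norm (mollify k U x - U x)) <= e/2"
  using mollify_L1_approx[OF iu e2] by metis
 obtain d2 where d2: "d2 > 0" "!!r k Dk. mollifier r k Dk ==> r < d2 ==> integrable lborel (mollify k DU) & (LBINT x. norm (mollify k DU x - DU x)) <= e/2"
  using mollify_L1_approx[OF iD e2] by metis
 define r where "r = min (min d1 d2) e0 / 2"
 have r: "r > 0" "r < d1" "r < d2" "r < e0" unfolding r_def using d1(1) d2(1) e0 by auto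
 obtain k and Dk :: "'a => 'a" where m: "mollifier r k Dk" using mollifier_exists[OF r(1)] by metis
 have k: "!!x. 0 <= k x" "integrable lborel k" "(LBINT x. k x) = 1" "!!x. r <= norm x ==> k x = 0"
  using m unfolding mollifier_def by auto
 have grad: "(mollify k U has_derivative (%h. mollify k DU x \<bullet> h)) (at x)" if "x \<in> V" for x
  using mollify_has_derivative[OF m iu, of x] unfolding ibp[OF that m r(4)] by (simp add: mollify_def)
 have C1: "C1_on V (mollify k U) (mollify k DU)"
  unfolding C1_on_def
  by (intro conjI ballI grad continuous_on_subset[OF mollify_continuous[OF mollifier_continuous[OF m] k(4) iD] subset_UNIV])
 have lipG: "norm (mollify k DU x) <= L" if L: "L \<ge> 0" "\<forall>x\<in>K. \<forall>y\<in>K. \<bar>u x - u y\<bar> <= L * norm (x - y)" and x: "x \<in> V" for L x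
 proof (rule gradient_le_lipschitz[OF grad[OF x] V x L(1)])
  fix x' assume x': "x' \<in> V"
  have i: "integrable lborel (%z. k z *R U (y + z))" for y
  proof -
   have "integrable lborel (%z. k (z - y) *R U z)" by (rule integrable_mult_bounded_continuous[OF mollifier_continuous[OF m] k(4) iu])
   from integrable_lborel_shift[OF this, of y] show ?thesis by (simp add: add.commute)
  qed
  have eq: "mollify k U y = (LBINT z. k z *R U (y + z))" for y
  proof -
   have "integrable lborel (%z. k (z - y) *R U z)" by (rule integrable_mult_bounded_continuous[OF mollifier_continuous[OF m] k(4) iu])
   from borel_measurable_integrable[OF this] have "(%z. k (z - y) *R U z) \<in> borel_measurable borel" by simp
   from integral_lborel_shift[OF this, of y] show ?thesis unfolding mollify_def by (simp add: add.commute)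
  qed
  have "mollify k U x' - mollify k U x = (LBINT z. k z *R U (x' + z) - k z *R U (x + z))"
   unfolding eq by (rule bi_integral_diff[OF i i, symmetric])
  hence "\<bar>mollify k U x' - mollify k U x\<bar> = \<bar>\<integral>z. k z *R U (x' + z) - k z *R U (x + z) \<partial>lborel\<bar>" by simp
  also have "... <= (LBINT z. \<bar>k z *R U (x' + z) - k z *R U (x + z)\<bar>)" by (rule integral_abs_bound)
  also have "... <= (LBINT z. L * norm (x' - x) * k z)"
  proof (rule integral_mono)
   show "integrable lborel (%z. \<bar>k z *R U (x' + z) - k z *R U (x + z)\<bar>)"
    by (intro integrable_abs bi_integrable_diff i)
   show "integrable lborel (%z. L * norm (x' - x) * k z)" by (intro integrable_mult_right k)
   show "\<bar>k z *R U (x' + z) - k z *R U (x + z)\<bar> <= L * norm (x' - x) * k z" for z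
   proof (cases "r <= norm z")
    case True thus ?thesis by (simp add: k(4))
   next
    case False
    hence "x + z \<in> cball x e0" "x' + z \<in> cball x' e0" using r(4) by (auto simp: dist_norm)
    hence K: "x + z \<in> K" "x' + z \<in> K" using VK[OF x] VK[OF x'] by blast+
    hence "\<bar>u (x' + z) - u (x + z)\<bar> <= L * norm (x' - x)" using L(2)[rule_format, OF K(2) K(1)] by simp
    hence "k z * \<bar>u (x' + z) - u (x + z)\<bar> <= k z * (L * norm (x' - x))" by (rule mult_left_mono[OF _ k(1)])
    thus ?thesis unfolding U_def using K k(1)[of z] by (simp add: right_diff_distrib[symmetric] abs_mult mult.commute)
   qed
  qed
  also have "... = L * norm (x' - x)" using k(3) by simp
  finally show "\<bar>mollify k U x' - mollify k U x\<bar> <= L * norm (x' - x)" .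
 qed
 have b: "(LBINT x. norm (mollify k U x - U x)) < e" "(LBINT x. norm (mollify k DU x - DU x)) < e"
  using d1(2)[OF m r(2)] d2(2)[OF m r(3)] e by linarith+
 show ?thesis
  unfolding U_def[symmetric] DU_def[symmetric]
  by (intro exI[of _ "mollify k U"] exI[of _ "mollify k DU"] conjI allI impI ballI C1 b conjunct1[OF d1(2)[OF m r(2)]] conjunct1[OF d2(2)[OF m r(3)]])
   (rule lipG)
qed

text \<open>Links a weak gradient, known only through mollifying kernels, with \<open>W11\<close>.
  For the second conclusion, the excess of |Du| over L is at most the distance to some G with |G|
  \<le> L, and this distance can be made arbitrarily small in L1.\<close>

lemma W11_of_weak_gradient:
 fixes u :: "'a::euclidean_space => real"
 assumes V: "open V" and e0: "e0 > 0" and VK: "!!x. x \<in> V ==> cball x e0 \<subseteq> K"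
  and iu: "integrable lborel (%y. indicator K y *R u y)" and iD: "integrable lborel (%y. indicator K y *R Du y)"
  and ibp: "!!x r k Dk. x \<in> V ==> mollifier r k Dk ==> r < e0 ==>
   (LBINT y. (indicator K y *R u y) *R Dk (y - x)) = - (LBINT y. k (y - x) *R (indicator K y *R Du y))"
 shows "W11 V u Du"
  and "0 <= L ==> (!!x y. x \<in> K ==> y \<in> K ==> \<bar>u x - u y\<bar> <= L * norm (x - y)) ==> AE x in lb_on V. norm (Du x) <= L"
proof -
 have inK: "x \<in> V ==> x \<in> K" for x using VK[of x] e0 by auto
 have app: "\<exists>F G. C1_on V F G & integrable lborel F & integrable lborel G &
   (LBINT x. norm (F x - indicator K x *R u x)) < e & (LBINT x. norm (G x - indicator K x *R Du x)) < e &
   (\<forall>L\<ge>0. (\<forall>x\<in>K. \<forall>y\<in>K. \<bar>u x - u y\<bar> <= L * norm (x - y)) --> (\<forall>x\<in>V. norm (G x) <= L))" if "e > 0" for e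
 proof (rule weak_gradient_mollify[OF V e0 _ iu iD _ that])
  show "x \<in> V ==> cball x e0 \<subseteq> K" for x by (rule VK)
  show "(LBINT y. (indicator K y *R u y) *R Dk (y - x)) = - (LBINT y. k (y - x) *R (indicator K y *R Du y))"
   if "x \<in> V" "mollifier r k Dk" "r < e0" for x r k Dk using that by (rule ibp)
 qed
 note R = integrable_lb_on_restrict[OF V]
 have "W11 V (%y. indicator K y *R u y) (%y. indicator K y *R Du y)"
  unfolding W11_def
 proof (intro conjI allI impI R(1)[OF iu] R(1)[OF iD])
  fix e :: real assume e: "e > 0"
  obtain F G where FG: "C1_on V F G" "integrable lborel F" "integrable lborel G"
   "(LBINT x. norm (F x - indicator K x *R u x)) < e" "(LBINT x. norm (G x - indicator K x *R Du x)) < e"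
   using app[OF e] by (elim exE conjE) (rule that)
  show "\<exists>F G. C1_on V F G & L1_on V F & L1_on V G &
   (LINT x|lb_on V. norm (F x - indicator K x *R u x)) < e & (LINT x|lb_on V. norm (G x - indicator K x *R Du x)) < e"
   using R(2)[OF bi_integrable_diff[OF FG(2) iu]] R(2)[OF bi_integrable_diff[OF FG(3) iD]] FG(4,5)
   by (intro exI[of _ F] exI[of _ G] conjI FG(1) R(1)[OF FG(2)] R(1)[OF FG(3)]) linarith+
 qed
 thus s: "W11 V u Du" by (rule W11_cong) (simp_all add: inK)
 assume L: "0 <= L" and lip: "!!x y. x \<in> K ==> y \<in> K ==> \<bar>u x - u y\<bar> <= L * norm (x - y)"
 note iDu = W11_integrable(2)[OF s]
 have [measurable]: "Du \<in> bm_on V" using iDu by (rule borel_measurable_integrable)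
 have le: "max 0 (norm (Du x) - L) <= norm (G x - indicator K x *R Du x)" if "x \<in> V" "norm (G x) <= L" for G x
  using that inK[OF that(1)] norm_triangle_ineq2[of "Du x" "G x"] by (simp add: norm_minus_commute)
 have im: "L1_on V (%x. max 0 (norm (Du x) - L))"
 proof (rule bi_integrable_bound[OF integrable_norm[OF iDu]])
  show "AE x in lb_on V. norm (max 0 (norm (Du x) - L)) <= norm (norm (Du x))" using L by (intro AE_I2) simp
 qed measurable
 have small: "(LINT x|lb_on V. max 0 (norm (Du x) - L)) <= e" if e: "e > 0" for e
 proof -
  obtain F G where FG: "integrable lborel G" "(LBINT x. norm (G x - indicator K x *R Du x)) < e"
   and GL: "\<forall>L\<ge>0. (\<forall>x\<in>K. \<forall>y\<in>K. \<bar>u x - u y\<bar> <= L * norm (x - y)) --> (\<forall>x\<in>V. norm (G x) <= L)"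
   using app[OF e] by (elim exE conjE) (rule that)
  have G: "norm (G x) <= L" if "x \<in> V" for x using GL L lip that by simp
  have "(LINT x|lb_on V. max 0 (norm (Du x) - L)) <= (LINT x|lb_on V. norm (G x - indicator K x *R Du x))"
  proof (rule integral_mono[OF im])
   show "L1_on V (%x. norm (G x - indicator K x *R Du x))"
    by (intro integrable_norm R(1) bi_integrable_diff FG iD)
   fix x assume "x \<in> space (lb_on V)"
   hence "x \<in> V" by (simp add: space_restrict_space)
   thus "max 0 (norm (Du x) - L) <= norm (G x - indicator K x *R Du x)" by (intro le G)
  qed
  also have "... <= (LBINT x. norm (G x - indicator K x *R Du x))" by (rule R(2)[OF bi_integrable_diff[OF FG(1) iD]])
  finally show ?thesis using FG(2) by linarith
 qed
 have "(LINT x|lb_on V. max 0 (norm (Du x) - L)) <= 0" by (rule field_le_epsilon) (simp add: small)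
 moreover have "(LINT x|lb_on V. max 0 (norm (Du x) - L)) \<ge> 0" by (intro bi_integral_nonneg) simp
 ultimately have "(LINT x|lb_on V. max 0 (norm (Du x) - L)) = 0" by linarith
 hence "AE x in lb_on V. max 0 (norm (Du x) - L) = 0"
  using integral_nonneg_eq_0_iff_AE[OF im AE_I2] by simp
 thus "AE x in lb_on V. norm (Du x) <= L"
  by (rule AE_mp) (intro AE_I2 impI, simp add: max_def split: if_splits)
qed

text \<open>Difference quotients integrate to 0 by translation invariance. They converge to the
  directional derivative and are dominated by a constant on a ball enlarged by |h|.\<close>

lemma integral_gradient_zero:
 fixes phi :: "'a::euclidean_space => real"
 assumes D: "!!x. (phi has_derivative (%h. Dphi x \<bullet> h)) (at x)" and c: "continuous_on UNIV Dphi"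
  and z: "!!x. r <= norm x ==> phi x = 0" "!!x. r <= norm x ==> Dphi x = 0"
 shows "(LBINT x. Dphi x \<bullet> h) = 0"
proof -
 have cphi: "continuous_on UNIV phi" by (intro continuous_at_imp_continuous_on ballI has_derivative_continuous[OF D])
 have iphi: "integrable lborel phi" by (rule integrable_continuous_compact_support[OF cphi z(1)])
 have [measurable]: "phi \<in> borel_measurable borel" using cphi by (rule borel_measurable_continuous_onI)
 have [measurable]: "Dphi \<in> borel_measurable borel" using c by (rule borel_measurable_continuous_onI)
 have "bounded (Dphi ` cball 0 r)" by (intro compact_imp_bounded compact_continuous_image compact_cball continuous_on_subset[OF c]) simp
 then obtain B where B: "\<forall>y\<in>Dphi ` cball 0 r. norm y <= B" unfolding bounded_iff ..
 have nB: "norm (Dphi x) <= \<bar>B\<bar>" for x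
 proof (cases "r <= norm x")
  case False
  hence "norm (Dphi x) <= B" using B by simp
  thus ?thesis by linarith
 qed (simp add: z)
 define t :: "nat => real" where "t n = 1 / real (Suc n)" for n
 have t: "t n > 0" "t n <= 1" for n unfolding t_def by simp_all
 have t0: "t ~~> 0" unfolding t_def[abs_def] by (rule LIMSEQ_Suc[OF lim_1_over_n])
 define s where "s n x = (phi (x + t n *R h) - phi x) / t n" for n x
 have int0: "(LBINT x. s n x) = 0" for n
 proof -
  have "(LBINT x. s n x) = ((LBINT x. phi (x + t n *R h)) - (LBINT x. phi x)) / t n"
   unfolding s_def using bi_integral_diff[OF integrable_lborel_shift[OF iphi, of "t n *R h"] iphi] by simp
  also have "(LBINT x. phi (x + t n *R h)) = (LBINT x. phi x)" by (rule integral_lborel_shift) measurable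
  finally show ?thesis by simp
 qed
 have "(%n. \<integral>x. s n x \<partial>lborel) ~~> (LBINT x. Dphi x \<bullet> h)"
 proof (rule integral_dominated_convergence[where w="%x. indicator (cball 0 (r + norm h)) x *R (\<bar>B\<bar> * norm h)"])
  show "integrable lborel (%x::'a. indicator (cball 0 (r + norm h)) x *R (\<bar>B\<bar> * norm h))"
   by (intro borel_integrable_compact compact_cball continuous_on_const)
  show "AE x in lborel. (%n. s n x) ~~> Dphi x \<bullet> h"
  proof (rule AE_I2)
   fix x
   have "((%t. x + t *R h) has_derivative (%s. s *R h)) (at 0)" by (auto intro!: derivative_eq_intros)
   moreover have "(phi has_derivative (%h. Dphi x \<bullet> h)) (at (x + 0 *R h))" using D by simp
   ultimately have "((%t. phi (x + t *R h)) has_derivative (%s. Dphi x \<bullet> (s *R h))) (at 0)" by (rule has_derivative_compose)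
   moreover have "(%s. Dphi x \<bullet> (s *R h)) = (%s. (Dphi x \<bullet> h) * s)" by (simp add: fun_eq_iff mult.commute)
   ultimately have "((%t. phi (x + t *R h)) has_real_derivative Dphi x \<bullet> h) (at 0)" by (simp add: has_field_derivative_def)
   hence lim: "((%t. (phi (x + t *R h) - phi x) / t) \<longlongrightarrow> Dphi x \<bullet> h) (at 0)" by (simp add: DERIV_def)
   have "filterlim t (at 0) sequentially" by (rule filterlim_atI[OF t0]) (use t in \<open>simp add: less_imp_neq[symmetric] order_less_imp_not_eq2\<close>)
   from filterlim_compose[OF lim this] show "(%n. s n x) ~~> Dphi x \<bullet> h" unfolding s_def .
  qed
  show "AE x in lborel. norm (s n x) <= indicator (cball 0 (r + norm h)) x *R (\<bar>B\<bar> * norm h)" for n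
  proof (rule AE_I2)
   fix x :: 'a
   have th: "norm (t n *R h) <= norm h" using t[of n] mult_right_mono[of "t n" 1 "norm h"] by simp
   show "norm (s n x) <= indicator (cball 0 (r + norm h)) x *R (\<bar>B\<bar> * norm h)"
   proof (cases "norm x <= r + norm h")
    case True
    have "\<bar>phi (x + t n *R h) - phi x\<bar> <= \<bar>B\<bar> * norm ((x + t n *R h) - x)" by (rule gradient_bounded_lipschitz[OF D nB])
    hence "\<bar>phi (x + t n *R h) - phi x\<bar> <= (\<bar>B\<bar> * norm h) * t n" using t[of n] by (simp add: mult.commute mult.left_commute)
    thus ?thesis unfolding s_def using t[of n] True by (simp add: divide_le_eq)
   next
    case False
    have "norm x <= norm (x + t n *R h) + norm (t n *R h)" using norm_triangle_ineq4[of "x + t n *R h" "t n *R h"] by simp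
    hence "r <= norm (x + t n *R h)" "r <= norm x" using False th norm_ge_zero[of h] by linarith+
    thus ?thesis unfolding s_def using False z by simp
   qed
  qed
  show "(%x. Dphi x \<bullet> h) \<in> borel_measurable lborel" by measurable
  show "s n \<in> borel_measurable lborel" for n unfolding s_def[abs_def] by measurable
 qed
 hence "(%n::nat. 0) ~~> (LBINT x. Dphi x \<bullet> h)" unfolding int0 .
 thus ?thesis by (rule LIMSEQ_unique[OF _ tendsto_const])
qed

text \<open>For a C1 function the product with \<open>phi\<close>, extended by 0 off
  \<open>V\<close>, is C1 with compact support, so its gradient integrates to 0. Both sides are L1
  continuous in (f, g), which passes the identity from the approximants to the limit.\<close>

lemma W11_integration_by_parts:
 fixes f :: "'a::euclidean_space => real"
 assumes s: "W11 V f g" and V: "open V"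
  and D: "!!x. (phi has_derivative (%h. Dphi x \<bullet> h)) (at x)" and c: "continuous_on UNIV Dphi"
  and K: "compact K" "K \<subseteq> V" and z: "!!x. x \<notin> K ==> phi x = 0"
 shows "(LINT x|lb_on V. f x * (Dphi x \<bullet> h)) = - (LINT x|lb_on V. (g x \<bullet> h) * phi x)"
proof -
 note i = W11_integrable[OF s]
 have oK: "open (- K)" using K(1) by (simp add: compact_imp_closed open_Compl)
 have zD: "Dphi x = 0" if "x \<notin> K" for x
 proof -
  have "((%x. 0) has_derivative (%h. Dphi x \<bullet> h)) (at x)"
   by (rule has_derivative_transform_within_open[OF D oK]) (use that z in auto)
  from has_derivative_unique[OF this has_derivative_const] have "Dphi x \<bullet> Dphi x = 0" by (rule fun_cong)
  thus ?thesis by simp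
 qed
 have cphi: "continuous_on UNIV phi" by (intro continuous_at_imp_continuous_on ballI has_derivative_continuous[OF D])
 obtain r where r: "!!x. x \<in> K ==> norm x < r"
  using compact_imp_bounded[OF K(1)] unfolding bounded_pos_less by blast
 have "bounded (phi ` K)" "bounded (Dphi ` K)"
  by (intro compact_imp_bounded compact_continuous_image K(1) continuous_on_subset[OF cphi subset_UNIV],
    intro compact_imp_bounded compact_continuous_image K(1) continuous_on_subset[OF c subset_UNIV])
 then obtain B1 B2 where B: "\<forall>y\<in>phi ` K. norm y <= B1" "\<forall>y\<in>Dphi ` K. norm y <= B2" unfolding bounded_iff by blast
 define B where "B = max \<bar>B1\<bar> \<bar>B2\<bar> * (norm h + 1)"
 have b0: "\<bar>phi x\<bar> <= max \<bar>B1\<bar> \<bar>B2\<bar>" "norm (Dphi x) <= max \<bar>B1\<bar> \<bar>B2\<bar>" for x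
 proof -
  have "\<bar>phi x\<bar> <= max \<bar>B1\<bar> \<bar>B2\<bar> & norm (Dphi x) <= max \<bar>B1\<bar> \<bar>B2\<bar>"
  proof (cases "x \<in> K")
   case True
   hence "norm (phi x) <= B1" "norm (Dphi x) <= B2" using B by blast+
   hence "\<bar>phi x\<bar> <= \<bar>B1\<bar>" "norm (Dphi x) <= \<bar>B2\<bar>" by simp_all
   thus ?thesis unfolding le_max_iff_disj by blast
  qed (simp add: z zD le_max_iff_disj)
  thus "\<bar>phi x\<bar> <= max \<bar>B1\<bar> \<bar>B2\<bar>" "norm (Dphi x) <= max \<bar>B1\<bar> \<bar>B2\<bar>" by auto
 qed
 have b1: "\<bar>phi x\<bar> * norm h <= B" "\<bar>Dphi x \<bullet> h\<bar> <= B" for x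
 proof -
  have "\<bar>phi x\<bar> * norm h <= max \<bar>B1\<bar> \<bar>B2\<bar> * norm h" "norm (Dphi x) * norm h <= max \<bar>B1\<bar> \<bar>B2\<bar> * norm h"
   by (intro mult_right_mono b0 norm_ge_zero)+
  moreover have "max \<bar>B1\<bar> \<bar>B2\<bar> * norm h <= B" unfolding B_def by (intro mult_left_mono) (auto simp: le_max_iff_disj)
  ultimately show "\<bar>phi x\<bar> * norm h <= B" "\<bar>Dphi x \<bullet> h\<bar> <= B" using Cauchy_Schwarz_ineq2[of "Dphi x" h] by linarith+
 qed
 have B0: "B \<ge> 0" using b1(2)[of undefined] by linarith
 have [measurable]: "phi \<in> borel_measurable borel" using cphi by (rule borel_measurable_continuous_onI)
 have [measurable]: "Dphi \<in> borel_measurable borel" using c by (rule borel_measurable_continuous_onI)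
 have mV: "phi \<in> bm_on V" "Dphi \<in> bm_on V"
  by (rule measurable_restrict_space1, measurable)+
 have i1: "L1_on V (%x. F x * (Dphi x \<bullet> h))" if "L1_on V F" for F
 proof (rule bi_integrable_bound[OF integrable_mult_right[OF that, of B]])
  have [measurable]: "F \<in> bm_on V" using that by (rule borel_measurable_integrable)
  note mV [measurable]
  show "(%x. F x * (Dphi x \<bullet> h)) \<in> bm_on V" by measurable
  show "AE x in lb_on V. norm (F x * (Dphi x \<bullet> h)) <= norm (B * F x)"
  proof (rule AE_I2)
   fix x show "norm (F x * (Dphi x \<bullet> h)) <= norm (B * F x)"
    using mult_right_mono[OF b1(2)[of x] abs_ge_zero[of "F x"]] B0 by (simp add: abs_mult mult.commute)
  qed
 qed
 have i2: "L1_on V (%x. (G x \<bullet> h) * phi x)" if "L1_on V G" for G :: "'a => 'a"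
 proof (rule bi_integrable_bound[OF integrable_scaleR_right[OF that, of B]])
  have [measurable]: "G \<in> bm_on V" using that by (rule borel_measurable_integrable)
  note mV [measurable]
  show "(%x. (G x \<bullet> h) * phi x) \<in> bm_on V" by measurable
  show "AE x in lb_on V. norm ((G x \<bullet> h) * phi x) <= norm (B *R G x)"
  proof (rule AE_I2)
   fix x
   have "\<bar>G x \<bullet> h\<bar> * \<bar>phi x\<bar> <= norm (G x) * norm h * \<bar>phi x\<bar>" by (intro mult_right_mono Cauchy_Schwarz_ineq2) simp
   also have "... = norm (G x) * (\<bar>phi x\<bar> * norm h)" by simp
   also have "... <= norm (G x) * B" by (intro mult_left_mono b1 norm_ge_zero)
   finally show "norm ((G x \<bullet> h) * phi x) <= norm (B *R G x)" using B0 by (simp add: abs_mult mult.commute)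
  qed
 qed
 have C1: "(LINT x|lb_on V. F x * (Dphi x \<bullet> h)) + (LINT x|lb_on V. (G x \<bullet> h) * phi x) = 0"
  if FG: "C1_on V F G" "L1_on V F" "L1_on V G" for F G
 proof -
  define psi where "psi x = (if x \<in> V then F x * phi x else 0)" for x
  define Dpsi where "Dpsi x = (if x \<in> V then phi x *R G x + F x *R Dphi x else 0)" for x
  have zpsi: "psi x = 0" "Dpsi x = 0" if "x \<notin> K" for x unfolding psi_def Dpsi_def using z[OF that] zD[OF that] by simp_all
  have d: "(psi has_derivative (%h. Dpsi x \<bullet> h)) (at x)" for x
  proof (cases "x \<in> V")
   case True
   have "(F has_derivative (%h. G x \<bullet> h)) (at x)" using FG(1) True unfolding C1_on_def by blast
   from has_derivative_mult[OF this D]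
   have "((%x. F x * phi x) has_derivative (%h. Dpsi x \<bullet> h)) (at x)" unfolding Dpsi_def using True by (simp add: inner_add_left algebra_simps)
   thus ?thesis by (rule has_derivative_transform_within_open[OF _ V True]) (simp add: psi_def)
  next
   case False
   hence nK: "x \<in> - K" using K(2) by blast
   have "((%x. 0) has_derivative (%h. Dpsi x \<bullet> h)) (at x)" using zpsi(2)[of x] nK by simp
   thus ?thesis by (rule has_derivative_transform_within_open[OF _ oK nK]) (simp add: zpsi)
  qed
  have "continuous_on V Dpsi"
  proof -
   have "continuous_on V (%x. phi x *R G x + F x *R Dphi x)"
    using FG(1) unfolding C1_on_def
    by (intro continuous_on_add continuous_on_scaleR continuous_on_subset[OF c subset_UNIV] continuous_on_subset[OF cphi subset_UNIV] C1_on_continuous[OF FG(1)]) simp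
   thus ?thesis by (rule continuous_on_eq) (simp add: Dpsi_def)
  qed
  moreover have "continuous_on (- K) Dpsi" by (rule continuous_on_eq[OF continuous_on_const[of _ 0]]) (simp add: zpsi)
  ultimately have "continuous_on (V \<union> - K) Dpsi" by (intro continuous_on_open_Un V oK)
  moreover have "V \<union> - K = UNIV" using K(2) by blast
  ultimately have cD: "continuous_on UNIV Dpsi" by simp
  have rz: "x \<notin> K" if "r <= norm x" for x using r[of x] that by auto
  have "0 = (LBINT x. Dpsi x \<bullet> h)"
   by (rule integral_gradient_zero[OF d cD zpsi(1)[OF rz] zpsi(2)[OF rz], symmetric])
  also have "... = (LBINT x. indicator V x *R (F x * (Dphi x \<bullet> h) + (G x \<bullet> h) * phi x))"
   by (intro bi_integral_cong refl) (simp add: Dpsi_def indicator_def inner_add_left mult.commute)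
  also have "... = (LINT x|lb_on V. F x * (Dphi x \<bullet> h) + (G x \<bullet> h) * phi x)"
   by (rule integral_restrict_space[symmetric]) (use V in simp)
  also have "... = (LINT x|lb_on V. F x * (Dphi x \<bullet> h)) + (LINT x|lb_on V. (G x \<bullet> h) * phi x)"
   by (rule bi_integral_add[OF i1[OF FG(2)] i2[OF FG(3)]])
  finally show ?thesis by simp
 qed
 have "\<bar>(LINT x|lb_on V. f x * (Dphi x \<bullet> h)) + (LINT x|lb_on V. (g x \<bullet> h) * phi x)\<bar> <= 0 + e" if e: "e > 0" for e
 proof -
  define e' where "e' = e / (2 * (B + 1))"
  have e': "e' > 0" unfolding e'_def using e B0 by simp
  obtain F G where FG: "C1_on V F G" "L1_on V F" "L1_on V G"
   "(LINT x|lb_on V. norm (F x - f x)) < e'" "(LINT x|lb_on V. norm (G x - g x)) < e'" by (rule W11_approx[OF s e'])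
  have 1: "\<bar>(LINT x|lb_on V. f x * (Dphi x \<bullet> h)) - (LINT x|lb_on V. F x * (Dphi x \<bullet> h))\<bar> <= B * e'"
  proof -
   have "\<bar>(LINT x|lb_on V. f x * (Dphi x \<bullet> h)) - (LINT x|lb_on V. F x * (Dphi x \<bullet> h))\<bar> = \<bar>\<integral>x. f x * (Dphi x \<bullet> h) - F x * (Dphi x \<bullet> h) \<partial>lb_on V\<bar>"
    by (simp only: bi_integral_diff[OF i1[OF i(1)] i1[OF FG(2)]])
   also have "... <= (LINT x|lb_on V. \<bar>f x * (Dphi x \<bullet> h) - F x * (Dphi x \<bullet> h)\<bar>)" by (rule integral_abs_bound)
   also have "... <= (LINT x|lb_on V. B * norm (F x - f x))"
   proof (rule integral_mono)
    show "L1_on V (%x. \<bar>f x * (Dphi x \<bullet> h) - F x * (Dphi x \<bullet> h)\<bar>)"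
     by (intro integrable_abs bi_integrable_diff i1 i FG)
    show "L1_on V (%x. B * norm (F x - f x))"
     by (intro integrable_mult_right integrable_norm bi_integrable_diff i FG)
    show "\<bar>f x * (Dphi x \<bullet> h) - F x * (Dphi x \<bullet> h)\<bar> <= B * norm (F x - f x)" for x
     using mult_right_mono[OF b1(2)[of x] abs_ge_zero[of "F x - f x"]]
     by (simp add: left_diff_distrib[symmetric] abs_mult abs_minus_commute mult.commute)
   qed
   also have "... = B * (LINT x|lb_on V. norm (F x - f x))" by simp
   also have "... <= B * e'" using FG(4) B0 by (intro mult_left_mono) auto
   finally show ?thesis .
  qed
  have 2: "\<bar>(LINT x|lb_on V. (g x \<bullet> h) * phi x) - (LINT x|lb_on V. (G x \<bullet> h) * phi x)\<bar> <= B * e'"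
  proof -
   have "\<bar>(LINT x|lb_on V. (g x \<bullet> h) * phi x) - (LINT x|lb_on V. (G x \<bullet> h) * phi x)\<bar> = \<bar>\<integral>x. (g x \<bullet> h) * phi x - (G x \<bullet> h) * phi x \<partial>lb_on V\<bar>"
    by (simp only: bi_integral_diff[OF i2[OF i(2)] i2[OF FG(3)]])
   also have "... <= (LINT x|lb_on V. \<bar>(g x \<bullet> h) * phi x - (G x \<bullet> h) * phi x\<bar>)" by (rule integral_abs_bound)
   also have "... <= (LINT x|lb_on V. B * norm (G x - g x))"
   proof (rule integral_mono)
    show "L1_on V (%x. \<bar>(g x \<bullet> h) * phi x - (G x \<bullet> h) * phi x\<bar>)"
     by (intro integrable_abs bi_integrable_diff i2 i FG)
    show "L1_on V (%x. B * norm (G x - g x))"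
     by (intro integrable_mult_right integrable_norm bi_integrable_diff i FG)
    show "\<bar>(g x \<bullet> h) * phi x - (G x \<bullet> h) * phi x\<bar> <= B * norm (G x - g x)" for x
    proof -
     have "\<bar>(g x \<bullet> h) * phi x - (G x \<bullet> h) * phi x\<bar> = \<bar>(g x - G x) \<bullet> h\<bar> * \<bar>phi x\<bar>" by (simp add: inner_diff_left left_diff_distrib[symmetric] abs_mult)
     also have "... <= norm (g x - G x) * norm h * \<bar>phi x\<bar>" by (intro mult_right_mono Cauchy_Schwarz_ineq2) simp
     also have "... = norm (G x - g x) * (\<bar>phi x\<bar> * norm h)" by (simp add: norm_minus_commute)
     also have "... <= norm (G x - g x) * B" by (intro mult_left_mono b1 norm_ge_zero)
     finally show ?thesis by (simp add: mult.commute)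
    qed
   qed
   also have "... = B * (LINT x|lb_on V. norm (G x - g x))" by simp
   also have "... <= B * e'" using FG(5) B0 by (intro mult_left_mono) auto
   finally show ?thesis .
  qed
  have "2 * (B * e') <= 2 * ((B + 1) * e')" using e' by (intro mult_left_mono mult_right_mono) auto
  also have "... = e" unfolding e'_def using B0 by (simp add: field_simps)
  finally show ?thesis using 1 2 C1[OF FG(1-3)] by linarith
 qed
 hence "\<bar>(LINT x|lb_on V. f x * (Dphi x \<bullet> h)) + (LINT x|lb_on V. (g x \<bullet> h) * phi x)\<bar> <= 0" by (rule field_le_epsilon)
 thus ?thesis by linarith
qed

section \<open>Translation estimates, Faber-Krahn and Poincare inequalities\<close>

lemma nn_integral_lb_on:
 fixes g :: "'a::euclidean_space => 'b::{banach, second_countable_topology}"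
 assumes V: "open V" and g: "L1_on V g"
 shows "(\<integral>\<^sup>+x. ennreal (norm (indicator V x *R g x)) \<partial>lborel) = ennreal (LINT x|lb_on V. norm (g x))"
  "(%x. indicator V x *R g x) \<in> borel_measurable borel"
proof -
 have V': "V \<inter> space lborel \<in> sets lborel" using V by simp
 have i: "integrable lborel (%x. indicator V x *R g x)" using g unfolding integrable_restrict_space[OF V'] .
 have "(\<integral>\<^sup>+x. ennreal (norm (indicator V x *R g x)) \<partial>lborel) = ennreal (LBINT x. norm (indicator V x *R g x))"
  by (rule nn_integral_eq_integral[OF integrable_norm[OF i]]) simp
 also have "(LBINT x. norm (indicator V x *R g x)) = (LINT x|lb_on V. norm (g x))"
  by (subst integral_restrict_space[OF V']) (simp add: abs_of_nonneg)
 finally show "(\<integral>\<^sup>+x. ennreal (norm (indicator V x *R g x)) \<partial>lborel) = ennreal (LINT x|lb_on V. norm (g x))" .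
 show "(%x. indicator V x *R g x) \<in> borel_measurable borel" using borel_measurable_integrable[OF i] by simp
qed

text \<open>The increment is an integral of the gradient along a segment that convexity keeps in
  \<open>V\<close>. Tonelli's theorem and translation invariance then remove the position along the
  segment.\<close>

lemma C1_translation_le:
 fixes F :: "'a::euclidean_space => real"
 assumes V: "open V" "convex V" and FG: "C1_on V F G" "L1_on V F" "L1_on V G"
 shows "(\<integral>\<^sup>+x. ennreal (indicator V x * indicator V (x + h) * \<bar>F (x + h) - F x\<bar>) \<partial>lborel)
  <= ennreal (norm h * (LINT x|lb_on V. norm (G x)))"
proof -
 define G' where "G' x = indicator V x *R G x" for x
 have [measurable]: "G' \<in> borel_measurable borel" unfolding G'_def by (rule nn_integral_lb_on(2)[OF V(1) FG(3)])
 have pt: "ennreal (indicator V x * indicator V (x + h) * \<bar>F (x + h) - F x\<bar>)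
  <= (\<integral>\<^sup>+t. ennreal (indicator {0..1} t * (norm h * norm (G' (x + t *R h)))) \<partial>lborel)" for x
 proof (cases "x \<in> V & x + h \<in> V")
  case True
  have inV: "x + t *R h \<in> V" if "0 <= t" "t <= 1" for t
  proof -
   have "(1 - t) *R x + t *R (x + h) \<in> V" using V(2) True that by (intro convexD) auto
   thus ?thesis by (simp add: algebra_simps)
  qed
  define gamma where "gamma t = F (x + t *R h)" for t :: real
  define gamma' where "gamma' t = G (x + t *R h) \<bullet> h" for t :: real
  have d: "(gamma has_vector_derivative gamma' t) (at t within {0..1})" if "0 <= t" "t <= 1" for t
  proof -
   have "((%t. x + t *R h) has_derivative (%s. s *R h)) (at t)" by (auto intro!: derivative_eq_intros)
   moreover have "(F has_derivative (%k. G (x + t *R h) \<bullet> k)) (at (x + t *R h))"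
    using FG(1) inV[OF that] unfolding C1_on_def by blast
   ultimately have "((%t. F (x + t *R h)) has_derivative (%s. G (x + t *R h) \<bullet> (s *R h))) (at t)" by (rule has_derivative_compose)
   thus ?thesis unfolding gamma_def[abs_def] gamma'_def has_vector_derivative_def by (simp add: has_derivative_at_withinI)
  qed
  have c: "continuous_on {0..1} gamma'" unfolding gamma'_def
  proof (intro continuous_intros)
   show "continuous_on {0..1} (%t. G (x + t *R h))"
   proof (rule continuous_on_compose2[of V G])
    show "continuous_on V G" using FG(1) unfolding C1_on_def by blast
    show "(%t. x + t *R h) ` {0..1} \<subseteq> V" using inV by auto
   qed (intro continuous_intros)
  qed
  have eq: "(LBINT t. indicator {0..1} t *R gamma' t) = gamma 1 - gamma 0" by (rule integral_FTC_Icc[OF _ d c]) auto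
  have i: "integrable lborel (%t. indicator {0..1} t *R gamma' t)" by (rule borel_integrable_compact[OF compact_Icc c])
  have "ennreal (indicator V x * indicator V (x + h) * \<bar>F (x + h) - F x\<bar>) = ennreal (norm (LBINT t. indicator {0..1} t *R gamma' t))"
   unfolding eq using True by (simp add: gamma_def)
  also have "... <= (\<integral>\<^sup>+t. ennreal (norm (indicator {0..1} t *R gamma' t)) \<partial>lborel)" by (rule integral_norm_bound_ennreal[OF i])
  also have "... <= (\<integral>\<^sup>+t. ennreal (indicator {0..1} t * (norm h * norm (G' (x + t *R h)))) \<partial>lborel)"
  proof (rule nn_integral_mono, rule ennreal_leI)
   fix t :: real
   show "norm (indicator {0..1} t *R gamma' t) <= indicator {0..1} t * (norm h * norm (G' (x + t *R h)))"
   proof (cases "t \<in> {0..1}")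
    case t: True
    hence "G' (x + t *R h) = G (x + t *R h)" using inV[of t] by (simp add: G'_def)
    thus ?thesis using t Cauchy_Schwarz_ineq2[of "G (x + t *R h)" h] by (simp add: gamma'_def mult.commute)
   qed simp
  qed
  finally show ?thesis .
 next
  case False
  hence 0: "indicator V x * indicator V (x + h) * \<bar>F (x + h) - F x\<bar> = 0" by (auto simp: indicator_def)
  show ?thesis unfolding 0 by simp
 qed
 have "(\<integral>\<^sup>+x. ennreal (indicator V x * indicator V (x + h) * \<bar>F (x + h) - F x\<bar>) \<partial>lborel)
  <= (\<integral>\<^sup>+x. (\<integral>\<^sup>+t. ennreal (indicator {0..1} t * (norm h * norm (G' (x + t *R h)))) \<partial>lborel) \<partial>lborel)"
  by (rule nn_integral_mono) (rule pt)
 also have "... = (\<integral>\<^sup>+t. (\<integral>\<^sup>+x. ennreal (indicator {0..1} t * (norm h * norm (G' (x + t *R h)))) \<partial>lborel) \<partial>lborel)"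
 proof (rule nn_integral_lborel_swap)
  show "(%(x, t::real). ennreal (indicator {0..1} t * (norm h * norm (G' (x + t *R h))))) \<in> borel_measurable (borel \<Otimes>\<^sub>M borel)" by measurable
 qed
 also have "... <= (\<integral>\<^sup>+t. indicator {0..1} (t::real) * ennreal (norm h * (LINT x|lb_on V. norm (G x))) \<partial>lborel)"
 proof (rule nn_integral_mono)
  fix t :: real
  have "(\<integral>\<^sup>+x. ennreal (indicator {0..1} t * (norm h * norm (G' (x + t *R h)))) \<partial>lborel)
   = (\<integral>\<^sup>+x. (indicator {0..1} t * ennreal (norm h)) * ennreal (norm (G' (x + t *R h))) \<partial>lborel)"
   by (intro nn_integral_cong) (simp add: ennreal_mult indicator_def)
  also have "... = (indicator {0..1} t * ennreal (norm h)) * (\<integral>\<^sup>+x. ennreal (norm (G' (x + t *R h))) \<partial>lborel)"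
   by (rule nn_integral_cmult) measurable
  also have "(\<integral>\<^sup>+x. ennreal (norm (G' (x + t *R h))) \<partial>lborel) = (\<integral>\<^sup>+x. ennreal (norm (G' x)) \<partial>lborel)"
   by (rule nn_integral_lborel_shift[where f="%x. ennreal (norm (G' x))"]) measurable
  also have "... = ennreal (LINT x|lb_on V. norm (G x))" unfolding G'_def by (rule nn_integral_lb_on(1)[OF V(1) FG(3)])
  also have "(indicator {0..1} t * ennreal (norm h)) * ennreal (LINT x|lb_on V. norm (G x)) = indicator {0..1} t * ennreal (norm h * (LINT x|lb_on V. norm (G x)))"
   by (simp add: ennreal_mult mult.assoc bi_integral_nonneg)
  finally show "(\<integral>\<^sup>+x. ennreal (indicator {0..1} t * (norm h * norm (G' (x + t *R h)))) \<partial>lborel)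
   <= indicator {0..1} t * ennreal (norm h * (LINT x|lb_on V. norm (G x)))" by simp
 qed
 also have "... = ennreal (norm h * (LINT x|lb_on V. norm (G x)))"
  by (subst nn_integral_multc) simp_all
 finally show ?thesis .
qed

lemma W11_translation_le:
 fixes f :: "'a::euclidean_space => real"
 assumes V: "open V" "convex V" and s: "W11 V f g"
 shows "(\<integral>\<^sup>+x. ennreal (indicator V x * indicator V (x + h) * \<bar>f (x + h) - f x\<bar>) \<partial>lborel)
  <= ennreal (norm h * (LINT x|lb_on V. norm (g x)))"
proof (rule ennreal_le_epsilon)
 note i = W11_integrable[OF s]
 fix e :: real assume e: "e > 0"
 define e' where "e' = e / (norm h + 2)"
 have "norm h + 2 > 0" by (rule add_nonneg_pos) simp_all
 hence e': "e' > 0" "(norm h + 2) * e' = e" unfolding e'_def using e by simp_all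
 obtain F G where FG: "C1_on V F G" "L1_on V F" "L1_on V G"
   "(LINT x|lb_on V. norm (F x - f x)) < e'" "(LINT x|lb_on V. norm (G x - g x)) < e'" by (rule W11_approx[OF s e'(1)])
 define D where "D x = indicator V x *R (F x - f x)" for x
 note iD = bi_integrable_diff[OF FG(2) i(1)]
 have [measurable]: "D \<in> borel_measurable borel" unfolding D_def by (rule nn_integral_lb_on(2)[OF V(1) iD])
 define F' where "F' x = indicator V x *R F x" for x
 have [measurable]: "F' \<in> borel_measurable borel" unfolding F'_def by (rule nn_integral_lb_on(2)[OF V(1) FG(2)])
 have [measurable]: "V \<in> sets borel" using V(1) by simp
 have meas: "(%x. indicator V x * indicator V (x + h) * \<bar>F (x + h) - F x\<bar>) \<in> borel_measurable borel"
 proof -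
  have "(%x. indicator V x * indicator V (x + h) * \<bar>F (x + h) - F x\<bar>) = (%x. indicator V x * indicator V (x + h) * \<bar>F' (x + h) - F' x\<bar>)"
   by (auto simp: F'_def indicator_def fun_eq_iff)
  also have "... \<in> borel_measurable borel" by measurable
  finally show ?thesis .
 qed
 have iDn: "(\<integral>\<^sup>+x. ennreal (norm (D x)) \<partial>lborel) <= ennreal e'"
  unfolding D_def nn_integral_lb_on(1)[OF V(1) iD] using FG(4) by (intro ennreal_leI) simp
 have iDh: "(\<integral>\<^sup>+x. ennreal (norm (D (x + h))) \<partial>lborel) <= ennreal e'"
  using iDn nn_integral_lborel_shift[of "%x. ennreal (norm (D x))" h] by simp
 have "(\<integral>\<^sup>+x. ennreal (indicator V x * indicator V (x + h) * \<bar>f (x + h) - f x\<bar>) \<partial>lborel)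
  <= (\<integral>\<^sup>+x. ennreal (indicator V x * indicator V (x + h) * \<bar>F (x + h) - F x\<bar>) + (ennreal (norm (D (x + h))) + ennreal (norm (D x))) \<partial>lborel)"
 proof (rule nn_integral_mono)
  fix x
  have "indicator V x * indicator V (x + h) * \<bar>f (x + h) - f x\<bar>
   <= indicator V x * indicator V (x + h) * \<bar>F (x + h) - F x\<bar> + (norm (D (x + h)) + norm (D x))"
   by (auto simp: D_def indicator_def)
  hence "ennreal (indicator V x * indicator V (x + h) * \<bar>f (x + h) - f x\<bar>)
   <= ennreal (indicator V x * indicator V (x + h) * \<bar>F (x + h) - F x\<bar> + (norm (D (x + h)) + norm (D x)))" by (rule ennreal_leI)
  thus "ennreal (indicator V x * indicator V (x + h) * \<bar>f (x + h) - f x\<bar>)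
   <= ennreal (indicator V x * indicator V (x + h) * \<bar>F (x + h) - F x\<bar>) + (ennreal (norm (D (x + h))) + ennreal (norm (D x)))"
   by (simp add: ennreal_plus)
 qed
 also have "... = (\<integral>\<^sup>+x. ennreal (indicator V x * indicator V (x + h) * \<bar>F (x + h) - F x\<bar>) \<partial>lborel)
  + ((\<integral>\<^sup>+x. ennreal (norm (D (x + h))) \<partial>lborel) + (\<integral>\<^sup>+x. ennreal (norm (D x)) \<partial>lborel))"
  using meas by (subst nn_integral_add; (subst nn_integral_add)?) simp_all
 also have "... <= ennreal (norm h * (LINT x|lb_on V. norm (G x))) + (ennreal e' + ennreal e')"
  by (intro add_mono C1_translation_le[OF V FG(1-3)] iDn iDh)
 also have "... = ennreal (norm h * (LINT x|lb_on V. norm (G x)) + (e' + e'))"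
  using e' by (simp add: ennreal_plus[symmetric] bi_integral_nonneg del: ennreal_plus)
 also have "... <= ennreal (norm h * (LINT x|lb_on V. norm (g x)) + e)"
 proof (rule ennreal_leI)
  have "(LINT x|lb_on V. norm (G x)) <= (LINT x|lb_on V. norm (g x)) + e'"
  proof -
   have "(LINT x|lb_on V. norm (G x - 0)) <= (LINT x|lb_on V. norm (G x - g x)) + (LINT x|lb_on V. norm (g x - 0))"
    by (rule integral_norm_triangle[OF FG(3) i(2)]) simp
   thus ?thesis using FG(5) by simp
  qed
  hence "norm h * (LINT x|lb_on V. norm (G x)) <= norm h * ((LINT x|lb_on V. norm (g x)) + e')" by (rule mult_left_mono) simp
  thus "norm h * (LINT x|lb_on V. norm (G x)) + (e' + e') <= norm h * (LINT x|lb_on V. norm (g x)) + e"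
   using e'(2) by (simp add: distrib_left distrib_right)
 qed
 also have "... = ennreal (norm h * (LINT x|lb_on V. norm (g x))) + ennreal e"
  using e by (simp add: ennreal_plus[symmetric] bi_integral_nonneg del: ennreal_plus)
 finally show "(\<integral>\<^sup>+x. ennreal (indicator V x * indicator V (x + h) * \<bar>f (x + h) - f x\<bar>) \<partial>lborel)
  <= ennreal (norm h * (LINT x|lb_on V. norm (g x))) + ennreal e" .
qed

text \<open>Averaging the translation estimate over a ball of shifts; both the Faber-Krahn and the Poincare inequality follow from it.\<close>
lemma W11_average_translation_le:
 fixes f :: "'a::euclidean_space => real"
 assumes V: "open V" "convex V" and s: "W11 V f g" and rho: "rho \<ge> 0"
 shows "(\<integral>\<^sup>+x. (\<integral>\<^sup>+h. indicator (ball 0 rho) h * ennreal (indicator V x * indicator V (x + h) * \<bar>f (x + h) - f x\<bar>) \<partial>lborel) \<partial>lborel)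
  <= emeasure lborel (ball (0::'a) rho) * ennreal (rho * (LINT x|lb_on V. norm (g x)))"
proof -
 note i = W11_integrable[OF s]
 define f' where "f' x = indicator V x *R f x" for x
 have [measurable]: "f' \<in> borel_measurable borel" unfolding f'_def by (rule nn_integral_lb_on(2)[OF V(1) i(1)])
 have [measurable]: "V \<in> sets borel" "ball (0::'a) rho \<in> sets borel" using V(1) by simp_all
 have eq: "indicator V x * indicator V (x + h) * \<bar>f (x + h) - f x\<bar> = indicator V x * indicator V (x + h) * \<bar>f' (x + h) - f' x\<bar>" for x h
  by (auto simp: f'_def indicator_def)
 have m1: "(%x. ennreal (indicator V x * indicator V (x + h) * \<bar>f (x + h) - f x\<bar>)) \<in> borel_measurable lborel" for h
  unfolding eq by measurable
 have "(\<integral>\<^sup>+x. (\<integral>\<^sup>+h. indicator (ball 0 rho) h * ennreal (indicator V x * indicator V (x + h) * \<bar>f (x + h) - f x\<bar>) \<partial>lborel) \<partial>lborel)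
  = (\<integral>\<^sup>+h. (\<integral>\<^sup>+x. indicator (ball 0 rho) h * ennreal (indicator V x * indicator V (x + h) * \<bar>f (x + h) - f x\<bar>) \<partial>lborel) \<partial>lborel)"
  unfolding eq
 proof (rule nn_integral_lborel_swap)
  show "(%(x, h). indicator (ball 0 rho) h * ennreal (indicator V x * indicator V (x + h) * \<bar>f' (x + h) - f' x\<bar>)) \<in> borel_measurable (borel \<Otimes>\<^sub>M borel)"
   by measurable
 qed
 also have "... <= (\<integral>\<^sup>+h. indicator (ball (0::'a) rho) h * ennreal (rho * (LINT x|lb_on V. norm (g x))) \<partial>lborel)"
 proof (rule nn_integral_mono)
  fix h :: 'a
  have "(\<integral>\<^sup>+x. indicator (ball 0 rho) h * ennreal (indicator V x * indicator V (x + h) * \<bar>f (x + h) - f x\<bar>) \<partial>lborel)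
   = indicator (ball 0 rho) h * (\<integral>\<^sup>+x. ennreal (indicator V x * indicator V (x + h) * \<bar>f (x + h) - f x\<bar>) \<partial>lborel)"
   by (rule nn_integral_cmult[OF m1])
  also have "... <= indicator (ball 0 rho) h * ennreal (norm h * (LINT x|lb_on V. norm (g x)))"
   by (intro mult_left_mono W11_translation_le[OF V s]) simp
  also have "... <= indicator (ball 0 rho) h * ennreal (rho * (LINT x|lb_on V. norm (g x)))"
  proof (cases "h \<in> ball 0 rho")
   case True
   hence "norm h * (LINT x|lb_on V. norm (g x)) <= rho * (LINT x|lb_on V. norm (g x))"
    by (intro mult_right_mono bi_integral_nonneg) auto
   thus ?thesis by (intro mult_left_mono ennreal_leI) auto
  qed simp
  finally show "(\<integral>\<^sup>+x. indicator (ball 0 rho) h * ennreal (indicator V x * indicator V (x + h) * \<bar>f (x + h) - f x\<bar>) \<partial>lborel)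
   <= indicator (ball 0 rho) h * ennreal (rho * (LINT x|lb_on V. norm (g x)))" .
 qed
 also have "... = emeasure lborel (ball (0::'a) rho) * ennreal (rho * (LINT x|lb_on V. norm (g x)))"
  by (subst nn_integral_multc) simp_all
 finally show ?thesis .
qed

text \<open>Shifts are taken from a ball with twice the volume of \<open>A\<close>: from any point x
  at least half of them lead out of \<open>A\<close>, where f vanishes, so f(x) |A| is at most the
  integral of |f(x+h) - f(x)| over the shifts. Integrating in x gives the bound with factor 2 rho.
  The domain has radius \<open>4 * r\<close> because shifts may be as long as 2r.\<close>

lemma faber_krahn:
 fixes f :: "'a::euclidean_space => real"
 assumes s: "W11 (ball x0 (4 * r)) f g" and r: "r > 0"
  and f0: "!!x. x \<in> ball x0 (4 * r) ==> f x \<ge> 0" "!!x. x \<in> ball x0 (4 * r) ==> x \<notin> ball x0 r ==> f x = 0"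
  and A: "A \<in> sets borel" "A \<subseteq> ball x0 r" "!!x. x \<in> ball x0 r ==> f x \<noteq> 0 ==> x \<in> A"
 shows "(LINT x|lb_on (ball x0 (4 * r)). f x) <=
  2 * (2 * measure lborel A / unit_ball_vol (real DIM('a))) powr (1 / real DIM('a)) * (LINT x|lb_on (ball x0 (4 * r)). norm (g x))"
proof -
 define V where "V = ball x0 (4 * r)"
 note s = s[folded V_def] and f0 = f0[folded V_def]
 have V: "open V" "convex V" unfolding V_def by simp_all
 note i = W11_integrable[OF s]
 define f' where "f' x = indicator V x *R f x" for x
 have [measurable]: "f' \<in> borel_measurable borel" unfolding f'_def by (rule nn_integral_lb_on(2)[OF V(1) i(1)])
 have [measurable]: "A \<in> sets borel" by fact
 have f'0: "f' x \<ge> 0" for x unfolding f'_def using f0(1)[of x] by (simp add: indicator_def)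
 have f'A: "f' x = 0" if "x \<notin> A" for x
  unfolding f'_def using that f0(2)[of x] A(3)[of x] by (auto simp: indicator_def)
 define I where "I = (LINT x|lb_on V. norm (g x))"
 have I0: "I \<ge> 0" unfolding I_def by (intro bi_integral_nonneg) simp
 define S where "S = (LINT x|lb_on V. f x)"
 have S: "ennreal S = (\<integral>\<^sup>+x. ennreal (f' x) \<partial>lborel)"
 proof -
  have "(\<integral>\<^sup>+x. ennreal (norm (indicator V x *R f x)) \<partial>lborel) = ennreal (LINT x|lb_on V. norm (f x))"
   by (rule nn_integral_lb_on(1)[OF V(1) i(1)])
  moreover have "(LINT x|lb_on V. norm (f x)) = S" unfolding S_def
   by (intro bi_integral_cong refl) (simp add: space_restrict_space f0)
  moreover have "norm (indicator V x *R f x) = f' x" for x using f'0[of x] unfolding f'_def[symmetric] by simp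
  ultimately show ?thesis by simp
 qed
 define N where "N = DIM('a)"
 have N: "N > 0" unfolding N_def by simp
 define omega where "omega = unit_ball_vol (real N)"
 have omega: "omega > 0" unfolding omega_def by simp
 define m where "m = measure lborel A"
 have Afin: "emeasure lborel A < \<infinity>"
  using emeasure_mono[OF A(2), of lborel] emeasure_lborel_ball_finite[of x0 r] by (simp add: order_le_less_trans)
 have eA: "emeasure lborel A = ennreal m" unfolding m_def using emeasure_eq_ennreal_measure[of lborel A] Afin by simp
 have mb: "m <= omega * r ^ N"
 proof -
  have "m <= measure lborel (ball x0 r)" unfolding m_def
   by (rule measure_mono_fmeasurable[OF A(2)]) (use A fmeasurableI[OF _ emeasure_lborel_ball_finite[of x0 r]] in simp_all)
  thus ?thesis unfolding omega_def N_def using content_ball[of r x0] r by simp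
 qed
 have "S <= 2 * (2 * m / omega) powr (1 / real N) * I"
 proof (cases "m = 0")
  case True
  have "A \<in> null_sets lborel" using eA True A by (simp add: null_sets_def)
  hence "AE x in lborel. x \<notin> A" by (rule AE_not_in)
  hence "AE x in lborel. ennreal (f' x) = 0" by (rule AE_mp) (intro AE_I2 impI, simp add: f'A)
  hence "(\<integral>\<^sup>+x. ennreal (f' x) \<partial>lborel) = 0" by (subst nn_integral_0_iff_AE) simp_all
  hence "S <= 0" using S by (simp add: ennreal_eq_0_iff)
  thus ?thesis using I0 True by simp
 next
  case False
  hence m: "m > 0" unfolding m_def by (simp add: zero_less_measure_iff)
  \<comment> \<open>The radius at which the ball of shifts has volume 2m.\<close>
  define rho where "rho = (2 * m / omega) powr (1 / real N)"
  have rho: "rho > 0" unfolding rho_def using m omega by simp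
  have rhoN: "rho ^ N = 2 * m / omega"
  proof -
   have "rho ^ N = rho powr real N" using rho by (simp add: powr_realpow)
   also have "... = 2 * m / omega" unfolding rho_def powr_powr using N m omega by simp
   finally show ?thesis .
  qed
  \<comment> \<open>From m \<le> omega r^N and 2 \<le> 2^N.\<close>
  have rhor: "rho <= 2 * r"
  proof (rule power_le_imp_le_base[of _ "N - 1"])
   have "rho ^ N <= 2 * r ^ N" unfolding rhoN using mb omega by (simp add: divide_le_eq mult.commute)
   also have "... <= 2 ^ N * r ^ N" using N r by (intro mult_right_mono) (simp_all add: self_le_power)
   finally show "rho ^ Suc (N - 1) <= (2 * r) ^ Suc (N - 1)" using N by (simp add: power_mult_distrib)
  qed (use r in simp)
  have volB: "emeasure lborel (ball (0::'a) rho) = ennreal m + ennreal m"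
  proof -
   have "measure lborel (ball (0::'a) rho) = omega * rho ^ N" unfolding omega_def N_def using content_ball[of rho "0::'a"] rho by simp
   also have "... = m + m" unfolding rhoN using omega by simp
   finally have "measure lborel (ball (0::'a) rho) = m + m" .
   thus ?thesis using emeasure_eq_ennreal_measure[of lborel "ball (0::'a) rho"] emeasure_lborel_ball_finite[of "0::'a" rho] m
    by (simp add: ennreal_plus[symmetric] del: ennreal_plus)
  qed
  have Bmeas [measurable]: "ball (0::'a) rho \<in> sets borel" "V \<in> sets borel" using V by simp_all
  define J where "J x = (\<integral>\<^sup>+h. indicator (ball 0 rho) h * ennreal (indicator V x * indicator V (x + h) * \<bar>f (x + h) - f x\<bar>) \<partial>lborel)" for x
  have key: "ennreal (f' x) * ennreal m <= J x" for x
  proof (cases "x \<in> A")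
   case False thus ?thesis using f'A by simp
  next
   case True
   hence xr: "x \<in> ball x0 r" using A(2) by blast
   hence xV: "x \<in> V" unfolding V_def using r by auto
   have xhV: "x + h \<in> V" if "h \<in> ball 0 rho" for h
   proof -
    have "norm h < 2 * r" using that rhor by simp
    moreover have "dist x0 (x + h) <= dist x0 x + norm h" by (metis add_diff_cancel_left' dist_commute dist_norm dist_triangle)
    ultimately show ?thesis unfolding V_def using xr r by simp
   qed
   \<comment> \<open>Either x + h lies outside \<open>A\<close> and the increment is f(x), or the
     shift is charged to \<open>A\<close>, whose translates all have measure m.\<close>
   have pt: "indicator (ball 0 rho) h * ennreal (f' x) <= indicator (ball 0 rho) h * ennreal (indicator V x * indicator V (x + h) * \<bar>f (x + h) - f x\<bar>) + ennreal (f' x) * indicator A (x + h)" for h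
   proof (cases "h \<in> ball 0 rho")
    case True
    show ?thesis
    proof (cases "x + h \<in> A")
     case False
     hence "f (x + h) = 0" using f'A[of "x + h"] xhV[OF True] by (simp add: f'_def)
     thus ?thesis using True xhV[OF True] xV by (simp add: f'_def add_increasing2)
    qed (use True in \<open>simp add: add_increasing\<close>)
   qed simp
   have "ennreal (f' x) * ennreal m + ennreal (f' x) * ennreal m = (\<integral>\<^sup>+h. indicator (ball (0::'a) rho) h * ennreal (f' x) \<partial>lborel)"
    by (subst nn_integral_multc) (simp_all add: volB distrib_left distrib_right mult.commute)
   also have "... <= (\<integral>\<^sup>+h. indicator (ball 0 rho) h * ennreal (indicator V x * indicator V (x + h) * \<bar>f (x + h) - f x\<bar>) + ennreal (f' x) * indicator A (x + h) \<partial>lborel)"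
    by (rule nn_integral_mono) (rule pt)
   also have "... = J x + (\<integral>\<^sup>+h. ennreal (f' x) * indicator A (x + h) \<partial>lborel)"
   proof (unfold J_def, rule nn_integral_add)
    have eq: "ennreal (indicator V x * indicator V (x + h) * \<bar>f (x + h) - f x\<bar>) = ennreal (indicator V x * indicator V (x + h) * \<bar>f' (x + h) - f' x\<bar>)" for h
     by (auto simp: f'_def indicator_def)
    show "(%h. indicator (ball 0 rho) h * ennreal (indicator V x * indicator V (x + h) * \<bar>f (x + h) - f x\<bar>)) \<in> borel_measurable lborel"
     unfolding eq by measurable
    show "(%h. ennreal (f' x) * indicator A (x + h)) \<in> borel_measurable lborel" by measurable
   qed
   also have "(\<integral>\<^sup>+h. ennreal (f' x) * indicator A (x + h) \<partial>lborel) = ennreal (f' x) * ennreal m"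
   proof -
    have "(\<integral>\<^sup>+h. indicator A (h + x) \<partial>lborel) = (\<integral>\<^sup>+h. indicator A h \<partial>lborel)" by (rule nn_integral_lborel_shift) measurable
    hence "(\<integral>\<^sup>+h. indicator A (x + h) \<partial>lborel) = ennreal m" using A(1) eA by (simp add: add.commute)
    thus ?thesis by (subst nn_integral_cmult) simp_all
   qed
   finally have "ennreal (f' x) * ennreal m + ennreal (f' x) * ennreal m <= ennreal (f' x) * ennreal m + J x" by (simp add: add.commute)
   thus ?thesis by (subst (asm) ennreal_add_left_cancel_le) (simp add: ennreal_mult[symmetric] f'0 less_imp_le[OF m])
  qed
  have "ennreal (S * m) = (\<integral>\<^sup>+x. ennreal (f' x) * ennreal m \<partial>lborel)"
  proof -
   have "S \<ge> 0" unfolding S_def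
    by (intro bi_integral_nonneg_AE AE_I2) (simp add: space_restrict_space f0)
   thus ?thesis using m by (subst nn_integral_multc) (simp_all add: ennreal_mult S)
  qed
  also have "... <= (\<integral>\<^sup>+x. J x \<partial>lborel)" by (rule nn_integral_mono) (rule key)
  also have "... <= emeasure lborel (ball (0::'a) rho) * ennreal (rho * I)"
   unfolding J_def I_def by (rule W11_average_translation_le[OF V s]) (use rho in simp)
  also have "... = ennreal ((2 * rho * I) * m)"
   unfolding volB using m rho I0 by (simp add: ennreal_plus[symmetric] ennreal_mult[symmetric] algebra_simps del: ennreal_plus)
  finally have "S * m <= (2 * rho * I) * m" using m rho I0 by (subst (asm) ennreal_le_iff) simp_all
  hence "S <= 2 * rho * I" using m by simp
  thus ?thesis unfolding rho_def .
 qed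
 thus ?thesis unfolding S_def I_def V_def m_def omega_def N_def .
qed

text \<open>Shifts of length up to 2r join any two points of the ball. From each x the shifts that
  land in \<open>Z\<close> have measure |Z|, and on them the increment equals v(x). The factor is
  2^N for the volume of the doubled ball, 2 for the share of \<open>Z\<close>, and 2 for the length
  of the shifts.\<close>

lemma poincare_zero_set:
 fixes v :: "'a::euclidean_space => real"
 assumes s: "W11 (ball x0 r) v g" and r: "r > 0"
  and v0: "!!x. x \<in> ball x0 r ==> v x \<ge> 0"
  and Z: "Z \<in> sets borel" "Z \<subseteq> ball x0 r" "!!x. x \<in> Z ==> v x = 0" "measure lborel (ball x0 r) <= 2 * measure lborel Z"
 shows "(LINT x|lb_on (ball x0 r). v x) <= 2 ^ (DIM('a) + 2) * r * (LINT x|lb_on (ball x0 r). norm (g x))"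
proof -
 define V where "V = ball x0 r"
 note s = s[folded V_def] and v0 = v0[folded V_def] and Z = Z[folded V_def]
 have V: "open V" "convex V" unfolding V_def by simp_all
 note i = W11_integrable[OF s]
 define f' where "f' x = indicator V x *R v x" for x
 have [measurable]: "f' \<in> borel_measurable borel" unfolding f'_def by (rule nn_integral_lb_on(2)[OF V(1) i(1)])
 have [measurable]: "Z \<in> sets borel" by fact
 have f'0: "f' x \<ge> 0" for x unfolding f'_def using v0[of x] by (simp add: indicator_def)
 define I where "I = (LINT x|lb_on V. norm (g x))"
 have I0: "I \<ge> 0" unfolding I_def by (intro bi_integral_nonneg) simp
 define S where "S = (LINT x|lb_on V. v x)"
 have S: "ennreal S = (\<integral>\<^sup>+x. ennreal (f' x) \<partial>lborel)"
 proof -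
  have "(\<integral>\<^sup>+x. ennreal (norm (indicator V x *R v x)) \<partial>lborel) = ennreal (LINT x|lb_on V. norm (v x))"
   by (rule nn_integral_lb_on(1)[OF V(1) i(1)])
  moreover have "(LINT x|lb_on V. norm (v x)) = S" unfolding S_def
   by (intro bi_integral_cong refl) (simp add: space_restrict_space v0)
  moreover have "norm (indicator V x *R v x) = f' x" for x using f'0[of x] unfolding f'_def[symmetric] by simp
  ultimately show ?thesis by simp
 qed
 define m where "m = measure lborel Z"
 have Zfin: "emeasure lborel Z < \<infinity>"
  using emeasure_mono[OF Z(2), of lborel] emeasure_lborel_ball_finite[of x0 r] unfolding V_def by (simp add: order_le_less_trans)
 have eZ: "emeasure lborel Z = ennreal m" unfolding m_def using emeasure_eq_ennreal_measure[of lborel Z] Zfin by simp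
 have vV: "measure lborel V = unit_ball_vol (real DIM('a)) * r ^ DIM('a)" unfolding V_def using content_ball[of r x0] r by simp
 have m: "m > 0" using Z(4) vV unfolding m_def
  using mult_pos_pos[OF unit_ball_vol_pos[of "real DIM('a)"] zero_less_power[OF r, of "DIM('a)"]] by simp
 have volB: "emeasure lborel (ball (0::'a) (2 * r)) = ennreal (2 ^ DIM('a) * measure lborel V)"
 proof -
  have "measure lborel (ball (0::'a) (2 * r)) = 2 ^ DIM('a) * measure lborel V"
   unfolding vV using content_ball[of "2 * r" "0::'a"] r by (simp add: power_mult_distrib)
  thus ?thesis using emeasure_eq_ennreal_measure[of lborel "ball (0::'a) (2 * r)"] emeasure_lborel_ball_finite[of "0::'a" "2 * r"] by simp
 qed
 have [measurable]: "ball (0::'a) (2 * r) \<in> sets borel" "V \<in> sets borel" using V by simp_all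
 define J where "J x = (\<integral>\<^sup>+h. indicator (ball 0 (2 * r)) h * ennreal (indicator V x * indicator V (x + h) * \<bar>v (x + h) - v x\<bar>) \<partial>lborel)" for x
 have key: "ennreal (f' x) * ennreal m <= J x" for x
 proof (cases "x \<in> V")
  case False thus ?thesis by (simp add: f'_def)
 next
  case True
  have pt: "ennreal (f' x) * indicator Z (x + h) <= indicator (ball 0 (2 * r)) h * ennreal (indicator V x * indicator V (x + h) * \<bar>v (x + h) - v x\<bar>)" for h
  proof (cases "x + h \<in> Z")
   case z: True
   hence xh: "x + h \<in> V" using Z(2) by blast
   have "norm h = dist x (x + h)" by (simp add: dist_norm)
   also have "... <= dist x0 x + dist x0 (x + h)" by (metis dist_commute dist_triangle)
   finally have "h \<in> ball 0 (2 * r)" using True xh unfolding V_def by simp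
   thus ?thesis using z xh True Z(3)[OF z] by (simp add: f'_def)
  qed simp
  have "(\<integral>\<^sup>+h. indicator Z (h + x) \<partial>lborel) = (\<integral>\<^sup>+h. indicator Z h \<partial>lborel)" by (rule nn_integral_lborel_shift) measurable
  hence "(\<integral>\<^sup>+h. indicator Z (x + h) \<partial>lborel) = ennreal m" using Z(1) eZ by (simp add: add.commute)
  hence "ennreal (f' x) * ennreal m = (\<integral>\<^sup>+h. ennreal (f' x) * indicator Z (x + h) \<partial>lborel)"
   by (subst nn_integral_cmult) simp_all
  also have "... <= J x" unfolding J_def by (rule nn_integral_mono) (rule pt)
  finally show ?thesis .
 qed
 have S0: "S \<ge> 0" unfolding S_def
  by (intro bi_integral_nonneg_AE AE_I2) (simp add: space_restrict_space v0)
 have "ennreal (S * m) = (\<integral>\<^sup>+x. ennreal (f' x) * ennreal m \<partial>lborel)"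
  using m S0 by (subst nn_integral_multc) (simp_all add: ennreal_mult S)
 also have "... <= (\<integral>\<^sup>+x. J x \<partial>lborel)" by (rule nn_integral_mono) (rule key)
 also have "... <= emeasure lborel (ball (0::'a) (2 * r)) * ennreal ((2 * r) * I)"
  unfolding J_def I_def by (rule W11_average_translation_le[OF V s]) (use r in simp)
 also have "... = ennreal (2 ^ DIM('a) * measure lborel V * ((2 * r) * I))"
  unfolding volB using r I0 by (simp add: ennreal_mult[symmetric])
 finally have "S * m <= 2 ^ DIM('a) * measure lborel V * ((2 * r) * I)" using r I0 by (subst (asm) ennreal_le_iff) simp_all
 also have "... <= 2 ^ DIM('a) * (2 * m) * ((2 * r) * I)"
  using Z(4) r I0 unfolding m_def by (intro mult_right_mono mult_left_mono) simp_all
 also have "... = (2 ^ (DIM('a) + 2) * r * I) * m" by simp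
 finally have "S <= 2 ^ (DIM('a) + 2) * r * I" using m by simp
 thus ?thesis unfolding S_def I_def V_def .
qed

section \<open>Energy estimates for supersolutions\<close>

lemma powr_log_small:
 fixes t :: real
 assumes "0 < t" "t <= 1" "0 < s"
 shows "t powr s * \<bar>ln t\<bar> <= 1 / s"
proof -
 define y where "y = t powr s"
 have y: "y > 0" unfolding y_def using assms by simp
 have "ln (1 / y) <= 1 / y - 1" using y by (intro ln_le_minus_one) simp
 hence "- ln y <= 1 / y - 1" using y by (simp add: ln_div)
 hence "y * (- ln y) <= y * (1 / y - 1)" using y by (intro mult_left_mono) auto
 also have "... <= 1" using y by (simp add: right_diff_distrib)
 finally have 1: "y * (- ln y) <= 1" .
 have "ln y = s * ln t" unfolding y_def using assms by (simp add: ln_powr)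
 moreover have "ln t <= 0" using assms by simp
 ultimately have "y * (s * \<bar>ln t\<bar>) <= 1" using 1 by simp
 thus ?thesis using assms unfolding y_def by (simp add: le_divide_eq mult.commute mult.left_commute)
qed

text \<open>Plays the role of Young's inequality for the logarithm, uniformly for exponents in
  [pm, pM]. Near 0 the factor T^(pm-1) beats the logarithm because pm > 1; for large T the bound ln
  T \<le> 2 sqrt T lets it be absorbed; in between everything is bounded.\<close>

lemma powr_log_absorb:
 fixes pm pM c Lam :: real
 assumes pm: "1 < pm" and c: "0 < c" and Lam: "0 <= Lam"
 obtains C where "0 <= C" "!!p T. pm <= p ==> p <= pM ==> 0 <= T ==> Lam * (T powr (p - 1) * \<bar>ln T\<bar>) <= c * T powr p + C"
proof
 \<comment> \<open>Beyond (2 Lam / c)^2 one has 2 Lam \<le> c sqrt T, hence Lam |ln T| \<le> c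
   T.\<close>
 define T0 where "T0 = max 1 ((2 * Lam / c)\<^sup>2)"
 define C where "C = Lam / (pm - 1) + Lam * T0 powr (\<bar>pM\<bar> + 1)"
 have T0: "T0 \<ge> 1" "T0 \<ge> (2 * Lam / c)\<^sup>2" unfolding T0_def by auto
 show C: "0 <= C" unfolding C_def using Lam pm by (intro add_nonneg_nonneg) auto
 have C12: "Lam / (pm - 1) <= C" "Lam * T0 powr (\<bar>pM\<bar> + 1) <= C" unfolding C_def using Lam pm by auto
 fix p T :: real assume p: "pm <= p" "p <= pM" and T: "0 <= T"
 have cT: "0 <= c * T powr p" using c by simp
 consider "T = 0" | "0 < T" "T <= 1" | "1 < T" "T <= T0" | "T0 < T" using T by linarith
 thus "Lam * (T powr (p - 1) * \<bar>ln T\<bar>) <= c * T powr p + C"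
 proof cases
  case 1 thus ?thesis using C by simp
 next
  case 2
  have "T powr (p - 1) <= T powr (pm - 1)" using 2 p by (intro powr_mono') auto
  hence "T powr (p - 1) * \<bar>ln T\<bar> <= T powr (pm - 1) * \<bar>ln T\<bar>" by (rule mult_right_mono) simp
  also have "... <= 1 / (pm - 1)" by (rule powr_log_small) (use 2 pm in auto)
  finally have "Lam * (T powr (p - 1) * \<bar>ln T\<bar>) <= Lam * (1 / (pm - 1))" using Lam by (rule mult_left_mono)
  thus ?thesis using C12 cT by simp
 next
  case 3
  have "T powr (p - 1) <= T powr \<bar>pM\<bar>" using 3 p pm by (intro powr_mono) auto
  also have "... <= T0 powr \<bar>pM\<bar>" using 3 by (intro powr_mono2) auto
  finally have a: "T powr (p - 1) <= T0 powr \<bar>pM\<bar>" .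
  have "ln T <= T - 1" using 3 by (intro ln_le_minus_one) auto
  hence "\<bar>ln T\<bar> <= T0" using 3 by simp
  with a have "T powr (p - 1) * \<bar>ln T\<bar> <= T0 powr \<bar>pM\<bar> * T0" by (intro mult_mono) auto
  also have "... = T0 powr (\<bar>pM\<bar> + 1)" using T0(1) by (simp add: powr_add)
  finally have "Lam * (T powr (p - 1) * \<bar>ln T\<bar>) <= Lam * T0 powr (\<bar>pM\<bar> + 1)" using Lam by (rule mult_left_mono)
  thus ?thesis using C12 cT by linarith
 next
  case 4
  hence T1: "T > 1" using T0 by linarith
  have "ln (sqrt T) <= sqrt T - 1" using T1 by (intro ln_le_minus_one) auto
  moreover have "ln (sqrt T) = ln T / 2" using T1 by (simp add: ln_sqrt)
  ultimately have "\<bar>ln T\<bar> <= 2 * sqrt T" using T1 by simp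
  moreover have "2 * Lam <= c * sqrt T"
  proof -
   have "(2 * Lam / c)\<^sup>2 <= T" using T0 4 by linarith
   hence "2 * Lam / c <= sqrt T" by (rule real_le_rsqrt)
   thus ?thesis using c by (simp add: divide_le_eq mult.commute)
  qed
  ultimately have "Lam * \<bar>ln T\<bar> <= Lam * (2 * sqrt T)" using Lam by (intro mult_left_mono)
  also have "... = (2 * Lam) * sqrt T" by simp
  also have "... <= (c * sqrt T) * sqrt T" using \<open>2 * Lam <= c * sqrt T\<close> by (rule mult_right_mono) (use T1 in simp)
  also have "... = c * T" using T1 by simp
  finally have "T powr (p - 1) * (Lam * \<bar>ln T\<bar>) <= T powr (p - 1) * (c * T)" by (rule mult_left_mono) simp
  also have "T powr (p - 1) * (c * T) = c * T powr p" using T1 by (simp add: powr_diff)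
  finally show ?thesis using C by (simp add: mult.left_commute)
 qed
qed

text \<open>Young's inequality by cases, which avoids conjugate exponents depending on x: either q D
  is at most c eta T and is absorbed directly, or eta T \<le> X and the whole term is bounded. The
  condition q \<ge> p enters in passing from eta^(q-1) to eta^(p-1).\<close>

lemma cutoff_power_absorb:
 fixes eta T D X c p :: real
 assumes eta: "0 <= eta" "eta <= 1" and T: "0 <= T" and p: "1 <= p" "p <= pM" and q: "p <= real q" "2 <= q"
  and D: "0 <= D" "real q * D <= c * X" and X: "1 <= X" and c: "0 < c"
 shows "real q * eta ^ (q - 1) * D * T powr (p - 1) <= c * (eta ^ q * T powr p) + c * X powr pM"
proof -
 have nn: "0 <= c * (eta ^ q * T powr p)" "0 <= c * X powr pM" using c eta by auto
 show ?thesis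
 proof (cases "eta = 0 \<or> T = 0")
  case True
  hence "real q * eta ^ (q - 1) * D * T powr (p - 1) = 0" using q(2) by auto
  thus ?thesis using nn by linarith
 next
  case False
  hence pos: "eta > 0" "T > 0" using eta T by auto
  have qs: "eta ^ q = eta ^ (q - 1) * eta" using q(2) by (metis mult.commute power_eq_if not_numeral_le_zero)
  have Tp: "T powr p = T powr (p - 1) * T" using pos by (simp add: powr_diff)
  show ?thesis
  proof (cases "real q * D <= c * (eta * T)")
   case True
   hence "(eta ^ (q - 1) * T powr (p - 1)) * (real q * D) <= (eta ^ (q - 1) * T powr (p - 1)) * (c * (eta * T))"
    using pos by (intro mult_left_mono) auto
   also have "... = c * (eta ^ q * T powr p)" unfolding qs Tp by simp
   finally show ?thesis using nn by (simp add: mult.commute mult.left_commute)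
  next
   case False
   hence "c * (eta * T) <= c * X" using D by linarith
   hence hT: "eta * T <= X" using c by simp
   have "eta ^ (q - 1) * T powr (p - 1) = eta powr (real (q - 1)) * T powr (p - 1)" using pos by (simp add: powr_realpow)
   also have "... <= eta powr (p - 1) * T powr (p - 1)"
    using pos eta q by (intro mult_right_mono powr_mono') auto
   also have "... = (eta * T) powr (p - 1)" using pos by (simp add: powr_mult)
   also have "... <= X powr (p - 1)" using hT pos p by (intro powr_mono2) auto
   finally have "(eta ^ (q - 1) * T powr (p - 1)) * (real q * D) <= X powr (p - 1) * (c * X)"
    by (rule mult_mono) (use D in auto)
   also have "... = c * X powr p" using X by (simp add: powr_diff)
   also have "... <= c * X powr pM" using X p c by (intro mult_left_mono powr_mono) auto
   finally show ?thesis using nn by (simp add: mult.commute mult.left_commute)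
  qed
 qed
qed

lemma smooth_cutoff:
 fixes x0 :: "'a::euclidean_space"
 assumes ab: "0 < a" "a < b"
 obtains eta Deta where "!!x. (eta has_derivative (%h. Deta x \<bullet> h)) (at x)" "continuous_on UNIV Deta"
  "!!x. 0 <= eta x" "!!x. eta x <= 1" "!!x. x \<in> ball x0 a ==> eta x = 1"
  "!!x. x \<notin> ball x0 b ==> eta x = 0" "!!x. x \<notin> ball x0 b ==> Deta x = (0::'a)" "!!x. norm (Deta x) <= 3 / (b - a)"
proof
 \<comment> \<open>The smooth step 3 t^2 - 2 t^3; beyond t = 1 the terms in t - 1 reduce the
   polynomial to the constant 1. It is evaluated at an affine function of |x - x0|^2, which is
   smooth at the centre too.\<close>
 define S where "S t = 3 * (max 0 t)^2 - 2 * (max 0 t)^3 + 2 * (max 0 (t - 1))^3 + 3 * (max 0 (t - 1))^2" for t :: real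
 define S' where "S' t = 6 * (max 0 t) - 6 * (max 0 t)^2 + 6 * (max 0 (t - 1))^2 + 6 * (max 0 (t - 1))" for t :: real
 have S: "(S has_real_derivative S' t) (at t)" for t
 proof -
  have d2: "((%t. (max 0 t)^2) has_real_derivative 2 * max 0 t) (at t)" for t :: real
   using max0_power_has_derivative[of 1 t] by (simp add: numeral_2_eq_2)
  have d3: "((%t. (max 0 t)^3) has_real_derivative 3 * (max 0 t)^2) (at t)" for t :: real
   using max0_power_has_derivative[of 2 t] by (simp add: numeral_3_eq_3 numeral_2_eq_2)
  have sh: "((%t. t - 1) has_real_derivative 1) (at t)" for t :: real by (auto intro!: derivative_eq_intros)
  have e2: "((%t. (max 0 (t - 1))^2) has_real_derivative 2 * max 0 (t - 1)) (at t)" using DERIV_chain2[OF d2 sh] by simp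
  have e3: "((%t. (max 0 (t - 1))^3) has_real_derivative 3 * (max 0 (t - 1))^2) (at t)" using DERIV_chain2[OF d3 sh] by simp
  have "(S has_real_derivative 3 * (2 * max 0 t) - 2 * (3 * (max 0 t)^2) + 2 * (3 * (max 0 (t - 1))^2) + 3 * (2 * max 0 (t - 1))) (at t)"
   unfolding S_def[abs_def] by (intro DERIV_add DERIV_diff DERIV_cmult d2 d3 e2 e3)
  thus ?thesis unfolding S'_def by simp
 qed
 have S0: "S t = 0" "S' t = 0" if "t <= 0" for t unfolding S_def S'_def using that by (simp_all add: max_def)
 have S1: "S t = 1" "S' t = 0" if "t \<ge> 1" for t
 proof -
  have m: "max 0 t = t" "max 0 (t - 1) = t - 1" using that by auto
  show "S t = 1" "S' t = 0" unfolding S_def S'_def m by (simp_all add: power2_eq_square power3_eq_cube algebra_simps)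
 qed
 have S'b: "0 <= S' t & S' t <= 3/2" for t
 proof -
  consider "t <= 0" | "0 < t" "t < 1" | "t \<ge> 1" by linarith
  thus ?thesis
  proof cases
   case 2
   hence m: "max 0 t = t" "max 0 (t - 1) = 0" by auto
   have e: "S' t = 6 * (t * (1 - t))" unfolding S'_def m by (simp add: power2_eq_square algebra_simps)
   have "0 <= (t - 1/2)\<^sup>2" by simp
   hence "t * (1 - t) <= 1/4" by (simp add: power2_eq_square algebra_simps)
   moreover have "0 <= t * (1 - t)" using 2 by simp
   ultimately show ?thesis unfolding e by simp
  qed (simp_all add: S0 S1)
 qed
 have Sb: "0 <= S t & S t <= 1" for t
 proof -
  have mono: "S s <= S t" if "s <= t" for s t
   by (rule DERIV_nonneg_imp_nondecreasing[OF that]) (use S S'b in blast)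
  have "S (min t 0) <= S t" "S t <= S (max t 1)" by (intro mono, simp)+
  thus ?thesis using S0(1)[of "min t 0"] S1(1)[of "max t 1"] by simp
 qed
 define d where "d = b\<^sup>2 - a\<^sup>2"
 have d: "d = (b - a) * (b + a)" unfolding d_def by (simp add: power2_eq_square algebra_simps)
 hence d0: "d > 0" using ab by simp
 define tau where "tau x = (b\<^sup>2 - (x - x0) \<bullet> (x - x0)) / d" for x
 define eta where "eta x = S (tau x)" for x
 define Deta where "Deta x = (- (S' (tau x) * 2 / d)) *R (x - x0)" for x
 show "(eta has_derivative (%h. Deta x \<bullet> h)) (at x)" for x
 proof -
  have 1: "(tau has_derivative (%h. - (2 / d * ((x - x0) \<bullet> h)))) (at x)"
   unfolding tau_def[abs_def] using d0 by (auto intro!: derivative_eq_intros simp: inner_commute field_simps)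
  show ?thesis using has_derivative_compose[OF 1 S[unfolded has_field_derivative_def]] unfolding eta_def[abs_def] Deta_def
   by (simp add: mult.assoc)
 qed
 have ctau: "continuous_on UNIV tau" unfolding tau_def[abs_def] by (intro continuous_intros) (use d0 in simp)
 show "continuous_on UNIV Deta" unfolding Deta_def[abs_def] S'_def by (intro continuous_intros ctau) (use d0 in simp)
 show "0 <= eta x" "eta x <= 1" for x unfolding eta_def using Sb by auto
 have nsq: "(x - x0) \<bullet> (x - x0) = (norm (x - x0))\<^sup>2" for x by (simp add: dot_square_norm)
 show "eta x = 1" if "x \<in> ball x0 a" for x
 proof -
  have "(norm (x - x0))\<^sup>2 <= a\<^sup>2" using that by (intro power_mono) (simp_all add: dist_norm norm_minus_commute)
  hence "tau x \<ge> 1" unfolding tau_def nsq using d0 by (simp add: le_divide_eq d_def)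
  thus ?thesis unfolding eta_def by (rule S1)
 qed
 have out: "tau x <= 0" if "x \<notin> ball x0 b" for x
 proof -
  have "b\<^sup>2 <= (norm (x - x0))\<^sup>2" using that ab by (intro power_mono) (simp_all add: dist_norm norm_minus_commute)
  thus ?thesis unfolding tau_def nsq using d0 by (simp add: divide_le_eq)
 qed
 show "eta x = 0" "Deta x = 0" if "x \<notin> ball x0 b" for x unfolding eta_def Deta_def using S0[OF out[OF that]] by simp_all
 show "norm (Deta x) <= 3 / (b - a)" for x
 proof (cases "x \<in> ball x0 b")
  case False
  thus ?thesis using S0[OF out[OF False]] ab unfolding Deta_def by simp
 next
  case True
  have "norm (Deta x) = S' (tau x) * 2 / d * norm (x - x0)" unfolding Deta_def using S'b[of "tau x"] d0 by simp
  also have "... <= (3/2) * 2 / d * b"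
   using S'b[of "tau x"] d0 True ab by (intro mult_mono divide_right_mono) (simp_all add: dist_norm norm_minus_commute)
  also have "... = 3 * b / ((b - a) * (b + a))" unfolding d by simp
  also have "... <= 3 / (b - a)"
  proof -
   have "b / (b + a) <= 1" using ab by simp
   hence "3 / (b - a) * (b / (b + a)) <= 3 / (b - a) * 1" using ab by (intro mult_left_mono) auto
   thus ?thesis by simp
  qed
  finally show ?thesis .
 qed
qed

lemma emeasure_ball_less_top: "emeasure lborel (ball (x::'a::euclidean_space) r) < \<infinity>"
 using emeasure_lborel_ball_finite[of x r] by simp

text \<open>\<open>z\<close> may be unbounded, so it is truncated at height n, where all factors are
  bounded and the product and power rules apply. \<open>G\<close> supplies a majorant of functions
  and gradients that is uniform in n.\<close>

lemma W11_shifted_product_powr: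
 fixes z b e :: "'a::euclidean_space => real"
 assumes V: "open V" "emeasure lborel V < \<infinity>"
  and z: "W11 V z Dz" and b: "W11 V b Db" and e: "W11 V e De"
  and z0: "!!x. x \<in> V ==> 0 <= z x" and bb: "!!x. x \<in> V ==> \<bar>b x\<bar> <= B" and B: "0 <= B"
  and e01: "!!x. x \<in> V ==> 0 <= e x & e x <= 1" and De: "!!x. x \<in> V ==> norm (De x) <= E" and delta: "0 < delta" and r: "0 < r"
  and G: "L1_on V G"
   "!!x t. x \<in> V ==> 0 <= t ==> t <= z x ==> t * ((t + delta) / r) powr b x <= G x"
   "!!x t. x \<in> V ==> 0 <= t ==> t <= z x ==> t * ((t + delta) / r) powr b x * \<bar>ln ((t + delta) / r)\<bar> * norm (Db x) <= G x"
   "!!x. x \<in> V ==> ((z x + delta) / r) powr b x * (1 + B) * norm (Dz x) <= G x"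
 shows "W11 V (%x. e x * (z x * ((z x + delta) / r) powr b x))
  (%x. (z x * ((z x + delta) / r) powr b x) *R De x
   + (e x * (((z x + delta) / r) powr b x * (1 + b x * z x / (z x + delta)))) *R Dz x
   + (e x * (z x * ((z x + delta) / r) powr b x * ln ((z x + delta) / r))) *R Db x)"
proof -
 define zM where "zM n x = min (z x) (real n)" for n x
 define DzM where "DzM n x = (if z x > real n then 0 else Dz x)" for n x
 define W where "W t x = ((t + delta) / r) powr b x" for t x
 define l where "l t = ln ((t + delta) / r)" for t
 have iz: "W11 V (zM n) (DzM n)" for n
 proof -
  have c: "W11 V (%x. 1) (%x. 0)" by (rule W11_C1[OF V, where B=1]) (simp_all add: C1_on_def)
  have 1: "W11 V (%x. 1 * z x + - real n * 1) (%x. 1 *R Dz x + - real n *R 0)" by (rule W11_linear[OF z c V])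
  have 2: "W11 V (%x. max 0 (1 * z x + - real n * 1)) (%x. if 1 * z x + - real n * 1 > 0 then 1 *R Dz x + - real n *R 0 else 0)"
   by (rule W11_max0[OF 1 V])
  have 3: "W11 V (%x. 1 * z x + -1 * max 0 (1 * z x + - real n * 1)) (%x. 1 *R Dz x + -1 *R (if 1 * z x + - real n * 1 > 0 then 1 *R Dz x + - real n *R 0 else 0))"
   by (rule W11_linear[OF z 2 V])
  show ?thesis by (rule W11_cong[OF 3]) (auto simp: zM_def DzM_def)
 qed
 have zMb: "0 <= zM n x" "zM n x <= real n" "zM n x <= z x" if "x \<in> V" for n x using z0[OF that] by (auto simp: zM_def)
 have prod: "W11 V (%x. e x * (zM n x * W (zM n x) x))
  (%x. (zM n x * W (zM n x) x) *R De x + (e x * (W (zM n x) x * (1 + b x * zM n x / (zM n x + delta)))) *R DzM n x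
   + (e x * (zM n x * W (zM n x) x * l (zM n x))) *R Db x)" for n
 proof -
  have c: "W11 V (%x. 1) (%x. 0)" by (rule W11_C1[OF V, where B=1]) (simp_all add: C1_on_def)
  have 1: "W11 V (%x. (1 / r) * zM n x + (delta / r) * 1) (%x. (1 / r) *R DzM n x + (delta / r) *R 0)" by (rule W11_linear[OF iz c V])
  define w where "w x = (1 / r) * zM n x + (delta / r) * 1" for x
  have w: "w x = (zM n x + delta) / r" for x unfolding w_def by (simp add: add_divide_distrib)
  have wb: "delta / r <= w x & w x <= (real n + delta) / r" if "x \<in> V" for x
   unfolding w using zMb[OF that, of n] r by (simp add: divide_right_mono)
  have dr: "0 < delta / r" "delta / r <= (real n + delta) / r" using delta r by (simp_all add: divide_right_mono)
  have 2: "W11 V (%x. w x powr b x) (%x. (b x * w x powr b x / w x) *R ((1 / r) *R DzM n x + (delta / r) *R 0) + (w x powr b x * ln (w x)) *R Db x)"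
   by (rule W11_powr[OF 1[folded w_def] b V dr wb bb B])
  define P where "P = max ((delta / r) powr B) ((delta / r) powr - B) + max (((real n + delta) / r) powr B) (((real n + delta) / r) powr - B)"
  have Wb: "\<bar>w x powr b x\<bar> <= P" if x: "x \<in> V" for x
  proof -
   have w0: "w x > 0" using wb[OF x] dr by linarith
   have bx: "- B <= b x" "b x <= B" using bb[OF x] by auto
   have nn: "0 <= max ((delta / r) powr B) ((delta / r) powr - B)" "0 <= max (((real n + delta) / r) powr B) (((real n + delta) / r) powr - B)" by (simp_all add: le_max_iff_disj)
   show ?thesis
   proof (cases "w x \<ge> 1")
    case True
    hence "w x powr b x <= w x powr B" using bx by (intro powr_mono) auto
    also have "... <= ((real n + delta) / r) powr B" using wb[OF x] w0 B by (intro powr_mono2) auto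
    finally have "w x powr b x <= P"
     using nn max.cobounded1[of "((real n + delta) / r) powr B" "((real n + delta) / r) powr - B"] unfolding P_def by linarith
    thus ?thesis by simp
   next
    case False
    hence "w x powr b x <= w x powr - B" using bx w0 by (intro powr_mono') auto
    also have "... <= (delta / r) powr - B" using wb[OF x] dr B by (intro powr_mono2') auto
    finally have "w x powr b x <= P"
     using nn max.cobounded2[of "(delta / r) powr - B" "(delta / r) powr B"]  max.commute[of "(delta / r) powr - B" "(delta / r) powr B"] unfolding P_def by linarith
    thus ?thesis by simp
   qed
  qed
  have P0: "0 <= P" unfolding P_def by (intro add_nonneg_nonneg) (simp_all add: le_max_iff_disj)
  have zb: "\<bar>zM n x\<bar> <= real n" if "x \<in> V" for x using zMb[OF that] by simp
  have 3: "W11 V (%x. zM n x * w x powr b x) (%x. (w x powr b x) *R DzM n x + zM n x *R ((b x * w x powr b x / w x) *R ((1 / r) *R DzM n x + (delta / r) *R 0) + (w x powr b x * ln (w x)) *R Db x))"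
   by (rule W11_mult[OF iz 2 V zb Wb _ P0]) simp_all
  have zWb: "\<bar>zM n x * w x powr b x\<bar> <= real n * P" if "x \<in> V" for x
   unfolding abs_mult by (intro mult_mono zb Wb that) simp_all
  have eb: "\<bar>e x\<bar> <= 1" if "x \<in> V" for x using e01[OF that] by simp
  have 4: "W11 V (%x. e x * (zM n x * w x powr b x)) (%x. (zM n x * w x powr b x) *R De x +
   e x *R ((w x powr b x) *R DzM n x + zM n x *R ((b x * w x powr b x / w x) *R ((1 / r) *R DzM n x + (delta / r) *R 0) + (w x powr b x * ln (w x)) *R Db x)))"
   by (rule W11_mult[OF e 3 V eb zWb]) (simp_all add: P0)
  show ?thesis
  proof (rule W11_cong[OF 4])
   fix x assume x: "x \<in> V"
   have W: "w x powr b x = W (zM n x) x" unfolding w W_def ..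
   have l: "ln (w x) = l (zM n x)" unfolding w l_def ..
   have wr: "w x * r = zM n x + delta" unfolding w using r by simp
   have "b x * w x powr b x / w x * (1 / r) = w x powr b x * (b x / (zM n x + delta))" unfolding wr[symmetric] by simp
   hence i: "zM n x * (b x * w x powr b x / w x * (1 / r)) = w x powr b x * (b x * zM n x / (zM n x + delta))" by simp
   show "e x * (zM n x * w x powr b x) = e x * (zM n x * W (zM n x) x)" unfolding W ..
   show "(zM n x * w x powr b x) *R De x +
   e x *R ((w x powr b x) *R DzM n x + zM n x *R ((b x * w x powr b x / w x) *R ((1 / r) *R DzM n x + (delta / r) *R 0) + (w x powr b x * ln (w x)) *R Db x))
   = (zM n x * W (zM n x) x) *R De x + (e x * (W (zM n x) x * (1 + b x * zM n x / (zM n x + delta)))) *R DzM n x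
   + (e x * (zM n x * W (zM n x) x * l (zM n x))) *R Db x"
   proof -
    have "zM n x *R ((b x * w x powr b x / w x) *R ((1 / r) *R DzM n x + (delta / r) *R 0)) = (w x powr b x * (b x * zM n x / (zM n x + delta))) *R DzM n x"
     unfolding scaleR_zero_right add_0_right scaleR_scaleR i[symmetric] ..
    thus ?thesis unfolding W[symmetric] l[symmetric]
     by (simp only: scaleR_add_right scaleR_scaleR) (simp add: algebra_simps)
   qed
  qed
 qed
 note mz = W11_integrable[OF z] and mb = W11_integrable[OF b] and me = W11_integrable[OF e]
 have [measurable]: "z \<in> bm_on V" "Dz \<in> bm_on V"
  "b \<in> bm_on V" "Db \<in> bm_on V"
  "e \<in> bm_on V" "De \<in> bm_on V"
  by (intro borel_measurable_integrable mz mb me)+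
 have spV: "x \<in> V" if "x \<in> space (lb_on V)" for x using that by (simp add: space_restrict_space)
 \<comment> \<open>At each point the truncation is inactive for large n, so every pointwise
   convergence below is eventual equality.\<close>
 have ev: "eventually (%n. zM n x = z x & DzM n x = Dz x) sequentially" for x
 proof -
  obtain N :: nat where "z x <= real N" using real_arch_simple by blast
  hence "\<forall>n\<ge>N. zM n x = z x & DzM n x = Dz x" by (auto simp: zM_def DzM_def)
  thus ?thesis unfolding eventually_sequentially by blast
 qed
 have main: "W11 V (%x. e x * (z x * W (z x) x))
  (%x. (z x * W (z x) x) *R De x + (e x * (W (z x) x * (1 + b x * z x / (z x + delta)))) *R Dz x
   + (e x * (z x * W (z x) x * l (z x))) *R Db x)"
 proof (rule W11_dominated_limit[OF prod, where w="%x. (\<bar>E\<bar> + 2) * \<bar>G x\<bar>"])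
  show "(%x. e x * (z x * W (z x) x)) \<in> bm_on V" unfolding W_def by measurable
  show "(%x. (z x * W (z x) x) *R De x + (e x * (W (z x) x * (1 + b x * z x / (z x + delta)))) *R Dz x
   + (e x * (z x * W (z x) x * l (z x))) *R Db x) \<in> bm_on V" unfolding W_def l_def by measurable
  show "L1_on V (%x. (\<bar>E\<bar> + 2) * \<bar>G x\<bar>)" by (intro integrable_mult_right integrable_abs G(1))
  show "AE x in lb_on V. (%n. e x * (zM n x * W (zM n x) x)) ~~> e x * (z x * W (z x) x)"
  proof (rule AE_I2, rule tendsto_eventually)
   fix x show "\<forall>\<^sub>F n in sequentially. e x * (zM n x * W (zM n x) x) = e x * (z x * W (z x) x)"
    by (rule eventually_mono[OF ev[of x]]) simp
  qed
  show "AE x in lb_on V. (%n. (zM n x * W (zM n x) x) *R De x + (e x * (W (zM n x) x * (1 + b x * zM n x / (zM n x + delta)))) *R DzM n x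
   + (e x * (zM n x * W (zM n x) x * l (zM n x))) *R Db x) ~~> (z x * W (z x) x) *R De x + (e x * (W (z x) x * (1 + b x * z x / (z x + delta)))) *R Dz x
   + (e x * (z x * W (z x) x * l (z x))) *R Db x"
  proof (rule AE_I2, rule tendsto_eventually)
   fix x show "\<forall>\<^sub>F n in sequentially. (zM n x * W (zM n x) x) *R De x + (e x * (W (zM n x) x * (1 + b x * zM n x / (zM n x + delta)))) *R DzM n x
   + (e x * (zM n x * W (zM n x) x * l (zM n x))) *R Db x = (z x * W (z x) x) *R De x + (e x * (W (z x) x * (1 + b x * z x / (z x + delta)))) *R Dz x
   + (e x * (z x * W (z x) x * l (z x))) *R Db x"
    by (rule eventually_mono[OF ev[of x]]) simp
  qed
  fix n
  have g1: "0 <= zM n x * W (zM n x) x" "zM n x * W (zM n x) x <= \<bar>G x\<bar>" if "x \<in> V" for x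
   using zMb[OF that, of n] order_trans[OF G(2)[OF that zMb(1)[OF that] zMb(3)[OF that, of n]] abs_ge_self] by (simp_all add: W_def)
  show "AE x in lb_on V. \<bar>e x * (zM n x * W (zM n x) x)\<bar> <= (\<bar>E\<bar> + 2) * \<bar>G x\<bar>"
  proof (rule AE_I2)
   fix x assume "x \<in> space (lb_on V)"
   note x = spV[OF this]
   have "\<bar>e x * (zM n x * W (zM n x) x)\<bar> <= 1 * \<bar>G x\<bar>" unfolding abs_mult[of "e x"]
    using g1[OF x] e01[OF x] by (intro mult_mono) auto
   also have "... <= (\<bar>E\<bar> + 2) * \<bar>G x\<bar>" by (intro mult_right_mono) auto
   finally show "\<bar>e x * (zM n x * W (zM n x) x)\<bar> <= (\<bar>E\<bar> + 2) * \<bar>G x\<bar>" .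
  qed
  show "AE x in lb_on V. norm ((zM n x * W (zM n x) x) *R De x + (e x * (W (zM n x) x * (1 + b x * zM n x / (zM n x + delta)))) *R DzM n x
   + (e x * (zM n x * W (zM n x) x * l (zM n x))) *R Db x) <= (\<bar>E\<bar> + 2) * \<bar>G x\<bar>"
  proof (rule AE_I2)
   fix x assume "x \<in> space (lb_on V)"
   note x = spV[OF this]
   have t1: "norm ((zM n x * W (zM n x) x) *R De x) <= \<bar>G x\<bar> * \<bar>E\<bar>"
    unfolding norm_scaleR using g1[OF x] De[OF x] by (intro mult_mono) auto
   have t2: "norm ((e x * (W (zM n x) x * (1 + b x * zM n x / (zM n x + delta)))) *R DzM n x) <= \<bar>G x\<bar>"
   proof (cases "z x > real n")
    case True thus ?thesis by (simp add: DzM_def)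
   next
    case False
    hence eq: "zM n x = z x" "DzM n x = Dz x" by (simp_all add: zM_def DzM_def)
    have q: "0 <= z x / (z x + delta)" "z x / (z x + delta) <= 1" using z0[OF x] delta by simp_all
    have "\<bar>b x * z x / (z x + delta)\<bar> = \<bar>b x\<bar> * (z x / (z x + delta))"
     unfolding times_divide_eq_right[symmetric] abs_mult abs_of_nonneg[OF q(1)] ..
    hence "\<bar>1 + b x * z x / (z x + delta)\<bar> <= 1 + \<bar>b x\<bar> * (z x / (z x + delta))"
     using abs_triangle_ineq[of 1 "b x * z x / (z x + delta)"] by simp
    also have "... <= 1 + B * 1" using q bb[OF x] B by (intro add_left_mono mult_mono) auto
    finally have "\<bar>1 + b x * z x / (z x + delta)\<bar> <= 1 + B" by simp
    hence "\<bar>e x\<bar> * (W (z x) x * \<bar>1 + b x * z x / (z x + delta)\<bar>) * norm (Dz x) <= 1 * (W (z x) x * (1 + B)) * norm (Dz x)"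
     using e01[OF x] by (intro mult_right_mono mult_mono) (auto simp: W_def)
    also have "... <= G x" using G(4)[OF x] by (simp add: W_def)
    finally show ?thesis unfolding eq norm_scaleR abs_mult by (simp add: W_def)
   qed
   have t3: "norm ((e x * (zM n x * W (zM n x) x * l (zM n x))) *R Db x) <= \<bar>G x\<bar>"
   proof -
    have "\<bar>e x\<bar> * (zM n x * W (zM n x) x * \<bar>l (zM n x)\<bar> * norm (Db x)) <= 1 * (zM n x * W (zM n x) x * \<bar>l (zM n x)\<bar> * norm (Db x))"
     using e01[OF x] g1(1)[OF x] by (intro mult_right_mono) auto
    also have "... <= G x" using G(3)[OF x zMb(1)[OF x] zMb(3)[OF x, of n]] by (simp add: W_def l_def)
    finally have "\<bar>e x\<bar> * (zM n x * W (zM n x) x * \<bar>l (zM n x)\<bar> * norm (Db x)) <= \<bar>G x\<bar>" by linarith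
    thus ?thesis
     unfolding norm_scaleR abs_mult[of "e x"] abs_mult[of "zM n x * W (zM n x) x"] abs_of_nonneg[OF g1(1)[OF x]]
     by (simp only: mult.assoc)
   qed
   show "norm ((zM n x * W (zM n x) x) *R De x + (e x * (W (zM n x) x * (1 + b x * zM n x / (zM n x + delta)))) *R DzM n x
   + (e x * (zM n x * W (zM n x) x * l (zM n x))) *R Db x) <= (\<bar>E\<bar> + 2) * \<bar>G x\<bar>"
    using norm_triangle_mono[OF norm_triangle_mono[OF t1 t2] t3] by (simp add: algebra_simps)
  qed
 qed
 thus ?thesis unfolding W_def l_def .
qed

text \<open>Homogeneity at work. Since the exponent b = gamma - p varies, \<open>Dphi\<close>
  contains -ln(w/r) \<open>Dp\<close>; together with ln |Du| this makes ln T. Multiplied out, |Du|^p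
  (w/r)^(gamma-p) becomes W T^p, so every term is expressed by W, T and the cutoff.
  \<open>sig\<close> records whether z increases or decreases with u.\<close>

lemma energy_pointwise:
 fixes Dz Deta Dp :: "'a::euclidean_space"
 assumes zw: "0 < z" "z <= w" and r: "0 < r" and eta: "0 <= eta" and L: "norm Dp <= L" and Dz: "Dz \<noteq> 0"
  and sig: "sig = 1 \<or> sig = (-1::real)" and Du: "Du = sig *R Dz" and b: "b = gamma - p"
  and T: "T = r * norm Dz / w" and W: "W = (w / r) powr gamma"
  and phi: "phi = eta ^ q * (z * (w / r) powr b)"
  and Dphi: "Dphi = (z * (w / r) powr b) *R ((real q * eta ^ (q - 1)) *R Deta)
   + (eta ^ q * ((w / r) powr b * (1 + b * z / w))) *R Dz
   + (eta ^ q * (z * (w / r) powr b * ln (w / r))) *R (- Dp)"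
 shows "\<bar>norm Du powr (p - 2) * (Du \<bullet> Dphi) + norm Du powr (p - 2) * ln (norm Du) * (Du \<bullet> Dp) * phi
   - sig * (1 + b * z / w) * (W * (eta ^ q * T powr p))\<bar>
  <= W * (real q * eta ^ (q - 1) * (r * norm Deta) * T powr (p - 1) + r * L * (eta ^ q * (T powr (p - 1) * \<bar>ln T\<bar>)))"
proof -
 define xi where "xi = norm Dz"
 have xi: "xi > 0" unfolding xi_def using Dz by simp
 have w: "w > 0" using zw by linarith
 define y where "y = w / r"
 have y: "y > 0" unfolding y_def using w r by simp
 have Ty: "T = xi / y" unfolding T y_def xi_def using w r by simp
 have T0: "T > 0" unfolding Ty using xi y by simp
 have xiT: "xi = T * y" unfolding Ty using y by simp
 have nDu: "norm Du = xi" unfolding Du xi_def using sig by auto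
 \<comment> \<open>This weight satisfies A |Dz|^2 = W T^p; one factor |Dz| fewer, with z in its
   place, costs at most W T^(p-1) r because z \<le> w.\<close>
 define A where "A = xi powr (p - 2) * y powr b"
 have A0: "A > 0" unfolding A_def using xi y by simp
 have A2: "A * xi\<^sup>2 = W * T powr p"
 proof -
  have "A * xi\<^sup>2 = (xi powr (p - 2) * xi powr 2) * y powr b" unfolding A_def using xi by simp
  also have "xi powr (p - 2) * xi powr 2 = xi powr p" by (simp add: powr_add[symmetric])
  also have "xi powr p = T powr p * y powr p" unfolding xiT using T0 y by (simp add: powr_mult)
  also have "(T powr p * y powr p) * y powr b = T powr p * y powr gamma" unfolding b by (simp add: powr_add[symmetric] mult.assoc)
  finally show ?thesis unfolding W y_def by simp
 qed
 have A1: "A * xi * z <= W * T powr (p - 1) * r"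
 proof -
  have "A * xi = A * xi\<^sup>2 / xi" using xi by (simp add: power2_eq_square)
  also have "... = W * (T powr p / xi)" unfolding A2 by simp
  also have "T powr p / xi = T powr (p - 1) / y" unfolding xiT using T0 y by (simp add: powr_diff)
  finally have e: "A * xi * z = W * T powr (p - 1) * (z / y)" by simp
  have "z / y <= r" unfolding y_def using zw w r by (simp add: divide_le_eq)
  moreover have "0 <= W * T powr (p - 1)" unfolding W by simp
  ultimately show ?thesis unfolding e by (rule mult_left_mono)
 qed
 have lnT: "ln T = ln xi - ln y" unfolding Ty using xi y by (simp add: ln_div)
 have eq: "norm Du powr (p - 2) * (Du \<bullet> Dphi) + norm Du powr (p - 2) * ln (norm Du) * (Du \<bullet> Dp) * phi
   - sig * (1 + b * z / w) * (W * (eta ^ q * T powr p))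
  = sig * ((A * z) * (real q * eta ^ (q - 1) * (Dz \<bullet> Deta) + eta ^ q * (ln T * (Dz \<bullet> Dp))))"
 proof -
  have 1: "Du \<bullet> Dphi = sig * (z * y powr b * (real q * eta ^ (q - 1)) * (Dz \<bullet> Deta) + eta ^ q * (y powr b * (1 + b * z / w)) * xi\<^sup>2 - eta ^ q * (z * y powr b * ln y) * (Dz \<bullet> Dp))"
   unfolding Du Dphi y_def[symmetric] xi_def by (simp add: inner_add_right dot_square_norm algebra_simps)
  have 2: "W * (eta ^ q * T powr p) = eta ^ q * (xi powr (p - 2) * y powr b * xi\<^sup>2)" using A2 unfolding A_def by simp
  have 3: "Du \<bullet> Dp = sig * (Dz \<bullet> Dp)" unfolding Du by simp
  show ?thesis unfolding nDu 1 2 3 phi y_def[symmetric] A_def lnT by (simp add: algebra_simps)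
 qed
 have i1: "\<bar>Dz \<bullet> Deta\<bar> <= xi * norm Deta" unfolding xi_def by (rule Cauchy_Schwarz_ineq2)
 have i2: "\<bar>Dz \<bullet> Dp\<bar> <= xi * L" using Cauchy_Schwarz_ineq2[of Dz Dp] mult_left_mono[OF L, of xi] xi unfolding xi_def by linarith
 have L0: "0 <= L" using L norm_ge_zero order_trans by blast
 have "\<bar>sig * ((A * z) * (real q * eta ^ (q - 1) * (Dz \<bullet> Deta) + eta ^ q * (ln T * (Dz \<bullet> Dp))))\<bar>
  = (A * z) * \<bar>real q * eta ^ (q - 1) * (Dz \<bullet> Deta) + eta ^ q * (ln T * (Dz \<bullet> Dp))\<bar>"
  using sig A0 zw by (auto simp: abs_mult)
 also have "... <= (A * z) * (real q * eta ^ (q - 1) * (xi * norm Deta) + eta ^ q * (\<bar>ln T\<bar> * (xi * L)))"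
 proof (rule mult_left_mono)
  have "\<bar>real q * eta ^ (q - 1) * (Dz \<bullet> Deta)\<bar> <= real q * eta ^ (q - 1) * (xi * norm Deta)"
   using i1 eta by (simp add: abs_mult mult_left_mono)
  moreover have "\<bar>eta ^ q * (ln T * (Dz \<bullet> Dp))\<bar> <= eta ^ q * (\<bar>ln T\<bar> * (xi * L))"
   using i2 eta by (simp add: abs_mult mult_left_mono)
  ultimately show "\<bar>real q * eta ^ (q - 1) * (Dz \<bullet> Deta) + eta ^ q * (ln T * (Dz \<bullet> Dp))\<bar> <= real q * eta ^ (q - 1) * (xi * norm Deta) + eta ^ q * (\<bar>ln T\<bar> * (xi * L))"
   by linarith
 qed (use A0 zw in simp)
 also have "... = (A * xi * z) * (real q * eta ^ (q - 1) * norm Deta + eta ^ q * (\<bar>ln T\<bar> * L))" by (simp add: algebra_simps)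
 also have "... <= (W * T powr (p - 1) * r) * (real q * eta ^ (q - 1) * norm Deta + eta ^ q * (\<bar>ln T\<bar> * L))"
  using eta L0 by (intro mult_right_mono A1 add_nonneg_nonneg) auto
 also have "... = W * (real q * eta ^ (q - 1) * (r * norm Deta) * T powr (p - 1) + r * L * (eta ^ q * (T powr (p - 1) * \<bar>ln T\<bar>)))"
  by (simp add: algebra_simps)
 finally show ?thesis unfolding eq .
qed

lemma powr_sum3_le:
 fixes a b c p pM :: real
 assumes "0 <= a" "0 <= b" "0 <= c" "0 <= p" "p <= pM"
 shows "(a + b + c) powr p <= 3 powr pM * (a powr p + b powr p + c powr p)"
proof -
 define m where "m = max a (max b c)"
 have m: "a <= m" "b <= m" "c <= m" "0 <= m" unfolding m_def using assms by auto
 have "(a + b + c) powr p <= (3 * m) powr p" using assms m by (intro powr_mono2) auto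
 also have "... = 3 powr p * m powr p" using m by (simp add: powr_mult)
 also have "... <= 3 powr pM * m powr p" using assms by (intro mult_right_mono powr_mono) auto
 also have "m powr p <= a powr p + b powr p + c powr p"
 proof -
  have "m = a \<or> m = b \<or> m = c" unfolding m_def by (auto simp: max_def)
  thus ?thesis by (elim disjE) simp_all
 qed
 finally show ?thesis by (simp add: mult_left_mono)
qed

lemma W11_const:
 assumes V: "open V" "emeasure lborel V < \<infinity>"
 shows "W11 V (%x. c) (%x. 0)"
 by (rule W11_C1[OF V, where B="\<bar>c\<bar>"]) (simp_all add: C1_on_def)

lemma ball_sets_lb_on:
 assumes "ball x b \<subseteq> V" "open V" shows "ball x b \<in> sets (lb_on V)"
 using assms unfolding sets_restrict_space by (auto simp: image_iff intro!: bexI[of _ "ball x b"])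

section \<open>Supersolutions and their Caccioppoli inequality\<close>

text \<open>The interface between the weak formulation and the estimates: Borel functions on the
  whole space, \<open>W11\<close> on balls whose closure lies in the domain, and test functions
  vanishing outside a smaller concentric ball. \<open>Dp\<close> is bounded everywhere rather than
  almost everywhere, which a change on a null set achieves. Instances are u, -u and their continuous
  representatives, with the same \<open>L\<close>, \<open>pm\<close> and \<open>pM\<close>.\<close>

locale supersol =
 fixes \<Omega> :: "(real^'n) set" and p u :: "real^'n => real" and Du Dp :: "real^'n => real^'n" and L pm pM :: real
 assumes open_dom: "open \<Omega>"
  and pm: "1 < pm" and p_bounds: "!!x. x \<in> \<Omega> ==> pm <= p x" "!!x. x \<in> \<Omega> ==> p x <= pM"
  and L: "0 <= L" and p_lipschitz: "!!x y. x \<in> \<Omega> ==> y \<in> \<Omega> ==> \<bar>p x - p y\<bar> <= L * norm (x - y)"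
  and Dp_le: "!!x. x \<in> \<Omega> ==> norm (Dp x) <= L"
  and meas: "p \<in> borel_measurable borel" "u \<in> borel_measurable borel" "Du \<in> borel_measurable borel" "Dp \<in> borel_measurable borel"
  and sobolev_u: "!!x R. 0 < R ==> cball x R \<subseteq> \<Omega> ==> W11 (ball x R) u Du"
  and sobolev_p: "!!x R. 0 < R ==> cball x R \<subseteq> \<Omega> ==> W11 (ball x R) p Dp"
  and integrable_u_powr: "!!x R. 0 < R ==> cball x R \<subseteq> \<Omega> ==> L1_on (ball x R) (%y. \<bar>u y\<bar> powr p y)"
  and integrable_Du_powr: "!!x R. 0 < R ==> cball x R \<subseteq> \<Omega> ==> L1_on (ball x R) (%y. norm (Du y) powr p y)"
  and supersolution: "!!x rho R phi Dphi. 0 < rho ==> rho < R ==> cball x R \<subseteq> \<Omega> ==> W11 (ball x R) phi Dphi ==>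
   (!!y. y \<in> ball x R ==> 0 <= phi y) ==> (!!y. y \<in> ball x R ==> y \<notin> ball x rho ==> phi y = 0 & Dphi y = 0) ==>
   L1_on (ball x R) (%y. \<bar>phi y\<bar> powr p y) ==> L1_on (ball x R) (%y. norm (Dphi y) powr p y) ==>
   0 <= (LINT y|lb_on (ball x R). (if Du y = 0 then 0 else norm (Du y) powr (p y - 2) * (Du y \<bullet> Dphi y)
     + norm (Du y) powr (p y - 2) * ln (norm (Du y)) * (Du y \<bullet> Dp y) * phi y))"
begin

definition energy :: "(real^'n => real) => (real^'n => real^'n) => real^'n => real" where
 "energy phi Dphi y = (if Du y = 0 then 0 else norm (Du y) powr (p y - 2) * (Du y \<bullet> Dphi y)
     + norm (Du y) powr (p y - 2) * ln (norm (Du y)) * (Du y \<bullet> Dp y) * phi y)"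

lemma energy_measurable:
 assumes "W11 V phi Dphi"
 shows "energy phi Dphi \<in> bm_on V"
proof -
 note i = W11_integrable[OF assms]
 have [measurable]: "phi \<in> bm_on V" "Dphi \<in> bm_on V"
  by (intro borel_measurable_integrable i)+
 have [measurable]: "p \<in> bm_on V" "Du \<in> bm_on V" "Dp \<in> bm_on V"
  by (rule measurable_restrict_space1, simp add: meas)+
 show ?thesis unfolding energy_def[abs_def] by measurable
qed

lemma lb_on_measurable [measurable]:
 "p \<in> bm_on V" "Du \<in> bm_on V" "Dp \<in> bm_on V" "u \<in> bm_on V"
 by (rule measurable_restrict_space1, simp add: meas)+

text \<open>Admissibility of test functions: whatever grows at most linearly in |u| and |Du|,
  gradient included, has an integrable p(x)-th power.\<close>

lemma integrable_powr_linear: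
 fixes f :: "real^'n => 'b::euclidean_space"
 assumes R: "0 < R" "cball x R \<subseteq> \<Omega>" and f: "f \<in> bm_on (ball x R)" and C: "0 <= C"
  and le: "!!y. y \<in> ball x R ==> norm (f y) <= C * (1 + \<bar>u y\<bar> + norm (Du y))"
 shows "L1_on (ball x R) (%y. norm (f y) powr p y)"
proof (rule bi_integrable_bound)
 show "L1_on (ball x R) (%y. (C + 1) powr pM * (3 powr pM * (1 + \<bar>u y\<bar> powr p y + norm (Du y) powr p y)))"
  by (intro integrable_mult_right bi_integrable_add integrable_u_powr integrable_Du_powr R integrable_lb_on_const open_ball emeasure_ball_less_top)
 note f [measurable]
 show "(%y. norm (f y) powr p y) \<in> bm_on (ball x R)" by measurable
 show "AE y in lb_on (ball x R). norm (norm (f y) powr p y) <= norm ((C + 1) powr pM * (3 powr pM * (1 + \<bar>u y\<bar> powr p y + norm (Du y) powr p y)))"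
 proof (rule AE_I2)
  fix y assume "y \<in> space (lb_on (ball x R))"
  hence y: "y \<in> ball x R" by (simp add: space_restrict_space)
  hence y\<Omega>: "y \<in> \<Omega>" using R(2) by auto
  have p: "0 <= p y" "p y <= pM" using p_bounds[OF y\<Omega>] pm by auto
  have "norm (f y) powr p y <= ((C + 1) * (1 + \<bar>u y\<bar> + norm (Du y))) powr p y"
  proof (rule powr_mono2[OF p(1)])
   show "norm (f y) <= (C + 1) * (1 + \<bar>u y\<bar> + norm (Du y))"
    using le[OF y] mult_right_mono[of C "C + 1" "1 + \<bar>u y\<bar> + norm (Du y)"] by simp
  qed simp
  also have "... = (C + 1) powr p y * (1 + \<bar>u y\<bar> + norm (Du y)) powr p y" by (rule powr_mult)
  also have "... <= (C + 1) powr pM * (3 powr pM * (1 powr p y + \<bar>u y\<bar> powr p y + norm (Du y) powr p y))"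
   using C p by (intro mult_mono powr_mono powr_sum3_le) auto
  finally show "norm (norm (f y) powr p y) <= norm ((C + 1) powr pM * (3 powr pM * (1 + \<bar>u y\<bar> powr p y + norm (Du y) powr p y)))"
   by simp
 qed
qed

text \<open>The test function is eta^q z (w/r)^(gamma - p) with w = z + delta. Hypothesis
  \<open>kappa\<close> fixes the sign of the main term. It serves two purposes: z = (k - u)_+ with
  \<open>sig = -1\<close> and gamma just below p, and z a shift of the truncated u with
  \<open>sig = 1\<close> and gamma = 0. The numbers \<open>s\<close> and \<open>delta\<close> make
  the test function admissible and do not enter the constant of the estimate.\<close>

lemma caccioppoli:
 fixes x0 :: "real^'n" and q :: nat and r b s gamma sig delta A c X X0 C2 :: real
 defines "V \<equiv> ball x0 (4 * r)"
 assumes r: "0 < r" "r <= 1" and sub: "cball x0 (4 * r) \<subseteq> \<Omega>" and b: "0 < b" "b < 4 * r"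
  and gamma: "0 <= gamma" and s: "0 < s" and ps: "!!x. x \<in> V ==> s <= p x - gamma" and delta: "0 < delta" and sig: "sig = 1 \<or> sig = -1"
  and sz: "W11 V z Dz" and z0: "!!x. 0 <= z x" and A: "0 <= A" and zA: "!!x. z x <= A * (1 + \<bar>u x\<bar>)"
  and Dzu: "!!x. norm (Dz x) <= norm (Du x)"
  and zD: "AE x in lb_on V. if 0 < z x then Du x = sig *R Dz x else Dz x = 0"
  and etaD: "!!x. (eta has_derivative (%h. Deta x \<bullet> h)) (at x)" "continuous_on UNIV Deta" and eta: "!!x. 0 <= eta x" "!!x. eta x <= 1"
  and eta0: "!!x. x \<notin> ball x0 b ==> eta x = 0" "!!x. x \<notin> ball x0 b ==> Deta x = 0" and X0: "!!x. r * norm (Deta x) <= X0"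
  and q: "\<bar>pM\<bar> <= real q" "2 <= q" and c: "0 < c" and X: "1 <= X" "real q * X0 <= c * X"
  and C2: "0 <= C2" "!!p' T. pm <= p' ==> p' <= pM ==> 0 <= T ==> L * (T powr (p' - 1) * \<bar>ln T\<bar>) <= c * T powr p' + C2"
  and kappa: "!!x. x \<in> V ==> 4 * c <= - sig * (1 + (gamma - p x) * z x / (z x + delta))"
 shows "W11 V (%x. eta x ^ q) (%x. (real q * eta x ^ (q - 1)) *R Deta x)" (is ?C1)
  and "L1_on V (%x. ((z x + delta) / r) powr gamma)" (is ?C2)
  and "L1_on V (%x. ((z x + delta) / r) powr gamma * (r * norm (Dz x) / (z x + delta)) powr p x)" (is ?C3)
  and "2 * c * (LINT x|lb_on V. ((z x + delta) / r) powr gamma * (eta x ^ q * (r * norm (Dz x) / (z x + delta)) powr p x))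
   <= (c * X powr pM + C2) * (LINT x|lb_on V. indicator {x \<in> ball x0 b. 0 < z x} x * ((z x + delta) / r) powr gamma)" (is ?C4)
proof -
 have V: "open V" "emeasure lborel V < \<infinity>" unfolding V_def by (rule open_ball) (rule emeasure_ball_less_top)
 have R: "0 < 4 * r" using r by simp
 have V\<Omega>: "x \<in> \<Omega>" if "x \<in> V" for x using that sub unfolding V_def by auto
 have spV: "x \<in> V" if "x \<in> space (lb_on V)" for x using that by (simp add: space_restrict_space)
 have ballV: "ball x0 b \<subseteq> V" unfolding V_def using b by (auto intro!: subset_ball)
 have pV: "pm <= p x" "p x <= pM" if "x \<in> V" for x using p_bounds[OF V\<Omega>[OF that]] by auto
 have pM1: "1 < pM" using pV[of x0] R pm unfolding V_def by simp
 have pM0: "0 <= pM" using pM1 by simp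
 define e where "e x = eta x ^ q" for x
 define De where "De x = (real q * eta x ^ (q - 1)) *R Deta x" for x
 have eD: "(e has_derivative (%h. De x \<bullet> h)) (at x)" for x
  unfolding e_def[abs_def] De_def using has_derivative_power[OF etaD(1)[of x], of q] by (simp add: mult.assoc mult.commute mult.left_commute)
 have ceta: "continuous_on UNIV eta" by (intro continuous_at_imp_continuous_on ballI has_derivative_continuous[OF etaD(1)])
 have cDe: "continuous_on UNIV De" unfolding De_def[abs_def] by (intro continuous_intros ceta etaD(2))
 have e01: "0 <= e x & e x <= 1" for x unfolding e_def using eta by (simp add: power_le_one)
 define E where "E = real q * (X0 / r)"
 have nDe: "norm (De x) <= E" for x
 proof -
  have "norm (De x) = (real q * eta x ^ (q - 1)) * norm (Deta x)" unfolding De_def using eta by simp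
  also have "... <= (real q * 1) * (X0 / r)" using eta X0[of x] r
   by (intro mult_mono power_le_one) (auto simp: le_divide_eq mult.commute)
  finally show ?thesis unfolding E_def by simp
 qed
 have E0: "0 <= E" using nDe[of x0] norm_ge_zero[of "De x0"] by linarith
 have se: "W11 V e De"
 proof (rule W11_C1[OF V, where B="max 1 E"])
  show "C1_on V e De" unfolding C1_on_def using eD cDe continuous_on_subset by blast
  show "\<bar>e x\<bar> <= max 1 E" for x using e01[of x] by (simp add: le_max_iff_disj)
  show "norm (De x) <= max 1 E" for x using nDe[of x] unfolding le_max_iff_disj by blast
 qed
 thus ?C1 unfolding e_def[abs_def] De_def[abs_def] .
 note su = sobolev_u[OF R sub, folded V_def] and sp = sobolev_p[OF R sub, folded V_def]
 define bb where "bb x = gamma - p x" for x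
 have sb: "W11 V bb (%x. - Dp x)"
  by (rule W11_cong[OF W11_linear[OF sp W11_const[OF V, of 1] V, of "-1" gamma]]) (auto simp: bb_def)
 have bbr: "- pM <= bb x" "bb x <= - s" "\<bar>bb x\<bar> <= pM" if "x \<in> V" for x using ps[OF that] s gamma pV[OF that] unfolding bb_def by auto
 define w where "w x = z x + delta" for x
 have w: "w x > 0" "z x <= w x" for x unfolding w_def using z0[of x] delta by auto
 have rd: "0 < r / delta" using r delta by simp
 define Q where "Q = (1 + r / delta) powr pM"
 define CW where "CW = 1 / s + Q * (1 + r / delta) + 1"
 have Q: "1 <= Q" unfolding Q_def using rd pM1 by (intro ge_one_powr_ge_zero) auto
 have CW: "1 <= CW" "Q <= CW" "1 / s <= CW" "Q * (1 + r / delta) <= CW"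
 proof -
  have a: "0 <= 1 / s" "0 <= Q * (1 + r / delta)" "Q * 1 <= Q * (1 + r / delta)" using s Q rd by (auto intro!: mult_left_mono)
  thus "1 <= CW" "Q <= CW" "1 / s <= CW" "Q * (1 + r / delta) <= CW" unfolding CW_def by linarith+
 qed
 \<comment> \<open>The exponent lies in [-pM, -s] and the base is at least delta / r. This bounds
   the weight and also the weight times the logarithm, so the test function and its gradient grow at
   most linearly.\<close>
 have Wb: "((t + delta) / r) powr bb x <= CW & ((t + delta) / r) powr bb x * \<bar>ln ((t + delta) / r)\<bar> <= CW" if x: "x \<in> V" and t: "0 <= t" for x t
 proof -
  define y where "y = (t + delta) / r"
  have y0: "0 < y" unfolding y_def using t delta r by simp
  have iy: "1 / y <= 1 + r / delta"
  proof -
   have "r / (t + delta) <= r / delta" using t delta r by (intro divide_left_mono) auto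
   thus ?thesis unfolding y_def by simp
  qed
  show ?thesis unfolding y_def[symmetric]
  proof (cases "1 <= y")
   case True
   have "y powr bb x <= y powr 0" using True bbr[OF x] s by (intro powr_mono) auto
   hence a: "y powr bb x <= 1" using y0 by simp
   have "y powr bb x * \<bar>ln y\<bar> <= y powr (- s) * \<bar>ln y\<bar>" using True bbr[OF x] by (intro mult_right_mono powr_mono) auto
   also have "... = (1 / y) powr s * \<bar>ln (1 / y)\<bar>" using y0 by (simp add: powr_minus_divide powr_divide ln_div)
   also have "... <= 1 / s" using True y0 s by (intro powr_log_small) auto
   finally show "y powr bb x <= CW & y powr bb x * \<bar>ln y\<bar> <= CW" using a CW by linarith
  next
   case False
   have "y powr bb x <= y powr (- pM)" using False y0 bbr[OF x] by (intro powr_mono') auto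
   also have "... = (1 / y) powr pM" using y0 by (simp add: powr_minus_divide powr_divide)
   also have "... <= Q" unfolding Q_def using iy y0 pM1 by (intro powr_mono2) auto
   finally have a: "y powr bb x <= Q" .
   have "\<bar>ln y\<bar> <= 1 / y" using False y0 ln_le_minus_one[of "1 / y"] by (simp add: ln_div)
   hence "y powr bb x * \<bar>ln y\<bar> <= Q * (1 + r / delta)" using a iy Q by (intro mult_mono) auto
   thus "y powr bb x <= CW & y powr bb x * \<bar>ln y\<bar> <= CW" using a CW by linarith
  qed
 qed
 define Y where "Y x = 1 + \<bar>u x\<bar> + norm (Du x)" for x
 define CG where "CG = A * CW + A * CW * L + CW * (1 + pM)"
 define G where "G x = CG * Y x" for x
 have Y: "1 <= Y x" "norm (Du x) <= Y x" "z x <= A * Y x" for x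
 proof -
  show "1 <= Y x" "norm (Du x) <= Y x" unfolding Y_def by simp_all
  have "A * (1 + \<bar>u x\<bar>) <= A * Y x" unfolding Y_def using A by (intro mult_left_mono) auto
  thus "z x <= A * Y x" using zA[of x] by linarith
 qed
 have iG: "L1_on V G" unfolding G_def[abs_def] Y_def
  by (intro integrable_mult_right bi_integrable_add integrable_lb_on_const V integrable_abs integrable_norm W11_integrable[OF su])
 have CGp: "0 <= A * CW" "0 <= A * CW * L" "0 <= CW * (1 + pM)" using A CW L pM1 by simp_all
 have CG0: "0 <= CG" unfolding CG_def using CGp by linarith
 have zG: "z x * CW <= G x" "z x * CW * L <= G x" "CW * (1 + pM) * norm (Du x) <= G x" for x
 proof -
  have a: "A * CW * Y x <= G x" "A * CW * L * Y x <= G x" "CW * (1 + pM) * Y x <= G x"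
   unfolding G_def CG_def using CGp Y(1)[of x] by (intro mult_right_mono; linarith)+
  have b: "z x * CW <= A * Y x * CW" by (rule mult_right_mono[OF Y(3)]) (use CW in simp)
  hence "z x * CW * L <= A * Y x * CW * L" by (rule mult_right_mono[OF _ L])
  moreover have "CW * (1 + pM) * norm (Du x) <= CW * (1 + pM) * Y x" by (rule mult_left_mono[OF Y(2) CGp(3)])
  ultimately show "z x * CW <= G x" "z x * CW * L <= G x" "CW * (1 + pM) * norm (Du x) <= G x" using a b by (simp_all add: mult.assoc mult.commute mult.left_commute)
 qed
 \<comment> \<open>The factor z makes the test function vanish off {z > 0}; the shift by delta keeps
   the base of the variable power positive.\<close>
 define phi where "phi x = e x * (z x * (w x / r) powr bb x)" for x
 define Dphi where "Dphi x = (z x * (w x / r) powr bb x) *R De x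
  + (e x * ((w x / r) powr bb x * (1 + bb x * z x / w x))) *R Dz x
  + (e x * (z x * (w x / r) powr bb x * ln (w x / r))) *R (- Dp x)" for x
 have sphi: "W11 V phi Dphi"
  unfolding phi_def[abs_def] Dphi_def[abs_def] w_def[abs_def]
 proof (rule W11_shifted_product_powr[OF V sz sb se z0 bbr(3) pM0 e01 nDe delta r(1) iG])
  show "t * ((t + delta) / r) powr bb x <= G x" if "x \<in> V" "0 <= t" "t <= z x" for x t
   using mult_mono[OF that(3) conjunct1[OF Wb[OF that(1,2)]] z0 powr_ge_zero] zG(1)[of x] by linarith
  show "t * ((t + delta) / r) powr bb x * \<bar>ln ((t + delta) / r)\<bar> * norm (- Dp x) <= G x" if "x \<in> V" "0 <= t" "t <= z x" for x t
  proof -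
   have "t * (((t + delta) / r) powr bb x * \<bar>ln ((t + delta) / r)\<bar>) * norm (- Dp x) <= z x * CW * L"
    using that Wb[OF that(1,2)] CW z0 Dp_le[OF V\<Omega>[OF that(1)]] by (intro mult_mono) auto
   thus ?thesis using zG(2)[of x] by (simp add: mult.assoc)
  qed
  show "((z x + delta) / r) powr bb x * (1 + pM) * norm (Dz x) <= G x" if "x \<in> V" for x
  proof -
   have "((z x + delta) / r) powr bb x * (1 + pM) * norm (Dz x) <= CW * (1 + pM) * norm (Du x)"
    using Wb[OF that z0[of x]] Dzu[of x] CW pM1 by (intro mult_mono) auto
   thus ?thesis using zG(3)[of x] by linarith
  qed
 qed
 have phi0: "0 <= phi x" for x unfolding phi_def using e01 z0 by simp
 have off: "e x = 0 & De x = 0" if "x \<notin> ball x0 b" for x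
  unfolding e_def De_def using eta0[OF that] q(2) by simp
 have zw: "0 <= z x / w x" "z x / w x <= 1" for x using w[of x] z0[of x] by simp_all
 have kappaabs: "\<bar>1 + bb x * z x / w x\<bar> <= 1 + pM" if x: "x \<in> V" for x
 proof -
  have "\<bar>bb x * (z x / w x)\<bar> <= pM * 1" unfolding abs_mult using bbr(3)[OF x] zw[of x] pM1 by (intro mult_mono) auto
  thus ?thesis unfolding times_divide_eq_right by linarith
 qed
 have W1: "(w x / r) powr bb x <= CW" "(w x / r) powr bb x * \<bar>ln (w x / r)\<bar> <= CW" if "x \<in> V" for x
  unfolding w_def using Wb[OF that z0] by auto
 have zW: "z x * (w x / r) powr bb x <= G x" if "x \<in> V" for x
  using mult_left_mono[OF W1(1)[OF that] z0[of x]] zG(1)[of x] by linarith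
 have G0: "0 <= G x" for x unfolding G_def using CG0 Y(1)[of x] by simp
 have phiG: "phi x <= G x" if "x \<in> V" for x
 proof -
  have "e x * (z x * (w x / r) powr bb x) <= 1 * G x" by (rule mult_mono[OF _ zW[OF that]]) (use e01[of x] z0[of x] in auto)
  thus ?thesis unfolding phi_def by simp
 qed
 have DphiG: "norm (Dphi x) <= (E + 2) * G x" if x: "x \<in> V" for x
 proof -
  have t1: "norm ((z x * (w x / r) powr bb x) *R De x) <= G x * E"
   unfolding norm_scaleR using zW[OF x] z0[of x] nDe G0 by (intro mult_mono) auto
  have t2: "norm ((e x * ((w x / r) powr bb x * (1 + bb x * z x / w x))) *R Dz x) <= G x"
  proof -
   have "\<bar>e x\<bar> * ((w x / r) powr bb x * \<bar>1 + bb x * z x / w x\<bar>) * norm (Dz x) <= 1 * (CW * (1 + pM)) * norm (Du x)"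
    by (intro mult_mono W1(1)[OF x] kappaabs[OF x] Dzu) (use e01[of x] CW pM1 in auto)
   thus ?thesis unfolding norm_scaleR abs_mult using zG(3)[of x] by simp
  qed
  have t3: "norm ((e x * (z x * (w x / r) powr bb x * ln (w x / r))) *R (- Dp x)) <= G x"
  proof -
   have "\<bar>e x\<bar> * (z x * ((w x / r) powr bb x * \<bar>ln (w x / r)\<bar>)) * norm (- Dp x) <= 1 * (z x * CW) * L"
    using e01[of x] W1[OF x] Dp_le[OF V\<Omega>[OF x]] CW z0[of x] by (intro mult_mono) auto
   thus ?thesis unfolding norm_scaleR abs_mult using zG(2)[of x] z0[of x] by (simp add: mult.assoc)
  qed
  show ?thesis unfolding Dphi_def using norm_triangle_mono[OF norm_triangle_mono[OF t1 t2] t3] by (simp add: algebra_simps)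
 qed
 have mphi: "phi \<in> bm_on V" "Dphi \<in> bm_on V"
  by (intro borel_measurable_integrable W11_integrable[OF sphi])+
 have iphip: "L1_on V (%y. \<bar>phi y\<bar> powr p y)"
  using integrable_powr_linear[OF R sub mphi(1)[unfolded V_def] CG0] phiG phi0 unfolding V_def G_def Y_def by simp
 have iDphip: "L1_on V (%y. norm (Dphi y) powr p y)"
  unfolding V_def
 proof (rule integrable_powr_linear[OF R sub mphi(2)[unfolded V_def], where C="(E + 2) * CG"])
  show "norm (Dphi y) <= (E + 2) * CG * (1 + \<bar>u y\<bar> + norm (Du y))" if "y \<in> ball x0 (4 * r)" for y
   using DphiG[of y] that unfolding V_def G_def Y_def by (simp add: mult.assoc)
 qed (use E0 CG0 in simp)
 have E0: "0 <= (LINT y|lb_on V. energy phi Dphi y)"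
  unfolding energy_def V_def
 proof (rule supersolution[OF b sub sphi[unfolded V_def] phi0 _ iphip[unfolded V_def] iDphip[unfolded V_def]])
  show "phi y = 0 & Dphi y = 0" if "y \<notin> ball x0 b" for y
   unfolding phi_def Dphi_def using off[OF that] by simp
 qed
 define T where "T x = r * norm (Dz x) / w x" for x
 define Wg where "Wg x = (w x / r) powr gamma" for x
 define P where "P x = Wg x * (e x * T x powr p x)" for x
 define S where "S = {x \<in> ball x0 b. 0 < z x}"
 have mzw [measurable]: "z \<in> bm_on V" "Dz \<in> bm_on V" "e \<in> bm_on V"
  by (intro borel_measurable_integrable W11_integrable[OF sz] W11_integrable[OF se])+
 have S: "S \<in> sets (lb_on V)"
 proof -
  have "S = ball x0 b \<inter> {x \<in> space (lb_on V). 0 < z x}" unfolding S_def using ballV by (auto simp: space_restrict_space)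
  moreover have "{x \<in> space (lb_on V). 0 < z x} \<in> sets (lb_on V)" by measurable
  ultimately show ?thesis using ball_sets_lb_on[OF ballV V(1)] by simp
 qed
 have T0: "0 <= T x" for x unfolding T_def using r w[of x] by simp
 have Wg0: "0 <= Wg x" for x unfolding Wg_def by simp
 have P0: "0 <= P x" for x unfolding P_def using Wg0 e01 by simp
 have iWg: "L1_on V Wg"
 proof (rule bi_integrable_bound)
  have "L1_on V (%x. norm (w x / r) powr p x)" unfolding V_def
  proof (rule integrable_powr_linear[OF R sub, where C="(A + delta) / r"])
   show "(%x. w x / r) \<in> bm_on (ball x0 (4 * r))" unfolding w_def V_def[symmetric] by measurable
   show "norm (w y / r) <= (A + delta) / r * (1 + \<bar>u y\<bar> + norm (Du y))" for y
   proof -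
    have "delta * 1 <= delta * Y y" using delta Y(1)[of y] by (intro mult_left_mono) auto
    hence "w y <= (A + delta) * Y y" unfolding w_def using Y(3)[of y] by (simp add: distrib_right)
    hence "w y / r <= (A + delta) * Y y / r" using r by (intro divide_right_mono) auto
    thus ?thesis unfolding Y_def using w[of y] r by simp
   qed
  qed (use r delta A in simp)
  thus "L1_on V (%x. 1 + norm (w x / r) powr p x)"
   by (intro bi_integrable_add integrable_lb_on_const V)
  show "Wg \<in> bm_on V" unfolding Wg_def[abs_def] w_def by measurable
  show "AE x in lb_on V. norm (Wg x) <= norm (1 + norm (w x / r) powr p x)"
  proof (rule AE_I2)
   fix x assume "x \<in> space (lb_on V)"
   note x = spV[OF this]
   have wr0: "0 < w x / r" using w[of x] r by simp
   have "Wg x <= 1 + (w x / r) powr p x"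
   proof (cases "1 <= w x / r")
    case True
    hence "Wg x <= (w x / r) powr p x" unfolding Wg_def using ps[OF x] s by (intro powr_mono) auto
    thus ?thesis by simp
   next
    case False
    hence "Wg x <= 1" unfolding Wg_def using gamma wr0 by (intro powr_le1) auto
    thus ?thesis by (simp add: add_increasing2)
   qed
   thus "norm (Wg x) <= norm (1 + norm (w x / r) powr p x)" unfolding real_norm_def abs_of_pos[OF wr0] using Wg0[of x] by simp
  qed
 qed
 thus ?C2 unfolding Wg_def[abs_def] w_def .
 have WT: "Wg x * T x powr p x = (w x / r) powr bb x * norm (Dz x) powr p x" for x
 proof -
  have tx: "T x = norm (Dz x) / (w x / r)" unfolding T_def using r w[of x] by simp
  have "T x powr p x = norm (Dz x) powr p x / (w x / r) powr p x" unfolding tx by (rule powr_divide; insert r w[of x], simp)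
  thus ?thesis unfolding Wg_def bb_def using r w[of x] by (simp add: powr_diff)
 qed
 have iWT: "L1_on V (%x. Wg x * T x powr p x)"
 proof (rule bi_integrable_bound)
  show "L1_on V (%x. CW * norm (Du x) powr p x)" unfolding V_def
   by (intro integrable_mult_right integrable_Du_powr R sub)
  show "(%x. Wg x * T x powr p x) \<in> bm_on V" unfolding Wg_def T_def w_def by measurable
  show "AE x in lb_on V. norm (Wg x * T x powr p x) <= norm (CW * norm (Du x) powr p x)"
  proof (rule AE_I2)
   fix x assume "x \<in> space (lb_on V)"
   note x = spV[OF this]
   have "(w x / r) powr bb x * norm (Dz x) powr p x <= CW * norm (Du x) powr p x"
    using Dzu[of x] CW pV[OF x] pm W1(1)[OF x] by (intro mult_mono powr_mono2) auto
   thus "norm (Wg x * T x powr p x) <= norm (CW * norm (Du x) powr p x)" unfolding WT using CW by simp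
  qed
 qed
 thus ?C3 unfolding Wg_def T_def w_def .
 have iP: "L1_on V P"
 proof (rule bi_integrable_bound[OF iWT])
  show "P \<in> bm_on V" unfolding P_def[abs_def] Wg_def T_def w_def by measurable
  show "AE x in lb_on V. norm (P x) <= norm (Wg x * T x powr p x)"
  proof (rule AE_I2)
   fix x
   have "Wg x * (e x * T x powr p x) <= Wg x * (1 * T x powr p x)" using e01[of x] Wg0[of x] by (intro mult_left_mono mult_right_mono) auto
   thus "norm (P x) <= norm (Wg x * T x powr p x)" using P0[of x] Wg0[of x] unfolding P_def by simp
  qed
 qed
 have iJ: "L1_on V (%x. indicator S x * Wg x)" using integrable_mult_indicator[OF S iWg] by simp
 define C1 where "C1 = c * X powr pM + C2"
 have C1: "0 <= C1" unfolding C1_def using C2(1) c by simp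
 \<comment> \<open>The cutoff and the logarithm each cost c P plus a constant times the weight.
   Against the 4c in \<open>kappa\<close> this leaves 2c P.\<close>
 have Ept: "\<bar>energy phi Dphi x - sig * (1 + bb x * z x / w x) * P x\<bar> <= 2 * c * P x + C1 * (indicator S x * Wg x)"
  if x: "x \<in> V" and D: "if 0 < z x then Du x = sig *R Dz x else Dz x = 0" for x
 proof (cases "x \<in> S & Du x \<noteq> 0")
  case False
  have "energy phi Dphi x = 0 & P x = 0"
  proof (cases "x \<in> ball x0 b & 0 < z x")
   case True
   hence "Du x = 0" using False unfolding S_def by blast
   moreover have "Dz x = 0" using D True sig \<open>Du x = 0\<close> by auto
   ultimately show ?thesis unfolding energy_def P_def T_def by simp
  next
   case nS: False
   have "phi x = 0 & Dphi x = 0 & P x = 0"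
   proof (cases "x \<in> ball x0 b")
    case True
    hence "z x = 0 & Dz x = 0" using nS D z0[of x] by auto
    thus ?thesis unfolding phi_def Dphi_def P_def T_def by simp
   next
    case False
    thus ?thesis unfolding phi_def Dphi_def P_def using off[OF False] by simp
   qed
   thus ?thesis unfolding energy_def by simp
  qed
  thus ?thesis using C1 Wg0[of x] by simp
 next
  case True
  hence xS: "x \<in> S" and Dux: "Du x \<noteq> 0" by auto
  have zx: "0 < z x" using xS unfolding S_def by simp
  have Dzx: "Du x = sig *R Dz x" using D zx by simp
  have Dz0: "Dz x \<noteq> 0" using Dux Dzx by auto
  have E1: "\<bar>norm (Du x) powr (p x - 2) * (Du x \<bullet> Dphi x) + norm (Du x) powr (p x - 2) * ln (norm (Du x)) * (Du x \<bullet> Dp x) * phi x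
   - sig * (1 + bb x * z x / w x) * (Wg x * (eta x ^ q * T x powr p x))\<bar>
   <= Wg x * (real q * eta x ^ (q - 1) * (r * norm (Deta x)) * T x powr (p x - 1) + r * L * (eta x ^ q * (T x powr (p x - 1) * \<bar>ln (T x)\<bar>)))"
   by (rule energy_pointwise[OF zx w(2) r(1) eta(1) Dp_le[OF V\<Omega>[OF x]] Dz0 sig Dzx bb_def T_def Wg_def])
    (simp_all only: phi_def Dphi_def e_def De_def)
  have 1: "\<bar>energy phi Dphi x - sig * (1 + bb x * z x / w x) * P x\<bar>
   <= Wg x * (real q * eta x ^ (q - 1) * (r * norm (Deta x)) * T x powr (p x - 1) + r * L * (eta x ^ q * (T x powr (p x - 1) * \<bar>ln (T x)\<bar>)))"
   using E1 unfolding energy_def P_def e_def by (simp only: Dux if_False)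
  have p1: "1 <= p x" using pV[OF x] pm by linarith
  have pq: "p x <= real q" using pV[OF x] q by linarith
  have 2: "real q * eta x ^ (q - 1) * (r * norm (Deta x)) * T x powr (p x - 1) <= c * (eta x ^ q * T x powr p x) + c * X powr pM"
  proof (rule cutoff_power_absorb[OF eta(1,2) T0 p1 pV(2)[OF x] pq q(2) _ _ X(1) c])
   show "0 <= r * norm (Deta x)" using r by simp
   have "real q * (r * norm (Deta x)) <= real q * X0" using X0[of x] by (intro mult_left_mono) auto
   thus "real q * (r * norm (Deta x)) <= c * X" using X(2) by linarith
  qed
  have 3: "r * L * (eta x ^ q * (T x powr (p x - 1) * \<bar>ln (T x)\<bar>)) <= c * (eta x ^ q * T x powr p x) + C2"
  proof -
   have "r * L * (eta x ^ q * (T x powr (p x - 1) * \<bar>ln (T x)\<bar>)) <= 1 * L * (eta x ^ q * (T x powr (p x - 1) * \<bar>ln (T x)\<bar>))"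
    using r L eta by (intro mult_right_mono) auto
   also have "... = eta x ^ q * (L * (T x powr (p x - 1) * \<bar>ln (T x)\<bar>))" by simp
   also have "... <= eta x ^ q * (c * T x powr p x + C2)"
    using eta C2(2)[OF pV(1)[OF x] pV(2)[OF x] T0] by (intro mult_left_mono) auto
   also have "... <= c * (eta x ^ q * T x powr p x) + C2"
    using mult_right_mono[of "eta x ^ q" 1 C2] eta C2(1) by (simp add: power_le_one distrib_left mult.left_commute)
   finally show ?thesis .
  qed
  have "Wg x * (real q * eta x ^ (q - 1) * (r * norm (Deta x)) * T x powr (p x - 1) + r * L * (eta x ^ q * (T x powr (p x - 1) * \<bar>ln (T x)\<bar>)))
   <= Wg x * (2 * c * (eta x ^ q * T x powr p x) + C1)"
   using 2 3 unfolding C1_def by (intro mult_left_mono Wg0) linarith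
  also have "... = 2 * c * P x + C1 * (indicator S x * Wg x)" unfolding P_def e_def using xS by (simp add: algebra_simps)
  finally show ?thesis using 1 by linarith
 qed
 have sig1: "\<bar>sig\<bar> = 1" using sig by auto
 have tri: "\<bar>a\<bar> <= s + t" if "\<bar>a - b\<bar> <= t" "\<bar>b\<bar> <= s" for a b s t :: real using that by linarith
 have iE: "L1_on V (energy phi Dphi)"
 proof (rule bi_integrable_bound)
  show "L1_on V (%x. (1 + pM + 2 * c) * P x + C1 * (indicator S x * Wg x))"
   by (intro bi_integrable_add integrable_mult_right iP iJ)
  show "energy phi Dphi \<in> bm_on V" by (rule energy_measurable[OF sphi])
  show "AE x in lb_on V. norm (energy phi Dphi x) <= norm ((1 + pM + 2 * c) * P x + C1 * (indicator S x * Wg x))"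
   using zD
  proof (rule AE_mp, intro AE_I2 impI)
   fix x assume "x \<in> space (lb_on V)" and D: "if 0 < z x then Du x = sig *R Dz x else Dz x = 0"
   note x = spV[OF this(1)]
   have "\<bar>sig * (1 + bb x * z x / w x) * P x\<bar> <= (1 + pM) * P x"
    unfolding abs_mult abs_of_nonneg[OF P0] sig1 mult_1_left by (rule mult_right_mono[OF kappaabs[OF x] P0])
   hence "\<bar>energy phi Dphi x\<bar> <= (1 + pM) * P x + (2 * c * P x + C1 * (indicator S x * Wg x))"
    by (rule tri[OF Ept[OF x D]])
   thus "norm (energy phi Dphi x) <= norm ((1 + pM + 2 * c) * P x + C1 * (indicator S x * Wg x))"
    by (simp add: distrib_right)
  qed
 qed
 have "(LINT x|lb_on V. energy phi Dphi x) <= (LINT x|lb_on V. - (2 * c) * P x + C1 * (indicator S x * Wg x))"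
 proof (rule integral_mono_AE[OF iE])
  show "L1_on V (%x. - (2 * c) * P x + C1 * (indicator S x * Wg x))"
   by (intro bi_integrable_add integrable_mult_right iP iJ)
  show "AE x in lb_on V. energy phi Dphi x <= - (2 * c) * P x + C1 * (indicator S x * Wg x)"
   using zD
  proof (rule AE_mp, intro AE_I2 impI)
   fix x assume "x \<in> space (lb_on V)" and D: "if 0 < z x then Du x = sig *R Dz x else Dz x = 0"
   note x = spV[OF this(1)]
   have "sig * (1 + bb x * z x / w x) <= - (4 * c)" using kappa[OF x] unfolding bb_def w_def by simp
   hence "sig * (1 + bb x * z x / w x) * P x <= - (4 * c) * P x" by (rule mult_right_mono[OF _ P0])
   thus "energy phi Dphi x <= - (2 * c) * P x + C1 * (indicator S x * Wg x)" using Ept[OF x D] by linarith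
  qed
 qed
 also have "... = - (2 * c) * (LINT x|lb_on V. P x) + C1 * (LINT x|lb_on V. indicator S x * Wg x)"
  by (subst bi_integral_add[OF integrable_mult_right[OF iP] integrable_mult_right[OF iJ]]) simp
 finally have "2 * c * (LINT x|lb_on V. P x) <= C1 * (LINT x|lb_on V. indicator S x * Wg x)" using E0 by linarith
 thus ?C4 unfolding P_def Wg_def T_def w_def S_def C1_def e_def .
qed

text \<open>Caccioppoli for (k - u)_+ turned into a gain of |{u < k}|^(1/N). The function eta^q z
  (w/r)^(gamma-1) has size at most r (w/r)^gamma, its gradient is controlled by weight and energy
  through T \<le> 1 + T^p, and Faber-Krahn applies since it vanishes off {u < k}. K is free of
  gamma, s, k and delta; the iteration needs this because delta shrinks.\<close>

lemma energy_step:
 obtains K where "0 < K"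
  "!!x0 r gamma s k delta a b. 0 < r ==> r <= 1 ==> cball x0 (4 * r) \<subseteq> \<Omega> ==> 1 <= gamma ==> 0 < s ==>
   (!!x. x \<in> ball x0 (4 * r) ==> s <= p x - gamma & p x - gamma <= 1/2) ==> 0 < delta ==> 0 < a ==> a < b ==> b <= r ==>
   L1_on (ball x0 (4 * r)) (%x. indicator {x \<in> ball x0 b. u x < k} x * ((k - u x + delta) / r) powr gamma) &
   L1_on (ball x0 (4 * r)) (%x. indicator (ball x0 a) x * (max 0 (k - u x) / r) powr gamma) &
   (LINT x|lb_on (ball x0 (4 * r)). indicator (ball x0 a) x * (max 0 (k - u x) / r) powr gamma)
    <= K / r * (r / (b - a)) powr pM * measure lborel {x \<in> ball x0 b. u x < k} powr (1 / real CARD('n))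
     * (LINT x|lb_on (ball x0 (4 * r)). indicator {x \<in> ball x0 b. u x < k} x * ((k - u x + delta) / r) powr gamma)"
proof -
 \<comment> \<open>The choice c = 1/8 matches 1 + (gamma - p) z/w \<ge> 1/2 = 4c, valid when p -
   gamma \<le> 1/2.\<close>
 obtain C2 where C2: "0 <= C2" "!!p' T. pm <= p' ==> p' <= pM ==> 0 <= T ==> L * (T powr (p' - 1) * \<bar>ln T\<bar>) <= 1/8 * T powr p' + C2"
  using powr_log_absorb[OF pm _ L, of "1/8" pM] by auto
 define q where "q = nat \<lceil>\<bar>pM\<bar>\<rceil> + 2"
 have q: "\<bar>pM\<bar> <= real q" "2 <= q" unfolding q_def by linarith+
 define omega where "omega = unit_ball_vol (real CARD('n))"
 have omega: "omega > 0" unfolding omega_def by simp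
 \<comment> \<open>Collects the contributions to |Df|: derivative of the cutoff, the weight from the
   1 in T \<le> 1 + T^p, and the energy.\<close>
 define K0 where "K0 = real q + \<bar>pM\<bar> + \<bar>pM\<bar> * ((8 * real q) powr pM / 2 + 4 * C2)"
 define N where "N = real CARD('n)"
 have N: "N > 0" unfolding N_def by simp
 define K where "K = 2 * (2 / omega) powr (1 / N) * K0 * 3 powr pM"
 have K0: "K0 > 0" unfolding K0_def using q C2(1) by (intro add_pos_nonneg add_nonneg_nonneg mult_nonneg_nonneg) auto
 have K: "K > 0" unfolding K_def using K0 omega by simp
 show ?thesis
 proof (rule that[OF K])
  fix x0 :: "real^'n" and r gamma s k delta a b :: real
  assume r: "0 < r" "r <= 1" and sub: "cball x0 (4 * r) \<subseteq> \<Omega>" and gamma: "1 <= gamma" and s: "0 < s"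
   and ps: "!!x. x \<in> ball x0 (4 * r) ==> s <= p x - gamma & p x - gamma <= 1/2" and delta: "0 < delta" and ab: "0 < a" "a < b" "b <= r"
  define V where "V = ball x0 (4 * r)"
  have V: "open V" "emeasure lborel V < \<infinity>" unfolding V_def by (rule open_ball) (rule emeasure_ball_less_top)
  have R: "0 < 4 * r" using r by simp
  note ps = ps[folded V_def]
  have V\<Omega>: "x \<in> \<Omega>" if "x \<in> V" for x using that sub unfolding V_def by auto
  have spV: "x \<in> V" if "x \<in> space (lb_on V)" for x using that by (simp add: space_restrict_space)
  have ballV: "ball x0 b \<subseteq> V" "ball x0 a \<subseteq> ball x0 b" unfolding V_def using ab r by (auto intro!: subset_ball)
  have pV: "pm <= p x" "p x <= pM" if "x \<in> V" for x using p_bounds[OF V\<Omega>[OF that]] by auto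
  have V0: "x0 \<in> V" unfolding V_def using R by simp
  have pM1: "1 < pM" using pV[OF V0] pm by linarith
  have gammapM: "gamma <= pM" using ps[OF V0] pV[OF V0] s by linarith
  obtain eta Deta where etaD: "!!x. (eta has_derivative (%h. Deta x \<bullet> h)) (at x)" "continuous_on UNIV Deta"
   and eta: "!!x. 0 <= eta x" "!!x. eta x <= 1" "!!x. x \<in> ball x0 a ==> eta x = 1"
   and eta0: "!!x. x \<notin> ball x0 b ==> eta x = 0" "!!x. x \<notin> ball x0 b ==> Deta x = 0" and Deta: "!!x. norm (Deta x) <= 3 / (b - a)"
   using smooth_cutoff[OF ab(1,2), of x0] by blast
  \<comment> \<open>A bound for r |Deta|. The constants grow at most like X0^pM, which yields the
    factor (r / (b - a))^pM.\<close>
  define X0 where "X0 = 3 * r / (b - a)"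
  have ba: "0 < b - a" "b - a <= r" using ab by auto
  have X0: "1 <= X0" "3 <= X0" unfolding X0_def using ba by (simp_all add: le_divide_eq)
  have rDeta: "r * norm (Deta x) <= X0" for x using mult_left_mono[OF Deta[of x], of r] r unfolding X0_def by (simp add: mult.commute)
  define e where "e x = eta x ^ q" for x
  define De where "De x = (real q * eta x ^ (q - 1)) *R Deta x" for x
  have e01: "0 <= e x & e x <= 1" for x unfolding e_def using eta by (simp add: power_le_one)
  have nDe: "norm (De x) <= real q * (3 / (b - a))" for x
  proof -
   have "norm (De x) = (real q * eta x ^ (q - 1)) * norm (Deta x)" unfolding De_def using eta by simp
   also have "... <= (real q * 1) * (3 / (b - a))" using eta Deta by (intro mult_mono power_le_one) auto
   finally show ?thesis by simp
  qed
  have c1: "W11 V (%x. 1) (%x. 0)" by (rule W11_C1[OF V, where B=1]) (simp_all add: C1_on_def)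
  note su = sobolev_u[OF R sub, folded V_def] and sp = sobolev_p[OF R sub, folded V_def]
  define z where "z x = max 0 (k - u x)" for x
  define Dz where "Dz x = (if u x < k then - Du x else 0)" for x
  have sz: "W11 V z Dz"
  proof -
   have 1: "W11 V (%x. -1 * u x + k * 1) (%x. -1 *R Du x + k *R 0)" by (rule W11_linear[OF su c1 V])
   show ?thesis by (rule W11_cong[OF W11_max0[OF 1 V]]) (auto simp: z_def Dz_def)
  qed
  define bb where "bb x = gamma - p x" for x
  have bbr: "- (1/2) <= bb x" "bb x <= - s" "\<bar>bb x\<bar> <= 1/2" if "x \<in> V" for x using ps[OF that] s unfolding bb_def by auto
  have z0: "0 <= z x" for x unfolding z_def by simp
  have zu: "z x <= \<bar>k\<bar> + \<bar>u x\<bar>" for x unfolding z_def by simp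
  have Dzu: "norm (Dz x) <= norm (Du x)" for x unfolding Dz_def by simp
  define w where "w x = z x + delta" for x
  have w: "w x > 0" "w x \<ge> delta" "z x <= w x" "z x < w x" for x unfolding w_def using z0[of x] delta by auto
  have off: "e x = 0 & De x = 0" if "x \<notin> ball x0 b" for x
   unfolding e_def De_def using eta0[OF that] q(2) by simp
  define T where "T x = r * norm (Dz x) / w x" for x
  define Wg where "Wg x = (w x / r) powr gamma" for x
  define P where "P x = Wg x * (e x * T x powr p x)" for x
  define S where "S = {x \<in> ball x0 b. u x < k}"
  have Smeas: "S \<in> sets borel"
  proof -
   have "S = ball x0 b \<inter> u -` {..<k}" unfolding S_def by auto
   moreover have "u -` {..<k} \<inter> space borel \<in> sets borel" by (rule measurable_sets[OF meas(2)]) simp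
   ultimately show ?thesis by simp
  qed
  have SV: "S \<in> sets (lb_on V)"
   using Smeas ballV V unfolding sets_restrict_space by (auto simp: S_def image_iff intro!: exI[of _ S] bexI[of _ S])
  have zu: "z x <= (1 + \<bar>k\<bar>) * (1 + \<bar>u x\<bar>)" for x
  proof -
   have "c + d <= (1 + c) * (1 + d)" if "0 <= c" "0 <= d" for c d :: real
    using mult_nonneg_nonneg[OF that] by (simp add: distrib_left distrib_right)
   from this[of "\<bar>k\<bar>" "\<bar>u x\<bar>"] show ?thesis using zu[of x] by simp
  qed
  have kappa: "4 * (1/8) <= - (- 1) * (1 + (gamma - p x) * z x / (z x + delta))" if x: "x \<in> V" for x
  proof -
   have zw: "0 <= z x / w x" "z x / w x <= 1" using w[of x] z0[of x] by simp_all
   have "(1/2) * (z x / w x) <= (1/2) * 1" using zw by (intro mult_left_mono) auto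
   moreover have "(- (1/2)) * (z x / w x) <= bb x * (z x / w x)" using bbr[OF x] zw by (intro mult_right_mono) auto
   ultimately have h: "- (1/2) <= bb x * (z x / w x)" by linarith
   have g: "4 * (1/8) <= - (- 1) * (1 + t)" if "- (1/2) <= t" for t :: real using that by simp
   have eq: "(gamma - p x) * z x / (z x + delta) = bb x * (z x / w x)" unfolding bb_def w_def by simp
   show ?thesis unfolding eq by (rule g[OF h])
  qed
  have zD: "AE x in lb_on V. if 0 < z x then Du x = - 1 *R Dz x else Dz x = 0"
   by (rule AE_I2) (auto simp: z_def Dz_def)
  have b4: "0 < b" "b < 4 * r" and g0: "0 <= gamma" and k0: "0 <= 1 + \<bar>k\<bar>" using ab r gamma by auto
  have psl: "s <= p x - gamma" if "x \<in> ball x0 (4 * r)" for x using ps[of x] that unfolding V_def by blast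
  have X8: "1 <= 8 * real q * X0" "real q * X0 <= 1/8 * (8 * real q * X0)"
  proof -
   have "1 * 1 <= real q * X0" using q(2) X0 by (intro mult_mono) auto
   thus "1 <= 8 * real q * X0" "real q * X0 <= 1/8 * (8 * real q * X0)" by simp_all
  qed
  have c8: "(0::real) < 1/8" by simp
  note cac = caccioppoli[OF r sub b4 g0 s psl delta disjI2[OF refl] sz[unfolded V_def] z0 k0 zu Dzu zD[unfolded V_def] etaD eta(1,2) eta0 rDeta q c8 X8 C2 kappa[unfolded V_def], folded V_def]
  have se: "W11 V e De" using cac(1) unfolding e_def[abs_def] De_def[abs_def] .
  have iWg: "L1_on V Wg" using cac(2) unfolding Wg_def[abs_def] w_def .
  have iWT: "L1_on V (%x. Wg x * T x powr p x)" using cac(3) unfolding Wg_def T_def w_def .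
  have mzw [measurable]: "z \<in> bm_on V" "Dz \<in> bm_on V" "e \<in> bm_on V"
   by (intro borel_measurable_integrable W11_integrable[OF sz] W11_integrable[OF se])+
  have T0: "0 <= T x" for x unfolding T_def using r w[of x] by simp
  have Wg0: "0 <= Wg x" for x unfolding Wg_def by simp
  have P0: "0 <= P x" for x unfolding P_def using Wg0 e01 by simp
  have iP: "L1_on V P"
  proof (rule bi_integrable_bound[OF iWT])
   show "P \<in> bm_on V" unfolding P_def[abs_def] Wg_def T_def w_def by measurable
   show "AE x in lb_on V. norm (P x) <= norm (Wg x * T x powr p x)"
   proof (rule AE_I2)
    fix x
    have "Wg x * (e x * T x powr p x) <= Wg x * (1 * T x powr p x)" using e01[of x] Wg0[of x] by (intro mult_left_mono mult_right_mono) auto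
    thus "norm (P x) <= norm (Wg x * T x powr p x)" using P0[of x] Wg0[of x] unfolding P_def by simp
   qed
  qed
  define J where "J = (LINT x|lb_on V. indicator S x * Wg x)"
  have iJ: "L1_on V (%x. indicator S x * Wg x)"
   using integrable_mult_indicator[OF SV iWg] by simp
  have J0: "0 <= J" unfolding J_def using Wg0 by (intro bi_integral_nonneg) simp
  define C1 where "C1 = 1/8 * (8 * real q * X0) powr pM + C2"
  have C1: "0 <= C1" unfolding C1_def using C2(1) by simp
  have PS: "P x = 0" if "x \<notin> S" for x
  proof (cases "x \<in> ball x0 b")
   case True
   hence "Dz x = 0" using that unfolding S_def Dz_def by auto
   thus ?thesis unfolding P_def T_def by simp
  next
   case False thus ?thesis unfolding P_def using off[OF False] by simp
  qed
  have PJ: "(LINT x|lb_on V. P x) <= 4 * C1 * J"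
  proof -
   have "{x \<in> ball x0 b. 0 < z x} = S" unfolding S_def z_def by auto
   hence "2 * (1/8) * (LINT x|lb_on V. P x) <= C1 * J"
    using cac(4) unfolding P_def Wg_def T_def w_def C1_def J_def e_def by simp
   thus ?thesis by simp
  qed
  \<comment> \<open>The exponent gamma - 1 is constant here, hence the gradient 0 in the last
    summand of \<open>Df\<close>.\<close>
  define f where "f x = e x * (z x * (w x / r) powr (gamma - 1))" for x
  define Df where "Df x = (z x * (w x / r) powr (gamma - 1)) *R De x
   + (e x * ((w x / r) powr (gamma - 1) * (1 + (gamma - 1) * z x / w x))) *R Dz x
   + (e x * (z x * (w x / r) powr (gamma - 1) * ln (w x / r))) *R 0" for x
  have Wg1: "z x * (w x / r) powr (gamma - 1) <= r * Wg x" "(w x / r) powr (gamma - 1) * norm (Dz x) = Wg x * T x" for x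
  proof -
   have a: "(w x / r) powr (gamma - 1) = Wg x * (r / w x)" unfolding Wg_def using w[of x] r by (simp add: powr_diff)
   have "z x / w x <= 1" using w[of x] z0[of x] by simp
   hence "(r * Wg x) * (z x / w x) <= (r * Wg x) * 1" using r Wg0[of x] by (intro mult_left_mono) auto
   thus "z x * (w x / r) powr (gamma - 1) <= r * Wg x" unfolding a by (simp add: mult.commute mult.left_commute)
   show "(w x / r) powr (gamma - 1) * norm (Dz x) = Wg x * T x" unfolding a T_def by simp
  qed
  \<comment> \<open>The gradient of f contains T linearly, the energy its power p(x).\<close>
  have T1: "T x <= 1 + T x powr p x" if x: "x \<in> V" for x
  proof (cases "T x <= 1")
   case True thus ?thesis by (simp add: add_increasing2)
  next
   case False
   hence "T x powr 1 <= T x powr p x" using pV[OF x] pm by (intro powr_mono) auto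
   thus ?thesis using False by simp
  qed
  have sbc: "W11 V (%x. gamma - 1) (%x. 0)"
   by (rule W11_C1[OF V, where B="\<bar>gamma\<bar> + 1"]) (auto simp: C1_on_def)
  have sf: "W11 V f Df"
   unfolding f_def[abs_def] Df_def[abs_def] w_def[abs_def]
  proof (rule W11_shifted_product_powr[OF V sz sbc se z0 _ _ e01 nDe delta r(1), where B="pM" and G="%x. r * Wg x + (1 + pM) * (Wg x + Wg x * T x powr p x)"])
   show "L1_on V (%x. r * Wg x + (1 + pM) * (Wg x + Wg x * T x powr p x))"
    by (intro bi_integrable_add integrable_mult_right iWg iWT)
   have nn: "0 <= (1 + pM) * (Wg x + Wg x * T x powr p x)" for x using pM1 Wg0[of x] by simp
   show "t * ((t + delta) / r) powr (gamma - 1) <= r * Wg x + (1 + pM) * (Wg x + Wg x * T x powr p x)" if "0 <= t" "t <= z x" for x t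
   proof -
    have "t * ((t + delta) / r) powr (gamma - 1) <= z x * (w x / r) powr (gamma - 1)"
     using that r delta gamma z0[of x] unfolding w_def by (intro mult_mono powr_mono2 divide_right_mono) auto
    thus ?thesis using Wg1(1)[of x] nn[of x] by linarith
   qed
   show "t * ((t + delta) / r) powr (gamma - 1) * \<bar>ln ((t + delta) / r)\<bar> * norm (0 :: real^'n) <= r * Wg x + (1 + pM) * (Wg x + Wg x * T x powr p x)" for x t
    using nn[of x] Wg0[of x] r by simp
   show "((z x + delta) / r) powr (gamma - 1) * (1 + pM) * norm (Dz x) <= r * Wg x + (1 + pM) * (Wg x + Wg x * T x powr p x)" if x: "x \<in> V" for x
   proof -
    have "((z x + delta) / r) powr (gamma - 1) * (1 + pM) * norm (Dz x) = (1 + pM) * (Wg x * T x)"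
     unfolding Wg1(2)[symmetric] w_def by simp
    also have "... <= (1 + pM) * (Wg x * (1 + T x powr p x))" using pM1 Wg0[of x] T1[OF x] by (intro mult_left_mono) auto
    also have "... <= r * Wg x + (1 + pM) * (Wg x + Wg x * T x powr p x)" using r Wg0[of x] by (simp add: distrib_left)
    finally show ?thesis .
   qed
  qed (use gamma gammapM pM1 in auto)
  have Dfpt: "norm (Df x) <= (real q * X0 + pM) * (indicator S x * Wg x) + pM * P x" if x: "x \<in> V" for x
  proof (cases "x \<in> S")
   case False
   have "Df x = 0"
   proof (cases "x \<in> ball x0 b")
    case True
    hence "z x = 0 & Dz x = 0" using False unfolding S_def z_def Dz_def by auto
    thus ?thesis unfolding Df_def by simp
   qed (simp add: Df_def off)
   thus ?thesis using False PS[OF False] by simp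
  next
   case True
   have t1: "norm ((z x * (w x / r) powr (gamma - 1)) *R De x) <= Wg x * (real q * X0)"
   proof -
    have nDe': "norm (De x) <= real q * norm (Deta x)"
    proof -
     have "norm (De x) = (real q * eta x ^ (q - 1)) * norm (Deta x)" unfolding De_def using eta by simp
     also have "... <= (real q * 1) * norm (Deta x)" using eta by (intro mult_right_mono mult_left_mono power_le_one) auto
     finally show ?thesis by simp
    qed
    have "norm ((z x * (w x / r) powr (gamma - 1)) *R De x) <= (r * Wg x) * (real q * norm (Deta x))"
     unfolding norm_scaleR using Wg1(1)[of x] nDe' z0[of x] r Wg0[of x] by (intro mult_mono) auto
    also have "... = Wg x * (real q * (r * norm (Deta x)))" by simp
    also have "... <= Wg x * (real q * X0)" using rDeta[of x] by (intro mult_left_mono Wg0) auto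
    finally show ?thesis .
   qed
   have t2: "norm ((e x * ((w x / r) powr (gamma - 1) * (1 + (gamma - 1) * z x / w x))) *R Dz x) <= pM * (Wg x + P x)"
   proof -
    have zw: "0 <= z x / w x" "z x / w x <= 1" using w[of x] z0[of x] by simp_all
    have k1: "0 <= 1 + (gamma - 1) * z x / w x" "1 + (gamma - 1) * z x / w x <= pM"
    proof -
     have "(gamma - 1) * (z x / w x) <= (gamma - 1) * 1" using gamma zw by (intro mult_left_mono) auto
     moreover have "0 <= (gamma - 1) * (z x / w x)" by (rule mult_nonneg_nonneg) (use gamma zw in auto)
     ultimately show "0 <= 1 + (gamma - 1) * z x / w x" "1 + (gamma - 1) * z x / w x <= pM" using gammapM by simp_all
    qed
    have "norm ((e x * ((w x / r) powr (gamma - 1) * (1 + (gamma - 1) * z x / w x))) *R Dz x)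
     = (1 + (gamma - 1) * z x / w x) * (e x * ((w x / r) powr (gamma - 1) * norm (Dz x)))"
     unfolding norm_scaleR abs_mult using e01[of x] k1(1) by simp
    also have "... <= pM * (e x * (Wg x * T x))" unfolding Wg1(2) using k1 e01[of x] Wg0[of x] T0[of x] by (intro mult_right_mono) auto
    also have "... <= pM * (e x * (Wg x * (1 + T x powr p x)))" using pM1 e01[of x] Wg0[of x] T1[OF x] by (intro mult_left_mono) auto
    also have "e x * (Wg x * (1 + T x powr p x)) <= Wg x + P x"
     using mult_right_mono[of "e x" 1 "Wg x"] e01[of x] Wg0[of x] unfolding P_def by (simp add: algebra_simps)
    finally show ?thesis using pM1 by (simp add: mult_left_mono)
   qed
   have "norm (Df x) <= Wg x * (real q * X0) + pM * (Wg x + P x)"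
    unfolding Df_def scaleR_zero_right add_0_right by (rule norm_triangle_mono[OF t1 t2])
   thus ?thesis using True by (simp add: algebra_simps)
  qed
  have iDf: "L1_on V (%x. norm (Df x))" by (intro integrable_norm W11_integrable(2)[OF sf])
  have IDf: "(LINT x|lb_on V. norm (Df x)) <= K0 * X0 powr pM * J"
  proof -
   have "(LINT x|lb_on V. norm (Df x)) <= (LINT x|lb_on V. (real q * X0 + pM) * (indicator S x * Wg x) + pM * P x)"
   proof (rule integral_mono[OF iDf])
    show "L1_on V (%x. (real q * X0 + pM) * (indicator S x * Wg x) + pM * P x)"
     by (intro bi_integrable_add integrable_mult_right iP iJ)
   qed (use Dfpt spV in blast)
   also have "... = (real q * X0 + pM) * J + pM * (LINT x|lb_on V. P x)"
    unfolding J_def by (subst bi_integral_add[OF integrable_mult_right[OF iJ] integrable_mult_right[OF iP]]) simp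
   also have "... <= (real q * X0 + pM) * J + pM * (4 * C1 * J)" using PJ pM1 by (intro add_left_mono mult_left_mono) auto
   also have "... = (real q * X0 + pM + pM * (4 * C1)) * J" by (simp add: algebra_simps)
   also have "... <= (K0 * X0 powr pM) * J"
   proof (rule mult_right_mono[OF _ J0])
    have X1: "X0 <= X0 powr pM" "1 <= X0 powr pM"
     using powr_mono[of 1 pM X0] powr_mono[of 0 pM X0] X0 pM1 by simp_all
    have a: "real q * X0 <= real q * X0 powr pM" using X1 by (intro mult_left_mono) auto
    have b: "pM * 1 <= pM * X0 powr pM" using X1 pM1 by (intro mult_left_mono) auto
    have c: "4 * C1 = (8 * real q) powr pM / 2 * X0 powr pM + 4 * C2" unfolding C1_def using X0 by (simp add: powr_mult)
    have d: "4 * C2 * 1 <= 4 * C2 * X0 powr pM" using X1 C2(1) by (intro mult_left_mono) auto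
    have "4 * C1 <= ((8 * real q) powr pM / 2 + 4 * C2) * X0 powr pM" unfolding c using d by (simp add: distrib_right)
    hence "pM * (4 * C1) <= pM * (((8 * real q) powr pM / 2 + 4 * C2) * X0 powr pM)" using pM1 by (intro mult_left_mono) auto
    thus "real q * X0 + pM + pM * (4 * C1) <= K0 * X0 powr pM" proof -
     assume h: "pM * (4 * C1) <= pM * (((8 * real q) powr pM / 2 + 4 * C2) * X0 powr pM)"
     have "K0 * X0 powr pM = real q * X0 powr pM + pM * X0 powr pM + pM * (((8 * real q) powr pM / 2 + 4 * C2) * X0 powr pM)"
      unfolding K0_def using pM1 by (simp add: algebra_simps)
     thus ?thesis using a b h by linarith
    qed
   qed
   finally show ?thesis .
  qed
  have fk: "(LINT x|lb_on V. f x) <= 2 * (2 * measure lborel S / omega) powr (1 / N) * (LINT x|lb_on V. norm (Df x))"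
   unfolding V_def omega_def N_def
  proof (rule faber_krahn[OF sf[unfolded V_def] r(1), unfolded DIM_cart DIM_real mult_1_right])
   show "0 <= f x" for x unfolding f_def using e01 z0 by simp
   show "f x = 0" if "x \<notin> ball x0 r" for x
   proof -
    have "x \<notin> ball x0 b" using that ab by auto
    thus ?thesis unfolding f_def using off[of x] by simp
   qed
   show "S \<in> sets borel" by (rule Smeas)
   show "S \<subseteq> ball x0 r" unfolding S_def using ab by auto
   show "x \<in> S" if "f x \<noteq> 0" for x
    using that off[of x] unfolding f_def S_def z_def by (auto simp: max_def split: if_splits)
  qed
  \<comment> \<open>On the smaller ball the cutoff is 1, and z \<le> w permits replacing z by w in
    the factor with exponent gamma - 1.\<close>
  have za: "indicator (ball x0 a) x * (z x / r) powr gamma <= f x / r" for x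
  proof (cases "x \<in> ball x0 a")
   case False thus ?thesis unfolding f_def using e01[of x] z0[of x] r by simp
  next
   case True
   have e1: "e x = 1" unfolding e_def using eta(3)[OF True] by simp
   show ?thesis
   proof (cases "z x = 0")
    case True thus ?thesis unfolding f_def by simp
   next
    case False
    hence zx: "0 < z x" using z0[of x] by simp
    have "(z x / r) powr gamma = (z x / r) powr (1 + (gamma - 1))" by simp
    also have "... = (z x / r) * (z x / r) powr (gamma - 1)" unfolding powr_add using zx r by simp
    also have "... <= (z x / r) * (w x / r) powr (gamma - 1)" using zx r gamma w[of x] by (intro mult_left_mono powr_mono2 divide_right_mono) auto
    finally show ?thesis unfolding f_def e1 using True by simp
   qed
  qed
  have if': "L1_on V f" by (rule W11_integrable(1)[OF sf])
  have iza: "L1_on V (%x. indicator (ball x0 a) x * (z x / r) powr gamma)"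
  proof (rule bi_integrable_bound[OF integrable_divide[OF if', of r]])
   have [measurable]: "ball x0 a \<in> sets (lb_on V)"
    using ballV V unfolding sets_restrict_space by (auto simp: image_iff intro!: bexI[of _ "ball x0 a"])
   show "(%x. indicator (ball x0 a) x * (z x / r) powr gamma) \<in> bm_on V" by measurable
   show "AE x in lb_on V. norm (indicator (ball x0 a) x * (z x / r) powr gamma) <= norm (f x / r)"
   proof (rule AE_I2)
    fix x
    have n: "0 <= indicator (ball x0 a) x * (z x / r) powr gamma" by simp
    show "norm (indicator (ball x0 a) x * (z x / r) powr gamma) <= norm (f x / r)"
     unfolding real_norm_def abs_of_nonneg[OF n] using za[of x] abs_ge_self[of "f x / r"] by linarith
   qed
  qed
  have WgS: "indicator S x * Wg x = indicator S x * ((k - u x + delta) / r) powr gamma" for x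
   unfolding Wg_def w_def z_def S_def by (simp add: indicator_def)
  have "(LINT x|lb_on V. indicator (ball x0 a) x * (z x / r) powr gamma) <= (LINT x|lb_on V. f x / r)"
   by (rule integral_mono[OF iza integrable_divide[OF if']]) (rule za)
  also have "... = (LINT x|lb_on V. f x) / r" by simp
  also have "... <= (2 * (2 * measure lborel S / omega) powr (1 / N) * (K0 * X0 powr pM * J)) / r"
  proof (rule divide_right_mono)
   have "2 * (2 * measure lborel S / omega) powr (1 / N) * (LINT x|lb_on V. norm (Df x)) <= 2 * (2 * measure lborel S / omega) powr (1 / N) * (K0 * X0 powr pM * J)"
    by (intro mult_left_mono IDf) simp
   thus "(LINT x|lb_on V. f x) <= 2 * (2 * measure lborel S / omega) powr (1 / N) * (K0 * X0 powr pM * J)" using fk by linarith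
  qed (use r in simp)
  also have "... = K / r * (r / (b - a)) powr pM * measure lborel S powr (1 / N) * J"
  proof -
   have 1: "(2 * measure lborel S / omega) powr (1 / N) = (2 / omega) powr (1 / N) * measure lborel S powr (1 / N)"
    using powr_mult[of "2 / omega" "measure lborel S" "1 / N"] omega by simp
   have 2: "X0 powr pM = 3 powr pM * (r / (b - a)) powr pM"
    unfolding X0_def using powr_mult[of 3 "r / (b - a)" pM] r ba by simp
   show ?thesis unfolding 1 2 K_def by simp
  qed
  finally have main: "(LINT x|lb_on V. indicator (ball x0 a) x * (z x / r) powr gamma) <= K / r * (r / (b - a)) powr pM * measure lborel S powr (1 / N) * J" .
  show "L1_on (ball x0 (4 * r)) (%x. indicator {x \<in> ball x0 b. u x < k} x * ((k - u x + delta) / r) powr gamma) &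
   L1_on (ball x0 (4 * r)) (%x. indicator (ball x0 a) x * (max 0 (k - u x) / r) powr gamma) &
   (LINT x|lb_on (ball x0 (4 * r)). indicator (ball x0 a) x * (max 0 (k - u x) / r) powr gamma)
    <= K / r * (r / (b - a)) powr pM * measure lborel {x \<in> ball x0 b. u x < k} powr (1 / real CARD('n))
     * (LINT x|lb_on (ball x0 (4 * r)). indicator {x \<in> ball x0 b. u x < k} x * ((k - u x + delta) / r) powr gamma)"
   using main iza iJ unfolding J_def WgS unfolding S_def z_def V_def N_def by blast
 qed
qed

end

section \<open>De Giorgi iteration and continuity\<close>

lemma W11_subset:
 assumes s: "W11 V f g" and V: "open V" "open V'" "V' \<subseteq> V"
 shows "W11 V' f g"
proof -
 have V0: "V \<inter> space lborel \<in> sets lborel" using V by simp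
 have sub: "L1_on V' h & (LINT x|lb_on V'. norm (h x)) <= (LINT x|lb_on V. norm (h x))"
  if h: "L1_on V h" for h :: "'a => 'c::{banach, second_countable_topology}"
 proof -
  have i: "integrable lborel (%x. indicator V x *R h x)" using h unfolding integrable_restrict_space[OF V0] .
  note R = integrable_lb_on_restrict[OF V(2) i]
  have eq: "indicator V x *R h x = h x" if "x \<in> space (lb_on V')" for x
   using that V(3) by (auto simp: space_restrict_space indicator_def)
  have 1: "L1_on V' h" using R(1) eq by (subst bi_integrable_cong[OF refl, of _ h "%x. indicator V x *R h x"]) auto
  have "(LINT x|lb_on V'. norm (h x)) = (LINT x|lb_on V'. norm (indicator V x *R h x))"
   using eq by (intro bi_integral_cong) auto
  also have "... <= (LBINT x. norm (indicator V x *R h x))" by (rule R(2))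
  also have "... = (LINT x|lb_on V. norm (h x))" by (subst integral_restrict_space[OF V0]) (simp add: abs_of_nonneg)
  finally show ?thesis using 1 by blast
 qed
 note i = W11_integrable[OF s]
 show ?thesis unfolding W11_def
 proof (intro conjI allI impI conjunct1[OF sub[OF i(1)]] conjunct1[OF sub[OF i(2)]])
  fix e :: real assume e: "e > 0"
  obtain F G where FG: "C1_on V F G" "L1_on V F" "L1_on V G"
   "(LINT x|lb_on V. norm (F x - f x)) < e" "(LINT x|lb_on V. norm (G x - g x)) < e" by (rule W11_approx[OF s e])
  have C: "C1_on V' F G" using FG(1) V(3) unfolding C1_on_def by (meson continuous_on_subset subsetD)
  show "\<exists>F G. C1_on V' F G & L1_on V' F & L1_on V' G &
   (LINT x|lb_on V'. norm (F x - f x)) < e & (LINT x|lb_on V'. norm (G x - g x)) < e"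
   using sub[OF bi_integrable_diff[OF FG(2) i(1)]] sub[OF bi_integrable_diff[OF FG(3) i(2)]] FG(4,5)
   by (intro exI[of _ F] exI[of _ G] conjI C conjunct1[OF sub[OF FG(2)]] conjunct1[OF sub[OF FG(3)]]) linarith+
 qed
qed

lemma W11_clamp:
 assumes s: "W11 V f g" and V: "open V" "emeasure lborel V < \<infinity>" and lh: "lo < hi"
 shows "W11 V (%x. max lo (min hi (f x))) (%x. if lo < f x & f x < hi then g x else 0)"
proof -
 note c = W11_const[OF V, of 1]
 have 1: "W11 V (%x. -1 * f x + hi * 1) (%x. -1 *R g x + hi *R 0)" by (rule W11_linear[OF s c V])
 have 2: "W11 V (%x. max 0 (-1 * f x + hi * 1)) (%x. if -1 * f x + hi * 1 > 0 then -1 *R g x + hi *R 0 else 0)"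
  by (rule W11_max0[OF 1 V])
 have 3: "W11 V (%x. -1 * max 0 (-1 * f x + hi * 1) + (hi - lo) * 1)
   (%x. -1 *R (if -1 * f x + hi * 1 > 0 then -1 *R g x + hi *R 0 else 0) + (hi - lo) *R 0)"
  by (rule W11_linear[OF 2 c V])
 note 4 = W11_max0[OF 3 V]
 have 5: "W11 V (%x. 1 * max 0 (-1 * max 0 (-1 * f x + hi * 1) + (hi - lo) * 1) + lo * 1)
   (%x. 1 *R (if -1 * max 0 (-1 * f x + hi * 1) + (hi - lo) * 1 > 0 then -1 *R (if -1 * f x + hi * 1 > 0 then -1 *R g x + hi *R 0 else 0) + (hi - lo) *R 0 else 0) + lo *R 0)"
  by (rule W11_linear[OF 4 c V])
 show ?thesis by (rule W11_cong[OF 5]) (use lh in \<open>auto simp: max_def min_def\<close>)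
qed

section \<open>De Giorgi iteration and local lower bounds\<close>

text \<open>Induction on Y n \<le> Y 0 b^n with b = B^(-1/alpha): the gain (b^n)^alpha compensates
  B^n exactly, and the threshold for Y 0 says A (Y 0)^alpha \<le> b.\<close>

lemma fast_geometric_convergence:
 fixes Y :: "nat => real"
 assumes Y: "!!n. 0 <= Y n" "!!n. Y (Suc n) <= A * B ^ n * Y n powr (1 + alpha)"
  and AB: "0 < A" "1 < B" "0 < alpha" and Y0: "Y 0 <= A powr (- 1 / alpha) * B powr (- 1 / alpha\<^sup>2)"
 shows "Y ~~> 0"
proof -
 define b where "b = B powr (- 1 / alpha)"
 have b: "0 < b" "b < 1" unfolding b_def using AB by (simp_all add: powr_less_one)
 have le: "Y n <= Y 0 * b ^ n" for n
 proof (induction n)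
  case (Suc n)
  have A0: "A * Y 0 powr alpha <= b"
  proof -
   have "Y 0 powr alpha <= (A powr (- 1 / alpha) * B powr (- 1 / alpha\<^sup>2)) powr alpha" using Y0 Y(1)[of 0] AB by (intro powr_mono2) auto
   also have "... = A powr (- 1) * B powr (- 1 / alpha)"
    using AB by (simp add: powr_mult powr_powr power2_eq_square)
   finally have "A * Y 0 powr alpha <= A * (A powr (- 1) * b)" unfolding b_def using AB by (intro mult_left_mono) auto
   also have "... = b" using AB by (simp add: powr_minus_divide)
   finally show ?thesis .
  qed
  have bn: "(b ^ n) powr alpha * B ^ n = 1"
  proof -
   have "(b ^ n) powr alpha = (b powr alpha) ^ n" using b by (simp add: powr_realpow[symmetric] powr_powr mult.commute)
   also have "b powr alpha = B powr (- 1)" unfolding b_def powr_powr using AB by simp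
   also have "B powr (- 1) = 1 / B" using AB by (simp add: powr_minus_divide)
   finally show ?thesis using AB by (simp add: power_one_over field_simps)
  qed
  have "Y (Suc n) <= A * B ^ n * Y n powr (1 + alpha)" by (rule Y)
  also have "... <= A * B ^ n * (Y 0 * b ^ n) powr (1 + alpha)"
   using Suc Y(1)[of n] AB by (intro mult_left_mono powr_mono2) auto
  also have "(Y 0 * b ^ n) powr (1 + alpha) = (Y 0 * b ^ n) * (Y 0 powr alpha * (b ^ n) powr alpha)"
  proof (cases "Y 0 = 0")
   case False
   thus ?thesis using Y(1)[of 0] b by (simp add: powr_add powr_mult)
  qed simp
  also have "A * B ^ n * ((Y 0 * b ^ n) * (Y 0 powr alpha * (b ^ n) powr alpha)) = (Y 0 * b ^ n) * (A * Y 0 powr alpha) * ((b ^ n) powr alpha * B ^ n)"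
   by simp
  also have "... = (Y 0 * b ^ n) * (A * Y 0 powr alpha)" unfolding bn by simp
  also have "... <= (Y 0 * b ^ n) * b" using A0 Y(1)[of 0] b by (intro mult_left_mono) auto
  finally show ?case by (simp add: mult.commute mult.left_commute)
 qed simp
 have "(%n. Y 0 * b ^ n) ~~> Y 0 * 0" using b by (intro tendsto_mult tendsto_const LIMSEQ_power_zero) auto
 hence "(%n. Y 0 * b ^ n) ~~> 0" by simp
 thus ?thesis by (rule tendsto_zero_squeeze[OF Y(1) le])
qed

context supersol begin

lemma sublevel_sets_lb_on:
 assumes "ball x b \<subseteq> V" "open V" shows "{y \<in> ball x b. u y < k} \<in> sets (lb_on V)" "{y \<in> ball x b. u y < k} \<in> sets borel"
proof -
 have "{y \<in> ball x b. u y < k} = ball x b \<inter> u -` {..<k}" by auto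
 moreover have "u -` {..<k} \<inter> space borel \<in> sets borel" by (rule measurable_sets[OF meas(2)]) simp
 ultimately show 1: "{y \<in> ball x b. u y < k} \<in> sets borel" by simp
 thus "{y \<in> ball x b. u y < k} \<in> sets (lb_on V)"
  using assms unfolding sets_restrict_space by (auto simp: image_iff intro!: bexI[of _ "{y \<in> ball x b. u y < k}"])
qed

text \<open>De Giorgi iteration on the levels k + \<kappa> / 2 ^ n and radii r (1 + 2 ^ - n) / 2.\<close>
lemma de_giorgi:
 obtains theta where "0 < theta"
  "!!x0 r gamma s k kappa. 0 < r ==> r <= 1 ==> cball x0 (4 * r) \<subseteq> \<Omega> ==> 1 <= gamma ==> 0 < s ==>
   (!!x. x \<in> ball x0 (4 * r) ==> s <= p x - gamma & p x - gamma <= 1/2) ==> 0 < kappa ==>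
   L1_on (ball x0 (4 * r)) (%x. indicator (ball x0 r) x * (max 0 (k + kappa - u x) / kappa) powr gamma) &
   ((LINT x|lb_on (ball x0 (4 * r)). indicator (ball x0 r) x * (max 0 (k + kappa - u x) / kappa) powr gamma) <= theta * r ^ CARD('n) -->
   (AE x in lborel. x \<in> ball x0 (r / 2) --> k <= u x))"
proof (rule energy_step)
 fix K assume K: "0 < K" and step: "!!x0 r gamma s k delta a b. 0 < r ==> r <= 1 ==> cball x0 (4 * r) \<subseteq> \<Omega> ==> 1 <= gamma ==> 0 < s ==>
   (!!x. x \<in> ball x0 (4 * r) ==> s <= p x - gamma & p x - gamma <= 1/2) ==> 0 < delta ==> 0 < a ==> a < b ==> b <= r ==>
   L1_on (ball x0 (4 * r)) (%x. indicator {x \<in> ball x0 b. u x < k} x * ((k - u x + delta) / r) powr gamma) &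
   L1_on (ball x0 (4 * r)) (%x. indicator (ball x0 a) x * (max 0 (k - u x) / r) powr gamma) &
   (LINT x|lb_on (ball x0 (4 * r)). indicator (ball x0 a) x * (max 0 (k - u x) / r) powr gamma)
    <= K / r * (r / (b - a)) powr pM * measure lborel {x \<in> ball x0 b. u x < k} powr (1 / real CARD('n))
     * (LINT x|lb_on (ball x0 (4 * r)). indicator {x \<in> ball x0 b. u x < k} x * ((k - u x + delta) / r) powr gamma)"
 define N where "N = real CARD('n)"
 have N: "1 <= N" unfolding N_def by (simp add: Suc_leI)
 \<comment> \<open>8^pM and 4^pM stem from (4 2^n)^pM, due to the shrinking gaps between radii,
   times (2^(n+1))^pM, due to the shrinking gaps between levels. The extra 1 in the exponent of
   \<open>B\<close> ensures B > 1.\<close>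
 define A where "A = K * 8 powr \<bar>pM\<bar>"
 define B where "B = 4 powr (\<bar>pM\<bar> + 1)"
 have A: "0 < A" unfolding A_def using K by simp
 have B: "1 < B" unfolding B_def by (rule gr_one_powr) auto
 \<comment> \<open>The threshold of \<open>fast_geometric_convergence\<close> for alpha =
   1/N.\<close>
 define theta where "theta = A powr (- 1 / (1 / N)) * B powr (- 1 / (1 / N)\<^sup>2)"
 have theta: "0 < theta" unfolding theta_def using A B by simp
 show ?thesis
 proof (rule that[OF theta])
  fix x0 :: "real^'n" and r gamma s k kappa :: real
  assume r: "0 < r" "r <= 1" and sub: "cball x0 (4 * r) \<subseteq> \<Omega>" and gamma: "1 <= gamma" and s: "0 < s"
   and ps: "!!x. x \<in> ball x0 (4 * r) ==> s <= p x - gamma & p x - gamma <= 1/2" and kappa: "0 < kappa"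
  define V where "V = ball x0 (4 * r)"
  have V: "open V" unfolding V_def by simp
  have x0V: "x0 \<in> ball x0 (4 * r)" using r by simp
  have pM: "gamma <= pM" "0 < pM"
   using ps[OF x0V] s p_bounds(2)[OF subsetD[OF sub, of x0]] gamma r by auto
  have step': "L1_on V (%x. indicator {x \<in> ball x0 b. u x < k} x * ((k - u x + delta) / r) powr gamma) &
   L1_on V (%x. indicator (ball x0 a) x * (max 0 (k - u x) / r) powr gamma) &
   (LINT x|lb_on V. indicator (ball x0 a) x * (max 0 (k - u x) / r) powr gamma)
    <= K / r * (r / (b - a)) powr pM * measure lborel {x \<in> ball x0 b. u x < k} powr (1 / real CARD('n))
     * (LINT x|lb_on V. indicator {x \<in> ball x0 b. u x < k} x * ((k - u x + delta) / r) powr gamma)"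
   if "0 < delta" "0 < a" "a < b" "b <= r" for delta a b k
   unfolding V_def by (rule step[OF r sub gamma s _ that]) (rule ps)
  define kk where "kk n = k + kappa / 2 ^ n" for n
  define aa where "aa n = r * (1/2 + 1 / 2 ^ Suc n)" for n
  define Y where "Y n = (LINT x|lb_on V. indicator (ball x0 (aa n)) x * (max 0 (kk n - u x) / r) powr gamma)" for n
  have aa: "0 < aa n" "aa (Suc n) < aa n" "aa n <= r" "r / 2 <= aa n" "aa n - aa (Suc n) = r / 2 ^ (n + 2)" for n
  proof -
   have "1 / 2 ^ Suc n <= (1/2::real)" by (simp add: divide_simps)
   hence "1/2 + 1 / 2 ^ Suc n <= (1::real)" by linarith
   thus "aa n <= r" unfolding aa_def using r mult_left_mono[of "1/2 + 1 / 2 ^ Suc n" 1 r] by simp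
   have "r * (1/2) <= aa n" unfolding aa_def using r by (intro mult_left_mono) auto
   thus h: "r / 2 <= aa n" by simp
   thus "0 < aa n" using r by linarith
   show d: "aa n - aa (Suc n) = r / 2 ^ (n + 2)" unfolding aa_def by (simp add: field_simps)
   have "0 < r / 2 ^ (n + 2)" using r by simp
   thus "aa (Suc n) < aa n" using d by linarith
  qed
  have bV: "ball x0 b \<subseteq> V" if "b <= r" for b using that r unfolding V_def by (auto intro!: subset_ball)
  have kd: "kk (Suc n) + kappa / 2 ^ Suc n = kk n" for n unfolding kk_def by (simp add: field_simps)
  have iY: "L1_on V (%x. indicator (ball x0 (aa n)) x * (max 0 (kk n - u x) / r) powr gamma)" for n
  proof (cases n)
   case (Suc m)
   show ?thesis unfolding Suc using step'[of 1 "aa (Suc m)" "aa m" "kk (Suc m)"] aa[of m] aa[of "Suc m"] by simp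
  next
   case 0
   have i: "L1_on V (%x. indicator {x \<in> ball x0 r. u x < kk 0} x * ((kk 0 - u x + 1) / r) powr gamma)"
    using step'[of 1 "r/2" r "kk 0"] r by simp
   show ?thesis unfolding 0
   proof (rule bi_integrable_bound[OF i])
    have [measurable]: "ball x0 (aa 0) \<in> sets (lb_on V)" by (rule ball_sets_lb_on[OF bV[OF aa(3)] V])
    show "(%x. indicator (ball x0 (aa 0)) x * (max 0 (kk 0 - u x) / r) powr gamma) \<in> bm_on V" by measurable
    show "AE x in lb_on V. norm (indicator (ball x0 (aa 0)) x * (max 0 (kk 0 - u x) / r) powr gamma) <= norm (indicator {x \<in> ball x0 r. u x < kk 0} x * ((kk 0 - u x + 1) / r) powr gamma)"
    proof (rule AE_I2)
     fix x
     show "norm (indicator (ball x0 (aa 0)) x * (max 0 (kk 0 - u x) / r) powr gamma) <= norm (indicator {x \<in> ball x0 r. u x < kk 0} x * ((kk 0 - u x + 1) / r) powr gamma)"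
     proof (cases "x \<in> ball x0 (aa 0) & u x < kk 0")
      case True
      hence "x \<in> ball x0 r" using aa(3)[of 0] by auto
      moreover have "((kk 0 - u x) / r) powr gamma <= ((kk 0 - u x + 1) / r) powr gamma"
       using True r gamma by (intro powr_mono2 divide_right_mono) auto
      ultimately show ?thesis using True by simp
     next
      case False
      hence 0: "indicator (ball x0 (aa 0)) x * (max 0 (kk 0 - u x) / r) powr gamma = 0" by (auto simp: indicator_def max_def)
      show ?thesis unfolding 0 by simp
     qed
    qed
   qed
  qed
  have Y0: "0 <= Y n" for n unfolding Y_def by (intro bi_integral_nonneg) simp
  have Yrec: "Y (Suc n) <= K / r * (4 * 2 ^ n) powr pM * (Y n * (r / (kappa / 2 ^ Suc n)) powr gamma) powr (1 / N) * Y n" for n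
  proof -
   \<comment> \<open>The gap between consecutive levels. With this delta the weight at level n+1
     equals k_n - u, so the right-hand side is at most Y n; the same gap bounds the sublevel set by
     Chebyshev's inequality.\<close>
   define delta where "delta = kappa / 2 ^ Suc n"
   have delta: "0 < delta" unfolding delta_def using kappa by simp
   define S where "S = {x \<in> ball x0 (aa n). u x < kk (Suc n)}"
   define J where "J = (LINT x|lb_on V. indicator S x * ((kk (Suc n) - u x + delta) / r) powr gamma)"
   have st: "L1_on V (%x. indicator S x * ((kk (Suc n) - u x + delta) / r) powr gamma)"
    "Y (Suc n) <= K / r * (r / (aa n - aa (Suc n))) powr pM * measure lborel S powr (1 / N) * J"
    using step'[OF delta aa(1)[of "Suc n"] aa(2)[of n] aa(3)[of n], of "kk (Suc n)"] unfolding S_def J_def Y_def N_def by blast+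
   have kn: "kk (Suc n) - u x + delta = kk n - u x" for x using kd[of n] unfolding delta_def by linarith
   have JY: "J <= Y n" unfolding J_def Y_def
   proof (rule integral_mono[OF st(1) iY])
    fix x show "indicator S x * ((kk (Suc n) - u x + delta) / r) powr gamma <= indicator (ball x0 (aa n)) x * (max 0 (kk n - u x) / r) powr gamma"
    proof (cases "x \<in> S")
     case True
     hence "kk n - u x > 0" using kn[of x] delta unfolding S_def by auto
     thus ?thesis using True unfolding kn S_def by simp
    qed simp
   qed
   have J0: "0 <= J" unfolding J_def by (intro bi_integral_nonneg) simp
   have Sm: "S \<in> sets (lb_on V)" "S \<in> sets borel" unfolding S_def by (rule sublevel_sets_lb_on[OF bV[OF aa(3)] V])+
   have mS: "measure lborel S <= Y n * (r / delta) powr gamma"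
   proof -
    have mE: "measure (lb_on V) S = measure lborel S"
     by (rule measure_restrict_space) (use V bV[OF aa(3)[of n]] in \<open>auto simp: S_def\<close>)
    have SV: "S \<subseteq> V" using bV[OF aa(3)[of n]] unfolding S_def by auto
    have fin: "emeasure (lb_on V) S < \<infinity>"
    proof -
     have "emeasure (lb_on V) S = emeasure lborel S" by (rule emeasure_restrict_space[OF _ SV]) (use V in simp)
     also have "... <= emeasure lborel V" by (rule emeasure_mono[OF SV]) (use V in simp)
     also have "... < \<infinity>" unfolding V_def by (rule emeasure_ball_less_top)
     finally show ?thesis .
    qed
    have "(delta / r) powr gamma * measure (lb_on V) S = (LINT x|lb_on V. (delta / r) powr gamma * indicator S x)"
     using Sm(1) fin by simp
    also have "... <= J" unfolding J_def
    proof (rule integral_mono[OF _ st(1)])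
     show "L1_on V (%x. (delta / r) powr gamma * indicator S x)" using Sm(1) fin by simp
     fix x show "(delta / r) powr gamma * indicator S x <= indicator S x * ((kk (Suc n) - u x + delta) / r) powr gamma"
     proof (cases "x \<in> S")
      case True
      hence "(delta / r) powr gamma <= ((kk (Suc n) - u x + delta) / r) powr gamma"
       using delta r gamma unfolding S_def by (intro powr_mono2 divide_right_mono) auto
      thus ?thesis using True by simp
     qed simp
    qed
    finally have "(delta / r) powr gamma * measure lborel S <= Y n" using JY unfolding mE by linarith
    hence "((r / delta) powr gamma * (delta / r) powr gamma) * measure lborel S <= (r / delta) powr gamma * Y n"
     unfolding mult.assoc by (rule mult_left_mono) simp
    moreover have "(r / delta) powr gamma * (delta / r) powr gamma = 1" using r delta by (simp add: powr_mult[symmetric])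
    ultimately show ?thesis by (simp only: mult_1_left mult.commute)
   qed
   have rb: "r / (aa n - aa (Suc n)) = 4 * 2 ^ n" unfolding aa(5) using r by simp
   have "K / r * (r / (aa n - aa (Suc n))) powr pM * measure lborel S powr (1 / N) * J
    <= K / r * (4 * 2 ^ n) powr pM * (Y n * (r / delta) powr gamma) powr (1 / N) * Y n"
    unfolding rb using K r N JY J0 mS pM by (intro mult_mono powr_mono2) auto
   thus ?thesis using st(2) unfolding delta_def by linarith
  qed
  \<comment> \<open>Normalisation that makes \<open>y n\<close> dimensionless: the recursion for it
    no longer contains r or kappa.\<close>
  define c where "c = (r / kappa) powr gamma / r powr N"
  have c: "0 < c" unfolding c_def using r kappa by simp
  define y where "y n = c * Y n" for n
  have yrec: "y (Suc n) <= A * B ^ n * y n powr (1 + 1 / N)" for n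
  proof (cases "Y n = 0")
   case True
   hence "Y (Suc n) <= 0" using Yrec[of n] by simp
   hence "y (Suc n) <= 0" unfolding y_def using c by (simp add: mult_nonneg_nonpos)
   also have "0 <= A * B ^ n * y n powr (1 + 1 / N)" using A B by simp
   finally show ?thesis .
  next
   case False
   hence Yp: "0 < Y n" using Y0[of n] by simp
   have e1: "(r / (kappa / 2 ^ Suc n)) powr gamma = (r / kappa) powr gamma * (2 ^ Suc n) powr gamma"
    using powr_mult[of "r / kappa" "2 ^ Suc n" gamma] r kappa by simp
   have e2: "(Y n * (r / (kappa / 2 ^ Suc n)) powr gamma) powr (1 / N) = r * (y n powr (1 / N)) * ((2 ^ Suc n) powr gamma) powr (1 / N)"
   proof -
    have "Y n * (r / (kappa / 2 ^ Suc n)) powr gamma = r powr N * y n * (2 ^ Suc n) powr gamma"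
     unfolding e1 y_def c_def using r by simp
    thus ?thesis using r Yp c N unfolding y_def by (simp add: powr_mult powr_powr)
   qed
   have e3: "((2 ^ Suc n) powr gamma) powr (1 / N) <= (2 ^ Suc n :: real) powr pM"
   proof -
    have "gamma * (1 / N) <= pM * 1" using N gamma pM by (intro mult_mono) (auto simp: divide_le_eq)
    moreover have "(1::real) <= 2 ^ Suc n" by (rule one_le_power) simp
    ultimately have "(2 ^ Suc n :: real) powr (gamma * (1 / N)) <= (2 ^ Suc n) powr pM" by (intro powr_mono) auto
    thus ?thesis by (simp add: powr_powr)
   qed
   have "y (Suc n) <= c * (K / r * (4 * 2 ^ n) powr pM * (Y n * (r / (kappa / 2 ^ Suc n)) powr gamma) powr (1 / N) * Y n)"
    unfolding y_def using c Yrec[of n] by (intro mult_left_mono) auto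
   also have "... = K * (4 * 2 ^ n) powr pM * ((2 ^ Suc n) powr gamma) powr (1 / N) * (y n powr (1 / N) * y n)"
    unfolding e2 y_def using r by simp
   also have "... <= K * (4 * 2 ^ n) powr pM * (2 ^ Suc n) powr pM * (y n powr (1 / N) * y n)"
    using K e3 c Yp unfolding y_def by (intro mult_right_mono mult_left_mono) auto
   also have "y n powr (1 / N) * y n = y n powr (1 + 1 / N)" using c Yp unfolding y_def by (simp add: powr_add)
   also have "K * (4 * 2 ^ n) powr pM * (2 ^ Suc n) powr pM = A * (4 powr pM) ^ n"
   proof -
    have "(4 * 2 ^ n) powr pM * (2 ^ Suc n) powr pM = ((4 * 2 ^ n) * (2 ^ Suc n) :: real) powr pM" by (rule powr_mult[symmetric])
    also have "(4 * 2 ^ n) * (2 ^ Suc n) = (8 * 4 ^ n :: real)" by (simp add: power_mult_distrib[symmetric])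
    also have "(8 * 4 ^ n :: real) powr pM = 8 powr pM * (4 ^ n) powr pM" by (simp add: powr_mult)
    also have "(4 ^ n :: real) powr pM = (4 powr pM) ^ n" by (simp add: powr_realpow[symmetric] powr_powr mult.commute)
    finally show ?thesis unfolding A_def using pM by simp
   qed
   also have "A * (4 powr pM) ^ n * y n powr (1 + 1 / N) <= A * B ^ n * y n powr (1 + 1 / N)"
    unfolding B_def using A pM by (intro mult_right_mono mult_left_mono power_mono powr_mono) auto
   finally show ?thesis .
  qed
  have yn: "0 <= y n" for n unfolding y_def using c Y0 by simp
  have scale: "(t / kappa) powr gamma = (r / kappa) powr gamma * (t / r) powr gamma" if "0 <= t" for t
   using powr_mult[of "r / kappa" "t / r" gamma] r kappa that by simp
  have aa0: "aa 0 = r" unfolding aa_def by simp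
  have kk0: "kk 0 = k + kappa" unfolding kk_def by simp
  have i0: "L1_on V (%x. indicator (ball x0 r) x * (max 0 (k + kappa - u x) / kappa) powr gamma)"
   using integrable_mult_right[OF iY[of 0], of "(r / kappa) powr gamma"] unfolding aa0 kk0
   by (subst scale) (simp_all add: mult.left_commute)
  have int0: "(LINT x|lb_on V. indicator (ball x0 r) x * (max 0 (k + kappa - u x) / kappa) powr gamma) = (r / kappa) powr gamma * Y 0"
  proof -
   have "(LINT x|lb_on V. indicator (ball x0 r) x * (max 0 (k + kappa - u x) / kappa) powr gamma)
    = (LINT x|lb_on V. (r / kappa) powr gamma * (indicator (ball x0 r) x * (max 0 (k + kappa - u x) / r) powr gamma))"
    by (intro bi_integral_cong refl) (simp add: scale)
   thus ?thesis unfolding Y_def aa0 kk0 by (simp only: integral_mult_right_zero)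
  qed
  have "AE x in lborel. x \<in> ball x0 (r / 2) --> k <= u x"
   if small: "(LINT x|lb_on V. indicator (ball x0 r) x * (max 0 (k + kappa - u x) / kappa) powr gamma) <= theta * r ^ CARD('n)"
  proof -
   have "y 0 <= theta"
   proof -
    have "r powr N = r ^ CARD('n)" unfolding N_def using r by (simp add: powr_realpow)
    thus ?thesis using small r unfolding int0 y_def c_def by (simp add: divide_le_eq)
   qed
   hence lim: "y ~~> 0"
    by (intro fast_geometric_convergence[OF yn yrec A B]) (use N in \<open>simp_all add: theta_def\<close>)
   \<comment> \<open>The limit level k and the limit radius r/2 lie below every stage, so the
     integral of \<open>g\<close> is at most each \<open>Y n\<close>.\<close>
   define g where "g x = indicator (ball x0 (r / 2)) x * (max 0 (k - u x) / r) powr gamma" for x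
   have gle: "g x <= indicator (ball x0 (aa n)) x * (max 0 (kk n - u x) / r) powr gamma" for n x
   proof (cases "x \<in> ball x0 (r / 2)")
    case True
    hence "x \<in> ball x0 (aa n)" using aa(4)[of n] by auto
    moreover have "(max 0 (k - u x) / r) powr gamma <= (max 0 (kk n - u x) / r) powr gamma"
    proof (intro powr_mono2 divide_right_mono)
     have "0 < kappa / 2 ^ n" using kappa by simp
     thus "max 0 (k - u x) <= max 0 (kk n - u x)" unfolding kk_def by linarith
    qed (use r gamma in auto)
    ultimately show ?thesis using True unfolding g_def by simp
   qed (simp add: g_def)
   have g0: "0 <= g x" for x unfolding g_def by simp
   have ig: "L1_on V g"
   proof (rule bi_integrable_bound[OF iY[of 0]])
    have [measurable]: "ball x0 (r / 2) \<in> sets (lb_on V)" by (rule ball_sets_lb_on[OF bV V]) (use r in simp)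
    show "g \<in> bm_on V" unfolding g_def[abs_def] by measurable
    show "AE x in lb_on V. norm (g x) <= norm (indicator (ball x0 (aa 0)) x * (max 0 (kk 0 - u x) / r) powr gamma)"
     by (rule AE_I2, unfold real_norm_def abs_of_nonneg[OF g0], rule order_trans[OF gle abs_ge_self])
   qed
   have "(LINT x|lb_on V. g x) <= Y n" for n unfolding Y_def by (rule integral_mono[OF ig iY gle])
   hence "c * (LINT x|lb_on V. g x) <= y n" for n unfolding y_def using c by (intro mult_left_mono) auto
   hence "c * (LINT x|lb_on V. g x) <= 0" by (intro LIMSEQ_le_const[OF lim]) auto
   hence "(LINT x|lb_on V. g x) <= 0" using c by (simp add: mult_le_0_iff)
   moreover have "0 <= (LINT x|lb_on V. g x)" using g0 by (intro bi_integral_nonneg)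
   ultimately have "(LINT x|lb_on V. g x) = 0" by linarith
   hence "AE x in lb_on V. g x = 0" using integral_nonneg_eq_0_iff_AE[OF ig AE_I2[OF g0]] by simp
   hence "AE x in lborel. x \<in> V --> g x = 0" by (subst (asm) AE_restrict_space_iff) (use V in simp_all)
   thus ?thesis
   proof (rule AE_mp, intro AE_I2 impI)
    fix x assume h: "x \<in> V --> g x = 0" and x: "x \<in> ball x0 (r / 2)"
    have "x \<in> V" using x bV[of "r/2"] r by auto
    hence "(max 0 (k - u x) / r) powr gamma = 0" using h x unfolding g_def by simp
    thus "k <= u x" using r by (simp add: max_def split: if_splits)
   qed
  qed
  thus "L1_on (ball x0 (4 * r)) (%x. indicator (ball x0 r) x * (max 0 (k + kappa - u x) / kappa) powr gamma) &
   ((LINT x|lb_on (ball x0 (4 * r)). indicator (ball x0 r) x * (max 0 (k + kappa - u x) / kappa) powr gamma) <= theta * r ^ CARD('n) -->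
   (AE x in lborel. x \<in> ball x0 (r / 2) --> k <= u x))" using i0 unfolding V_def by blast
 qed
qed

text \<open>Chosen so that p deviates by at most 4 L r0 \<le> 1/8 from its value at the centre of a
  ball of radius 4 r0.\<close>

definition r0 :: real where "r0 = 1 / (32 * (L + 1))"

lemma r0: "0 < r0" "r0 <= 1"
 using L unfolding r0_def by (simp_all add: divide_le_eq)

text \<open>gamma = p(x0) - 1/4 leaves p - gamma in [1/8, 3/8]. If that value is below 1, gamma = 1
  is taken instead: then pm > 1 gives a positive lower bound for p - gamma, and p(x0) < 5/4 gives
  the upper one.\<close>

lemma exponent_exists:
 assumes r: "0 < r" "r <= r0" and sub: "cball x0 (4 * r) \<subseteq> \<Omega>"
 obtains gamma s where "1 <= gamma" "gamma <= pM" "0 < s" "!!x. x \<in> ball x0 (4 * r) ==> s <= p x - gamma & p x - gamma <= 1/2"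
proof
 have x0: "x0 \<in> \<Omega>" using subsetD[OF sub, of x0] r by simp
 define gamma where "gamma = max 1 (p x0 - 1/4)"
 define s where "s = min (1/8) (pm - 1)"
 show "1 <= gamma" "gamma <= pM" "0 < s" unfolding gamma_def s_def using pm p_bounds[OF x0] by auto
 fix x assume x: "x \<in> ball x0 (4 * r)"
 hence x\<Omega>: "x \<in> \<Omega>" using sub by auto
 have "L * norm (x - x0) <= L * (4 * r0)" using x r L by (intro mult_left_mono) (auto simp: dist_norm norm_minus_commute)
 also have "... <= 1/8" unfolding r0_def using L by (simp add: divide_simps)
 finally have "\<bar>p x - p x0\<bar> <= 1/8" using p_lipschitz[OF x\<Omega> x0] by linarith
 hence "p x - p x0 <= 1/8" "p x0 - p x <= 1/8" by linarith+
 thus "s <= p x - gamma & p x - gamma <= 1/2" unfolding gamma_def s_def using p_bounds(1)[OF x\<Omega>] pm by linarith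
qed

text \<open>With k = -kappa the upper level is 0, and the normalised integral is that of the
  negative part of u to the power gamma, divided by kappa^gamma. It falls below the threshold once
  kappa is large.\<close>

lemma local_lower_bound:
 assumes x0: "x0 \<in> \<Omega>"
 obtains r M where "0 < r" "AE x in lborel. x \<in> ball x0 r --> M <= u x"
proof (rule de_giorgi)
 fix theta assume theta: "0 < theta" and dg: "!!x0 r gamma s k kappa. 0 < r ==> r <= 1 ==> cball x0 (4 * r) \<subseteq> \<Omega> ==> 1 <= gamma ==> 0 < s ==>
   (!!x. x \<in> ball x0 (4 * r) ==> s <= p x - gamma & p x - gamma <= 1/2) ==> 0 < kappa ==>
   L1_on (ball x0 (4 * r)) (%x. indicator (ball x0 r) x * (max 0 (k + kappa - u x) / kappa) powr gamma) &
   ((LINT x|lb_on (ball x0 (4 * r)). indicator (ball x0 r) x * (max 0 (k + kappa - u x) / kappa) powr gamma) <= theta * r ^ CARD('n) -->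
   (AE x in lborel. x \<in> ball x0 (r / 2) --> k <= u x))"
 obtain R where R: "0 < R" "cball x0 R \<subseteq> \<Omega>" using open_dom x0 open_contains_cball by blast
 define r where "r = min (R / 4) r0"
 have r: "0 < r" "r <= r0" "r <= 1" unfolding r_def using R r0 by auto
 have sub: "cball x0 (4 * r) \<subseteq> \<Omega>" using R(2) subset_cball[of "4 * r" R x0] unfolding r_def by auto
 obtain gamma s where gamma: "1 <= gamma" "gamma <= pM" "0 < s" "!!x. x \<in> ball x0 (4 * r) ==> s <= p x - gamma & p x - gamma <= 1/2"
  using exponent_exists[OF r(1,2) sub] by blast
 have dg': "(LINT x|lb_on (ball x0 (4 * r)). indicator (ball x0 r) x * (max 0 (k + kappa - u x) / kappa) powr gamma) <= theta * r ^ CARD('n) ==>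
   AE x in lborel. x \<in> ball x0 (r / 2) --> k <= u x" if "0 < kappa" for k kappa
 proof -
  assume small: "(LINT x|lb_on (ball x0 (4 * r)). indicator (ball x0 r) x * (max 0 (k + kappa - u x) / kappa) powr gamma) <= theta * r ^ CARD('n)"
  show ?thesis by (rule mp[OF conjunct2[OF dg[OF r(1,3) sub gamma(1,3) _ that]] small]) (rule gamma(4))
 qed
 define I where "I = (LINT x|lb_on (ball x0 (4 * r)). indicator (ball x0 r) x * (max 0 (- u x)) powr gamma)"
 define kappa where "kappa = \<bar>I\<bar> / (theta * r ^ CARD('n)) + 1"
 have thetar: "0 < theta * r ^ CARD('n)" using theta r by simp
 have kappa: "1 <= kappa" "I <= kappa * (theta * r ^ CARD('n))"
 proof -
  show "1 <= kappa" unfolding kappa_def using thetar by simp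
  have "a <= \<bar>a\<bar> / t * t" if "0 < t" for a t :: real using that by simp
  from this[OF thetar] have "I <= \<bar>I\<bar> / (theta * r ^ CARD('n)) * (theta * r ^ CARD('n))" .
  also have "... <= kappa * (theta * r ^ CARD('n))" unfolding kappa_def using thetar by (intro mult_right_mono) auto
  finally show "I <= kappa * (theta * r ^ CARD('n))" .
 qed
 have eq: "indicator (ball x0 r) x * (max 0 (- kappa + kappa - u x) / kappa) powr gamma = (1 / kappa powr gamma) * (indicator (ball x0 r) x * (max 0 (- u x)) powr gamma)" for x
  using kappa by (simp add: powr_divide)
 have "(LINT x|lb_on (ball x0 (4 * r)). indicator (ball x0 r) x * (max 0 (- kappa + kappa - u x) / kappa) powr gamma) = (1 / kappa powr gamma) * I"
  unfolding eq I_def by (rule integral_mult_right_zero)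
 also have "... <= theta * r ^ CARD('n)"
 proof -
  have "kappa powr 1 <= kappa powr gamma" using kappa gamma by (intro powr_mono) auto
  hence "kappa * (theta * r ^ CARD('n)) <= kappa powr gamma * (theta * r ^ CARD('n))" using kappa thetar by (intro mult_right_mono) auto
  hence "I <= (theta * r ^ CARD('n)) * kappa powr gamma" using kappa by (simp add: mult.commute)
  moreover have "0 < kappa powr gamma" using kappa by simp
  ultimately show ?thesis by (simp add: pos_divide_le_eq)
 qed
 finally have "AE x in lborel. x \<in> ball x0 (r / 2) --> - kappa <= u x" using dg'[of kappa "- kappa"] kappa by simp
 thus ?thesis using that[of "r / 2" "- kappa"] r by simp
qed


section \<open>Logarithmic estimate and growth of positivity\<close>

text \<open>The Caccioppoli inequality at gamma = 0: the test function behaves like w^(1-p), and the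
  sign of the main term comes from 1 - p < 0. The bound on |Dw| / w does not depend on eps although
  w may be as small as eps/2, which is what permits logarithms of w in the growth lemma.\<close>

lemma log_energy:
 obtains K where "0 < K"
  "!!x0 r m M eps. 0 < r ==> r <= 1 ==> cball x0 (4 * r) \<subseteq> \<Omega> ==> m <= M ==> 0 < eps ==>
   (AE x in lborel. x \<in> ball x0 (4 * r) --> m <= u x & u x <= M) ==>
   \<exists>w Dw. W11 (ball x0 (4 * r)) w Dw & (\<forall>x\<in>ball x0 (4 * r). eps / 2 <= w x & w x <= M - m + eps + 1) &
    (\<forall>x t. t <= u x & t <= M --> t - m + eps <= w x) &
    (AE x in lborel. x \<in> ball x0 (4 * r) --> w x = u x - m + eps) &
    L1_on (ball x0 (4 * r)) (%x. indicator (ball x0 r) x * (norm (Dw x) / w x)) &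
    (LINT x|lb_on (ball x0 (4 * r)). indicator (ball x0 r) x * (norm (Dw x) / w x)) <= K / r * r ^ CARD('n)"
proof -
 define c where "c = (pm - 1) / 8"
 have c: "0 < c" unfolding c_def using pm by simp
 show thesis
 proof (rule powr_log_absorb[OF pm c L, of pM])
 fix C2 assume C2: "0 <= C2" and C2le: "!!p' T. pm <= p' ==> p' <= pM ==> 0 <= T ==> L * (T powr (p' - 1) * \<bar>ln T\<bar>) <= c * T powr p' + C2"
 define q where "q = nat \<lceil>\<bar>pM\<bar>\<rceil> + 2"
 have q: "\<bar>pM\<bar> <= real q" "2 <= q" unfolding q_def by linarith+
 define X where "X = max 1 (real q * 3 / c)"
 have X: "1 <= X" "real q * 3 <= c * X"
 proof -
  show "1 <= X" unfolding X_def by simp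
  have "real q * 3 / c <= X" unfolding X_def by simp
  thus "real q * 3 <= c * X" using c by (simp add: pos_divide_le_eq mult.commute)
 qed
 define C1 where "C1 = c * X powr pM + C2"
 have C1: "0 <= C1" unfolding C1_def using c C2 by simp
 define omega where "omega = unit_ball_vol (real CARD('n))"
 have omega: "0 < omega" unfolding omega_def by simp
 define K where "K = (1 + C1 / (2 * c)) * (omega * 2 ^ CARD('n))"
 have K: "0 < K" unfolding K_def using C1 c omega by (intro mult_pos_pos add_pos_nonneg) auto
 show thesis
 proof (rule that[OF K])
  fix x0 :: "real^'n" and r m M eps :: real
  assume r: "0 < r" "r <= 1" and sub: "cball x0 (4 * r) \<subseteq> \<Omega>" and mM: "m <= M" and eps: "0 < eps"
   and AEu: "AE x in lborel. x \<in> ball x0 (4 * r) --> m <= u x & u x <= M"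
  define V where "V = ball x0 (4 * r)"
  have V: "open V" "emeasure lborel V < \<infinity>" unfolding V_def by (rule open_ball) (rule emeasure_ball_less_top)
  have R: "0 < 4 * r" using r by simp
  have V\<Omega>: "x \<in> \<Omega>" if "x \<in> V" for x using that sub unfolding V_def by auto
  have spV: "x \<in> V" if "x \<in> space (lb_on V)" for x using that by (simp add: space_restrict_space)
  have pV: "pm <= p x" "p x <= pM" if "x \<in> V" for x using p_bounds[OF V\<Omega>[OF that]] by auto
  have pM1: "1 < pM" using pV[of x0] pm R unfolding V_def by simp
  note su = sobolev_u[OF R sub, folded V_def] and sp = sobolev_p[OF R sub, folded V_def]
  note c1 = W11_const[OF V, of 1]
  \<comment> \<open>Truncating slightly outside [m, M] changes u on a null set of the ball only, and
    makes w bounded and bounded away from 0 at every point.\<close>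
  define lo where "lo = m - eps / 2"
  define hi where "hi = M + 1"
  have lh: "lo < hi" unfolding lo_def hi_def using mM eps by simp
  define w where "w x = max lo (min hi (u x)) - m + eps" for x
  define Dw where "Dw x = (if lo < u x & u x < hi then Du x else 0)" for x
  have sw: "W11 V w Dw"
   by (rule W11_cong[OF W11_linear[OF W11_clamp[OF su V lh] c1 V, of 1 "eps - m"]]) (auto simp: w_def Dw_def)
  have wb: "eps / 2 <= w x" "w x <= M - m + eps + 1" for x
   using lh mM eps unfolding w_def lo_def hi_def by (auto simp: max_def min_def)
  have w0: "0 < w x" for x using wb(1)[of x] eps by linarith
  have AEw: "AE x in lb_on V. w x = u x - m + eps & Dw x = Du x"
  proof -
   have "AE x in lb_on V. m <= u x & u x <= M"
    using AEu V(1) unfolding V_def by (subst AE_restrict_space_iff) simp_all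
   thus ?thesis
    by (rule AE_mp) (intro AE_I2 impI, use eps mM in \<open>auto simp: w_def Dw_def lo_def hi_def\<close>)
  qed
  \<comment> \<open>With this theta the bound z/w \<ge> 1 - theta loses at most (pm - 1)/2 in p z/w,
    which leaves 1 - p z/w \<le> -(pm - 1)/2 = -4c.\<close>
  define theta where "theta = (pm - 1) / (2 * pM)"
  have theta: "0 < theta" "theta <= 1/2" "pM * theta = (pm - 1) / 2"
  proof -
   have "pm <= pM" using pV[of x0] R unfolding V_def by simp
   thus "0 < theta" "theta <= 1/2" "pM * theta = (pm - 1) / 2" unfolding theta_def using pm pM1 by (simp_all add: divide_le_eq)
  qed
  define delta where "delta = theta * eps / 2"
  have delta: "0 < delta" "delta <= eps / 4" unfolding delta_def using theta eps by auto
  define z where "z x = w x - delta" for x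
  have sz: "W11 V z Dw"
   by (rule W11_cong[OF W11_linear[OF sw c1 V, of 1 "- delta"]]) (auto simp: z_def)
  have zw: "z x + delta = w x" for x unfolding z_def by simp
  have z0: "0 < z x" for x using wb(1)[of x] delta eps unfolding z_def by linarith
  define Z where "Z = M - m + eps + 1"
  have zZ: "z x <= Z" for x using wb(2)[of x] delta unfolding z_def Z_def by linarith
  have Z0: "0 < Z" using zZ[of x0] z0[of x0] by linarith
  have ab: "0 < r" "r < 2 * r" using r by auto
  show "\<exists>w Dw. W11 (ball x0 (4 * r)) w Dw & (\<forall>x\<in>ball x0 (4 * r). eps / 2 <= w x & w x <= M - m + eps + 1) &
    (\<forall>x t. t <= u x & t <= M --> t - m + eps <= w x) &
    (AE x in lborel. x \<in> ball x0 (4 * r) --> w x = u x - m + eps) &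
    L1_on (ball x0 (4 * r)) (%x. indicator (ball x0 r) x * (norm (Dw x) / w x)) &
    (LINT x|lb_on (ball x0 (4 * r)). indicator (ball x0 r) x * (norm (Dw x) / w x)) <= K / r * r ^ CARD('n)"
  proof (rule smooth_cutoff[OF ab, of x0])
  fix eta Deta assume etaD: "!!x. (eta has_derivative (%h. Deta x \<bullet> h)) (at x)" "continuous_on UNIV Deta"
   and eta: "!!x. 0 <= eta x" "!!x. eta x <= 1" "!!x. x \<in> ball x0 r ==> eta x = 1"
   and eta0: "!!x. x \<notin> ball x0 (2 * r) ==> eta x = 0" "!!x. x \<notin> ball x0 (2 * r) ==> Deta x = 0" and Deta': "!!x. norm (Deta x) <= 3 / (2 * r - r)"
  have rDeta: "r * norm (Deta x) <= 3" for x using mult_left_mono[OF Deta'[of x], of r] r by simp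
  define e where "e x = eta x ^ q" for x
  have e01: "0 <= e x & e x <= 1" for x unfolding e_def using eta by (simp add: power_le_one)
  define bb where "bb x = 0 - p x" for x
  have nDw: "norm (Dw x) <= norm (Du x)" for x unfolding Dw_def by simp
  have zr: "0 <= z x / w x" "z x / w x <= 1" "1 - theta <= z x / w x" for x
  proof -
   show "0 <= z x / w x" "z x / w x <= 1" using w0[of x] z0[of x] delta unfolding z_def by simp_all
   have "delta <= theta * w x" unfolding delta_def using wb(1)[of x] theta mult_left_mono[of "eps/2" "w x" theta] by simp
   hence "(1 - theta) * w x <= z x" unfolding z_def by (simp add: algebra_simps)
   thus "1 - theta <= z x / w x" using w0[of x] by (simp add: le_divide_eq)
  qed
  have kappa: "1 + bb x * z x / w x <= - ((pm - 1) / 2)" "- (1 + pM) <= 1 + bb x * z x / w x" if x: "x \<in> V" for x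
  proof -
   have "p x * (1 - theta) <= p x * (z x / w x)" using pV[OF x] pm zr by (intro mult_left_mono) auto
   moreover have "p x * theta <= pM * theta" using pV[OF x] theta by (intro mult_right_mono) auto
   ultimately have "pm - (pm - 1) / 2 <= p x * (z x / w x)" using theta(3) pV[OF x] right_diff_distrib[of "p x" 1 theta] by linarith
   moreover have "p x * (z x / w x) <= pM * 1" using pV[OF x] pm zr[of x] by (intro mult_mono) auto
   moreover have "bb x * z x / w x = - (p x * (z x / w x))" unfolding bb_def by simp
   ultimately show "1 + bb x * z x / w x <= - ((pm - 1) / 2)" "- (1 + pM) <= 1 + bb x * z x / w x"
   proof -
    have "1 + a <= - ((pm - 1) / 2) & - (1 + pM) <= 1 + a" if "pm - (pm - 1) / 2 <= t" "t <= pM * 1" "a = - t" for a t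
     using that by (simp add: field_simps)
    note this[OF \<open>pm - (pm - 1) / 2 <= p x * (z x / w x)\<close> \<open>p x * (z x / w x) <= pM * 1\<close> \<open>bb x * z x / w x = - (p x * (z x / w x))\<close>]
    thus "1 + bb x * z x / w x <= - ((pm - 1) / 2)" "- (1 + pM) <= 1 + bb x * z x / w x" by blast+
   qed
  qed
  define T where "T x = r * norm (Dw x) / w x" for x
  define P where "P x = e x * T x powr p x" for x
  have P0: "0 <= P x" for x unfolding P_def using e01[of x] by simp
  have bV: "ball x0 (2 * r) \<subseteq> V" "ball x0 r \<subseteq> V" unfolding V_def using r by (auto intro!: subset_ball)
  note sB = ball_sets_lb_on[OF bV(1) V(1)] ball_sets_lb_on[OF bV(2) V(1)]
  have vol: "measure (lb_on V) (ball x0 t) = omega * t ^ CARD('n)" "emeasure (lb_on V) (ball x0 t) < \<infinity>" if "ball x0 t \<subseteq> V" "0 <= t" for t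
  proof -
   have "measure (lb_on V) (ball x0 t) = measure lborel (ball x0 t)" by (rule measure_restrict_space) (use V that in auto)
   thus "measure (lb_on V) (ball x0 t) = omega * t ^ CARD('n)" unfolding omega_def using content_ball[of t x0] that by simp
   have "emeasure (lb_on V) (ball x0 t) = emeasure lborel (ball x0 t)" by (rule emeasure_restrict_space) (use V that in auto)
   thus "emeasure (lb_on V) (ball x0 t) < \<infinity>" using emeasure_ball_less_top by simp
  qed
  have iB: "L1_on V (%x. indicator (ball x0 (2 * r)) x :: real)" "L1_on V (%x. indicator (ball x0 r) x :: real)"
   using sB vol(2)[OF bV(1)] vol(2)[OF bV(2)] r by simp_all
  have psl: "1 <= p x - 0" if "x \<in> ball x0 (4 * r)" for x using pV[of x] that pm unfolding V_def by simp
  have zA: "z x <= Z * (1 + \<bar>u x\<bar>)" for x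
  proof -
   have "Z * 1 <= Z * (1 + \<bar>u x\<bar>)" using Z0 by (intro mult_left_mono) auto
   thus ?thesis using zZ[of x] by linarith
  qed
  have zD: "AE x in lb_on V. if 0 < z x then Du x = 1 *R Dw x else Dw x = 0"
   using AEw by (rule AE_mp) (intro AE_I2, simp add: z0)
  have k4: "4 * c <= - 1 * (1 + (0 - p x) * z x / (z x + delta))" if "x \<in> V" for x
  proof -
   have g: "a <= - 1 * (1 + t)" if "1 + t <= - a" for a t :: real using that by simp
   have "- ((pm - 1) / 2) = - (4 * c)" unfolding c_def by simp
   hence "1 + (0 - p x) * z x / (z x + delta) <= - (4 * c)" using kappa(1)[OF that] unfolding bb_def zw by (simp only:)
   thus ?thesis by (rule g)
  qed
  have rD3: "r * norm (Deta x) <= 3" for x using rDeta .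
  have b4: "0 < 2 * r" "2 * r < 4 * r" using r by auto
  note cac = caccioppoli[OF r sub b4 order_refl zero_less_one psl delta(1) disjI1[OF refl] sz[unfolded V_def] less_imp_le[OF z0] less_imp_le[OF Z0] zA nDw zD[unfolded V_def] etaD eta(1,2) eta0 rD3 q c X C2 C2le k4[unfolded V_def], folded V_def]
  have w1: "(w x / r) powr 0 = 1" for x using w0[of x] r by simp
  have cac1: "W11 V (%x. eta x ^ q) (%x. (real q * eta x ^ (q - 1)) *R Deta x)" by (rule cac(1))
  have cac3: "L1_on V (%x. ((z x + delta) / r) powr 0 * (r * norm (Dw x) / (z x + delta)) powr p x)" by (rule cac(3))
  have cac4: "2 * c * (LINT x|lb_on V. ((z x + delta) / r) powr 0 * (eta x ^ q * (r * norm (Dw x) / (z x + delta)) powr p x))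
   <= (c * X powr pM + C2) * (LINT x|lb_on V. indicator {x \<in> ball x0 (2 * r). 0 < z x} x * ((z x + delta) / r) powr 0)" by (rule cac(4))
  have mzw [measurable]: "w \<in> bm_on V" "Dw \<in> bm_on V" "e \<in> bm_on V"
   unfolding e_def[abs_def] by (intro borel_measurable_integrable W11_integrable[OF sw] W11_integrable[OF cac1])+
  have iP: "L1_on V P"
  proof (rule bi_integrable_bound)
   show "L1_on V (%x. T x powr p x)" using cac3 unfolding zw w1 mult_1_left T_def .
   show "P \<in> bm_on V" unfolding P_def[abs_def] T_def by measurable
   show "AE x in lb_on V. norm (P x) <= norm (T x powr p x)"
    by (rule AE_I2) (use e01 P0 in \<open>auto simp: P_def abs_mult intro: mult_left_le_one_le\<close>)
  qed
  have PJ: "2 * c * (LINT x|lb_on V. P x) <= C1 * (omega * (2 * r) ^ CARD('n))"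
  proof -
   have sb: "{x \<in> ball x0 (2 * r). 0 < z x} = ball x0 (2 * r)" using z0 by auto
   have "2 * c * (LINT x|lb_on V. P x) <= C1 * (LINT x|lb_on V. indicator (ball x0 (2 * r)) x)"
    using cac4 unfolding zw w1 mult_1_left mult_1_right sb P_def T_def C1_def e_def .
   also have "(LINT x|lb_on V. indicator (ball x0 (2 * r)) x) = omega * (2 * r) ^ CARD('n)"
    using vol(1)[OF bV(1)] r sB(1) by simp
   finally show ?thesis .
  qed
  have pt: "indicator (ball x0 r) x * (norm (Dw x) / w x) <= (1 / r) * (indicator (ball x0 r) x + P x)" if x: "x \<in> V" for x
  proof (cases "x \<in> ball x0 r")
   case False thus ?thesis using P0[of x] r by simp
  next
   case True
   have e1: "e x = 1" unfolding e_def using eta(3)[OF True] by simp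
   have "T x <= 1 + T x powr p x"
   proof (cases "T x <= 1")
    case True thus ?thesis by (simp add: add_increasing2)
   next
    case False
    hence "T x powr 1 <= T x powr p x" using pV[OF x] pm by (intro powr_mono) auto
    thus ?thesis using False by simp
   qed
   hence "T x / r <= (1 + T x powr p x) / r" using r by (intro divide_right_mono) auto
   moreover have "T x / r = norm (Dw x) / w x" unfolding T_def using r by simp
   ultimately show ?thesis using True unfolding P_def e1 by simp
  qed
  have iN: "L1_on V (%x. indicator (ball x0 r) x * (norm (Dw x) / w x))"
  proof (rule bi_integrable_bound)
   show "L1_on V (%x. (1 / r) * (indicator (ball x0 r) x + P x))"
    by (intro bi_integrable_add integrable_mult_right iP iB)
   note sB [measurable]
   show "(%x. indicator (ball x0 r) x * (norm (Dw x) / w x)) \<in> bm_on V" by measurable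
   show "AE x in lb_on V. norm (indicator (ball x0 r) x * (norm (Dw x) / w x)) <= norm ((1 / r) * (indicator (ball x0 r) x + P x))"
   proof (rule AE_I2)
    fix x assume "x \<in> space (lb_on V)"
    note x = spV[OF this]
    have n: "0 <= indicator (ball x0 r) x * (norm (Dw x) / w x)" using w0[of x] by simp
    show "norm (indicator (ball x0 r) x * (norm (Dw x) / w x)) <= norm ((1 / r) * (indicator (ball x0 r) x + P x))"
     unfolding real_norm_def abs_of_nonneg[OF n] by (rule order_trans[OF pt[OF x] abs_ge_self])
   qed
  qed
  have "(LINT x|lb_on V. indicator (ball x0 r) x * (norm (Dw x) / w x)) <= (LINT x|lb_on V. (1 / r) * (indicator (ball x0 r) x + P x))"
  proof (rule integral_mono[OF iN])
   show "L1_on V (%x. (1 / r) * (indicator (ball x0 r) x + P x))"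
    by (intro bi_integrable_add integrable_mult_right iP iB)
  qed (use pt spV in blast)
  also have "... = (1 / r) * (omega * r ^ CARD('n) + (LINT x|lb_on V. P x))"
   using vol(1)[OF bV(2)] r bi_integral_add[OF iB(2) iP] sB(2) by simp
  also have "... <= (1 / r) * (omega * (2 * r) ^ CARD('n) + C1 / (2 * c) * (omega * (2 * r) ^ CARD('n)))"
  proof (intro mult_left_mono add_mono)
   show "(LINT x|lb_on V. P x) <= C1 / (2 * c) * (omega * (2 * r) ^ CARD('n))" using PJ c by (simp add: field_simps)
   show "r ^ CARD('n) <= (2 * r) ^ CARD('n)" using r by (intro power_mono) auto
  qed (use r omega in auto)
  also have "... = K / r * r ^ CARD('n)" unfolding K_def by (simp add: power_mult_distrib algebra_simps add_divide_distrib)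
  finally have main: "(LINT x|lb_on V. indicator (ball x0 r) x * (norm (Dw x) / w x)) <= K / r * r ^ CARD('n)" .
  have AEw': "AE x in lborel. x \<in> V --> w x = u x - m + eps"
  proof -
   have "AE x in lborel. x \<in> V --> w x = u x - m + eps & Dw x = Du x" using AEw V(1) by (subst (asm) AE_restrict_space_iff) simp_all
   thus ?thesis by (rule AE_mp) (intro AE_I2, simp)
  qed
  show "\<exists>w Dw. W11 (ball x0 (4 * r)) w Dw & (\<forall>x\<in>ball x0 (4 * r). eps / 2 <= w x & w x <= M - m + eps + 1) &
    (\<forall>x t. t <= u x & t <= M --> t - m + eps <= w x) &
    (AE x in lborel. x \<in> ball x0 (4 * r) --> w x = u x - m + eps) &
    L1_on (ball x0 (4 * r)) (%x. indicator (ball x0 r) x * (norm (Dw x) / w x)) &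
    (LINT x|lb_on (ball x0 (4 * r)). indicator (ball x0 r) x * (norm (Dw x) / w x)) <= K / r * r ^ CARD('n)"
   unfolding V_def[symmetric] by (intro exI[of _ w] exI[of _ Dw] conjI sw AEw' iN main ballI wb) (auto simp: w_def hi_def max_def min_def)
  qed
 qed
 qed
qed

end

lemma integral_lb_on_subset:
 fixes f :: "'a::euclidean_space => real"
 assumes "open V" "open B" "B \<subseteq> V"
 shows "(LINT x|lb_on V. indicator B x * f x) = (LINT x|lb_on B. f x)"
  and "L1_on V (%x. indicator B x * f x) \<longleftrightarrow> L1_on B f"
proof -
 have e: "indicator V x *R (indicator B x * f x) = indicator B x *R f x" for x
  using assms(3) by (auto simp: indicator_def)
 have S: "V \<inter> space lborel \<in> sets lborel" "B \<inter> space lborel \<in> sets lborel" using assms by simp_all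
 show "(LINT x|lb_on V. indicator B x * f x) = (LINT x|lb_on B. f x)"
  unfolding integral_restrict_space[OF S(1)] integral_restrict_space[OF S(2)] e ..
 show "L1_on V (%x. indicator B x * f x) \<longleftrightarrow> L1_on B f"
  unfolding integrable_restrict_space[OF S(1)] integrable_restrict_space[OF S(2)] e ..
qed

context supersol
begin

text \<open>Where u is at least the midpoint, the positive part of ln(h/w) vanishes; this being half
  of the ball, Poincare and the logarithmic estimate bound its integral independently of j. Where u
  < m + lm/2 it is at least j, so the integral in De Giorgi's lemma is O(1/j) r^N, small enough for
  large j.\<close>

lemma growth:
 obtains c where "0 < c" "c < 1"
  "!!x0 r m M. 0 < r ==> r <= r0 ==> cball x0 (4 * r) \<subseteq> \<Omega> ==> m < M ==>
   (AE x in lborel. x \<in> ball x0 (4 * r) --> m <= u x & u x <= M) ==>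
   measure lborel (ball x0 r) <= 2 * measure lborel {x \<in> ball x0 r. (m + M) / 2 <= u x} ==>
   AE x in lborel. x \<in> ball x0 (r / 2) --> m + c * (M - m) <= u x"
proof (rule de_giorgi)
 fix theta assume theta: "0 < theta" and dg: "!!x0 r gamma s k kappa. 0 < r ==> r <= 1 ==> cball x0 (4 * r) \<subseteq> \<Omega> ==> 1 <= gamma ==> 0 < s ==>
   (!!x. x \<in> ball x0 (4 * r) ==> s <= p x - gamma & p x - gamma <= 1/2) ==> 0 < kappa ==>
   L1_on (ball x0 (4 * r)) (%x. indicator (ball x0 r) x * (max 0 (k + kappa - u x) / kappa) powr gamma) &
   ((LINT x|lb_on (ball x0 (4 * r)). indicator (ball x0 r) x * (max 0 (k + kappa - u x) / kappa) powr gamma) <= theta * r ^ CARD('n) -->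
   (AE x in lborel. x \<in> ball x0 (r / 2) --> k <= u x))"
 show thesis
 proof (rule log_energy)
 fix K assume K: "0 < K" and le: "!!x0 r m M eps. 0 < r ==> r <= 1 ==> cball x0 (4 * r) \<subseteq> \<Omega> ==> m <= M ==> 0 < eps ==>
   (AE x in lborel. x \<in> ball x0 (4 * r) --> m <= u x & u x <= M) ==>
   \<exists>w Dw. W11 (ball x0 (4 * r)) w Dw & (\<forall>x\<in>ball x0 (4 * r). eps / 2 <= w x & w x <= M - m + eps + 1) &
    (\<forall>x t. t <= u x & t <= M --> t - m + eps <= w x) &
    (AE x in lborel. x \<in> ball x0 (4 * r) --> w x = u x - m + eps) &
    L1_on (ball x0 (4 * r)) (%x. indicator (ball x0 r) x * (norm (Dw x) / w x)) &
    (LINT x|lb_on (ball x0 (4 * r)). indicator (ball x0 r) x * (norm (Dw x) / w x)) <= K / r * r ^ CARD('n)"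
 define CP where "CP = (2 :: real) ^ (CARD('n) + 2)"
 have CP: "0 < CP" unfolding CP_def by simp
 \<comment> \<open>Makes 2^pM / j times the bound \<open>CP * K\<close> for the integral of v equal
   to the threshold theta.\<close>
 define j where "j = 2 powr pM * CP * K / theta"
 have j: "0 < j" unfolding j_def using CP K theta by simp
 have jj: "2 powr pM / j * (CP * K) = theta" unfolding j_def using CP K theta by simp
 \<comment> \<open>The gain is lm / 4 with lm = exp(-j) (M - m) / 2.\<close>
 define c where "c = exp (- j) / 8"
 have c: "0 < c" "c < 1" unfolding c_def using j by (simp_all add: order_less_trans[of "exp (-j)" 1])
 show thesis
 proof (rule that[OF c])
  fix x0 :: "real^'n" and r m M :: real
  assume r: "0 < r" "r <= r0" and sub: "cball x0 (4 * r) \<subseteq> \<Omega>" and mM: "m < M"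
   and AEu: "AE x in lborel. x \<in> ball x0 (4 * r) --> m <= u x & u x <= M"
   and half: "measure lborel (ball x0 r) <= 2 * measure lborel {x \<in> ball x0 r. (m + M) / 2 <= u x}"
  have r1: "r <= 1" using r r0 by linarith
  define V B where "V = ball x0 (4 * r)" and "B = ball x0 r"
  have V: "open V" "emeasure lborel V < \<infinity>" and B: "open B" "emeasure lborel B < \<infinity>" "B \<subseteq> V"
   unfolding V_def B_def using r by (auto simp: emeasure_ball_less_top[simplified])
  define h lm where "h = (M - m) / 2" and "lm = h * exp (- j)"
  have h: "0 < h" unfolding h_def using mM by simp
  have lm: "0 < lm" "0 < lm / 2" unfolding lm_def using h by simp_all
  from le[OF r(1) r1 sub less_imp_le[OF mM] lm(2) AEu, folded V_def B_def]
  obtain w Dw where sw: "W11 V w Dw" and wb: "!!x. x \<in> V ==> lm / 2 / 2 <= w x & w x <= M - m + lm / 2 + 1"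
   and wt: "!!x t. t <= u x ==> t <= M ==> t - m + lm / 2 <= w x"
   and AEw: "AE x in lborel. x \<in> V --> w x = u x - m + lm / 2"
   and iN: "L1_on V (%x. indicator B x * (norm (Dw x) / w x))"
   and N: "(LINT x|lb_on V. indicator B x * (norm (Dw x) / w x)) <= K / r * r ^ CARD('n)" by auto
  have w0: "0 < w x" if "x \<in> V" for x using wb[OF that] lm by linarith
  define v where "v x = max 0 (- ln (w x) + ln h)" for x
  define Dv where "Dv x = (if - ln (w x) + ln h > 0 then - ((1 / w x) *R Dw x) else 0)" for x
  have sv: "W11 V v Dv"
  proof -
   have d: "0 < lm / 2 / 2" "lm / 2 / 2 <= M - m + lm / 2 + 1" using lm mM by auto
   have "W11 V (%x. - 1 * ln (w x) + ln h * 1) (%x. - 1 *R ((1 / w x) *R Dw x) + ln h *R 0)"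
    by (rule W11_linear[OF W11_ln[OF sw V d wb] W11_const[OF V] V])
   from W11_max0[OF this V] show ?thesis by (rule W11_cong) (simp_all add: v_def Dv_def)
  qed
  have svB: "W11 B v Dv" by (rule W11_subset[OF sv V(1) B(1,3)])
  have v0: "0 <= v x" for x unfolding v_def by simp
  \<comment> \<open>The lower bound \<open>wt\<close> for w holds at every point, so v vanishes on
    all of \<open>Z\<close> and not merely almost everywhere.\<close>
  define Z where "Z = {x \<in> B. (m + M) / 2 <= u x}"
  have "(LINT x|lb_on B. v x) <= 2 ^ (DIM(real^'n) + 2) * r * (LINT x|lb_on B. norm (Dv x))"
   unfolding B_def
  proof (rule poincare_zero_set[OF svB[unfolded B_def] r(1) v0, of Z])
   have "Z = ball x0 r \<inter> {x. (m + M) / 2 <= u x}" unfolding Z_def B_def by auto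
   also have "... \<in> sets borel" using borel_measurable_iff_ge[THEN iffD1, OF meas(2), rule_format, of "(m + M) / 2"] by (intro sets.Int) simp_all
   finally show "Z \<in> sets borel" .
   show "Z \<subseteq> ball x0 r" unfolding Z_def B_def by auto
   show "measure lborel (ball x0 r) <= 2 * measure lborel Z" using half unfolding Z_def B_def .
   show "v x = 0" if "x \<in> Z" for x
   proof -
    have "(m + M) / 2 - m + lm / 2 <= w x" by (rule wt) (use that mM in \<open>auto simp: Z_def\<close>)
    moreover have "(m + M) / 2 - m = h" unfolding h_def by (simp add: field_simps)
    ultimately have "h <= w x" using lm by linarith
    hence "ln h <= ln (w x)" using h by simp
    thus ?thesis unfolding v_def by simp
   qed
  qed
  also have "... <= 2 ^ (DIM(real^'n) + 2) * r * (K / r * r ^ CARD('n))"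
  proof (rule mult_left_mono)
   have "(LINT x|lb_on B. norm (Dv x)) <= (LINT x|lb_on B. norm (Dw x) / w x)"
   proof (rule integral_mono)
    show "L1_on B (%x. norm (Dv x))" by (intro integrable_norm W11_integrable[OF svB])
    show "L1_on B (%x. norm (Dw x) / w x)" using iN unfolding integral_lb_on_subset(2)[OF V(1) B(1,3)] .
    fix x assume "x \<in> space (lb_on B)"
    hence "x \<in> V" using B by (auto simp: space_restrict_space)
    thus "norm (Dv x) <= norm (Dw x) / w x" unfolding Dv_def using w0[of x] by simp
   qed
   also have "... <= K / r * r ^ CARD('n)" using N unfolding integral_lb_on_subset(1)[OF V(1) B(1,3)] .
   finally show "(LINT x|lb_on B. norm (Dv x)) <= K / r * r ^ CARD('n)" .
  qed (use r in simp)
  also have "... = CP * K * r ^ CARD('n)" unfolding CP_def using r by simp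
  finally have Iv: "(LINT x|lb_on B. v x) <= CP * K * r ^ CARD('n)" .
  obtain gamma s where gamma: "1 <= gamma" "gamma <= pM" "0 < s" "!!x. x \<in> ball x0 (4 * r) ==> s <= p x - gamma & p x - gamma <= 1/2"
   using exponent_exists[OF r sub] by blast
  have kappa: "0 < lm / 4" using lm by simp
  have dg': "L1_on V (%x. indicator B x * (max 0 (m + lm / 4 + lm / 4 - u x) / (lm / 4)) powr gamma) &
   ((LINT x|lb_on V. indicator B x * (max 0 (m + lm / 4 + lm / 4 - u x) / (lm / 4)) powr gamma) <= theta * r ^ CARD('n) -->
   (AE x in lborel. x \<in> ball x0 (r / 2) --> m + lm / 4 <= u x))"
   unfolding V_def B_def by (rule dg[OF r(1) r1 sub gamma(1,3) _ kappa]) (rule gamma(4))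
  have "(LINT x|lb_on V. indicator B x * (max 0 (m + lm / 4 + lm / 4 - u x) / (lm / 4)) powr gamma)
   <= (LINT x|lb_on V. 2 powr pM / j * (indicator B x * v x))"
  proof (rule integral_mono_AE)
   show "L1_on V (%x. 2 powr pM / j * (indicator B x * v x))"
    by (intro integrable_mult_right) (simp add: integral_lb_on_subset(2)[OF V(1) B(1,3)] W11_integrable[OF svB])
   have "AE x in lborel. x \<in> V --> m <= u x" using AEu unfolding V_def by (rule AE_mp) (intro AE_I2, simp)
   hence "AE x in lb_on V. m <= u x & w x = u x - m + lm / 2"
    using AEw V(1) by (simp add: AE_restrict_space_iff)
   thus "AE x in lb_on V. indicator B x * (max 0 (m + lm / 4 + lm / 4 - u x) / (lm / 4)) powr gamma <= 2 powr pM / j * (indicator B x * v x)"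
   proof (rule AE_mp, intro AE_I2 impI)
    fix x assume sp: "x \<in> space (lb_on V)" and H: "m <= u x & w x = u x - m + lm / 2"
    have x: "x \<in> V" using sp by (simp add: space_restrict_space)
    have R0: "0 <= 2 powr pM / j * (indicator B x * v x)" using j v0[of x] by simp
    show "indicator B x * (max 0 (m + lm / 4 + lm / 4 - u x) / (lm / 4)) powr gamma <= 2 powr pM / j * (indicator B x * v x)"
    proof (cases "x \<in> B & u x < m + lm / 2")
     case False
     hence "indicator B x * (max 0 (m + lm / 4 + lm / 4 - u x) / (lm / 4)) powr gamma = 0"
      by (cases "x \<in> B") (auto simp: max_def)
     thus ?thesis using R0 by linarith
    next
     case True
     have "w x <= lm" using H True by linarith
     hence "ln (w x) <= ln lm" using w0[OF x] lm by simp
     also have "... = ln h - j" unfolding lm_def using h by (simp add: ln_mult)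
     finally have vj: "j <= v x" unfolding v_def by linarith
     have "max 0 (m + lm / 4 + lm / 4 - u x) / (lm / 4) <= 2" using H lm by (simp add: divide_le_eq max_def)
     hence "(max 0 (m + lm / 4 + lm / 4 - u x) / (lm / 4)) powr gamma <= 2 powr gamma" using lm gamma by (intro powr_mono2) auto
     also have "... <= 2 powr pM" using gamma by (intro powr_mono) auto
     also have "... = 2 powr pM / j * j" using j by simp
     also have "... <= 2 powr pM / j * v x" using vj j by (intro mult_left_mono) auto
     finally show ?thesis using True by simp
    qed
   qed
  qed (use dg' in blast)
  also have "... = 2 powr pM / j * (LINT x|lb_on B. v x)"
   by (simp only: integral_mult_right_zero integral_lb_on_subset(1)[OF V(1) B(1,3)])
  also have "... <= 2 powr pM / j * (CP * K * r ^ CARD('n))" using j by (intro mult_left_mono Iv) auto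
  also have "... = theta * r ^ CARD('n)" unfolding jj[symmetric] by simp
  finally have "AE x in lborel. x \<in> ball x0 (r / 2) --> m + lm / 4 <= u x" using dg' by blast
  moreover have "m + lm / 4 = m + c * (M - m)" unfolding lm_def h_def c_def by simp
  ultimately show "AE x in lborel. x \<in> ball x0 (r / 2) --> m + c * (M - m) <= u x" by simp
 qed
 qed
qed

end

section \<open>Oscillation decay and the continuous representative\<close>

text \<open>By Lindelof countably many of the open sets cover, so their exceptional null sets may be
  united.\<close>

lemma AE_locally:
 fixes M :: "'a::{metric_space, second_countable_topology} measure"
 assumes "!!x. x \<in> \<Omega> ==> \<exists>r>0. AE y in M. y \<in> ball x r --> P y"
 shows "AE y in M. y \<in> \<Omega> --> P y"
proof -
 define F where "F = {U. open U & (AE y in M. y \<in> U --> P y)}"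
 have "!!S. S \<in> F ==> open S" unfolding F_def by blast
 then obtain F' where F': "F' \<subseteq> F" "countable F'" "\<Union>F' = \<Union>F" using Lindelof[of F] by metis
 have "AE y in M. \<forall>U\<in>F'. y \<in> U --> P y"
  using F' by (subst AE_ball_countable) (auto simp: F_def)
 thus ?thesis
 proof (rule AE_mp, intro AE_I2 impI)
  fix y assume H: "\<forall>U\<in>F'. y \<in> U --> P y" and y: "y \<in> \<Omega>"
  obtain r where "r > 0" "AE z in M. z \<in> ball y r --> P z" using assms[OF y] by blast
  hence "ball y r \<in> F" "y \<in> ball y r" unfolding F_def by auto
  thus "P y" using F'(3) H by blast
 qed
qed

lemma lborel_ball_not_null:
 assumes "0 < r" "AE y in lborel. y \<in> ball (x::'a::euclidean_space) r --> P y"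
 obtains y where "y \<in> ball x r" "P y"
proof -
 have "\<not> (AE y in lborel. y \<notin> ball x r)"
 proof
  assume "AE y in lborel. y \<notin> ball x r"
  hence "ball x r \<in> null_sets lborel" by (subst AE_iff_null_sets) auto
  hence "emeasure lborel (ball x r) = 0" by auto
  hence "measure lborel (ball x r) = 0" by (simp add: measure_def)
  moreover have "0 < measure lborel (ball x r)" using content_ball[of r x] assms(1) by simp
  ultimately show False by simp
 qed
 moreover have "AE y in lborel. y \<notin> ball x r" if "!!y. y \<in> ball x r ==> \<not> P y"
  using assms(2) by (rule AE_mp) (intro AE_I2, use that in blast)
 ultimately show thesis using that by blast
qed

text \<open>v(x) is the lower essential limit of u at x, the supremum of the almost everywhere lower
  bounds valid near x. Bounds of u on a ball pass to v at each of its points, so small essential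
  oscillation gives continuity and equality with u almost everywhere.\<close>

lemma continuous_representative:
 fixes u :: "'a::euclidean_space => real"
 assumes osc: "!!x e. x \<in> \<Omega> ==> 0 < e ==> \<exists>r>0. \<exists>m. AE y in lborel. y \<in> ball x r --> m <= u y & u y <= m + e"
 obtains v where "continuous_on \<Omega> v" "AE y in lborel. y \<in> \<Omega> --> v y = u y"
proof -
 define S where "S x = {a. \<exists>r>0. AE y in lborel. y \<in> ball x r --> a <= u y}" for x
 define v where "v x = Sup (S x)" for x
 have vb: "m <= v x & v x <= m + e" if x: "x \<in> ball x0 r" and ae: "AE y in lborel. y \<in> ball x0 r --> m <= u y & u y <= m + e" for x x0 r m e
 proof -
  obtain t where t: "t > 0" "ball x t \<subseteq> ball x0 r" using x open_ball openE by blast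
  have ae': "AE y in lborel. y \<in> ball x t --> m <= u y & u y <= m + e" using ae by (rule AE_mp) (intro AE_I2, use t in blast)
  hence "AE y in lborel. y \<in> ball x t --> m <= u y" by (rule AE_mp) (intro AE_I2, blast)
  hence mS: "m \<in> S x" unfolding S_def using t by blast
  have ub: "a <= m + e" if a: "a \<in> S x" for a
  proof -
   obtain q where q: "q > 0" "AE y in lborel. y \<in> ball x q --> a <= u y" using a unfolding S_def by blast
   have "AE y in lborel. y \<in> ball x (min q t) --> a <= m + e"
    using q(2) ae' by (rule AE_mp[OF _ AE_mp]) (intro AE_I2, force)
   then obtain y where "y \<in> ball x (min q t)" "a <= m + e" by (rule lborel_ball_not_null[rotated]) (use q t in auto)
   thus ?thesis by blast
  qed
  have "m <= v x" unfolding v_def using mS ub by (intro cSup_upper bdd_aboveI)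
  moreover have "v x <= m + e" unfolding v_def using mS ub by (intro cSup_least) auto
  ultimately show ?thesis by blast
 qed
 have "continuous_on \<Omega> v"
  unfolding continuous_on_iff
 proof (intro ballI allI impI)
  fix x and e :: real assume x: "x \<in> \<Omega>" and e: "0 < e"
  then obtain r m where r: "r > 0" "AE y in lborel. y \<in> ball x r --> m <= u y & u y <= m + e/2" using osc[of x "e/2"] by auto
  have "dist (v y) (v x) < e" if "dist y x < r" for y
  proof -
   have "y \<in> ball x r" "x \<in> ball x r" using that r by (simp_all add: dist_commute)
   hence "m <= v y & v y <= m + e/2" "m <= v x & v x <= m + e/2" using vb[OF _ r(2)] by blast+
   thus ?thesis using e unfolding dist_real_def by linarith
  qed
  thus "\<exists>d>0. \<forall>x'\<in>\<Omega>. dist x' x < d --> dist (v x') (v x) < e" using r(1) by blast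
 qed
 moreover have "AE y in lborel. y \<in> \<Omega> --> v y = u y"
 proof -
  have "AE y in lborel. y \<in> \<Omega> --> \<bar>v y - u y\<bar> <= e" if e: "0 < e" for e
  proof (rule AE_locally)
   fix x assume "x \<in> \<Omega>"
   then obtain r m where r: "r > 0" "AE y in lborel. y \<in> ball x r --> m <= u y & u y <= m + e" using osc e by blast
   have "AE y in lborel. y \<in> ball x r --> \<bar>v y - u y\<bar> <= e"
    using r(2)
   proof (rule AE_mp, intro AE_I2 impI)
    fix y assume "y \<in> ball x r --> m <= u y & u y <= m + e" and y: "y \<in> ball x r"
    thus "\<bar>v y - u y\<bar> <= e" using vb[OF y r(2)] by (simp add: abs_le_iff)
   qed
   thus "\<exists>r>0. AE y in lborel. y \<in> ball x r --> \<bar>v y - u y\<bar> <= e" using r(1) by blast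
  qed
  hence "AE y in lborel. \<forall>k. y \<in> \<Omega> --> \<bar>v y - u y\<bar> <= 1 / real (Suc k)" by (subst AE_all_countable) simp
  thus ?thesis
  proof (rule AE_mp, intro AE_I2 impI)
   fix y assume H: "\<forall>k. y \<in> \<Omega> --> \<bar>v y - u y\<bar> <= 1 / real (Suc k)" and "y \<in> \<Omega>"
   hence h: "\<bar>v y - u y\<bar> <= 1 / real (Suc k)" for k by blast
   have "\<bar>v y - u y\<bar> <= 0"
    by (rule LIMSEQ_le_const[OF LIMSEQ_Suc[OF lim_1_over_n]]) (use h in auto)
   thus "v y = u y" by simp
  qed
 qed
 ultimately show thesis by (rule that)
qed

text \<open>One of the sets where u is above or below the midpoint fills half of the ball, so the
  growth lemma for u or for -u cuts the oscillation by the factor 1 - c. The lower bounds for u and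
  -u supply the finite oscillation that starts the iteration.\<close>

lemma solution_continuous_representative:
 assumes "supersol \<Omega> p u Du Dp L pm pM" "supersol \<Omega> p (%x. - u x) Du' Dp' L pm pM"
 obtains v where "continuous_on \<Omega> v" "AE y in lborel. y \<in> \<Omega> --> v y = u y"
proof -
 note obtained = that
 interpret A: supersol \<Omega> p u Du Dp L pm pM by fact
 interpret B: supersol \<Omega> p "%x. - u x" Du' Dp' L pm pM by fact
 have um: "u \<in> borel_measurable borel" by (rule A.meas)
 show thesis
 proof (rule A.growth)
 fix c1 assume c1: "0 < c1" "c1 < 1" and g1: "!!x0 r m M. 0 < r ==> r <= A.r0 ==> cball x0 (4 * r) \<subseteq> \<Omega> ==> m < M ==>
   (AE x in lborel. x \<in> ball x0 (4 * r) --> m <= u x & u x <= M) ==>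
   measure lborel (ball x0 r) <= 2 * measure lborel {x \<in> ball x0 r. (m + M) / 2 <= u x} ==>
   AE x in lborel. x \<in> ball x0 (r / 2) --> m + c1 * (M - m) <= u x"
 show thesis
 proof (rule B.growth)
 fix c2 assume c2: "0 < c2" "c2 < 1" and g2: "!!x0 r m M. 0 < r ==> r <= A.r0 ==> cball x0 (4 * r) \<subseteq> \<Omega> ==> m < M ==>
   (AE x in lborel. x \<in> ball x0 (4 * r) --> m <= - u x & - u x <= M) ==>
   measure lborel (ball x0 r) <= 2 * measure lborel {x \<in> ball x0 r. (m + M) / 2 <= - u x} ==>
   AE x in lborel. x \<in> ball x0 (r / 2) --> m + c2 * (M - m) <= - u x"
 define c where "c = min c1 c2"
 have c: "0 < c" "c < 1" "c <= c1" "c <= c2" unfolding c_def using c1 c2 by auto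
 have decay: "\<exists>m' M'. m' <= M' & M' - m' <= (1 - c) * (M - m) & (AE x in lborel. x \<in> ball x0 (r / 2) --> m' <= u x & u x <= M')"
  if r: "0 < r" "r <= A.r0" and sub: "cball x0 (4 * r) \<subseteq> \<Omega>" and mM: "m <= M"
   and ae: "AE x in lborel. x \<in> ball x0 (4 * r) --> m <= u x & u x <= M" for x0 r m M
 proof -
  have ae2: "AE x in lborel. x \<in> ball x0 (r / 2) --> m <= u x & u x <= M"
   using ae by (rule AE_mp) (intro AE_I2, use r in auto)
  consider "m = M" | "m < M" using mM by linarith
  thus ?thesis
  proof cases
   case 1 thus ?thesis using ae2 by (intro exI[of _ m] exI[of _ M]) simp
  next
   case 2
   note lt = 2
   \<comment> \<open>\<open>S2\<close> is written for -u, whose essential bounds are -M and -m, so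
     that the growth lemma applies to it literally.\<close>
   define S1 S2 where "S1 = {x \<in> ball x0 r. (m + M) / 2 <= u x}" and "S2 = {x \<in> ball x0 r. (- M + - m) / 2 <= - u x}"
   have Sm: "S1 \<in> sets lborel" "S2 \<in> sets lborel"
   proof -
    have "S1 = ball x0 r \<inter> {x. (m + M) / 2 <= u x}" "S2 = ball x0 r \<inter> {x. u x <= (m + M) / 2}"
     unfolding S1_def S2_def by (auto simp: field_simps)
    moreover have "{x. (m + M) / 2 <= u x} \<in> sets borel" "{x. u x <= (m + M) / 2} \<in> sets borel"
     using borel_measurable_iff_ge[THEN iffD1, OF um, rule_format, of "(m + M) / 2"]
      borel_measurable_iff_le[THEN iffD1, OF um, rule_format, of "(m + M) / 2"] by simp_all
    ultimately show "S1 \<in> sets lborel" "S2 \<in> sets lborel" by auto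
   qed
   have Sf: "S1 \<subseteq> ball x0 r" "S2 \<subseteq> ball x0 r" unfolding S1_def S2_def by auto
   have fm: "S \<in> fmeasurable lborel" if "S \<in> sets lborel" "S \<subseteq> ball x0 r" for S
    by (rule fmeasurableI2[of "ball x0 r"]) (use that in \<open>auto simp: fmeasurable_def emeasure_ball_less_top[simplified]\<close>)
   have "ball x0 r \<subseteq> S1 \<union> S2" unfolding S1_def S2_def by (auto simp: field_simps)
   hence "measure lborel (ball x0 r) <= measure lborel (S1 \<union> S2)"
    using Sm Sf by (intro measure_mono_fmeasurable fm) auto
   also have "... <= measure lborel S1 + measure lborel S2" by (rule measure_Un_le[OF Sm])
   finally consider "measure lborel (ball x0 r) <= 2 * measure lborel S1" | "measure lborel (ball x0 r) <= 2 * measure lborel S2" by linarith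
   thus ?thesis
   proof cases
    case 1
    have "AE x in lborel. x \<in> ball x0 (r / 2) --> m + c1 * (M - m) <= u x" by (rule g1[OF r sub lt ae 1[unfolded S1_def]])
    hence "AE x in lborel. x \<in> ball x0 (r / 2) --> m + c * (M - m) <= u x & u x <= M"
     using ae2
    proof (rule AE_mp[OF _ AE_mp], intro AE_I2 impI)
     fix x assume "x \<in> ball x0 (r / 2) --> m <= u x & u x <= M" "x \<in> ball x0 (r / 2) --> m + c1 * (M - m) <= u x" "x \<in> ball x0 (r / 2)"
     moreover have "c * (M - m) <= c1 * (M - m)" using c mM by (intro mult_right_mono) auto
     ultimately show "m + c * (M - m) <= u x & u x <= M" by linarith
    qed
    moreover have "m + c * (M - m) <= M" using mult_right_mono[of c 1 "M - m"] c mM by simp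
    ultimately show ?thesis by (intro exI[of _ "m + c * (M - m)"] exI[of _ M]) (simp add: algebra_simps)
   next
    case 2
    have "AE x in lborel. x \<in> ball x0 (r / 2) --> - M + c2 * (- m - - M) <= - u x"
     by (rule g2[OF r sub _ _ 2[unfolded S2_def]]) (use lt ae in auto)
    hence "AE x in lborel. x \<in> ball x0 (r / 2) --> m <= u x & u x <= M - c * (M - m)"
     using ae2
    proof (rule AE_mp[OF _ AE_mp], intro AE_I2 impI)
     fix x assume "x \<in> ball x0 (r / 2) --> m <= u x & u x <= M" "x \<in> ball x0 (r / 2) --> - M + c2 * (- m - - M) <= - u x" "x \<in> ball x0 (r / 2)"
     moreover have "c * (M - m) <= c2 * (M - m)" using c mM by (intro mult_right_mono) auto
     moreover have "- m - - M = M - m" by simp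
     ultimately show "m <= u x & u x <= M - c * (M - m)" by auto
    qed
    moreover have "m <= M - c * (M - m)" using mult_right_mono[of c 1 "M - m"] c mM by simp
    ultimately show ?thesis by (intro exI[of _ m] exI[of _ "M - c * (M - m)"]) (simp add: algebra_simps)
   qed
  qed
 qed
 show thesis
 proof (rule continuous_representative[of \<Omega> u])
  show thesis if "continuous_on \<Omega> v" "AE y in lborel. y \<in> \<Omega> --> v y = u y" for v by (rule obtained[OF that])
  fix x0 and e :: real assume x0: "x0 \<in> \<Omega>" and e: "0 < e"
  obtain r1 m1 where r1: "0 < r1" "AE x in lborel. x \<in> ball x0 r1 --> m1 <= u x" by (rule A.local_lower_bound[OF x0])
  obtain r2 m2 where r2: "0 < r2" "AE x in lborel. x \<in> ball x0 r2 --> m2 <= - u x" by (rule B.local_lower_bound[OF x0])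
  obtain r3 where r3: "0 < r3" "cball x0 r3 \<subseteq> \<Omega>" using A.open_dom x0 open_contains_cball by blast
  define r where "r = min (min (r1 / 4) (r2 / 4)) (min (r3 / 4) A.r0)"
  have r: "0 < r" "4 * r <= r1" "4 * r <= r2" "4 * r <= r3" "r <= A.r0" unfolding r_def using r1 r2 r3 A.r0 by auto
  define M1 where "M1 = max m1 (- m2)"
  have base: "AE x in lborel. x \<in> ball x0 (4 * r) --> m1 <= u x & u x <= M1"
   using r1(2) r2(2)
  proof (rule AE_mp[OF _ AE_mp], intro AE_I2 impI)
   fix x assume "x \<in> ball x0 r2 --> m2 <= - u x" "x \<in> ball x0 r1 --> m1 <= u x" "x \<in> ball x0 (4 * r)"
   thus "m1 <= u x & u x <= M1" using r unfolding M1_def by auto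
  qed
  \<comment> \<open>One decay step leads from radius 4r to r/2, hence the powers of 8.\<close>
  have it: "\<exists>m M. m <= M & M - m <= (1 - c) ^ n * (M1 - m1) & (AE x in lborel. x \<in> ball x0 (4 * (r / 8 ^ n)) --> m <= u x & u x <= M)" for n
  proof (induction n)
   case 0
   thus ?case using base by (intro exI[of _ m1] exI[of _ M1]) (simp add: M1_def)
  next
   case (Suc n)
   then obtain m M where mM: "m <= M" "M - m <= (1 - c) ^ n * (M1 - m1)" "AE x in lborel. x \<in> ball x0 (4 * (r / 8 ^ n)) --> m <= u x & u x <= M" by blast
   have rn: "r / 8 ^ n <= r" using r(1) by (simp add: divide_le_eq)
   have "cball x0 (4 * (r / 8 ^ n)) \<subseteq> cball x0 r3" using rn r by (intro subset_cball) linarith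
   hence sub: "cball x0 (4 * (r / 8 ^ n)) \<subseteq> \<Omega>" using r3 by blast
   have "0 < r / 8 ^ n" "r / 8 ^ n <= A.r0" using r rn by (simp, linarith)
   from decay[OF this sub mM(1,3)] obtain m' M' where m': "m' <= M'" "M' - m' <= (1 - c) * (M - m)" "AE x in lborel. x \<in> ball x0 (r / 8 ^ n / 2) --> m' <= u x & u x <= M'" by blast
   have "M' - m' <= (1 - c) * ((1 - c) ^ n * (M1 - m1))" using m'(2) mult_left_mono[OF mM(2), of "1 - c"] c by linarith
   hence d: "M' - m' <= (1 - c) ^ Suc n * (M1 - m1)" by (simp add: mult.assoc)
   have e: "4 * (r / 8 ^ Suc n) = r / 8 ^ n / 2" by simp
   show ?case unfolding e using m'(1,3) d by (intro exI[of _ m'] exI[of _ M'] conjI)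
  qed
  have "(%n. (1 - c) ^ n * (M1 - m1)) ~~> 0 * (M1 - m1)"
   by (intro tendsto_mult LIMSEQ_power_zero tendsto_const) (use c in simp)
  hence "\<forall>\<^sub>F n in sequentially. (1 - c) ^ n * (M1 - m1) < e" using e by (intro order_tendstoD(2)[where y=0]) auto
  then obtain n where n: "(1 - c) ^ n * (M1 - m1) < e" by (auto simp: eventually_sequentially)
  obtain m M where mM: "M - m <= (1 - c) ^ n * (M1 - m1)" "AE x in lborel. x \<in> ball x0 (4 * (r / 8 ^ n)) --> m <= u x & u x <= M" using it[of n] by blast
  have "AE x in lborel. x \<in> ball x0 (4 * (r / 8 ^ n)) --> m <= u x & u x <= m + e"
   using mM(2) by (rule AE_mp) (intro AE_I2, use mM(1) n in force)
  thus "\<exists>r>0. \<exists>m. AE y in lborel. y \<in> ball x0 r --> m <= u y & u y <= m + e"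
   using r(1) by (intro exI[of _ "4 * (r / 8 ^ n)"]) auto
 qed
 qed
 qed
qed

section \<open>Comparison with quadratic functions\<close>

definition pflux :: "real => 'a::real_inner => 'a" where
 "pflux p xi = norm xi powr (p - 2) *R xi"

text \<open>For xi \<noteq> 0, the derivative of \<open>pflux\<close> with respect to p. Both fluxes
  are 0 at xi = 0, which agrees with the convention for the integrand where Du = 0.\<close>

definition plogflux :: "real => 'a::real_inner => 'a" where
 "plogflux p xi = (norm xi powr (p - 2) * ln (norm xi)) *R xi"

lemma norm_line_has_derivative:
 fixes q d :: "'a::real_inner"
 assumes "q + t *R d \<noteq> 0"
 shows "((%t. norm (q + t *R d)) has_real_derivative ((q + t *R d) \<bullet> d) / norm (q + t *R d)) (at t)"
proof -
 have l: "((%t. q + t *R d) has_derivative (%h. h *R d)) (at t)" by (auto intro!: derivative_eq_intros)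
 have n: "(norm has_derivative (%h. sgn (q + t *R d) \<bullet> h)) (at (q + t *R d))"
  using has_derivative_norm[OF assms] by (simp add: inner_commute)
 have "((%t. norm (q + t *R d)) has_derivative (%h. sgn (q + t *R d) \<bullet> (h *R d))) (at t)"
  by (rule has_derivative_compose[OF l n])
 moreover have "(%h. sgn (q + t *R d) \<bullet> (h *R d)) = (*) (((q + t *R d) \<bullet> d) / norm (q + t *R d))"
  by (rule ext) (simp add: sgn_div_norm divide_inverse mult.commute mult.left_commute)
 ultimately show ?thesis unfolding has_field_derivative_def by simp
qed

text \<open>Cauchy-Schwarz reduces the claim to monotonicity of t^(p-1) applied to the two
  norms.\<close>

lemma pflux_monotone:
 fixes x y :: "'a::real_inner"
 assumes p: "1 < p"
 shows "0 <= (pflux p x - pflux p y) \<bullet> (x - y)"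
proof -
 have s: "norm z powr (p - 2) * (norm z * norm z) = norm z powr (p - 1) * norm z" for z :: 'a
  by (cases "z = 0") (simp_all add: powr_diff power2_eq_square)
 have c: "norm z powr (p - 2) * (z \<bullet> z') <= norm z powr (p - 1) * norm z'" for z z' :: 'a
 proof -
  have "norm z powr (p - 2) * (z \<bullet> z') <= norm z powr (p - 2) * (norm z * norm z')"
   using norm_cauchy_schwarz[of z z'] by (intro mult_left_mono) auto
  also have "... = norm z powr (p - 1) * norm z'"
   by (cases "z = 0") (simp_all add: powr_diff power2_eq_square)
  finally show ?thesis .
 qed
 have "0 <= (norm x powr (p - 1) - norm y powr (p - 1)) * (norm x - norm y)"
 proof (cases "norm x <= norm y")
  case True
  hence "norm x powr (p - 1) <= norm y powr (p - 1)" using p by (intro powr_mono2) auto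
  thus ?thesis using True by (simp add: mult_nonpos_nonpos)
 next
  case False
  hence "norm y powr (p - 1) <= norm x powr (p - 1)" using p by (intro powr_mono2) auto
  thus ?thesis using False by simp
 qed
 also have "... = norm x powr (p - 1) * norm x + norm y powr (p - 1) * norm y - norm x powr (p - 1) * norm y - norm y powr (p - 1) * norm x"
  by (simp add: algebra_simps)
 also have "... <= norm x powr (p - 2) * (norm x * norm x) + norm y powr (p - 2) * (norm y * norm y)
   - norm x powr (p - 2) * (x \<bullet> y) - norm y powr (p - 2) * (y \<bullet> x)"
  using c[of x y] c[of y x] s[of x] s[of y] by linarith
 also have "... = (pflux p x - pflux p y) \<bullet> (x - y)"
  unfolding pflux_def by (simp add: inner_diff_left inner_diff_right inner_commute[of y x] norm_eq_sqrt_inner algebra_simps)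
 finally show ?thesis .
qed

text \<open>Mean value theorem on the segment from q to q + d, for the flux paired with d minus zeta
  times the logarithmic flux paired with w; |d| \<le> a/2 keeps the segment away from 0. The
  derivative has a quadratic part of at least min(1, p-1) |d|^2, and the rest is linear in |d|.
  \<open>n\<close> is the norm at the intermediate point.\<close>

lemma pflux_near:
 fixes q d w :: "'a::real_inner"
 assumes p: "1 < p" and a: "0 < a" "a <= norm q" "norm q <= b" and d: "norm d <= a / 2" and w: "norm w <= L"
  and zeta: "0 <= zeta" and Lam: "!!n. a / 2 <= n ==> n <= b + a / 2 ==> \<bar>ln n\<bar> <= Lam"
 shows "\<exists>n. a / 2 <= n & n <= b + a / 2 &
  n powr (p - 2) * (min 1 (p - 1) * (norm d)\<^sup>2 - zeta * (L * (\<bar>p - 2\<bar> * Lam + 1 + Lam)) * norm d)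
   <= (pflux p (q + d) - pflux p q) \<bullet> d - zeta * ((plogflux p (q + d) - plogflux p q) \<bullet> w)"
proof -
 define z where "z t = q + t *R d" for t
 define n where "n t = norm (z t)" for t
 have nb: "a / 2 <= n t & n t <= b + a / 2" if "0 <= t" "t <= 1" for t
 proof -
  have td: "norm (t *R d) <= a / 2" using d that mult_mono[of t 1 "norm d" "a / 2"] a by simp
  have "norm q - norm (t *R d) <= n t" unfolding n_def z_def by (metis norm_diff_ineq)
  moreover have "n t <= norm q + norm (t *R d)" unfolding n_def z_def by (rule norm_triangle_ineq)
  ultimately show ?thesis using td a by linarith
 qed
 define H where "H t = n t powr (p - 2) * (z t \<bullet> d - zeta * (ln (n t) * (z t \<bullet> w)))" for t
 define s tau where "s t = (z t \<bullet> d) / n t" and "tau t = (z t \<bullet> w) / n t" for t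
 define Q where "Q t = d \<bullet> d + (p - 2) * (s t)\<^sup>2 - zeta * ((p - 2) * s t * ln (n t) * tau t + s t * tau t + ln (n t) * (d \<bullet> w))" for t
 have HD: "(H has_real_derivative n t powr (p - 2) * Q t) (at t)" if t: "0 <= t" "t <= 1" for t
 proof -
  have n0: "0 < n t" using nb[OF t] a by linarith
  hence z0: "q + t *R d \<noteq> 0" unfolding n_def z_def by auto
  have dn: "(n has_real_derivative s t) (at t)"
   unfolding n_def[abs_def] s_def z_def[abs_def] by (rule norm_line_has_derivative[OF z0])
  have dz: "((%t. z t \<bullet> y) has_real_derivative d \<bullet> y) (at t)" for y
   unfolding z_def[abs_def] has_field_derivative_def by (auto intro!: derivative_eq_intros simp: fun_eq_iff mult.commute)
  have dp: "((%t. n t powr (p - 2)) has_real_derivative (p - 2) * n t powr (p - 2 - 1) * s t) (at t)"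
   by (rule DERIV_chain2[OF has_real_derivative_powr[OF n0] dn])
  have dl: "((%t. ln (n t)) has_real_derivative 1 / n t * s t) (at t)"
   by (rule DERIV_chain2[OF DERIV_ln_divide[OF n0] dn])
  have A: "z t \<bullet> d = s t * n t" "z t \<bullet> w = tau t * n t" unfolding s_def tau_def using n0 by simp_all
  have B: "n t powr (p - 2 - 1) = n t powr (p - 2) / n t" using n0 powr_diff[of "n t" "p - 2" 1] by simp
  have alg: "((p - 2) * (N / m) * s) * (s * m - zeta * (l * (t * m))) + (e - zeta * (1 / m * s * (t * m) + f * l)) * N
   = N * (e + (p - 2) * s\<^sup>2 - zeta * ((p - 2) * s * l * t + s * t + l * f))" if "0 < m" for N m s l t e f :: real
   using that by (simp add: field_simps power2_eq_square)
  have "(H has_real_derivative ((p - 2) * n t powr (p - 2 - 1) * s t) * (z t \<bullet> d - zeta * (ln (n t) * (z t \<bullet> w)))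
    + (d \<bullet> d - zeta * (1 / n t * s t * (z t \<bullet> w) + d \<bullet> w * ln (n t))) * n t powr (p - 2)) (at t)"
   unfolding H_def[abs_def]
   by (rule DERIV_mult[OF dp DERIV_diff[OF dz DERIV_cmult[OF DERIV_mult[OF dl dz]]]])
  thus ?thesis unfolding A B alg[OF n0] Q_def .
 qed
 obtain t where t: "0 < t" "t < 1" "H 1 - H 0 = (1 - 0) * (n t powr (p - 2) * Q t)"
  using MVT2[of 0 1 H "%t. n t powr (p - 2) * Q t"] HD by auto
 have t': "0 <= t" "t <= 1" using t by auto
 have n0: "0 < n t" using nb[OF t'] a by linarith
 have "\<bar>z t \<bullet> y\<bar> <= n t * norm y" for y unfolding n_def by (rule Cauchy_Schwarz_ineq2)
 hence cs: "\<bar>(z t \<bullet> y) / n t\<bar> <= norm y" for y using n0 by (simp add: divide_le_eq mult.commute)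
 have s: "\<bar>s t\<bar> <= norm d" and tau: "\<bar>tau t\<bar> <= L" unfolding s_def tau_def using cs[of d] cs[of w] w by auto
 have L: "0 <= L" using w norm_ge_zero[of w] by linarith
 have Lam0: "\<bar>ln (n t)\<bar> <= Lam" using Lam nb[OF t'] by blast
 hence Lam1: "0 <= Lam" by linarith
 have e1: "\<bar>(p - 2) * s t * ln (n t) * tau t\<bar> <= \<bar>p - 2\<bar> * norm d * Lam * L"
  unfolding abs_mult using s tau Lam0 Lam1 L by (intro mult_mono) auto
 have e2: "\<bar>s t * tau t\<bar> <= norm d * L" unfolding abs_mult using s tau L by (intro mult_mono) auto
 have e3: "\<bar>ln (n t) * (d \<bullet> w)\<bar> <= Lam * (norm d * L)"
 proof -
  have "\<bar>d \<bullet> w\<bar> <= norm d * norm w" by (rule Cauchy_Schwarz_ineq2)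
  also have "... <= norm d * L" using w by (intro mult_left_mono) auto
  finally show ?thesis unfolding abs_mult using Lam0 Lam1 by (intro mult_mono) auto
 qed
 have "(p - 2) * s t * ln (n t) * tau t + s t * tau t + ln (n t) * (d \<bullet> w) <= \<bar>p - 2\<bar> * norm d * Lam * L + norm d * L + Lam * (norm d * L)"
  using e1 e2 e3 by linarith
 also have "... = L * (\<bar>p - 2\<bar> * Lam + 1 + Lam) * norm d" by (simp add: algebra_simps)
 finally have e: "zeta * ((p - 2) * s t * ln (n t) * tau t + s t * tau t + ln (n t) * (d \<bullet> w)) <= zeta * (L * (\<bar>p - 2\<bar> * Lam + 1 + Lam) * norm d)"
  by (rule mult_left_mono[OF _ zeta])
 \<comment> \<open>Since |s| \<le> |d|, a negative factor p - 2 can consume at most (2 - p)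
   |d|^2.\<close>
 have "min 1 (p - 1) * (norm d)\<^sup>2 <= d \<bullet> d + (p - 2) * (s t)\<^sup>2"
 proof -
  have s2: "(s t)\<^sup>2 <= (norm d)\<^sup>2" using s by (simp add: abs_le_square_iff[symmetric])
  show ?thesis
  proof (cases "2 <= p")
   case True
   hence "0 <= (p - 2) * (s t)\<^sup>2" by simp
   thus ?thesis using True by (simp add: power2_norm_eq_inner)
  next
   case False
   hence "(p - 2) * (norm d)\<^sup>2 <= (p - 2) * (s t)\<^sup>2" using s2 by (simp add: mult_left_mono_neg)
   moreover have "min 1 (p - 1) = 1 + (p - 2)" using False by simp
   ultimately show ?thesis by (simp only: power2_norm_eq_inner distrib_right)
  qed
 qed
 hence "min 1 (p - 1) * (norm d)\<^sup>2 - zeta * (L * (\<bar>p - 2\<bar> * Lam + 1 + Lam)) * norm d <= Q t"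
  unfolding Q_def using e by (simp add: mult.assoc)
 hence "n t powr (p - 2) * (min 1 (p - 1) * (norm d)\<^sup>2 - zeta * (L * (\<bar>p - 2\<bar> * Lam + 1 + Lam)) * norm d) <= H 1 - H 0"
  unfolding t(3) by (simp add: mult_left_mono)
 moreover have "H 1 - H 0 = (pflux p (q + d) - pflux p q) \<bullet> d - zeta * ((plogflux p (q + d) - plogflux p q) \<bullet> w)"
  unfolding H_def n_def z_def pflux_def plogflux_def by (simp add: inner_diff_left inner_add_left algebra_simps)
 ultimately show ?thesis using nb[OF t'] by metis
qed

text \<open>Near q the gain is quadratic and the loss is zeta times linear in |xi - q|, so
  completing the square leaves K zeta^2. Far from q the monotone part has a positive lower bound and
  grows like |xi|^p, and therefore outweighs the logarithmic flux as soon as zeta is small.\<close>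

lemma pflux_comparison:
 fixes pm pM a b L :: real
 assumes pm: "1 < pm" and a: "0 < a" "a <= b" and L: "0 <= L"
 obtains K zeta0 where "0 <= K" "0 < zeta0"
  "!!p zeta q xi w :: 'a::real_inner. pm <= p ==> p <= pM ==> a <= norm q ==> norm q <= b ==> norm w <= L ==> 0 <= zeta ==> zeta <= zeta0 ==>
   zeta * ((plogflux p xi - plogflux p q) \<bullet> w) <= (pflux p xi - pflux p q) \<bullet> (xi - q) + K * zeta\<^sup>2"
proof (rule powr_log_absorb[OF pm zero_less_one L, of pM])
 fix C2 assume C2: "0 <= C2" and C2le: "!!p T. pm <= p ==> p <= pM ==> 0 <= T ==> L * (T powr (p - 1) * \<bar>ln T\<bar>) <= 1 * T powr p + C2"
 define Lam where "Lam = max \<bar>ln (a / 2)\<bar> \<bar>ln (b + a / 2)\<bar>"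
 have Lam: "\<bar>ln n\<bar> <= Lam" if "a / 2 <= n" "n <= b + a / 2" for n
 proof -
  have "ln (a / 2) <= ln n" "ln n <= ln (b + a / 2)" using that a by simp_all
  thus ?thesis unfolding Lam_def by linarith
 qed
 have Lam0: "0 <= Lam" unfolding Lam_def by simp
 \<comment> \<open>Both |p - 2| and |ln n| are bounded on the annulus, so n^(p-2) lies between
   exp(-S) and exp S there.\<close>
 define S where "S = (\<bar>pM\<bar> + 2) * Lam"
 have nS: "exp (- S) <= n powr (p - 2) & n powr (p - 2) <= exp S" if "a / 2 <= n" "n <= b + a / 2" "pm <= p" "p <= pM" for n p
 proof -
  have "\<bar>(p - 2) * ln n\<bar> <= S" unfolding S_def abs_mult using Lam[OF that(1,2)] that pm by (intro mult_mono) auto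
  moreover have "n powr (p - 2) = exp ((p - 2) * ln n)" unfolding powr_def using that a by auto
  ultimately show ?thesis by (simp add: abs_le_iff)
 qed
 define mu where "mu = min 1 (pm - 1)"
 have mu: "0 < mu" unfolding mu_def using pm by simp
 define C where "C = L * ((\<bar>pM\<bar> + 2) * Lam + 1 + Lam)"
 have C: "0 <= C" unfolding C_def using L Lam0 by simp
 \<comment> \<open>C^2 / (4 mu) is the cost of completing the square in mu |d|^2 - zeta C
   |d|.\<close>
 define K where "K = exp S * (C\<^sup>2 / (4 * mu))"
 have K: "0 <= K" unfolding K_def using mu by simp
 define m1 where "m1 = exp (- S) * (mu * (a / 2)\<^sup>2)"
 have m1: "0 < m1" unfolding m1_def using mu a by simp
 define b1 where "b1 = max 1 b powr \<bar>pM\<bar>"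
 have b1: "0 < b1" unfolding b1_def by simp
 have qb1: "n powr (p - 1) <= b1" if "0 <= n" "n <= b" "pm <= p" "p <= pM" for n p
 proof -
  have "n powr (p - 1) <= max 1 b powr (p - 1)" using that pm by (intro powr_mono2) auto
  also have "... <= b1" unfolding b1_def using that pm by (intro powr_mono) auto
  finally show ?thesis .
 qed
 \<comment> \<open>For T beyond this size each of the two mixed terms in the product of flux
   difference and d is at most T^p / 4.\<close>
 define X where "X = max (max 1 (4 * b)) ((4 * b1) powr (1 / (pm - 1)))"
 have X: "1 <= X" "4 * b <= X" "(4 * b1) powr (1 / (pm - 1)) <= X" unfolding X_def by auto
 have Xpm: "4 * b1 <= X powr (pm - 1)"
 proof -
  have "((4 * b1) powr (1 / (pm - 1))) powr (pm - 1) <= X powr (pm - 1)" using X pm by (intro powr_mono2) auto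
  moreover have "((4 * b1) powr (1 / (pm - 1))) powr (pm - 1) = 4 * b1" unfolding powr_powr using pm b1 by simp
  ultimately show ?thesis by simp
 qed
 define C3 where "C3 = X powr \<bar>pM\<bar>"
 have C3: "0 < C3" unfolding C3_def using X by simp
 \<comment> \<open>Weight of a convex combination of the two lower bounds T^p / 2 - C3 and m1 for
   the monotone part; it keeps a share of T^p and a positive constant at once.\<close>
 define theta where "theta = min (1 / 4) (m1 / (4 * C3))"
 have theta: "0 < theta" "theta <= 1 / 4" "theta * C3 <= m1 / 4"
 proof -
  show "0 < theta" "theta <= 1 / 4" unfolding theta_def using m1 C3 by simp_all
  have "theta <= m1 / (4 * C3)" unfolding theta_def by simp
  thus "theta * C3 <= m1 / 4" using C3 by (simp add: field_simps)
 qed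
 define D where "D = C2 + L * (b1 * Lam) + 1"
 have D: "0 < D" unfolding D_def using C2 L b1 Lam0 by (intro add_nonneg_pos add_nonneg_nonneg mult_nonneg_nonneg) auto
 define zeta0 where "zeta0 = min (theta / 2) (m1 / (2 * D))"
 have zeta0: "0 < zeta0" "zeta0 <= theta / 2" "zeta0 * D <= m1 / 2"
 proof -
  show "0 < zeta0" "zeta0 <= theta / 2" unfolding zeta0_def using m1 D theta by simp_all
  have "zeta0 <= m1 / (2 * D)" unfolding zeta0_def by simp
  thus "zeta0 * D <= m1 / 2" using D by (simp add: field_simps)
 qed
 show thesis
 proof (rule that[OF K zeta0(1)])
  fix p zeta :: real and q xi w :: 'a
  assume p: "pm <= p" "p <= pM" and q: "a <= norm q" "norm q <= b" and w: "norm w <= L" and zeta: "0 <= zeta" "zeta <= zeta0"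
  have p1: "1 < p" using p pm by linarith
  have mup: "mu <= min 1 (p - 1)" unfolding mu_def using p by auto
  define d where "d = xi - q"
  define M where "M = (pflux p xi - pflux p q) \<bullet> d"
  show "zeta * ((plogflux p xi - plogflux p q) \<bullet> w) <= (pflux p xi - pflux p q) \<bullet> (xi - q) + K * zeta\<^sup>2"
  proof (cases "norm d <= a / 2")
   case True
   have "\<exists>n. a / 2 <= n & n <= b + a / 2 &
    n powr (p - 2) * (min 1 (p - 1) * (norm d)\<^sup>2 - zeta * (L * (\<bar>p - 2\<bar> * Lam + 1 + Lam)) * norm d)
     <= (pflux p (q + d) - pflux p q) \<bullet> d - zeta * ((plogflux p (q + d) - plogflux p q) \<bullet> w)"
    by (rule pflux_near[OF p1 a(1) q True w zeta(1) Lam])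
   then obtain n where n: "a / 2 <= n" "n <= b + a / 2" and le: "n powr (p - 2) * (min 1 (p - 1) * (norm d)\<^sup>2 - zeta * (L * (\<bar>p - 2\<bar> * Lam + 1 + Lam)) * norm d)
     <= M - zeta * ((plogflux p xi - plogflux p q) \<bullet> w)" unfolding M_def d_def by auto
   have c: "L * (\<bar>p - 2\<bar> * Lam + 1 + Lam) <= C" unfolding C_def using L Lam0 p p1
    by (intro mult_left_mono add_mono mult_right_mono order_refl) auto
   have "0 <= (2 * mu * norm d - zeta * C)\<^sup>2" by simp
   hence "- (zeta\<^sup>2 * (C\<^sup>2 / (4 * mu))) <= mu * (norm d)\<^sup>2 - zeta * C * norm d"
    using mu by (simp add: power2_eq_square field_simps)
   also have "... <= min 1 (p - 1) * (norm d)\<^sup>2 - zeta * (L * (\<bar>p - 2\<bar> * Lam + 1 + Lam)) * norm d"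
    using mup c zeta by (intro diff_mono mult_right_mono mult_left_mono) auto
   finally have 1: "- (zeta\<^sup>2 * (C\<^sup>2 / (4 * mu))) <= min 1 (p - 1) * (norm d)\<^sup>2 - zeta * (L * (\<bar>p - 2\<bar> * Lam + 1 + Lam)) * norm d" .
   have "n powr (p - 2) * (zeta\<^sup>2 * (C\<^sup>2 / (4 * mu))) <= exp S * (zeta\<^sup>2 * (C\<^sup>2 / (4 * mu)))"
    using nS[OF n p] mu by (intro mult_right_mono) auto
   moreover have "n powr (p - 2) * (- (zeta\<^sup>2 * (C\<^sup>2 / (4 * mu)))) <= M - zeta * ((plogflux p xi - plogflux p q) \<bullet> w)"
    by (rule order_trans[OF mult_left_mono[OF 1] le]) simp
   ultimately have "zeta * ((plogflux p xi - plogflux p q) \<bullet> w) <= M + exp S * (zeta\<^sup>2 * (C\<^sup>2 / (4 * mu)))" by simp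
   thus ?thesis unfolding M_def d_def K_def by (simp add: mult.commute mult.left_commute)
  next
   case False
   hence dn: "a / 2 < norm d" "0 < norm d" using a by auto
   \<comment> \<open>Marks the point of the segment at distance a/2 from q. The increment of the
     flux up to it is bounded below by the near estimate, the remaining one is nonnegative by
     monotonicity.\<close>
   define t where "t = (a / 2) / norm d"
   have t: "0 < t" "t < 1" unfolding t_def using dn a by (simp_all add: divide_less_eq)
   have ntd: "norm (t *R d) = a / 2" unfolding t_def using dn a by simp
   define eta where "eta = q + t *R d"
   \<comment> \<open>With zeta = 0 and w = 0 the near estimate is plain strong monotonicity.\<close>
   have "\<exists>n. a / 2 <= n & n <= b + a / 2 &
    n powr (p - 2) * (min 1 (p - 1) * (norm (t *R d))\<^sup>2 - 0 * (0 * (\<bar>p - 2\<bar> * Lam + 1 + Lam)) * norm (t *R d))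
     <= (pflux p (q + t *R d) - pflux p q) \<bullet> (t *R d) - 0 * ((plogflux p (q + t *R d) - plogflux p q) \<bullet> 0)"
    by (rule pflux_near[OF p1 a(1) q eq_refl[OF ntd] _ order_refl Lam]) simp
   then obtain n where n: "a / 2 <= n" "n <= b + a / 2" and le: "n powr (p - 2) * (min 1 (p - 1) * (a / 2)\<^sup>2) <= t * ((pflux p eta - pflux p q) \<bullet> d)"
    unfolding eta_def ntd by auto
   have "m1 <= n powr (p - 2) * (min 1 (p - 1) * (a / 2)\<^sup>2)"
    unfolding m1_def using nS[OF n p] mup mu by (intro mult_mono mult_right_mono) auto
   hence mt: "m1 <= t * ((pflux p eta - pflux p q) \<bullet> d)" using le by linarith
   hence "0 < (pflux p eta - pflux p q) \<bullet> d" using m1 t by (metis less_le_trans zero_less_mult_pos)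
   hence "t * ((pflux p eta - pflux p q) \<bullet> d) <= (pflux p eta - pflux p q) \<bullet> d" using t by simp
   moreover have "0 <= (pflux p xi - pflux p eta) \<bullet> d"
   proof -
    have "xi - eta = (1 - t) *R d" unfolding eta_def d_def by (simp add: algebra_simps)
    hence "0 <= (1 - t) * ((pflux p xi - pflux p eta) \<bullet> d)" using pflux_monotone[OF p1, of xi eta] by simp
    thus ?thesis using t by (simp add: zero_le_mult_iff)
   qed
   moreover have "M = (pflux p xi - pflux p eta) \<bullet> d + (pflux p eta - pflux p q) \<bullet> d" unfolding M_def by (simp add: inner_diff_left)
   ultimately have M1: "m1 <= M" using mt by linarith
   define T where "T = norm xi"
   have T: "0 <= T" unfolding T_def by simp
   have M2: "T powr p / 2 - C3 <= M"
   proof (cases "T <= X")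
    case True
    hence "T powr p <= X powr p" using T p1 by (intro powr_mono2) auto
    also have "... <= C3" unfolding C3_def using X p by (intro powr_mono) auto
    finally show ?thesis using M1 m1 C3 by linarith
   next
    case False
    hence TX: "X <= T" "1 <= T" "0 < T" "4 * b <= T" using X by auto
    have T1: "T powr p = T powr (p - 1) * T" "T powr p = T powr (p - 2) * (T * T)"
     using TX by (simp_all add: powr_diff power2_eq_square)
    have "4 * b1 <= T powr (p - 1)"
    proof -
     have "X powr (pm - 1) <= X powr (p - 1)" using X p by (intro powr_mono) auto
     also have "... <= T powr (p - 1)" using TX X p1 by (intro powr_mono2) auto
     finally show ?thesis using Xpm by linarith
    qed
    hence i1: "b1 * T <= T powr p / 4" unfolding T1(1) using TX mult_right_mono[of "4 * b1" "T powr (p - 1)" T] by simp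
    have i2: "T powr (p - 1) * b <= T powr p / 4" unfolding T1(1) using TX mult_left_mono[of "4 * b" T "T powr (p - 1)"] by simp
    have i3: "norm xi powr (p - 2) * (xi \<bullet> q) <= T powr (p - 1) * b"
    proof -
     have "xi \<bullet> q <= T * b" unfolding T_def using norm_cauchy_schwarz[of xi q] mult_left_mono[OF q(2), of "norm xi"] by simp
     hence "T powr (p - 2) * (xi \<bullet> q) <= T powr (p - 2) * (T * b)" by (rule mult_left_mono) simp
     also have "... = T powr (p - 1) * b" using TX by (simp add: powr_diff power2_eq_square)
     finally show ?thesis unfolding T_def .
    qed
    have i4: "norm q powr (p - 2) * (q \<bullet> xi) <= b1 * T"
    proof -
     have q0: "0 < norm q" using q a by linarith
     have "norm q powr (p - 2) * (q \<bullet> xi) <= norm q powr (p - 2) * (norm q * T)"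
      unfolding T_def using norm_cauchy_schwarz[of q xi] by (intro mult_left_mono) auto
     also have "... = norm q powr (p - 1) * T" using q0 by (simp add: powr_diff power2_eq_square)
     also have "... <= b1 * T" using qb1[OF _ q(2) p] T by (intro mult_right_mono) auto
     finally show ?thesis .
    qed
    have "M = norm xi powr (p - 2) * (xi \<bullet> xi) + norm q powr (p - 2) * (q \<bullet> q) - norm xi powr (p - 2) * (xi \<bullet> q) - norm q powr (p - 2) * (q \<bullet> xi)"
     unfolding M_def d_def pflux_def by (simp add: inner_diff_left inner_diff_right inner_commute algebra_simps)
    moreover have "norm xi powr (p - 2) * (xi \<bullet> xi) = T powr p" using T1(2) unfolding T_def dot_square_norm power2_eq_square by simp
    moreover have "0 <= norm q powr (p - 2) * (q \<bullet> q)" by simp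
    ultimately show ?thesis using i1 i2 i3 i4 C3 by linarith
   qed
   have M3: "theta / 2 * T powr p + m1 / 2 <= M"
   proof -
    have "theta * (T powr p / 2 - C3) + (1 - theta) * m1 <= theta * M + (1 - theta) * M"
     using M1 M2 theta by (intro add_mono mult_left_mono) auto
    moreover have "theta * m1 <= 1 / 4 * m1" using theta m1 by (intro mult_right_mono) auto
    ultimately show ?thesis using theta(3) by (simp add: algebra_simps)
   qed
   have pl: "norm (plogflux p z) = norm z powr (p - 1) * \<bar>ln (norm z)\<bar>" for z :: 'a
    unfolding plogflux_def by (cases "z = 0") (simp_all add: abs_mult powr_diff power2_eq_square)
   have "norm (plogflux p q) <= b1 * Lam"
    unfolding pl using qb1[OF _ q(2) p] Lam[of "norm q"] q a b1 by (intro mult_mono) auto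
   hence "L * norm (plogflux p q) <= L * (b1 * Lam)" by (rule mult_left_mono[OF _ L])
   moreover have "L * norm (plogflux p xi) <= T powr p + C2" unfolding pl using C2le[OF p norm_ge_zero[of xi]] unfolding T_def by simp
   moreover have "(plogflux p xi - plogflux p q) \<bullet> w <= L * norm (plogflux p xi) + L * norm (plogflux p q)"
   proof -
    have "(plogflux p xi - plogflux p q) \<bullet> w <= norm (plogflux p xi - plogflux p q) * norm w" by (rule norm_cauchy_schwarz)
    also have "... <= (norm (plogflux p xi) + norm (plogflux p q)) * L" using w L by (intro mult_mono norm_triangle_ineq4) auto
    finally show ?thesis by (simp add: algebra_simps)
   qed
   ultimately have "(plogflux p xi - plogflux p q) \<bullet> w <= T powr p + D" unfolding D_def by linarith
   hence "zeta * ((plogflux p xi - plogflux p q) \<bullet> w) <= zeta * (T powr p + D)" using zeta(1) by (rule mult_left_mono)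
   also have "... <= zeta0 * (T powr p + D)" using zeta(2) D by (intro mult_right_mono add_nonneg_nonneg) auto
   also have "... <= theta / 2 * T powr p + m1 / 2"
    using zeta0(3) mult_right_mono[OF zeta0(2), of "T powr p"] by (simp add: distrib_left)
   also have "... <= M" by (rule M3)
   finally have "zeta * ((plogflux p xi - plogflux p q) \<bullet> w) <= M" .
   moreover have "0 <= K * zeta\<^sup>2" using K by simp
   ultimately show ?thesis unfolding M_def d_def by linarith
  qed
 qed
qed

lemma W11_cong_AE:
 assumes s: "W11 V f g" and ae: "AE x in lb_on V. f x = f' x" "AE x in lb_on V. g x = g' x"
  and m: "f' \<in> bm_on V" "g' \<in> bm_on V"
 shows "W11 V f' g'"
proof -
 note i = W11_integrable[OF s]
 have [measurable]: "f \<in> bm_on V" "g \<in> bm_on V" by (intro borel_measurable_integrable i)+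
 note m [measurable]
 have 1: "L1_on V f'" using i(1) integrable_cong_AE[OF _ m(1) ae(1)] by simp
 have 2: "L1_on V g'" using i(2) integrable_cong_AE[OF _ m(2) ae(2)] by simp
 have a: "(LINT x|lb_on V. norm (F x - f x)) = (LINT x|lb_on V. norm (F x - f' x))" if "L1_on V F" for F :: "'a => real"
 proof -
  have [measurable]: "F \<in> bm_on V" using that by simp
  show ?thesis by (rule integral_cong_AE) (use ae(1) in \<open>auto elim!: AE_mp\<close>)
 qed
 have b: "(LINT x|lb_on V. norm (G x - g x)) = (LINT x|lb_on V. norm (G x - g' x))" if "L1_on V G" for G :: "'a => 'a"
 proof -
  have [measurable]: "G \<in> bm_on V" using that by simp
  show ?thesis by (rule integral_cong_AE) (use ae(2) in \<open>auto elim!: AE_mp\<close>)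
 qed
 show ?thesis unfolding W11_def
 proof (intro conjI 1 2 allI impI)
  fix e :: real assume "0 < e"
  then obtain F G where FG: "C1_on V F G" "L1_on V F" "L1_on V G"
   "(LINT x|lb_on V. norm (F x - f x)) < e" "(LINT x|lb_on V. norm (G x - g x)) < e"
   using s unfolding W11_def by blast
  show "\<exists>F G. C1_on V F G & L1_on V F & L1_on V G &
   (LINT x|lb_on V. norm (F x - f' x)) < e & (LINT x|lb_on V. norm (G x - g' x)) < e"
   using FG(1,2,3) FG(4)[unfolded a[OF FG(2)]] FG(5)[unfolded b[OF FG(3)]] by blast
 qed
qed

text \<open>f and g vanish outside the ball of radius rho, so \<open>psi\<close> may be multiplied
  by a cutoff equal to 1 there. Thus any C1 function, a constant in particular, can serve as if it
  had compact support.\<close>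

lemma W11_ibp_supported:
 fixes f :: "'a::euclidean_space => real"
 assumes s: "W11 (ball x R) f g" and rho: "0 < rho" "rho < R"
  and z: "!!y. y \<in> ball x R ==> y \<notin> ball x rho ==> f y = 0 & g y = 0"
  and Dpsi: "!!y. (psi has_derivative (%h. Dpsi y \<bullet> h)) (at y)" and cD: "continuous_on UNIV Dpsi"
 shows "(LINT y|lb_on (ball x R). f y * (Dpsi y \<bullet> h)) = - (LINT y|lb_on (ball x R). (g y \<bullet> h) * psi y)"
proof -
 define b where "b = (rho + R) / 2"
 have b: "rho < b" "b < R" unfolding b_def using rho by auto
 show ?thesis
 proof (rule smooth_cutoff[OF rho(1) b(1), of x])
  fix eta Deta assume etaD: "!!x. (eta has_derivative (%h. Deta x \<bullet> h)) (at x)" "continuous_on UNIV Deta"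
   and eta1: "!!y. y \<in> ball x rho ==> eta y = 1" and eta0: "!!y. y \<notin> ball x b ==> eta y = 0"
  have D0: "Deta y = 0" if y: "y \<in> ball x rho" for y
  proof -
   have "((%_. 1) has_derivative (%h. Deta y \<bullet> h)) (at y)"
    by (rule has_derivative_transform_within_open[OF etaD(1) open_ball y]) (rule eta1)
   hence "(%h. Deta y \<bullet> h) = (%h. 0)" by (rule has_derivative_unique) (rule has_derivative_const)
   hence "Deta y \<bullet> Deta y = 0" by metis
   thus ?thesis by simp
  qed
  have c: "continuous_on UNIV eta" "continuous_on UNIV psi"
   by (intro continuous_at_imp_continuous_on ballI has_derivative_continuous[OF etaD(1)] has_derivative_continuous[OF Dpsi])+
  define phi Dphi where "phi y = psi y * eta y" and "Dphi y = psi y *R Deta y + eta y *R Dpsi y" for y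
  have Dphi: "(phi has_derivative (%h. Dphi y \<bullet> h)) (at y)" for y
   using has_derivative_mult[OF Dpsi etaD(1)] unfolding phi_def[abs_def] Dphi_def by (simp add: inner_add_left mult.commute)
  have cDphi: "continuous_on UNIV Dphi" unfolding Dphi_def[abs_def] by (intro continuous_intros c cD etaD(2))
  have K: "compact (cball x b)" "cball x b \<subseteq> ball x R" using b by auto
  have z': "phi y = 0" if "y \<notin> cball x b" for y using eta0[of y] that unfolding phi_def by auto
  have "(LINT y|lb_on (ball x R). f y * (Dphi y \<bullet> h)) = - (LINT y|lb_on (ball x R). (g y \<bullet> h) * phi y)"
   by (rule W11_integration_by_parts[OF s open_ball Dphi cDphi K z'])
  moreover have "(LINT y|lb_on (ball x R). f y * (Dphi y \<bullet> h)) = (LINT y|lb_on (ball x R). f y * (Dpsi y \<bullet> h))"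
  proof (rule bi_integral_cong[OF refl])
   fix y assume "y \<in> space (lb_on (ball x R))"
   hence "y \<in> ball x R" by (simp add: space_restrict_space)
   thus "f y * (Dphi y \<bullet> h) = f y * (Dpsi y \<bullet> h)" using D0[of y] z[of y] eta1[of y] unfolding Dphi_def by (cases "y \<in> ball x rho") simp_all
  qed
  moreover have "(LINT y|lb_on (ball x R). (g y \<bullet> h) * phi y) = (LINT y|lb_on (ball x R). (g y \<bullet> h) * psi y)"
  proof (rule bi_integral_cong[OF refl])
   fix y assume "y \<in> space (lb_on (ball x R))"
   hence "y \<in> ball x R" by (simp add: space_restrict_space)
   thus "(g y \<bullet> h) * phi y = (g y \<bullet> h) * psi y" using eta1[of y] z[of y] unfolding phi_def by (cases "y \<in> ball x rho") simp_all
  qed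
  ultimately show ?thesis by simp
 qed
qed

lemma W11_gradient_integral_zero:
 fixes f :: "'a::euclidean_space => real"
 assumes s: "W11 (ball x R) f g" and rho: "0 < rho" "rho < R"
  and z: "!!y. y \<in> ball x R ==> y \<notin> ball x rho ==> f y = 0 & g y = 0"
 shows "(LINT y|lb_on (ball x R). g y \<bullet> h) = 0"
proof -
 have "((%_. 1) has_derivative (%h. 0 \<bullet> h)) (at y)" for y :: 'a by simp
 from W11_ibp_supported[OF s rho z this continuous_on_const, of h] show ?thesis by simp
qed

section \<open>The viscosity inequality at a touching point\<close>

lemma symmetric_matrix_inner:
 fixes Y :: "real^'n^'n"
 assumes "transpose Y = Y"
 shows "(Y *v a) \<bullet> b = a \<bullet> (Y *v b)"
 by (metis assms dot_lmul_matrix inner_commute vector_transpose_matrix)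

context supersol
begin

text \<open>The divergence of zeta |q|^(p-2) q integrates to 0, q being the gradient of a quadratic
  function. Differentiating the exponent yields |q|^(p-2) ln |q| (q \<bullet> Dp), which is the
  lower order term of the equation; what remains is |q|^(p-2) times the normalized operator, free of
  \<open>Dp\<close>. Since p is only Lipschitz, the product is differentiated within
  \<open>W11\<close>, component by component.\<close>

lemma flux_identity:
 fixes Y :: "real^'n^'n" and eta x0 :: "real^'n"
 defines "q \<equiv> %y. eta + Y *v (y - x0)"
 assumes Y: "transpose Y = Y" and rho: "0 < rho" "rho < R" and sub: "cball x0 R \<subseteq> \<Omega>" and a: "0 < a"
  and qb: "!!y. y \<in> ball x0 R ==> a <= norm (q y) & norm (q y) <= b"
  and szeta: "W11 (ball x0 R) zeta Dzeta" and zetab: "!!y. y \<in> ball x0 R ==> \<bar>zeta y\<bar> <= Z"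
  and z: "!!y. y \<in> ball x0 R ==> y \<notin> ball x0 rho ==> zeta y = 0 & Dzeta y = 0"
 shows "L1_on (ball x0 R) (%y. pflux (p y) (q y) \<bullet> Dzeta y + zeta y * (plogflux (p y) (q y) \<bullet> Dp y))" (is ?A)
  and "L1_on (ball x0 R) (%y. zeta y * (norm (q y) powr (p y - 2) * F_norm p y (q y) Y))" (is ?B)
  and "(LINT y|lb_on (ball x0 R). pflux (p y) (q y) \<bullet> Dzeta y + zeta y * (plogflux (p y) (q y) \<bullet> Dp y))
   = (LINT y|lb_on (ball x0 R). zeta y * (norm (q y) powr (p y - 2) * F_norm p y (q y) Y))" (is ?C)
proof -
 define V where "V = ball x0 R"
 have V: "open V" "emeasure lborel V < \<infinity>" unfolding V_def by (rule open_ball) (rule emeasure_ball_less_top)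
 note qb = qb[folded V_def] and szeta = szeta[folded V_def] and zetab = zetab[folded V_def] and z = z[folded V_def]
 have R: "0 < R" using rho by linarith
 have V\<Omega>: "y \<in> \<Omega>" if "y \<in> V" for y using that sub unfolding V_def by auto
 have spV: "y \<in> V" if "y \<in> space (lb_on V)" for y using that by (simp add: space_restrict_space)
 have x0V: "x0 \<in> V" unfolding V_def using R by simp
 have ab: "a <= b" using qb[OF x0V] by linarith
 have Z0: "0 <= Z" using zetab[OF x0V] by linarith
 note sp = sobolev_p[OF R sub, folded V_def]
 define n where "n y = norm (q y)" for y
 have n0: "0 < n y" if "y \<in> V" for y using qb[OF that] a unfolding n_def by linarith
 define A where "A y = n y powr (p y - 2)" for y
 obtain KY where KY: "norm (Y *v h) <= norm h * KY" for h
  using bounded_linear.bounded[OF matrix_vector_mul_bounded_linear[of Y]] by blast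
 have dq: "(q has_derivative (%h. Y *v h)) (at y)" for y
  unfolding q_def
  using has_derivative_add[OF has_derivative_const[of eta] bounded_linear.has_derivative[OF matrix_vector_mul_bounded_linear[of Y] has_derivative_diff[OF has_derivative_ident has_derivative_const[of x0]]], where F="at y"]
  by simp
 have cq: "continuous_on S q" for S by (intro continuous_at_imp_continuous_on ballI has_derivative_continuous[OF dq])
 have cYq: "continuous_on S (%y. Y *v q y)" for S
  by (rule bounded_linear.continuous_on[OF matrix_vector_mul_bounded_linear cq])
 have cn: "continuous_on S n" for S unfolding n_def[abs_def] by (intro continuous_intros cq)
 have c1 [simp]: "W11 V (%x. 1) (%x. 0)" by (rule W11_const[OF V])
 have sn: "W11 V n (%y. (1 / n y) *R (Y *v q y))"
 proof (rule W11_C1[OF V, where B="max b KY"])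
  show "C1_on V n (%y. (1 / n y) *R (Y *v q y))"
   unfolding C1_on_def
  proof (intro conjI ballI)
   fix y assume y: "y \<in> V"
   have q0: "q y \<noteq> 0" using n0[OF y] unfolding n_def by auto
   have "(n has_derivative (%h. (Y *v h) \<bullet> sgn (q y))) (at y)"
    unfolding n_def[abs_def] by (rule has_derivative_compose[OF dq has_derivative_norm[OF q0]])
   moreover have "(Y *v h) \<bullet> sgn (q y) = ((1 / n y) *R (Y *v q y)) \<bullet> h" for h
    unfolding symmetric_matrix_inner[OF Y] sgn_div_norm n_def
    by (simp add: matrix_vector_mult_scaleR inner_commute[of h] divide_inverse)
   ultimately show "(n has_derivative (%h. ((1 / n y) *R (Y *v q y)) \<bullet> h)) (at y)" by simp
  next
   show "continuous_on V (%y. (1 / n y) *R (Y *v q y))"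
    by (intro continuous_on_scaleR continuous_on_divide continuous_on_const cn cYq) (use n0 in force)
  qed
  show "\<bar>n y\<bar> <= max b KY" if "y \<in> V" for y using qb[OF that] unfolding n_def by (simp add: le_max_iff_disj)
  show "norm ((1 / n y) *R (Y *v q y)) <= max b KY" if "y \<in> V" for y
  proof -
   have "norm (Y *v q y) <= n y * KY" using KY[of "q y"] unfolding n_def .
   hence "norm ((1 / n y) *R (Y *v q y)) <= KY" using n0[OF that] by (simp add: divide_le_eq mult.commute)
   thus ?thesis by simp
  qed
 qed
 have sp2: "W11 V (%y. p y - 2) Dp"
  by (rule W11_cong[OF W11_linear[OF sp c1 V, of 1 "-2"]]) simp_all
 have pb: "\<bar>p y - 2\<bar> <= \<bar>pM\<bar> + 2" if "y \<in> V" for y using p_bounds[OF V\<Omega>[OF that]] pm by linarith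
 \<comment> \<open>Gradient of |q|^(p-2): the former summand comes from the base, the logarithmic
   one from the exponent.\<close>
 define DA where "DA y = ((p y - 2) * n y powr (p y - 2) / n y) *R ((1 / n y) *R (Y *v q y)) + (n y powr (p y - 2) * ln (n y)) *R Dp y" for y
 have sA: "W11 V A DA"
  unfolding A_def[abs_def] DA_def[abs_def]
  by (rule W11_powr[OF sn sp2 V a ab _ pb]) (use qb in \<open>auto simp: n_def\<close>)
 define Lam where "Lam = max \<bar>ln a\<bar> \<bar>ln b\<bar>"
 have Lam: "\<bar>ln (n y)\<bar> <= Lam" if "y \<in> V" for y
 proof -
  have "ln a <= ln (n y)" "ln (n y) <= ln b" using qb[OF that] n0[OF that] a unfolding n_def by simp_all
  thus ?thesis unfolding Lam_def by linarith
 qed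
 have Lam0: "0 <= Lam" unfolding Lam_def by simp
 define CA where "CA = exp ((\<bar>pM\<bar> + 2) * Lam)"
 have A: "0 <= A y" "A y <= CA" if "y \<in> V" for y
 proof -
  show "0 <= A y" unfolding A_def by simp
  have "\<bar>(p y - 2) * ln (n y)\<bar> <= (\<bar>pM\<bar> + 2) * Lam" unfolding abs_mult using pb[OF that] Lam[OF that] by (intro mult_mono) auto
  moreover have "A y = exp ((p y - 2) * ln (n y))" unfolding A_def powr_def using n0[OF that] by simp
  ultimately show "A y <= CA" unfolding CA_def by simp
 qed
 have CA: "0 <= CA" unfolding CA_def by simp
 have b0: "0 <= b" using a ab by linarith
 define e :: "'n => real^'n" where "e i = axis i 1" for i
 have ne: "norm (e i) = 1" for i unfolding e_def by (simp add: norm_eq_sqrt_inner inner_axis_axis)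
 have qe: "\<bar>q y \<bullet> e i\<bar> <= b" if "y \<in> V" for y i
  using Cauchy_Schwarz_ineq2[of "q y" "e i"] qb[OF that] unfolding ne by linarith
 \<comment> \<open>The gradient of zeta |q|^(p-2) q_i; only its i-th component contributes to the
   divergence.\<close>
 define g where "g i y = (A y * (q y \<bullet> e i)) *R Dzeta y + zeta y *R ((q y \<bullet> e i) *R DA y + A y *R (Y *v e i))" for i y
 have sg: "W11 V (%y. zeta y * (A y * (q y \<bullet> e i))) (g i)" for i
 proof -
  have sqi: "W11 V (%y. q y \<bullet> e i) (%y. Y *v e i)"
  proof (rule W11_C1[OF V, where B="max b (norm (Y *v e i))"])
   show "C1_on V (%y. q y \<bullet> e i) (%y. Y *v e i)"
    unfolding C1_on_def
   proof (intro conjI ballI continuous_on_const)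
    fix y
    have "((%y. q y \<bullet> e i) has_derivative (%h. (Y *v h) \<bullet> e i)) (at y)" by (rule has_derivative_inner_left[OF dq])
    moreover have "(Y *v h) \<bullet> e i = (Y *v e i) \<bullet> h" for h
     unfolding symmetric_matrix_inner[OF Y, of h] by (rule inner_commute)
    ultimately show "((%y. q y \<bullet> e i) has_derivative (%h. (Y *v e i) \<bullet> h)) (at y)" by (simp only:)
   qed
  qed (use qe in \<open>simp_all add: le_max_iff_disj\<close>)
  have sAq: "W11 V (%y. A y * (q y \<bullet> e i)) (%y. (q y \<bullet> e i) *R DA y + A y *R (Y *v e i))"
   by (rule W11_mult[OF sA sqi V _ qe CA b0]) (use A in auto)
  have "W11 V (%y. zeta y * (A y * (q y \<bullet> e i))) (%y. (A y * (q y \<bullet> e i)) *R Dzeta y + zeta y *R ((q y \<bullet> e i) *R DA y + A y *R (Y *v e i)))"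
  proof (rule W11_mult[OF szeta sAq V zetab _ Z0])
   show "\<bar>A y * (q y \<bullet> e i)\<bar> <= CA * b" if "y \<in> V" for y
    unfolding abs_mult using A[OF that] qe[OF that, of i] CA by (intro mult_mono) auto
   show "0 <= CA * b" using CA b0 by simp
  qed
  thus ?thesis unfolding g_def[abs_def] .
 qed
 have g0: "(LINT y|lb_on V. g i y \<bullet> e i) = 0" for i
  unfolding V_def
 proof (rule W11_gradient_integral_zero[OF sg[unfolded V_def] rho])
  fix y assume "y \<in> ball x0 R" "y \<notin> ball x0 rho"
  thus "zeta y * (A y * (q y \<bullet> e i)) = 0 & g i y = 0" using z[of y] unfolding g_def V_def by simp
 qed
 have ig: "L1_on V (%y. g i y \<bullet> e i)" for i
  by (intro integrable_inner_left W11_integrable[OF sg])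
 have S0: "(LINT y|lb_on V. (\<Sum>i\<in>UNIV. g i y \<bullet> e i)) = 0"
  by (subst bi_integral_sum[OF ig]) (simp add: g0)
 have iS: "L1_on V (%y. \<Sum>i\<in>UNIV. g i y \<bullet> e i)" by (intro bi_integrable_sum ig)
 define E where "E y = pflux (p y) (q y) \<bullet> Dzeta y + zeta y * (plogflux (p y) (q y) \<bullet> Dp y)" for y
 define F where "F y = zeta y * (norm (q y) powr (p y - 2) * F_norm p y (q y) Y)" for y
 have id: "E y - (\<Sum>i\<in>UNIV. g i y \<bullet> e i) = F y" if y: "y \<in> V" for y
 proof -
  have ve: "w \<bullet> e i = w $ i" for w :: "real^'n" and i unfolding e_def by (simp add: inner_axis)
  have dot: "(\<Sum>i\<in>UNIV. (v $ i) * (w $ i)) = v \<bullet> w" for v w :: "real^'n" by (simp add: inner_vec_def)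
  have tr: "(\<Sum>i\<in>UNIV. (Y *v e i) $ i) = trace Y" unfolding e_def matrix_vector_mult_basis column_def trace_def by simp
  have "(\<Sum>i\<in>UNIV. g i y \<bullet> e i) = (\<Sum>i\<in>UNIV. A y * ((q y $ i) * (Dzeta y $ i)) + zeta y * ((q y $ i) * (DA y $ i) + A y * (Y *v e i) $ i))"
   unfolding g_def ve by (simp add: mult.assoc)
  also have "... = A y * (q y \<bullet> Dzeta y) + zeta y * (q y \<bullet> DA y + A y * trace Y)"
   by (simp only: sum.distrib sum_distrib_left[symmetric] dot tr)
  also have "q y \<bullet> DA y = (p y - 2) * A y / n y * (1 / n y * ((Y *v q y) \<bullet> q y)) + A y * ln (n y) * (q y \<bullet> Dp y)"
   unfolding DA_def A_def by (simp add: inner_add_right inner_commute)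
  finally have S: "(\<Sum>i\<in>UNIV. g i y \<bullet> e i) = A y * (q y \<bullet> Dzeta y) + zeta y * ((p y - 2) * A y / n y * (1 / n y * ((Y *v q y) \<bullet> q y)) + A y * ln (n y) * (q y \<bullet> Dp y) + A y * trace Y)" .
  have "E y = A y * (q y \<bullet> Dzeta y) + zeta y * (A y * ln (n y) * (q y \<bullet> Dp y))"
   unfolding E_def pflux_def plogflux_def A_def n_def by simp
  moreover have "F y = - (zeta y * (A y * (trace Y + (p y - 2) / (n y)\<^sup>2 * ((Y *v q y) \<bullet> q y))))"
   unfolding F_def F_norm_def A_def n_def by (simp only: mult_minus_right)
  moreover have "(p y - 2) * A y / n y * (1 / n y * ((Y *v q y) \<bullet> q y)) = A y * ((p y - 2) / (n y)\<^sup>2 * ((Y *v q y) \<bullet> q y))"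
   by (simp add: power2_eq_square)
  ultimately show ?thesis unfolding S by (simp only: distrib_left)
 qed
 have [measurable]: "q \<in> bm_on V" by (rule borel_measurable_lb_on_continuous[OF V(1) cq])
 have [measurable]: "zeta \<in> bm_on V" "Dzeta \<in> bm_on V"
  by (intro borel_measurable_integrable W11_integrable[OF szeta])+
 have iE: "L1_on V E"
 proof (rule bi_integrable_bound)
  show "L1_on V (%y. CA * b * norm (Dzeta y) + Z * (CA * Lam * (b * L)))"
   by (intro bi_integrable_add integrable_mult_right integrable_norm W11_integrable[OF szeta] integrable_lb_on_const V)
  show "E \<in> bm_on V" unfolding E_def[abs_def] pflux_def plogflux_def by measurable
  show "AE y in lb_on V. norm (E y) <= norm (CA * b * norm (Dzeta y) + Z * (CA * Lam * (b * L)))"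
  proof (rule AE_I2)
   fix y assume "y \<in> space (lb_on V)"
   note y = spV[OF this]
   have nb: "norm (q y) <= b" using qb[OF y] by simp
   have "\<bar>q y \<bullet> Dzeta y\<bar> <= b * norm (Dzeta y)" using Cauchy_Schwarz_ineq2[of "q y" "Dzeta y"] mult_right_mono[OF nb, of "norm (Dzeta y)"] by simp
   hence 1: "\<bar>A y * (q y \<bullet> Dzeta y)\<bar> <= CA * (b * norm (Dzeta y))" unfolding abs_mult using A[OF y] CA by (intro mult_mono) auto
   have "\<bar>q y \<bullet> Dp y\<bar> <= b * L" using Cauchy_Schwarz_ineq2[of "q y" "Dp y"] mult_mono[OF nb Dp_le[OF V\<Omega>[OF y]] b0] by simp
   hence 2: "\<bar>zeta y * (A y * ln (n y) * (q y \<bullet> Dp y))\<bar> <= Z * (CA * Lam * (b * L))"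
    unfolding abs_mult using A[OF y] CA zetab[OF y] Lam[OF y] Lam0 Z0 by (intro mult_mono) auto
   have "E y = A y * (q y \<bullet> Dzeta y) + zeta y * (A y * ln (n y) * (q y \<bullet> Dp y))"
    unfolding E_def pflux_def plogflux_def A_def n_def by simp
   thus "norm (E y) <= norm (CA * b * norm (Dzeta y) + Z * (CA * Lam * (b * L)))" using 1 2 by simp
  qed
 qed
 have iF: "L1_on V F"
  by (rule bi_integrable_cong[THEN iffD1, OF refl _ bi_integrable_diff[OF iE iS]]) (rule id[OF spV])
 have "(LINT y|lb_on V. F y) = (LINT y|lb_on V. E y - (\<Sum>i\<in>UNIV. g i y \<bullet> e i))"
  by (rule bi_integral_cong[OF refl]) (rule id[OF spV, symmetric])
 also have "... = (LINT y|lb_on V. E y)" by (subst bi_integral_diff[OF iE iS]) (simp add: S0)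
 finally show ?A ?B ?C using iE iF unfolding E_def F_def V_def by simp_all
qed

text \<open>Half of the strict slack in \<open>F_norm\<close> is spent on making the touching
  strict, the other half gives a negative upper bound for \<open>Phi\<close> near the point.
  Continuity of u is what makes the almost everywhere conclusion on the test function contradict the
  touching at a single point.\<close>

lemma viscosity_inequality:
 fixes eta x0 :: "real^'n" and X :: "real^'n^'n"
 assumes cu: "continuous_on \<Omega> u" and x0: "x0 \<in> \<Omega>" and jet: "(eta, X) \<in> subjet2 \<Omega> u x0"
  and X: "transpose X = X" and eta: "eta \<noteq> 0"
 shows "0 <= F_norm p x0 eta X"
proof (rule ccontr)
 assume "\<not> 0 <= F_norm p x0 eta X"
 hence F0: "F_norm p x0 eta X < 0" by simp
 define s0 where "s0 = real CARD('n) + (p x0 - 2)"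
 have "1 <= real CARD('n)" using zero_less_card_finite[where 'a='n] by linarith
 hence s0: "0 < s0" unfolding s0_def using p_bounds(1)[OF x0] pm by linarith
 \<comment> \<open>Lowering X by 4e times the identity raises \<open>F_norm\<close> by 4 e s0, and
   this e makes that half of its absolute value. s0 = N + p(x0) - 2 is positive because N \<ge> 1
   and p > 1.\<close>
 define e where "e = - F_norm p x0 eta X / (8 * s0)"
 have e: "0 < e" unfolding e_def using F0 s0 by (intro divide_pos_pos) auto
 define Y where "Y = X - (4 * e) *R mat 1"
 have Yv: "Y *v d = X *v d - (4 * e) *R d" for d
  unfolding Y_def matrix_vector_mult_diff_rdistrib scaleR_matrix_vector_assoc[symmetric] by simp
 have Ysym: "transpose Y = Y"
 proof -
  have "X $ i $ j = X $ j $ i" for i j using X by (metis transpose_def vec_lambda_beta)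
  thus ?thesis unfolding Y_def by (simp add: vec_eq_iff transpose_def mat_def)
 qed
 have FY: "F_norm p x0 eta Y = F_norm p x0 eta X / 2"
 proof -
  have "trace Y = trace X - 4 * e * real CARD('n)" unfolding Y_def trace_def mat_def by (simp add: sum_subtractf)
  moreover have "(Y *v eta) \<bullet> eta = (X *v eta) \<bullet> eta - 4 * e * (norm eta)\<^sup>2" unfolding Yv by (simp add: inner_diff_left power2_norm_eq_inner)
  moreover have "(p x0 - 2) / (norm eta)\<^sup>2 * (t - 4 * e * (norm eta)\<^sup>2) = (p x0 - 2) / (norm eta)\<^sup>2 * t - 4 * e * (p x0 - 2)" for t
   using eta by (simp add: field_simps)
  moreover have "4 * e * s0 = 4 * e * real CARD('n) + 4 * e * (p x0 - 2)" unfolding s0_def by (rule distrib_left)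
  ultimately have "F_norm p x0 eta Y = F_norm p x0 eta X + 4 * e * s0" unfolding F_norm_def by simp
  moreover have "4 * e * s0 = - F_norm p x0 eta X / 2" unfolding e_def using s0 by simp
  ultimately show ?thesis by simp
 qed
 define q where "q y = eta + Y *v (y - x0)" for y
 define Phi where "Phi y = norm (q y) powr (p y - 2) * F_norm p y (q y) Y" for y
 have bY: "bounded_linear ((*v) Y)" by (rule matrix_vector_mul_bounded_linear)
 have dq: "(q has_derivative (%h. Y *v h)) (at y)" for y
  unfolding q_def[abs_def]
  using has_derivative_add[OF has_derivative_const[of eta] bounded_linear.has_derivative[OF bY has_derivative_diff[OF has_derivative_ident has_derivative_const[of x0]]], where F="at y"]
  by simp
 have q0: "q x0 = eta" unfolding q_def by simp
 have tq: "(q \<longlongrightarrow> eta) (at x0)" using has_derivative_continuous[OF dq, of x0] unfolding isCont_def q0 .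
 have tp: "(p \<longlongrightarrow> p x0) (at x0)"
 proof (rule tendstoI)
  fix t :: real assume t: "0 < t"
  obtain r where r: "0 < r" "ball x0 r \<subseteq> \<Omega>" using open_dom x0 openE by blast
  show "\<forall>\<^sub>F y in at x0. dist (p y) (p x0) < t"
   unfolding eventually_at
  proof (intro exI[of _ "min r (t / (L + 1))"] conjI ballI impI)
   show "0 < min r (t / (L + 1))" using r t L by simp
   fix y assume y: "y \<noteq> x0 & dist y x0 < min r (t / (L + 1))"
   hence "y \<in> \<Omega>" using r by (auto simp: dist_commute)
   hence "\<bar>p y - p x0\<bar> <= L * norm (y - x0)" by (rule p_lipschitz[OF _ x0])
   also have "... <= (L + 1) * norm (y - x0)" by (intro mult_right_mono) auto
   also have "... < t" using y L by (simp add: dist_norm less_divide_eq mult.commute)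
   finally show "dist (p y) (p x0) < t" by (simp add: dist_real_def)
  qed
 qed
 have tn: "((%y. norm (q y)) \<longlongrightarrow> norm eta) (at x0)" by (intro tendsto_intros tq)
 have tYq: "((%y. Y *v q y) \<longlongrightarrow> Y *v eta) (at x0)" by (rule bounded_linear.tendsto[OF bY tq])
 have tPhi: "(Phi \<longlongrightarrow> norm eta powr (p x0 - 2) * F_norm p x0 eta Y) (at x0)"
  unfolding Phi_def[abs_def] F_norm_def using eta by (intro tendsto_intros tn tp tYq tq) simp_all
 \<comment> \<open>\<open>Phi x0\<close> equals -2c, so \<open>Phi\<close> is at most -c
   nearby.\<close>
 define c where "c = - (norm eta powr (p x0 - 2) * F_norm p x0 eta Y) / 2"
 have cc: "norm eta powr (p x0 - 2) * F_norm p x0 eta Y = - (2 * c)" unfolding c_def by simp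
 have "0 < norm eta powr (p x0 - 2)" using eta by simp
 hence c: "0 < c" unfolding c_def FY using F0 by (simp add: mult_less_0_iff zero_less_mult_iff)
 have neta: "0 < norm eta" using eta by simp
 have "\<forall>\<^sub>F y in at x0. Phi y < - c" using c by (intro order_tendstoD(2)[OF tPhi]) (simp add: cc)
 moreover have "\<forall>\<^sub>F y in at x0. norm eta / 2 < norm (q y)" using neta by (intro order_tendstoD(1)[OF tn]) simp
 moreover have "\<forall>\<^sub>F y in at x0. norm (q y) < 2 * norm eta" using neta by (intro order_tendstoD(2)[OF tn]) simp
 ultimately have "\<forall>\<^sub>F y in at x0. Phi y < - c & norm eta / 2 < norm (q y) & norm (q y) < 2 * norm eta"
  by eventually_elim blast
 then obtain d1 where d1: "0 < d1" "!!y. y \<noteq> x0 ==> dist y x0 < d1 ==> Phi y < - c & norm eta / 2 < norm (q y) & norm (q y) < 2 * norm eta"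
  unfolding eventually_at by blast
 have near: "Phi y <= - c & norm eta / 2 <= norm (q y) & norm (q y) <= 2 * norm eta" if "dist y x0 < d1" for y
 proof (cases "y = x0")
  case True
  thus ?thesis using c neta unfolding Phi_def by (simp add: q0 cc)
 qed (use d1(2)[of y] that in auto)
 obtain delta where delta: "0 < delta" "!!y. y \<in> \<Omega> ==> norm (y - x0) < delta ==>
   u y \<ge> u x0 + eta \<bullet> (y - x0) + (1/2) * ((X *v (y - x0)) \<bullet> (y - x0)) - e * (norm (y - x0))\<^sup>2"
  using jet e unfolding subjet2_def by blast
 obtain R1 where R1: "0 < R1" "cball x0 R1 \<subseteq> \<Omega>" using open_dom x0 open_contains_cball by blast
 define R where "R = min R1 (min delta d1)"
 have R: "0 < R" "R <= R1" "R <= delta" "R <= d1" unfolding R_def using R1 delta d1 by auto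
 have sub: "cball x0 R \<subseteq> \<Omega>" using R(2) R1(2) subset_cball[of R R1 x0] by blast
 define rho where "rho = R / 2"
 have rho: "0 < rho" "rho < R" unfolding rho_def using R by auto
 define V where "V = ball x0 R"
 have V: "open V" "emeasure lborel V < \<infinity>" unfolding V_def by (rule open_ball) (rule emeasure_ball_less_top)
 have V\<Omega>: "y \<in> \<Omega>" if "y \<in> V" for y using that sub unfolding V_def by auto
 have spV: "y \<in> V" if "y \<in> space (lb_on V)" for y using that by (simp add: space_restrict_space)
 have dV: "dist y x0 < R" if "y \<in> V" for y using that unfolding V_def by (simp add: dist_commute)
 have qV: "norm eta / 2 <= norm (q y)" "norm (q y) <= 2 * norm eta" "Phi y <= - c" if "y \<in> V" for y
  using near[of y] dV[OF that] R by auto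
 define psi where "psi y = u x0 + eta \<bullet> (y - x0) + (1/2) * ((Y *v (y - x0)) \<bullet> (y - x0))" for y
 \<comment> \<open>Passing from X to Y adds 2e |y - x0|^2 to the lower bound of the jet, whose error
   term consumes e |y - x0|^2; the margin e |y - x0|^2 remains.\<close>
 have touch: "psi y + e * (norm (y - x0))\<^sup>2 <= u y" if "y \<in> V" for y
 proof -
  have "(X *v (y - x0)) \<bullet> (y - x0) = (Y *v (y - x0)) \<bullet> (y - x0) + 4 * e * (norm (y - x0))\<^sup>2"
   unfolding Yv by (simp add: inner_diff_left power2_norm_eq_inner)
  moreover have "u y \<ge> u x0 + eta \<bullet> (y - x0) + (1/2) * ((X *v (y - x0)) \<bullet> (y - x0)) - e * (norm (y - x0))\<^sup>2"
   using delta(2)[OF V\<Omega>[OF that]] dV[OF that] R by (simp add: dist_norm)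
  ultimately show ?thesis unfolding psi_def by (simp add: distrib_left)
 qed
 have dpsi: "(psi has_derivative (%h. q y \<bullet> h)) (at y)" for y
 proof -
  have 1: "((%y. y - x0) has_derivative (%h. h)) (at y)" by (auto intro!: derivative_eq_intros)
  have 2: "((%y. Y *v (y - x0)) has_derivative (%h. Y *v h)) (at y)" by (rule bounded_linear.has_derivative[OF bY 1])
  have "(psi has_derivative (%h. 0 + eta \<bullet> h + (1/2) * ((Y *v (y - x0)) \<bullet> h + (Y *v h) \<bullet> (y - x0)))) (at y)"
   unfolding psi_def[abs_def]
   by (intro has_derivative_add has_derivative_const has_derivative_inner_right has_derivative_mult_right has_derivative_inner 1 2)
  moreover have "0 + eta \<bullet> h + (1/2) * ((Y *v (y - x0)) \<bullet> h + (Y *v h) \<bullet> (y - x0)) = q y \<bullet> h" for h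
   unfolding q_def symmetric_matrix_inner[OF Ysym, of h] inner_commute[of h] by (simp add: inner_add_left)
  ultimately show ?thesis by simp
 qed
 have cpsi: "continuous_on S psi" for S by (intro continuous_at_imp_continuous_on ballI has_derivative_continuous[OF dpsi])
 have cq: "continuous_on S q" for S by (intro continuous_at_imp_continuous_on ballI has_derivative_continuous[OF dq])
 have spsi: "W11 V psi q"
 proof -
  have "compact (psi ` cball x0 R)" by (intro compact_continuous_image cpsi compact_cball)
  then obtain B where "\<forall>y\<in>cball x0 R. \<bar>psi y\<bar> <= B" using compact_imp_bounded[of "psi ` cball x0 R"] unfolding bounded_iff by auto
  hence B: "\<bar>psi y\<bar> <= B" if "y \<in> cball x0 R" for y using that by blast
  show ?thesis
  proof (rule W11_C1[OF V, where B="max B (2 * norm eta)"])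
   show "C1_on V psi q" unfolding C1_on_def using dpsi cq by blast
   show "\<bar>psi y\<bar> <= max B (2 * norm eta)" if "y \<in> V" for y using B[of y] that unfolding V_def by auto
   show "norm (q y) <= max B (2 * norm eta)" if "y \<in> V" for y using qV(2)[OF that] by simp
  qed
 qed
 show False
 proof (rule pflux_comparison[OF pm _ _ L, of "norm eta / 2" "2 * norm eta" pM])
 show "0 < norm eta / 2" "norm eta / 2 <= 2 * norm eta" using neta by simp_all
 fix K zeta0 assume K: "0 <= K" and zeta0: "0 < zeta0" and cmp: "!!p' zeta q' xi (w::real^'n). pm <= p' ==> p' <= pM ==> norm eta / 2 <= norm q' ==> norm q' <= 2 * norm eta ==> norm w <= L ==> 0 <= zeta ==> zeta <= zeta0 ==>
   zeta * ((plogflux p' xi - plogflux p' q') \<bullet> w) <= (pflux p' xi - pflux p' q') \<bullet> (xi - q') + K * zeta\<^sup>2"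
 \<comment> \<open>l \<le> e rho^2 makes zeta vanish outside the ball of radius rho, l \<le> zeta0
   admits the flux comparison, and K l \<le> c/2 lets the remainder K zeta^2 be absorbed by c
   zeta.\<close>
 define l where "l = min (min (e * rho\<^sup>2) zeta0) (c / (2 * (K + 1)))"
 have l: "0 < l" "l <= e * rho\<^sup>2" "l <= zeta0" "K * l <= c / 2"
 proof -
  show "0 < l" "l <= e * rho\<^sup>2" "l <= zeta0" unfolding l_def using e rho zeta0 c K by auto
  have "l <= c / (2 * (K + 1))" unfolding l_def by simp
  hence "(K + 1) * l <= c / 2" using K by (simp add: field_simps)
  thus "K * l <= c / 2" using \<open>0 < l\<close> by (simp add: distrib_right)
 qed
 define zeta where "zeta y = max 0 (psi y + l - u y)" for y
 define Dzeta where "Dzeta y = (if 0 < psi y + l - u y then q y - Du y else 0)" for y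
 note su = sobolev_u[OF R(1) sub, folded V_def]
 have szeta: "W11 V zeta Dzeta"
 proof -
  have "W11 V (%y. 1 * (1 * psi y + l * 1) + - 1 * u y) (%y. 1 *R (1 *R q y + l *R 0) + - 1 *R Du y)"
   by (intro W11_linear spsi W11_const V su)
  from W11_max0[OF this V] show ?thesis by (rule W11_cong) (simp_all add: zeta_def Dzeta_def)
 qed
 have zetal: "0 <= zeta y" "zeta y <= l" if "y \<in> V" for y
 proof -
  show "0 <= zeta y" unfolding zeta_def by simp
  have "0 <= e * (norm (y - x0))\<^sup>2" using e by simp
  thus "zeta y <= l" unfolding zeta_def using touch[OF that] l by simp
 qed
 have off: "zeta y = 0 & Dzeta y = 0" if y: "y \<in> V" "y \<notin> ball x0 rho" for y
 proof -
  have "rho <= norm (y - x0)" using y(2) by (simp add: dist_norm norm_minus_commute)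
  hence "rho\<^sup>2 <= (norm (y - x0))\<^sup>2" using rho by (intro power_mono) auto
  hence "e * rho\<^sup>2 <= e * (norm (y - x0))\<^sup>2" using e by (intro mult_left_mono) auto
  hence "psi y + l - u y <= 0" using touch[OF y(1)] l(2) by linarith
  thus ?thesis unfolding zeta_def Dzeta_def by simp
 qed
 have mzeta: "zeta \<in> bm_on V" "Dzeta \<in> bm_on V"
  by (intro borel_measurable_integrable W11_integrable[OF szeta])+
 have izetap: "L1_on V (%y. \<bar>zeta y\<bar> powr p y)"
 proof -
  have "norm (zeta y) <= l * (1 + \<bar>u y\<bar> + norm (Du y))" if "y \<in> ball x0 R" for y
  proof -
   have "l * 1 <= l * (1 + \<bar>u y\<bar> + norm (Du y))" using l by (intro mult_left_mono) auto
   thus ?thesis using zetal[of y] that unfolding V_def by simp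
  qed
  from integrable_powr_linear[OF R(1) sub mzeta(1)[unfolded V_def] less_imp_le[OF l(1)] this] show ?thesis unfolding V_def by simp
 qed
 have nDzeta: "norm (Dzeta y) <= 2 * norm eta + norm (Du y)" if "y \<in> V" for y
  using qV(2)[OF that] norm_triangle_ineq4[of "q y" "Du y"] unfolding Dzeta_def by (auto intro: add_nonneg_nonneg)
 have iDzetap: "L1_on V (%y. norm (Dzeta y) powr p y)"
  unfolding V_def
 proof (rule integrable_powr_linear[OF R(1) sub mzeta(2)[unfolded V_def], where C="2 * norm eta + 1"])
  show "norm (Dzeta y) <= (2 * norm eta + 1) * (1 + \<bar>u y\<bar> + norm (Du y))" if "y \<in> ball x0 R" for y
  proof -
   have "t + s <= (t + 1) * (1 + r + s)" if "0 <= t" "0 <= r" "0 <= s" for t r s :: real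
    using that mult_nonneg_nonneg[of t r] mult_nonneg_nonneg[of t s] by (simp add: algebra_simps)
   from this[of "2 * norm eta" "\<bar>u y\<bar>" "norm (Du y)"] show ?thesis using nDzeta[of y] that unfolding V_def by simp
  qed
 qed simp
 have E0: "0 <= (LINT y|lb_on V. energy zeta Dzeta y)"
  unfolding energy_def V_def
  by (rule supersolution[OF rho sub szeta[unfolded V_def] _ _ izetap[unfolded V_def] iDzetap[unfolded V_def]])
   (use zetal off in \<open>auto simp: V_def\<close>)
 have en: "energy zeta Dzeta y = pflux (p y) (Du y) \<bullet> Dzeta y + zeta y * (plogflux (p y) (Du y) \<bullet> Dp y)" for y
  unfolding energy_def pflux_def plogflux_def by simp
 \<comment> \<open>A non-integrable energy would have integral 0 by convention, and
   \<open>E0\<close> would then say nothing; so integrability is secured before integrals are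
   compared.\<close>
 have iE: "L1_on V (energy zeta Dzeta)"
 proof (rule powr_log_absorb[OF pm zero_less_one L, of pM])
  fix C2 assume C2: "0 <= C2" and C2le: "!!p' T. pm <= p' ==> p' <= pM ==> 0 <= T ==> L * (T powr (p' - 1) * \<bar>ln T\<bar>) <= 1 * T powr p' + C2"
  have iDup: "L1_on V (%y. norm (Du y) powr p y)" unfolding V_def by (rule integrable_Du_powr[OF R(1) sub])
  show ?thesis
  proof (rule bi_integrable_bound)
   show "L1_on V (%y. (2 * norm eta + 1 + l) * norm (Du y) powr p y + (2 * norm eta + l * C2))"
    by (intro bi_integrable_add integrable_mult_right iDup integrable_lb_on_const V)
   show "energy zeta Dzeta \<in> bm_on V" by (rule energy_measurable[OF szeta])
   show "AE y in lb_on V. norm (energy zeta Dzeta y) <= norm ((2 * norm eta + 1 + l) * norm (Du y) powr p y + (2 * norm eta + l * C2))"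
   proof (rule AE_I2)
    fix y assume "y \<in> space (lb_on V)"
    note y = spV[OF this]
    note pb = p_bounds[OF V\<Omega>[OF y]]
    define T where "T = norm (Du y)"
    have T0: "0 <= T" unfolding T_def by simp
    have np: "norm (pflux (p y) (Du y)) = T powr (p y - 1)" "norm (plogflux (p y) (Du y)) = T powr (p y - 1) * \<bar>ln T\<bar>"
     unfolding pflux_def plogflux_def T_def by (cases "Du y = 0"; simp add: abs_mult powr_diff power2_eq_square)+
    have T1: "T powr (p y - 1) <= 1 + T powr p y"
    proof (cases "T <= 1")
     case True
     hence "T powr (p y - 1) <= 1" using T0 pb pm powr_mono2[of "p y - 1" T 1] by simp
     thus ?thesis by (simp add: add_increasing2)
    next
     case False
     hence "T powr (p y - 1) <= T powr p y" by (intro powr_mono) auto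
     thus ?thesis by simp
    qed
    have T2: "T powr (p y - 1) * T = T powr p y" using T0 pb pm by (cases "T = 0") (simp_all add: powr_diff)
    have "\<bar>pflux (p y) (Du y) \<bullet> Dzeta y\<bar> <= T powr (p y - 1) * norm (Dzeta y)"
     using Cauchy_Schwarz_ineq2[of "pflux (p y) (Du y)" "Dzeta y"] unfolding np .
    also have "... <= T powr (p y - 1) * (2 * norm eta + T)" using nDzeta[OF y] unfolding T_def by (intro mult_left_mono) auto
    also have "... = 2 * norm eta * T powr (p y - 1) + T powr p y" unfolding T2[symmetric] by (simp add: algebra_simps)
    also have "... <= 2 * norm eta * (1 + T powr p y) + T powr p y" using T1 by (intro add_right_mono mult_left_mono) auto
    finally have 1: "\<bar>pflux (p y) (Du y) \<bullet> Dzeta y\<bar> <= 2 * norm eta * (1 + T powr p y) + T powr p y" .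
    have "\<bar>plogflux (p y) (Du y) \<bullet> Dp y\<bar> <= (T powr (p y - 1) * \<bar>ln T\<bar>) * L"
     using Cauchy_Schwarz_ineq2[of "plogflux (p y) (Du y)" "Dp y"] mult_left_mono[OF Dp_le[OF V\<Omega>[OF y]], of "T powr (p y - 1) * \<bar>ln T\<bar>"]
     unfolding np by simp
    also have "... <= T powr p y + C2" using C2le[OF pb T0] by (simp add: mult.commute)
    finally have "\<bar>plogflux (p y) (Du y) \<bullet> Dp y\<bar> <= T powr p y + C2" .
    hence 2: "\<bar>zeta y * (plogflux (p y) (Du y) \<bullet> Dp y)\<bar> <= l * (T powr p y + C2)"
     unfolding abs_mult using zetal[OF y] by (intro mult_mono) auto
    have "\<bar>energy zeta Dzeta y\<bar> <= (2 * norm eta + 1 + l) * T powr p y + (2 * norm eta + l * C2)"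
     unfolding en using 1 2 by (simp add: algebra_simps)
    thus "norm (energy zeta Dzeta y) <= norm ((2 * norm eta + 1 + l) * norm (Du y) powr p y + (2 * norm eta + l * C2))"
     unfolding T_def by simp
   qed
  qed
 qed
 have qb: "norm eta / 2 <= norm (eta + Y *v (y - x0)) & norm (eta + Y *v (y - x0)) <= 2 * norm eta" if "y \<in> ball x0 R" for y
  using qV[of y] that unfolding V_def q_def by simp
 have zetab: "\<bar>zeta y\<bar> <= l" if "y \<in> ball x0 R" for y using zetal[of y] that unfolding V_def by simp
 have n2: "0 < norm eta / 2" using neta by simp
 note id = flux_identity[OF Ysym rho sub n2 qb szeta[unfolded V_def] zetab off[unfolded V_def], folded q_def V_def, folded Phi_def]
 have id3: "(LINT y|lb_on V. pflux (p y) (q y) \<bullet> Dzeta y + zeta y * (plogflux (p y) (q y) \<bullet> Dp y)) = (LINT y|lb_on V. zeta y * Phi y)"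
  unfolding Phi_def q_def V_def by (rule flux_identity(3)[OF Ysym rho sub n2 qb szeta[unfolded V_def] zetab off[unfolded V_def]])
 have izeta: "L1_on V zeta" by (rule W11_integrable[OF szeta])
 define I where "I = (LINT y|lb_on V. zeta y)"
 have "(LINT y|lb_on V. energy zeta Dzeta y) <= (LINT y|lb_on V. (pflux (p y) (q y) \<bullet> Dzeta y + zeta y * (plogflux (p y) (q y) \<bullet> Dp y)) + K * l * zeta y)"
 proof (rule integral_mono[OF iE])
  show "L1_on V (%y. (pflux (p y) (q y) \<bullet> Dzeta y + zeta y * (plogflux (p y) (q y) \<bullet> Dp y)) + K * l * zeta y)"
   by (intro bi_integrable_add id(1) integrable_mult_right izeta)
  fix y assume "y \<in> space (lb_on V)"
  note y = spV[OF this]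
  show "energy zeta Dzeta y <= (pflux (p y) (q y) \<bullet> Dzeta y + zeta y * (plogflux (p y) (q y) \<bullet> Dp y)) + K * l * zeta y"
  proof (cases "0 < psi y + l - u y")
   case False
   thus ?thesis unfolding en Dzeta_def zeta_def by simp
  next
   case True
   \<comment> \<open>On {zeta > 0} one has Dzeta = q - Du, so the monotone part of the comparison is
     minus the difference of the fluxes paired with \<open>Dzeta\<close>; the log fluxes supply the
     remaining terms of the two energies.\<close>
   have "zeta y * ((plogflux (p y) (Du y) - plogflux (p y) (q y)) \<bullet> Dp y) <= (pflux (p y) (Du y) - pflux (p y) (q y)) \<bullet> (Du y - q y) + K * (zeta y)\<^sup>2"
    using zetal[OF y] l(3) by (intro cmp p_bounds V\<Omega> y qV Dp_le) auto
   moreover have "K * (zeta y)\<^sup>2 <= K * l * zeta y" using zetal[OF y] K by (simp add: power2_eq_square mult.assoc mult_left_mono mult_right_mono)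
   moreover have "Dzeta y = q y - Du y" unfolding Dzeta_def using True by simp
   ultimately show ?thesis unfolding en by (simp add: inner_diff_left inner_diff_right right_diff_distrib)
  qed
 qed
 also have "... = (LINT y|lb_on V. zeta y * Phi y) + K * l * I"
 proof -
  have "(LINT y|lb_on V. (pflux (p y) (q y) \<bullet> Dzeta y + zeta y * (plogflux (p y) (q y) \<bullet> Dp y)) + K * l * zeta y)
   = (LINT y|lb_on V. pflux (p y) (q y) \<bullet> Dzeta y + zeta y * (plogflux (p y) (q y) \<bullet> Dp y)) + (LINT y|lb_on V. K * l * zeta y)"
   by (intro bi_integral_add id(1) integrable_mult_right izeta)
  moreover have "(LINT y|lb_on V. K * l * zeta y) = K * l * I" unfolding I_def by (rule integral_mult_right_zero)
  ultimately show ?thesis unfolding id3 by (simp only:)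
 qed
 also have "(LINT y|lb_on V. zeta y * Phi y) <= (LINT y|lb_on V. - c * zeta y)"
 proof (rule integral_mono[OF id(2) integrable_mult_right[OF izeta]])
  fix y assume "y \<in> space (lb_on V)"
  note y = spV[OF this]
  show "zeta y * Phi y <= - c * zeta y" using mult_left_mono[OF qV(3)[OF y] zetal(1)[OF y]] by (simp add: mult.commute)
 qed
 also have "(LINT y|lb_on V. - c * zeta y) = - c * I" unfolding I_def by simp
 finally have "0 <= - c * I + K * l * I" using E0 by linarith
 moreover have I0: "0 <= I" unfolding I_def by (rule bi_integral_nonneg) (use zeta_def in simp)
 moreover have "K * l * I <= c / 2 * I" by (rule mult_right_mono[OF l(4) I0])
 ultimately have "c * I <= 0" by simp
 hence "I = 0" using c I0 by (simp add: mult_le_0_iff)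
 hence "AE y in lb_on V. zeta y = 0"
  unfolding I_def using integral_nonneg_eq_0_iff_AE[OF izeta] by (simp add: zeta_def)
 hence ae: "AE y in lborel. y \<in> V --> zeta y = 0" using V(1) by (simp add: AE_restrict_space_iff)
 \<comment> \<open>At x0 the difference psi + l - u equals l > 0, so zeta is positive on a whole
   ball, which is not a null set.\<close>
 have "isCont u x0" using cu x0 open_dom continuous_on_eq_continuous_at by blast
 moreover have "isCont psi x0" by (rule has_derivative_continuous[OF dpsi])
 ultimately have "((%y. psi y + l - u y) \<longlongrightarrow> psi x0 + l - u x0) (at x0)" unfolding isCont_def by (intro tendsto_intros)
 moreover have "psi x0 + l - u x0 = l" unfolding psi_def by simp
 ultimately have "\<forall>\<^sub>F y in at x0. 0 < psi y + l - u y" using l(1) by (intro order_tendstoD(1)) auto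
 then obtain d2 where d2: "0 < d2" "!!y. y \<noteq> x0 ==> dist y x0 < d2 ==> 0 < psi y + l - u y" unfolding eventually_at by blast
 have pos: "0 < zeta y" if "dist y x0 < d2" for y
  using d2(2)[of y] that l(1) \<open>psi x0 + l - u x0 = l\<close> unfolding zeta_def by (cases "y = x0") auto
 have "AE y in lborel. y \<in> ball x0 (min d2 R) --> zeta y = 0" using ae by (rule AE_mp) (intro AE_I2, auto simp: V_def)
 then obtain y where y: "y \<in> ball x0 (min d2 R)" "zeta y = 0" by (rule lborel_ball_not_null[rotated]) (use d2 R in auto)
 thus False using pos[of y] by (simp add: dist_commute)
 qed
qed

text \<open>The conditions on u in \<open>supersol\<close> are insensitive to null sets; the
  indicator makes the representative Borel on the whole space.\<close>

lemma cong_AE: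
 assumes v: "continuous_on \<Omega> v" and ae: "AE x in lborel. x \<in> \<Omega> --> v x = u x"
 shows "supersol \<Omega> p (%x. indicator \<Omega> x *R v x) Du Dp L pm pM"
proof -
 define v' where "v' x = indicator \<Omega> x *R v x" for x
 have mv: "v' \<in> borel_measurable borel" unfolding v'_def[abs_def]
  by (rule borel_measurable_continuous_on_indicator[OF _ v]) (use open_dom in simp)
 have [measurable]: "v' \<in> bm_on V" for V by (rule measurable_restrict_space1) (simp add: mv)
 have aeV: "AE y in lb_on (ball x R). u y = v' y" if "cball x R \<subseteq> \<Omega>" for x R
 proof -
  have bO: "y \<in> \<Omega>" if "y \<in> ball x R" for y using that \<open>cball x R \<subseteq> \<Omega>\<close> ball_subset_cball by blast
  have "AE y in lborel. y \<in> ball x R --> u y = v' y"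
  proof (rule AE_mp[OF ae], intro AE_I2 impI)
   fix y assume "y \<in> \<Omega> --> v y = u y" "y \<in> ball x R"
   thus "u y = v' y" using bO[of y] by (simp add: v'_def)
  qed
  thus ?thesis by (subst AE_restrict_space_iff) auto
 qed
 have "supersol \<Omega> p v' Du Dp L pm pM"
 proof (rule supersol.intro)
  fix x :: "real^'n" and R :: real assume R: "0 < R" "cball x R \<subseteq> \<Omega>"
  show "W11 (ball x R) v' Du"
   by (rule W11_cong_AE[OF sobolev_u[OF R] aeV[OF R(2)] AE_I2]) simp_all
  show "L1_on (ball x R) (%y. \<bar>v' y\<bar> powr p y)"
  proof (rule integrable_cong_AE_imp[OF integrable_u_powr[OF R]])
   show "(%y. \<bar>v' y\<bar> powr p y) \<in> bm_on (ball x R)" by measurable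
   show "AE y in lb_on (ball x R). \<bar>u y\<bar> powr p y = \<bar>v' y\<bar> powr p y" using aeV[OF R(2)] by (rule AE_mp) (intro AE_I2, simp)
  qed
 qed (fact open_dom pm p_bounds L p_lipschitz Dp_le meas mv sobolev_p integrable_Du_powr supersolution)+
 thus ?thesis unfolding v'_def[abs_def] .
qed

lemma viscosity_supersolution:
 assumes v: "continuous_on \<Omega> v" and ae: "AE x in lborel. x \<in> \<Omega> --> v x = u x"
 shows "visc_supersolution \<Omega> p v"
proof -
 interpret W: supersol \<Omega> p "%x. indicator \<Omega> x *R v x" Du Dp L pm pM by (rule cong_AE[OF assms])
 have "continuous_on \<Omega> (%x. indicator \<Omega> x *R v x) \<longleftrightarrow> continuous_on \<Omega> v" by (rule continuous_on_cong) auto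
 hence cv: "continuous_on \<Omega> (%x. indicator \<Omega> x *R v x)" using v by blast
 show ?thesis
  unfolding visc_supersolution_def
 proof (intro conjI ballI allI impI)
  show "lsc_on \<Omega> v" unfolding lsc_on_def
  proof (intro ballI allI impI)
   fix x t assume "x \<in> \<Omega>" "t < v x"
   thus "\<forall>\<^sub>F y in at x within \<Omega>. t < v y" using v unfolding continuous_on_def by (intro order_tendstoD(1)) auto
  qed
  fix x eta X assume x: "x \<in> \<Omega>" and "(eta, X) \<in> subjet2 \<Omega> v x & transpose X = X & eta \<noteq> 0"
  moreover have "subjet2 \<Omega> v x = subjet2 \<Omega> (%x. indicator \<Omega> x *R v x) x" unfolding subjet2_def using x by (auto simp: indicator_def)
  ultimately show "0 <= F_norm p x eta X" by (intro W.viscosity_inequality[OF cv x]) auto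
 qed
qed

end

section \<open>Passage from the weak formulation\<close>

text \<open>The formulation integrates over the completed measure, the estimates over
  \<open>lborel\<close>; a Borel function that agrees almost everywhere with the integrand carries
  integrals and integrability across.\<close>

lemma set_lebesgue_integral_AE_eq:
 fixes f :: "'a::euclidean_space => 'b::euclidean_space"
 assumes g: "g \<in> borel_measurable borel" and ae: "AE x in lborel. indicator A x *R f x = g x"
 shows "set_lebesgue_integral lebesgue A f = (LBINT x. g x)"
  and "set_integrable lebesgue A f \<longleftrightarrow> integrable lborel g"
proof -
 have g': "g \<in> borel_measurable lborel" "g \<in> borel_measurable lebesgue" using g by (simp_all add: measurable_completion)
 have ae': "AE x in lebesgue. indicator A x *R f x = g x" by (rule AE_completion[OF ae])
 have m: "(%x. indicator A x *R f x) \<in> borel_measurable lebesgue"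
  by (rule borel_measurable_AE[OF g'(2)]) (use ae' in \<open>auto elim: AE_mp\<close>)
 show "set_lebesgue_integral lebesgue A f = (LBINT x. g x)"
  unfolding set_lebesgue_integral_def integral_cong_AE[OF m g'(2) ae'] by (rule integral_completion[OF g'(1)])
 show "set_integrable lebesgue A f \<longleftrightarrow> integrable lborel g"
  unfolding set_integrable_def integrable_cong_AE[OF m g'(2) ae'] by (rule integrable_completion[OF g'(1)])
qed

lemma borel_measurable_vec_component [measurable (raw)]:
 fixes h :: "'a => real^'m"
 assumes "h \<in> borel_measurable M"
 shows "(%x. h x $ i) \<in> borel_measurable M"
 by (rule measurable_compose[OF assms borel_measurable_continuous_onI]) (intro continuous_intros)

text \<open>Local integrability gives measurability on the compact sets of points at distance at
  least 1/(n+1) from the complement. They exhaust the open set, and each coordinate of the limit has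
  a Borel version.\<close>

lemma borel_representative:
 fixes f :: "real^'m => 'b::euclidean_space"
 assumes \<Omega>: "open \<Omega>" "bounded \<Omega>" and f: "!!K. compact K ==> K \<subseteq> \<Omega> ==> set_integrable lebesgue K f"
 obtains f' where "f' \<in> borel_measurable borel" "AE x in lborel. x \<in> \<Omega> --> f' x = f x"
proof -
 define C where "C n = {x. 1 / real (Suc n) <= infdist x (- \<Omega>)}" for n
 have ne: "- \<Omega> \<noteq> {}" using \<Omega>(2) not_bounded_UNIV by (metis Compl_empty_eq double_complement)
 have cl: "closed (- \<Omega>)" using \<Omega>(1) by (simp add: closed_Compl)
 have sub: "C n \<subseteq> \<Omega>" for n
 proof
  fix x assume "x \<in> C n"
  hence "0 < infdist x (- \<Omega>)" unfolding C_def by (simp add: less_le_trans[of 0 "1 / real (Suc n)"])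
  hence "infdist x (- \<Omega>) \<noteq> 0" by simp
  thus "x \<in> \<Omega>" using infdist_zero[of x "- \<Omega>"] by blast
 qed
 have cC: "closed (C n)" for n unfolding C_def by (intro closed_Collect_le continuous_intros)
 hence comp: "compact (C n)" for n using bounded_subset[OF \<Omega>(2) sub] by (simp add: compact_eq_bounded_closed)
 have ev: "\<exists>N. \<forall>n\<ge>N. x \<in> C n" if x: "x \<in> \<Omega>" for x
 proof -
  have "0 < infdist x (- \<Omega>)" using x in_closed_iff_infdist_zero[OF cl ne, of x] infdist_nonneg[of x "- \<Omega>"] by force
  then obtain N where N: "1 / real (Suc N) < infdist x (- \<Omega>)" using nat_approx_posE by blast
  have "1 / real (Suc n) <= infdist x (- \<Omega>)" if "N <= n" for n
  proof -
   have "1 / real (Suc n) <= 1 / real (Suc N)" using that by (intro divide_left_mono) auto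
   thus ?thesis using N by linarith
  qed
  thus ?thesis unfolding C_def by blast
 qed
 have m: "(%x. indicator \<Omega> x *R f x) \<in> borel_measurable lebesgue"
 proof (rule borel_measurable_LIMSEQ_metric)
  show "(%x. indicator (C n) x *R f x) \<in> borel_measurable lebesgue" for n
   using f[OF comp sub, of n] unfolding set_integrable_def by (rule borel_measurable_integrable)
  show "(%n. indicator (C n) x *R f x) ~~> indicator \<Omega> x *R f x" for x
  proof (cases "x \<in> \<Omega>")
   case True
   then obtain N where N: "!!n. N <= n ==> x \<in> C n" using ev by blast
   have "\<forall>\<^sub>F n in sequentially. indicator (C n) x *R f x = indicator \<Omega> x *R f x"
    unfolding eventually_sequentially using N True by (intro exI[of _ N]) simp
   thus ?thesis by (rule tendsto_eventually)
  next
   case False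
   hence "x \<notin> C n" for n using sub by blast
   thus ?thesis using False by simp
  qed
 qed
 have "\<exists>g\<in>borel_measurable lborel. AE x in lborel. (indicator \<Omega> x *R f x) \<bullet> i = g x" for i
  by (rule completion_ex_borel_measurable_real) (intro borel_measurable_inner m borel_measurable_const)
 then obtain g where g: "!!i. g i \<in> borel_measurable lborel" "!!i. AE x in lborel. (indicator \<Omega> x *R f x) \<bullet> i = g i x" by metis
 define f' where "f' x = (\<Sum>i\<in>Basis. g i x *R i)" for x
 have "f' \<in> borel_measurable borel" unfolding f'_def[abs_def] using g(1) by (intro borel_measurable_sum borel_measurable_scaleR) simp_all
 moreover have "AE x in lborel. x \<in> \<Omega> --> f' x = f x"
 proof -
  have "AE x in lborel. \<forall>i\<in>Basis. (indicator \<Omega> x *R f x) \<bullet> i = g i x" using g(2) by (subst AE_ball_countable[OF countable_finite[OF finite_Basis]]) blast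
  thus ?thesis
  proof (rule AE_mp, intro AE_I2 impI)
   fix x assume H: "\<forall>i\<in>Basis. (indicator \<Omega> x *R f x) \<bullet> i = g i x" and x: "x \<in> \<Omega>"
   have "f' x = (\<Sum>i\<in>Basis. (f x \<bullet> i) *R i)" unfolding f'_def by (rule sum.cong[OF refl]) (use H x in simp)
   thus "f' x = f x" by (simp add: euclidean_representation)
  qed
 qed
 ultimately show thesis by (rule that)
qed

text \<open>Translated mollifiers are admissible test functions: \<open>K\<close> is the sum of the
  closed ball and a small closed ball, still compact inside \<Omega>, and contains their
  supports.\<close>

lemma weak_gradient_W11:
 fixes f f' :: "real^'n => real" and Df Df' :: "real^'n => real^'n"
 assumes w: "weak_gradient \<Omega> f Df" and \<Omega>: "open \<Omega>"
  and m: "f' \<in> borel_measurable borel" "Df' \<in> borel_measurable borel"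
  and ae: "AE x in lborel. x \<in> \<Omega> --> f' x = f x" "AE x in lborel. x \<in> \<Omega> --> Df' x = Df x"
  and R: "cball x R \<subseteq> \<Omega>"
 shows "W11 (ball x R) f' Df'"
  and "0 <= L ==> (!!x y. x \<in> \<Omega> ==> y \<in> \<Omega> ==> \<bar>f' x - f' y\<bar> <= L * norm (x - y)) ==> AE y in lb_on (ball x R). norm (Df' y) <= L"
proof -
 obtain d where d: "0 < d" "(\<Union>y\<in>cball x R. ball y d) \<subseteq> \<Omega>"
  using compact_subset_open_imp_ball_epsilon_subset[OF compact_cball \<Omega> R] by blast
 define e where "e = d / 2"
 have e: "0 < e" "e < d" unfolding e_def using d by auto
 define K where "K = (\<Union>y\<in>cball x R. \<Union>z\<in>cball 0 e. {y + z})"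
 have K: "compact K" unfolding K_def by (intro compact_sums' compact_cball)
 have KO: "K \<subseteq> \<Omega>"
 proof
  fix a assume "a \<in> K"
  then obtain y z where yz: "y \<in> cball x R" "norm z <= e" "a = y + z" unfolding K_def by auto
  hence "a \<in> ball y d" using e by (simp add: dist_norm)
  thus "a \<in> \<Omega>" using d(2) yz(1) by blast
 qed
 have VK: "cball y e \<subseteq> K" if "y \<in> ball x R" for y
 proof
  fix a assume "a \<in> cball y e"
  hence "a = y + (a - y)" "a - y \<in> cball 0 e" "y \<in> cball x R" using that by (auto simp: dist_norm norm_minus_commute)
  thus "a \<in> K" unfolding K_def by blast
 qed
 have mK [measurable]: "K \<in> sets borel" using K by (simp add: borel_compact)
 note m [measurable]
 have si: "set_integrable lebesgue K f" "set_integrable lebesgue K Df" using w K KO unfolding weak_gradient_def by auto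
 have mi: "(%y. indicator K y *R f' y) \<in> borel_measurable borel" "(%y. indicator K y *R Df' y) \<in> borel_measurable borel" by measurable
 have ai: "AE y in lborel. indicator K y *R f y = indicator K y *R f' y" "AE y in lborel. indicator K y *R Df y = indicator K y *R Df' y"
  by (rule AE_mp[OF ae(1)], intro AE_I2, use KO in \<open>auto simp: indicator_def\<close>)
   (rule AE_mp[OF ae(2)], intro AE_I2, use KO in \<open>auto simp: indicator_def\<close>)
 have iu: "integrable lborel (%y. indicator K y *R f' y)" using si(1) set_lebesgue_integral_AE_eq(2)[OF mi(1) ai(1)] by simp
 have iD: "integrable lborel (%y. indicator K y *R Df' y)" using si(2) set_lebesgue_integral_AE_eq(2)[OF mi(2) ai(2)] by simp
 have ibp: "(LBINT a. (indicator K a *R f' a) *R Dk (a - y)) = - (LBINT a. k (a - y) *R (indicator K a *R Df' a))"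
  if y: "y \<in> ball x R" and mo: "mollifier r k Dk" and r: "r < e" for y r k Dk
 proof -
  have k: "!!x. (k has_derivative (%h. Dk x \<bullet> h)) (at x)" and cDk: "continuous_on UNIV Dk"
   and z: "!!x. r <= norm x ==> k x = 0" "!!x. r <= norm x ==> Dk x = 0"
   using mo unfolding mollifier_def by auto
  have ck: "continuous_on UNIV k" by (rule mollifier_continuous[OF mo])
  have nK: "k (a - y) = 0" "Dk (a - y) = 0" if "a \<notin> K" for a
  proof -
   have "a \<notin> cball y e" using VK[OF y] that by blast
   hence "r <= norm (a - y)" using r by (simp add: dist_norm norm_minus_commute)
   thus "k (a - y) = 0" "Dk (a - y) = 0" using z by auto
  qed
  have test: "C1c_test \<Omega> (%a. k (a - y)) (%a. Dk (a - y))"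
   unfolding C1c_test_def
  proof (intro conjI allI exI[of _ K] impI K KO)
   fix a
   have "((%a. a - y) has_derivative (%h. h)) (at a)" by (auto intro!: derivative_eq_intros)
   from has_derivative_compose[OF this k] show "((%a. k (a - y)) has_derivative (%h. Dk (a - y) \<bullet> h)) (at a)" .
   show "continuous_on UNIV (%a. Dk (a - y))" by (rule continuous_on_compose2[OF cDk]) (auto intro!: continuous_intros)
  qed (use nK in auto)
  have [measurable]: "k \<in> borel_measurable borel" "Dk \<in> borel_measurable borel"
   using ck cDk by (auto intro: borel_measurable_continuous_onI)
  have i1: "integrable lborel (%a. (Dk (a - y) $ i) *R (indicator K a *R f' a))" for i
   by (rule integrable_mult_bounded_continuous[where k="%a. Dk a $ i" and r=r, OF _ _ iu]) (use z(2) cDk in \<open>auto intro!: continuous_intros\<close>)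
  have i2: "integrable lborel (%a. k (a - y) *R (indicator K a *R Df' a))"
   by (rule integrable_mult_bounded_continuous[OF ck z(1) iD])
  have i3: "integrable lborel (%a. (indicator K a *R f' a) *R Dk (a - y))"
  proof -
   have "integrable lborel (%a. \<Sum>i\<in>UNIV. ((Dk (a - y) $ i) *R (indicator K a *R f' a)) *R axis i (1::real))"
    by (intro bi_integrable_sum integrable_scaleR_left i1)
   moreover have "(\<Sum>i\<in>UNIV. ((Dk (a - y) $ i) *R (indicator K a *R f' a)) *R axis i (1::real)) = (indicator K a *R f' a) *R Dk (a - y)" for a
    by (simp add: vec_eq_iff axis_def if_distrib sum.delta cong: if_cong)
   ultimately show ?thesis by simp
  qed
  have comp: "(LBINT a. F a) $ i = (LBINT a. F a $ i)" if "integrable lborel F" for F :: "real^'n => real^'n" and i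
   using integral_inner_left[of "axis i (1::real)" lborel F] that by (simp add: inner_axis)
  have "(LINT a:\<Omega>|lebesgue. f a * Dk (a - y) $ i) = - (LINT a:\<Omega>|lebesgue. Df a $ i * k (a - y))" for i
   using w test unfolding weak_gradient_def by blast
  moreover have "(LINT a:\<Omega>|lebesgue. f a * Dk (a - y) $ i) = (LBINT a. ((indicator K a *R f' a) *R Dk (a - y)) $ i)" for i
  proof (rule set_lebesgue_integral_AE_eq(1))
   show "(%a. ((indicator K a *R f' a) *R Dk (a - y)) $ i) \<in> borel_measurable borel" by measurable
   show "AE a in lborel. indicator \<Omega> a *R (f a * Dk (a - y) $ i) = ((indicator K a *R f' a) *R Dk (a - y)) $ i"
    using ae(1) by (rule AE_mp) (intro AE_I2 impI, use KO nK(2) in \<open>auto simp: indicator_def\<close>)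
  qed
  moreover have "(LINT a:\<Omega>|lebesgue. Df a $ i * k (a - y)) = (LBINT a. (k (a - y) *R (indicator K a *R Df' a)) $ i)" for i
  proof (rule set_lebesgue_integral_AE_eq(1))
   show "(%a. (k (a - y) *R (indicator K a *R Df' a)) $ i) \<in> borel_measurable borel" by measurable
   show "AE a in lborel. indicator \<Omega> a *R (Df a $ i * k (a - y)) = (k (a - y) *R (indicator K a *R Df' a)) $ i"
    using ae(2) by (rule AE_mp) (intro AE_I2 impI, use KO nK(1) in \<open>auto simp: indicator_def\<close>)
  qed
  ultimately show ?thesis unfolding vec_eq_iff by (simp only: comp[OF i2] comp[OF i3] vector_uminus_component simp_thms)
 qed
 show "W11 (ball x R) f' Df'"
  by (rule W11_of_weak_gradient(1)[OF open_ball e(1) VK iu iD ibp])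
 show "AE y in lb_on (ball x R). norm (Df' y) <= L" if "0 <= L" and lip: "!!x y. x \<in> \<Omega> ==> y \<in> \<Omega> ==> \<bar>f' x - f' y\<bar> <= L * norm (x - y)"
  by (rule W11_of_weak_gradient(2)[OF open_ball e(1) VK iu iD ibp \<open>0 <= L\<close>]) (use KO lip in auto)
qed

text \<open>The Lipschitz constant bounds the weak gradient of p almost everywhere, and setting the
  gradient to 0 on the exceptional set gives the bound everywhere. Test functions on a ball are
  extended by 0; the extended gradient is their weak gradient because they vanish near the boundary
  of the ball.\<close>

lemma weak_supersolution_supersol:
 fixes \<Omega> :: "(real^'n) set" and p p' u u' :: "real^'n => real"
 assumes \<Omega>: "open \<Omega>" "bounded \<Omega>" and pm: "1 < pm" and pb: "!!x. x \<in> \<Omega> ==> pm <= p x" "!!x. x \<in> \<Omega> ==> p x <= pM"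
  and L: "0 <= L" and lip: "!!x y. x \<in> \<Omega> ==> y \<in> \<Omega> ==> \<bar>p x - p y\<bar> <= L * norm (x - y)"
  and p': "p' \<in> borel_measurable borel" "!!x. x \<in> \<Omega> ==> p' x = p x"
  and u': "u' \<in> borel_measurable borel" "AE x in lborel. x \<in> \<Omega> --> u' x = u x"
  and sol: "weak_supersolution \<Omega> p u"
 shows "\<exists>Du Dp. supersol \<Omega> p' u' Du Dp L pm pM"
proof -
 obtain Du0 Dp0 where W: "var_W1p_loc \<Omega> p u Du0" and wp: "weak_gradient \<Omega> p Dp0"
  and sup: "!!phi Dphi. var_W1p \<Omega> p phi Dphi ==> compact_support_in \<Omega> phi ==> (!!x. x \<in> \<Omega> ==> 0 <= phi x) ==>
     0 <= (LINT x:\<Omega>|lebesgue. (if Du0 x = 0 then 0 else norm (Du0 x) powr (p x - 2) * (Du0 x \<bullet> Dphi x)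
         + norm (Du0 x) powr (p x - 2) * ln (norm (Du0 x)) * (Du0 x \<bullet> Dp0 x) * phi x))"
  using sol unfolding weak_supersolution_def by blast
 have wu: "weak_gradient \<Omega> u Du0" using W unfolding var_W1p_loc_def by blast
 have giD: "set_integrable lebesgue K Du0" "set_integrable lebesgue K Dp0" if "compact K" "K \<subseteq> \<Omega>" for K
  using wu wp that unfolding weak_gradient_def by blast+
 obtain Du where Du: "Du \<in> borel_measurable borel" "AE x in lborel. x \<in> \<Omega> --> Du x = Du0 x"
  by (rule borel_representative[OF \<Omega> giD(1)])
 obtain Dp1 where Dp1: "Dp1 \<in> borel_measurable borel" "AE x in lborel. x \<in> \<Omega> --> Dp1 x = Dp0 x"
  by (rule borel_representative[OF \<Omega> giD(2)])
 have aep: "AE x in lborel. x \<in> \<Omega> --> p' x = p x" using p'(2) by (intro AE_I2) blast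
 have lip': "\<bar>p' x - p' y\<bar> <= L * norm (x - y)" if "x \<in> \<Omega>" "y \<in> \<Omega>" for x y using lip p'(2) that by simp
 have bound: "AE x in lborel. x \<in> \<Omega> --> norm (Dp1 x) <= L"
 proof (rule AE_locally)
  fix x assume "x \<in> \<Omega>"
  then obtain R where R: "0 < R" "cball x R \<subseteq> \<Omega>" using \<Omega>(1) open_contains_cball by blast
  have "AE y in lb_on (ball x R). norm (Dp1 y) <= L"
   by (rule weak_gradient_W11(2)[OF wp \<Omega>(1) p'(1) Dp1(1) aep Dp1(2) R(2) L lip'])
  hence "AE y in lborel. y \<in> ball x R --> norm (Dp1 y) <= L" by (subst (asm) AE_restrict_space_iff) simp_all
  thus "\<exists>r>0. AE y in lborel. y \<in> ball x r --> norm (Dp1 y) <= L" using R(1) by blast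
 qed
 define Dp where "Dp x = (if norm (Dp1 x) <= L then Dp1 x else 0)" for x
 have [measurable]: "Dp1 \<in> borel_measurable borel" by (rule Dp1)
 have mDp: "Dp \<in> borel_measurable borel" unfolding Dp_def[abs_def] by measurable
 have Dp: "AE x in lborel. x \<in> \<Omega> --> Dp x = Dp0 x"
  using Dp1(2) bound by (rule AE_mp[OF _ AE_mp]) (intro AE_I2, auto simp: Dp_def)
 note [measurable] = p'(1) u'(1) Du(1) mDp
 have ballO: "y \<in> \<Omega>" if "y \<in> ball x R" "cball x R \<subseteq> \<Omega>" for x y R using that ball_subset_cball by blast
 have Lp: "L1_on (ball x R) (%y. norm (f' y) powr p' y)"
  if R: "0 < R" "cball x R \<subseteq> \<Omega>" and f: "var_Lp (ball x R) p f" and f': "f' \<in> borel_measurable borel" "AE x in lborel. x \<in> \<Omega> --> f' x = f x"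
  for x R and f f' :: "real^'n => 'b::euclidean_space"
 proof -
  note [measurable] = f'(1)
  have [measurable]: "ball x R \<in> sets borel" by simp
  have "set_integrable lebesgue (ball x R) (%y. norm (f y) powr p y)" using f unfolding var_Lp_def by blast
  moreover have "set_integrable lebesgue (ball x R) (%y. norm (f y) powr p y) \<longleftrightarrow> integrable lborel (%y. indicator (ball x R) y *R (norm (f' y) powr p' y))"
  proof (rule set_lebesgue_integral_AE_eq(2))
   show "(%y. indicator (ball x R) y *R (norm (f' y) powr p' y)) \<in> borel_measurable borel" by measurable
   show "AE y in lborel. indicator (ball x R) y *R (norm (f y) powr p y) = indicator (ball x R) y *R (norm (f' y) powr p' y)"
    using f'(2) by (rule AE_mp) (intro AE_I2 impI, use ballO[OF _ R(2)] p'(2) in \<open>auto simp: indicator_def\<close>)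
  qed
  ultimately show ?thesis by (subst integrable_restrict_space) simp_all
 qed
 have WV: "var_Lp (ball x R) p u" "var_Lp (ball x R) p Du0" if "0 < R" "cball x R \<subseteq> \<Omega>" for x R
  using W that unfolding var_W1p_loc_def var_W1p_def by auto
 have "supersol \<Omega> p' u' Du Dp L pm pM"
 proof (rule supersol.intro)
  show "pm <= p' x" "p' x <= pM" if "x \<in> \<Omega>" for x using pb p'(2) that by auto
  show "norm (Dp x) <= L" for x unfolding Dp_def using L by simp
  fix x :: "real^'n" and R :: real assume R: "0 < R" "cball x R \<subseteq> \<Omega>"
  show "W11 (ball x R) u' Du" by (rule weak_gradient_W11(1)[OF wu \<Omega>(1) u'(1) Du(1) u'(2) Du(2) R(2)])
  show "W11 (ball x R) p' Dp" by (rule weak_gradient_W11(1)[OF wp \<Omega>(1) p'(1) mDp aep Dp R(2)])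
  show "L1_on (ball x R) (%y. \<bar>u' y\<bar> powr p' y)" using Lp[OF R WV(1)[OF R] u'] by simp
  show "L1_on (ball x R) (%y. norm (Du y) powr p' y)" by (rule Lp[OF R WV(2)[OF R] Du])
 next
  fix x :: "real^'n" and rho R phi Dphi assume rho: "0 < rho" "rho < R" and sub: "cball x R \<subseteq> \<Omega>" and s: "W11 (ball x R) phi Dphi"
   and phi0: "!!y. y \<in> ball x R ==> 0 <= phi y" and z: "!!y. y \<in> ball x R ==> y \<notin> ball x rho ==> phi y = 0 & Dphi y = 0"
   and ip: "L1_on (ball x R) (%y. \<bar>phi y\<bar> powr p' y)" and iDp: "L1_on (ball x R) (%y. norm (Dphi y) powr p' y)"
  define B where "B = ball x R"
  have B: "open B" "B \<inter> space lborel \<in> sets lborel" unfolding B_def by simp_all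
  have BO: "y \<in> \<Omega>" if "y \<in> B" for y using ballO[OF _ sub] that unfolding B_def .
  note s' = s[folded B_def] and ip' = ip[folded B_def] and iDp' = iDp[folded B_def]
  define f Df where "f y = indicator B y *R phi y" and "Df y = indicator B y *R Dphi y" for y
  note i = W11_integrable[OF s']
  have mf: "f \<in> borel_measurable borel" "Df \<in> borel_measurable borel"
   unfolding f_def[abs_def] Df_def[abs_def] using nn_integral_lb_on(2)[OF B(1)] i by blast+
  note [measurable] = mf
  have ilb: "integrable lborel f" "integrable lborel Df"
   unfolding f_def[abs_def] Df_def[abs_def] using i unfolding integrable_restrict_space[OF B(2)] by blast+
  have Bb [measurable]: "B \<in> sets borel" using B(1) by simp
  have Om [measurable]: "\<Omega> \<in> sets borel" using \<Omega>(1) by simp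
  have Lpf: "var_Lp \<Omega> p g'" if g': "g' \<in> borel_measurable borel" "!!y. g' y = indicator B y *R g y" and ig: "L1_on B (%y. norm (g y) powr p' y)"
   for g g' :: "real^'n => 'b::euclidean_space"
   unfolding var_Lp_def
  proof
   note [measurable] = g'(1)
   show "g' \<in> borel_measurable (lebesgue_on \<Omega>)" using g'(1) by (intro measurable_restrict_space1 measurable_completion) simp
   have e: "indicator \<Omega> y *R (norm (g' y) powr p y) = indicator B y *R (norm (g y) powr p' y)" for y
    using BO[of y] p'(2)[of y] unfolding g'(2) by (auto simp: indicator_def)
   have il: "integrable lborel (%y. indicator B y *R (norm (g y) powr p' y))" using ig unfolding integrable_restrict_space[OF B(2)] .
   have "set_integrable lebesgue \<Omega> (%y. norm (g' y) powr p y) \<longleftrightarrow> integrable lborel (%y. indicator B y *R (norm (g y) powr p' y))"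
    using borel_measurable_integrable[OF il] by (intro set_lebesgue_integral_AE_eq(2) AE_I2 e) simp
   thus "set_integrable lebesgue \<Omega> (%x. norm (g' x) powr p x)" using il by blast
  qed
  have on: "(LBINT y. indicator B y *R h y) = (LINT y|lb_on B. h y)" for h :: "real^'n => real"
   by (rule integral_restrict_space[OF B(2), symmetric])
  have "weak_gradient \<Omega> f Df"
   unfolding weak_gradient_def
  proof (intro conjI allI impI)
   fix K assume "compact K & K \<subseteq> \<Omega>"
   hence "K \<in> sets lebesgue" by (simp add: borel_compact sets_completionI_sets)
   moreover have "integrable lebesgue f" "integrable lebesgue Df" using ilb mf by (simp_all add: integrable_completion)
   ultimately show "set_integrable lebesgue K f" "set_integrable lebesgue K Df"
    unfolding set_integrable_def by (blast intro: integrable_mult_indicator)+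
  next
   fix psi g i assume t: "C1c_test \<Omega> psi g"
   hence Dpsi: "!!y. (psi has_derivative (%h. g y \<bullet> h)) (at y)" and cg: "continuous_on UNIV g" unfolding C1c_test_def by auto
   have cpsi: "continuous_on UNIV psi" by (intro continuous_at_imp_continuous_on ballI has_derivative_continuous[OF Dpsi])
   have [measurable]: "psi \<in> borel_measurable borel" "g \<in> borel_measurable borel" using cpsi cg by (auto intro: borel_measurable_continuous_onI)
   have "(LINT y:\<Omega>|lebesgue. f y * g y $ i) = (LBINT y. f y * g y $ i)"
    by (rule set_lebesgue_integral_AE_eq(1)) (measurable, use BO in \<open>auto simp: f_def indicator_def\<close>)
   also have "... = (LINT y|lb_on B. phi y * (g y \<bullet> axis i 1))"
    unfolding on[symmetric] f_def by (simp add: inner_axis mult.assoc)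
   also have "... = - (LINT y|lb_on B. (Dphi y \<bullet> axis i 1) * psi y)"
    unfolding B_def by (rule W11_ibp_supported[OF s rho z Dpsi cg])
   also have "(LINT y|lb_on B. (Dphi y \<bullet> axis i 1) * psi y) = (LBINT y. Df y $ i * psi y)"
    unfolding on[symmetric] Df_def by (simp add: inner_axis mult.assoc)
   also have "... = (LINT y:\<Omega>|lebesgue. Df y $ i * psi y)"
    by (rule set_lebesgue_integral_AE_eq(1)[symmetric]) (measurable, use BO in \<open>auto simp: Df_def indicator_def\<close>)
   finally show "(LINT y:\<Omega>|lebesgue. f y * g y $ i) = - (LINT y:\<Omega>|lebesgue. Df y $ i * psi y)" .
  qed
  hence "var_W1p \<Omega> p f Df"
   unfolding var_W1p_def using Lpf[OF mf(1) f_def] Lpf[OF mf(2) Df_def iDp'] ip' by simp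
  moreover have "compact_support_in \<Omega> f"
   unfolding compact_support_in_def by (rule exI[of _ "cball x R"]) (use sub in \<open>auto simp: f_def B_def indicator_def\<close>)
  moreover have "0 <= f y" for y using phi0[of y] unfolding f_def B_def by (auto simp: indicator_def)
  ultimately have "0 <= (LINT y:\<Omega>|lebesgue. (if Du0 y = 0 then 0 else norm (Du0 y) powr (p y - 2) * (Du0 y \<bullet> Df y)
         + norm (Du0 y) powr (p y - 2) * ln (norm (Du0 y)) * (Du0 y \<bullet> Dp0 y) * f y))" by (intro sup)
  also have "... = (LBINT y. (if Du y = 0 then 0 else norm (Du y) powr (p' y - 2) * (Du y \<bullet> Df y)
         + norm (Du y) powr (p' y - 2) * ln (norm (Du y)) * (Du y \<bullet> Dp y) * f y))"
  proof (rule set_lebesgue_integral_AE_eq(1))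
   show "(%y. if Du y = 0 then 0 else norm (Du y) powr (p' y - 2) * (Du y \<bullet> Df y)
         + norm (Du y) powr (p' y - 2) * ln (norm (Du y)) * (Du y \<bullet> Dp y) * f y) \<in> borel_measurable borel" by measurable
   show "AE y in lborel. indicator \<Omega> y *R (if Du0 y = 0 then 0 else norm (Du0 y) powr (p y - 2) * (Du0 y \<bullet> Df y)
         + norm (Du0 y) powr (p y - 2) * ln (norm (Du0 y)) * (Du0 y \<bullet> Dp0 y) * f y)
    = (if Du y = 0 then 0 else norm (Du y) powr (p' y - 2) * (Du y \<bullet> Df y)
         + norm (Du y) powr (p' y - 2) * ln (norm (Du y)) * (Du y \<bullet> Dp y) * f y)"
    using Du(2) Dp
   proof (rule AE_mp[OF _ AE_mp], intro AE_I2 impI)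
    fix y assume H: "y \<in> \<Omega> --> Dp y = Dp0 y" "y \<in> \<Omega> --> Du y = Du0 y"
    show "indicator \<Omega> y *R (if Du0 y = 0 then 0 else norm (Du0 y) powr (p y - 2) * (Du0 y \<bullet> Df y)
         + norm (Du0 y) powr (p y - 2) * ln (norm (Du0 y)) * (Du0 y \<bullet> Dp0 y) * f y)
    = (if Du y = 0 then 0 else norm (Du y) powr (p' y - 2) * (Du y \<bullet> Df y)
         + norm (Du y) powr (p' y - 2) * ln (norm (Du y)) * (Du y \<bullet> Dp y) * f y)"
    proof (cases "y \<in> \<Omega>")
     case True thus ?thesis using H p'(2)[OF True] by simp
    next
     case False
     hence "y \<notin> B" using BO by blast
     thus ?thesis using False unfolding f_def Df_def by simp
    qed
   qed
  qed
  also have "... = (LINT y|lb_on B. (if Du y = 0 then 0 else norm (Du y) powr (p' y - 2) * (Du y \<bullet> Dphi y)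
         + norm (Du y) powr (p' y - 2) * ln (norm (Du y)) * (Du y \<bullet> Dp y) * phi y))"
   unfolding on[symmetric] by (rule bi_integral_cong[OF refl]) (simp add: f_def Df_def indicator_def)
  finally show "0 <= (LINT y|lb_on (ball x R). (if Du y = 0 then 0 else norm (Du y) powr (p' y - 2) * (Du y \<bullet> Dphi y)
     + norm (Du y) powr (p' y - 2) * ln (norm (Du y)) * (Du y \<bullet> Dp y) * phi y))" unfolding B_def .
 qed (fact \<Omega>(1) pm L lip' p'(1) u'(1) Du(1) mDp)+
 thus ?thesis by blast
qed

theorem theorem4p1:
  fixes \<Omega> :: "(real^'n) set" and p u :: "real^'n \<Rightarrow> real"
  assumes "open \<Omega>" and "bounded \<Omega>"
    and "\<forall>x\<in>\<Omega>. 1 < p x"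
    and "\<exists>C. C-lipschitz_on \<Omega> p"
    and "\<exists>pm>1. AE x in lebesgue. x \<in> \<Omega> \<longrightarrow> pm \<le> p x"
    and "weak_solution \<Omega> p u"
  shows "\<exists>v. (AE x in lebesgue. x \<in> \<Omega> \<longrightarrow> v x = u x) \<and> visc_solution \<Omega> p v"
proof (cases "\<Omega> = {}")
 case True
 thus ?thesis
  by (intro exI[of _ u]) (simp add: visc_solution_def visc_subsolution_def visc_supersolution_def lsc_on_def)
next
 case False
 then obtain x0 where x0: "x0 \<in> \<Omega>" by blast
 note \<Omega> = assms(1,2)
 obtain L where lip0: "L-lipschitz_on \<Omega> p" using assms(4) by blast
 have L: "0 <= L" using lip0 by (rule lipschitz_on_nonneg)
 have lip: "\<bar>p x - p y\<bar> <= L * norm (x - y)" if "x \<in> \<Omega>" "y \<in> \<Omega>" for x y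
  using lipschitz_onD[OF lip0 that] by (simp add: dist_norm)
 have cp: "continuous_on \<Omega> p" by (rule lipschitz_on_continuous_on[OF lip0])
 obtain pm where pm: "1 < pm" and "AE x in lebesgue. x \<in> \<Omega> --> pm <= p x" using assms(5) by blast
 hence pmae: "AE x in lborel. x \<in> \<Omega> --> pm <= p x" by (simp only: AE_completion_iff)
 \<comment> \<open>Balls are not null sets, so continuity of p turns the essential lower bound into
   one at every point.\<close>
 have pm_le: "pm <= p x" if x: "x \<in> \<Omega>" for x
 proof (rule ccontr)
  assume "\<not> pm <= p x"
  hence "p x < pm" by simp
  moreover have "(p \<longlongrightarrow> p x) (at x)" using cp x \<Omega>(1) by (simp add: continuous_on_eq_continuous_at isCont_def)
  ultimately have "\<forall>\<^sub>F y in at x. p y < pm" by (intro order_tendstoD(2))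
  then obtain d where d: "0 < d" "!!y. y \<noteq> x ==> dist y x < d ==> p y < pm" unfolding eventually_at by blast
  obtain r where r: "0 < r" "ball x r \<subseteq> \<Omega>" using \<Omega>(1) x openE by blast
  have "AE y in lborel. y \<in> ball x (min d r) --> pm <= p y" using pmae by (rule AE_mp) (intro AE_I2, use r in auto)
  then obtain y where y: "y \<in> ball x (min d r)" "pm <= p y" by (rule lborel_ball_not_null[rotated]) (use d r in auto)
  thus False using d(2)[of y] \<open>p x < pm\<close> by (cases "y = x") (auto simp: dist_commute)
 qed
 obtain D where D: "!!x. x \<in> \<Omega> ==> dist x0 x <= D" using \<Omega>(2) bounded_any_center by metis
 define pM where "pM = p x0 + L * D"
 have pM: "p x <= pM" if "x \<in> \<Omega>" for x
 proof -
  have "L * norm (x - x0) <= L * D" using D[OF that] L by (intro mult_left_mono) (simp_all add: dist_norm norm_minus_commute)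
  thus ?thesis unfolding pM_def using lip[OF that x0] by linarith
 qed
 define p' where "p' x = indicator \<Omega> x *R p x" for x
 have p': "p' \<in> borel_measurable borel" "!!x. x \<in> \<Omega> ==> p' x = p x"
  unfolding p'_def[abs_def] by (rule borel_measurable_continuous_on_indicator[OF _ cp], use \<Omega>(1) in simp) simp
 have sol: "weak_supersolution \<Omega> p u" "weak_supersolution \<Omega> p (%x. - u x)"
  using assms(6) unfolding weak_solution_def weak_subsolution_def by auto
 obtain Du0 where "var_W1p_loc \<Omega> p u Du0" using sol(1) unfolding weak_supersolution_def by blast
 hence "weak_gradient \<Omega> u Du0" unfolding var_W1p_loc_def by blast
 hence w: "\<forall>K. compact K & K \<subseteq> \<Omega> --> set_integrable lebesgue K u & set_integrable lebesgue K Du0"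
  unfolding weak_gradient_def by (rule conjunct1)
 have si: "set_integrable lebesgue K u" if "compact K" "K \<subseteq> \<Omega>" for K using w that by simp
 obtain u' where u': "u' \<in> borel_measurable borel" "AE x in lborel. x \<in> \<Omega> --> u' x = u x"
  by (rule borel_representative[OF \<Omega> si])
 have nu': "(%x. - u' x) \<in> borel_measurable borel" "AE x in lborel. x \<in> \<Omega> --> - u' x = - u x"
  using u' by simp_all
 \<comment> \<open>The gradients witnessing the two conditions are chosen separately; the two
   instances share only p', u' up to sign, and the constants.\<close>
 obtain Du Dp where S: "supersol \<Omega> p' u' Du Dp L pm pM"
  using weak_supersolution_supersol[OF \<Omega> pm pm_le pM L lip p' u' sol(1)] by blast
 obtain Du' Dp' where S': "supersol \<Omega> p' (%x. - u' x) Du' Dp' L pm pM"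
  using weak_supersolution_supersol[OF \<Omega> pm pm_le pM L lip p' nu' sol(2)] by blast
 obtain v where v: "continuous_on \<Omega> v" "AE x in lborel. x \<in> \<Omega> --> v x = u' x"
  by (rule solution_continuous_representative[OF S S'])
 have nv: "continuous_on \<Omega> (%x. - v x)" "AE x in lborel. x \<in> \<Omega> --> - v x = - u' x"
  using v by (auto intro: continuous_on_minus)
 have eq: "visc_supersolution \<Omega> p' w = visc_supersolution \<Omega> p w" for w
  unfolding visc_supersolution_def F_norm_def using p'(2) by auto
 have "visc_solution \<Omega> p v"
  unfolding visc_solution_def visc_subsolution_def eq[symmetric]
  using supersol.viscosity_supersolution[OF S v] supersol.viscosity_supersolution[OF S' nv] by blast
 moreover have "AE x in lebesgue. x \<in> \<Omega> --> v x = u x"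
 proof (rule AE_completion)
  show "AE x in lborel. x \<in> \<Omega> --> v x = u x"
   using v(2) u'(2) by (rule AE_mp[OF _ AE_mp]) (intro AE_I2, simp)
 qed
 ultimately show ?thesis by blast
qed

end
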